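(* Let $T>0$ and let $s\in\mathbb{R}$. Assume that $a\in\mathcal{C}^l([0,T])$ with $l\ge2$ satisfies $a(t)\ge0$ for all $t\in[0,T]$ and that $q\in L^\infty([0,T])$ is real-valued. Let $f\in C([0,T];\gamma^s_{\mathcal{H}})$. If $v_0,v_1\in\gamma^s_{\mathcal{H}}$, then the Cauchy problem $$\partial_t^2 v(t,x)+a(t)\mathcal{H}v(t,x)+q(t)v(t,x)=f(t,x),\quad (t,x)\in[0,T]\times\mathbb{R}^n,$$ $$v(0,x)=v_0(x),\qquad \partial_t v(0,x)=v_1(x),\quad x\in\mathbb{R}^n,$$ has a unique solution $v\in C^2([0,T];\gamma^s_{\mathcal{H}})$ provided that $$1\le s<1+\frac{l}{2}.$$
   Context: The operator $\mathcal{H}$. Let $V$ be a complex potential on $\mathbb{R}^n$ and let $\mathcal{H}_0=-\Delta+V$ be a densely defined Schrödinger operator on $L^2(\mathbb{R}^n)$ with purely discrete spectrum (empty essential spectrum) $\{\lambda_\xi\in\mathbb{C}:\xi\in\mathcal{I}\}$, $\mathcal{I}$ an ordered countable set, whose corresponding eigenfunctions $\{u_\xi\}_{\xi\in\mathcal{I}}$ form a Riesz basis of $L^2(\mathbb{R}^n)$. Let $\{v_\xi\}_{\xi\in\mathcal{I}}$ be the biorthogonal system, $\int_{\mathbb{R}^n}u_\xi\overline{v_\eta}\,dx=\delta_{\xi\eta}$. Then $\mathcal{H}:=|\mathcal{H}_0|$ denotes the operator with $\mathcal{H}u_\xi=|\lambda_\xi|u_\xi$ for every $\xi$ (this is not the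 absolute value in the operator-theoretic sense). If some $\lambda_\xi=0$, one instead fixes $c>0$ and lets $\mathcal{H}$ be the operator with eigenvalue $|\lambda_\xi|+c$ on each $u_\xi$. Write $\mu_\xi>0$ for the eigenvalue of $\mathcal{H}$ on $u_\xi$, and $\langle\xi\rangle:=(1+|\lambda_\xi|)^{1/2}$. The $\mathcal{H}$-Fourier transform is $\widehat f(\xi)=\int_{\mathbb{R}^n}f(x)\overline{v_\xi(x)}\,dx$, so that $f=\sum_\xi\widehat f(\xi)u_\xi$. Gevrey spaces. For real $s\ge1$, the (Roumieu) Gevrey space $\gamma^s_{\mathcal{H}}$ consists of all $f$ for which there exists $A>0$ with $\sum_{\xi\in\mathcal{I}}e^{2A\langle\xi\rangle^{1/s}}|\widehat f(\xi)|^2<\infty$. It is the union over $A>0$ of the Hilbert spaces given by this sum, with the inductive limit topology. $\mathcal{C}^l([0,T])$ ($l$ an integer) is the space of $l$ times continuously differentiable functions. Solutions of the equation are understood after $\mathcal{H}$-Fourier transform in $x$: for every $\xi\in\mathcal{I}$, $\partial_t^2\widehat v+a(t)\mu_\xi\widehat v+q(t)\widehat v=\widehat f$ in $t$ with the transformed initial data.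
   Formalization: For general q in L^∞ a C^2 solution need not exist (q with a jump), so for such q a unique solution is claimed in W^{2,∞}([0,T];γ^s) with the equation for a.e. t; the C^2 solution is claimed when q has a continuous representative, which then replaces q. *)

theory Defs
  imports "HOL-Analysis.Analysis"
begin

section \<open>Square-integrable functions\<close>

text \<open>Elements of \<open>L\<^sup>2\<close> are handled through representatives; equality in \<open>L\<^sup>2\<close> is written out as
  equality almost everywhere.\<close>

definition L2 :: "(real ^ 'n \<Rightarrow> complex) set" where
  "L2 = {f \<in> borel_measurable lebesgue. integrable lebesgue (\<lambda>x. (cmod (f x))\<^sup>2)}"

definition l2norm :: "(real ^ 'n \<Rightarrow> complex) \<Rightarrow> real" where
  "l2norm f = sqrt (\<integral>x. (cmod (f x))\<^sup>2 \<partial>lebesgue)"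

definition l2inner :: "(real ^ 'n \<Rightarrow> complex) \<Rightarrow> (real ^ 'n \<Rightarrow> complex) \<Rightarrow> complex" where
  "l2inner f g = (\<integral>x. f x * cnj (g x) \<partial>lebesgue)"

definition riesz_basis :: "'i set \<Rightarrow> ('i \<Rightarrow> real ^ 'n \<Rightarrow> complex) \<Rightarrow> bool" where
  "riesz_basis I u \<longleftrightarrow>
     (\<forall>\<xi>\<in>I. u \<xi> \<in> L2) \<and>
     (\<forall>f\<in>L2. \<forall>e>0. \<exists>F c. finite F \<and> F \<subseteq> I \<and> l2norm (\<lambda>x. f x - (\<Sum>\<xi>\<in>F. c \<xi> * u \<xi> x)) < e) \<and>
     (\<exists>m>0. \<exists>M>0. \<forall>F c. finite F \<and> F \<subseteq> I \<longrightarrow>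
        m * (\<Sum>\<xi>\<in>F. (cmod (c \<xi>))\<^sup>2) \<le> (l2norm (\<lambda>x. \<Sum>\<xi>\<in>F. c \<xi> * u \<xi> x))\<^sup>2 \<and>
        (l2norm (\<lambda>x. \<Sum>\<xi>\<in>F. c \<xi> * u \<xi> x))\<^sup>2 \<le> M * (\<Sum>\<xi>\<in>F. (cmod (c \<xi>))\<^sup>2))"

definition biorthogonal ::
    "'i set \<Rightarrow> ('i \<Rightarrow> real ^ 'n \<Rightarrow> complex) \<Rightarrow> ('i \<Rightarrow> real ^ 'n \<Rightarrow> complex) \<Rightarrow> bool" where
  "biorthogonal I u v \<longleftrightarrow>
     (\<forall>\<xi>\<in>I. v \<xi> \<in> L2) \<and>
     (\<forall>\<xi>\<in>I. \<forall>\<eta>\<in>I. l2inner (u \<xi>) (v \<eta>) = (if \<xi> = \<eta> then 1 else 0))"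


section \<open>Schroedinger operators\<close>

definition partial :: "'n \<Rightarrow> (real ^ 'n \<Rightarrow> complex) \<Rightarrow> real ^ 'n \<Rightarrow> complex" where
  "partial i \<phi> x = vector_derivative (\<lambda>h. \<phi> (x + h *\<^sub>R axis i 1)) (at 0)"

fun Ck :: "nat \<Rightarrow> (real ^ 'n \<Rightarrow> complex) \<Rightarrow> bool" where
  "Ck 0 \<phi> \<longleftrightarrow> continuous_on UNIV \<phi>"
| "Ck (Suc k) \<phi> \<longleftrightarrow> continuous_on UNIV \<phi> \<and>
     (\<forall>i. (\<forall>x. (\<lambda>h. \<phi> (x + h *\<^sub>R axis i 1)) differentiable (at 0)) \<and> Ck k (partial i \<phi>))"

definition test_function :: "(real ^ 'n \<Rightarrow> complex) \<Rightarrow> bool" where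
  "test_function \<phi> \<longleftrightarrow> (\<forall>k. Ck k \<phi>) \<and> (\<exists>K. compact K \<and> (\<forall>x. x \<notin> K \<longrightarrow> \<phi> x = 0))"

definition laplacian :: "(real ^ 'n \<Rightarrow> complex) \<Rightarrow> real ^ 'n \<Rightarrow> complex" where
  "laplacian \<phi> x = (\<Sum>i\<in>UNIV. partial i (partial i \<phi>) x)"

text \<open>Operators in \<open>L\<^sup>2\<close> are given by their graphs. On the domain \<open>D\<close> the operator acts as
  \<open>- \<Delta> + V\<close> in the sense of distributions, which determines its values up to null sets.\<close>

definition schroedinger ::
    "(real ^ 'n \<Rightarrow> complex) \<Rightarrow> (real ^ 'n \<Rightarrow> complex) set \<Rightarrow>
     ((real ^ 'n \<Rightarrow> complex) \<times> (real ^ 'n \<Rightarrow> complex)) set" where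
  "schroedinger V D = {(f, g). f \<in> D \<and> g \<in> L2 \<and>
     (\<forall>\<phi>. test_function \<phi> \<longrightarrow>
        - (\<integral>x. f x * laplacian \<phi> x \<partial>lebesgue) + (\<integral>x. V x * f x * \<phi> x \<partial>lebesgue)
        = (\<integral>x. g x * \<phi> x \<partial>lebesgue))}"

definition dense_domain :: "(real ^ 'n \<Rightarrow> complex) set \<Rightarrow> bool" where
  "dense_domain D \<longleftrightarrow> D \<subseteq> L2 \<and>
     (\<forall>f\<in>D. \<forall>g\<in>L2. (AE x in lebesgue. f x = g x) \<longrightarrow> g \<in> D) \<and>
     (\<forall>f\<in>D. \<forall>g\<in>D. \<forall>\<alpha> \<beta>. (\<lambda>x. \<alpha> * f x + \<beta> * g x) \<in> D) \<and>
     (\<forall>f\<in>L2. \<forall>e>0. \<exists>g\<in>D. l2norm (\<lambda>x. f x - g x) < e)"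

definition densely_defined_schroedinger ::
    "(real ^ 'n \<Rightarrow> complex) \<Rightarrow> (real ^ 'n \<Rightarrow> complex) set \<Rightarrow> bool" where
  "densely_defined_schroedinger V D \<longleftrightarrow>
     V \<in> borel_measurable lebesgue \<and> dense_domain D \<and>
     (\<forall>f\<in>D. \<forall>K. compact K \<longrightarrow> set_integrable lebesgue K (\<lambda>x. V x * f x)) \<and>
     D \<subseteq> Domain (schroedinger V D)"

definition shifted_range ::
    "((real ^ 'n \<Rightarrow> complex) \<times> (real ^ 'n \<Rightarrow> complex)) set \<Rightarrow> complex \<Rightarrow> (real ^ 'n \<Rightarrow> complex) set" where
  "shifted_range G z = {h \<in> L2. \<exists>(f, g)\<in>G. AE x in lebesgue. g x - z * f x = h x}"

definition shifted_kernel ::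
    "((real ^ 'n \<Rightarrow> complex) \<times> (real ^ 'n \<Rightarrow> complex)) set \<Rightarrow> complex \<Rightarrow> (real ^ 'n \<Rightarrow> complex) set" where
  "shifted_kernel G z = {f. \<exists>g. (f, g) \<in> G \<and> (AE x in lebesgue. g x = z * f x)}"

text \<open>The a priori estimate below is injectivity of \<open>G - z\<close> together with boundedness of its inverse.\<close>

definition op_spectrum ::
    "((real ^ 'n \<Rightarrow> complex) \<times> (real ^ 'n \<Rightarrow> complex)) set \<Rightarrow> complex set" where
  "op_spectrum G = {z. \<not> (shifted_range G z = L2 \<and>
     (\<exists>C. \<forall>(f, g)\<in>G. l2norm f \<le> C * l2norm (\<lambda>x. g x - z * f x)))}"

definition fredholm_at ::
    "((real ^ 'n \<Rightarrow> complex) \<times> (real ^ 'n \<Rightarrow> complex)) set \<Rightarrow> complex \<Rightarrow> bool" where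
  "fredholm_at G z \<longleftrightarrow>
     (\<exists>B. finite B \<and> B \<subseteq> L2 \<and>
        (\<forall>f\<in>shifted_kernel G z. \<exists>c. AE x in lebesgue. f x = (\<Sum>b\<in>B. c b * b x))) \<and>
     (\<exists>B. finite B \<and> B \<subseteq> L2 \<and>
        (\<forall>f\<in>L2. \<exists>h\<in>shifted_range G z. \<exists>c. AE x in lebesgue. f x = h x + (\<Sum>b\<in>B. c b * b x))) \<and>
     (\<forall>h f. (\<forall>k::nat. h k \<in> shifted_range G z) \<and> f \<in> L2 \<and>
        (\<lambda>k. l2norm (\<lambda>x. h k x - f x)) \<longlonglongrightarrow> 0 \<longrightarrow> f \<in> shifted_range G z)"

definition ess_spectrum ::
    "((real ^ 'n \<Rightarrow> complex) \<times> (real ^ 'n \<Rightarrow> complex)) set \<Rightarrow> complex set" where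
  "ess_spectrum G = {z. \<not> fredholm_at G z}"

definition schroedinger_eigensystem ::
    "(real ^ 'n \<Rightarrow> complex) \<Rightarrow> (real ^ 'n \<Rightarrow> complex) set \<Rightarrow> 'i set \<Rightarrow> ('i \<Rightarrow> complex) \<Rightarrow>
     ('i \<Rightarrow> real ^ 'n \<Rightarrow> complex) \<Rightarrow> ('i \<Rightarrow> real ^ 'n \<Rightarrow> complex) \<Rightarrow> bool" where
  "schroedinger_eigensystem V D I lam u v \<longleftrightarrow>
     densely_defined_schroedinger V D \<and>
     op_spectrum (schroedinger V D) = lam ` I \<and>
     ess_spectrum (schroedinger V D) = {} \<and>
     countable I \<and>
     (\<forall>\<xi>\<in>I. (u \<xi>, \<lambda>x. lam \<xi> * u \<xi> x) \<in> schroedinger V D) \<and>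
     riesz_basis I u \<and> biorthogonal I u v"

text \<open>Eigenvalues of the operator \<open>\<H>\<close> on the \<open>u \<xi>\<close>; the shift \<open>c\<close> is used only if \<open>0\<close> is an eigenvalue of
  \<open>\<H>\<^sub>0 = - \<Delta> + V\<close>.\<close>

definition mu :: "'i set \<Rightarrow> ('i \<Rightarrow> complex) \<Rightarrow> real \<Rightarrow> 'i \<Rightarrow> real" where
  "mu I lam c \<xi> = (if \<exists>\<eta>\<in>I. lam \<eta> = 0 then cmod (lam \<xi>) + c else cmod (lam \<xi>))"

definition bracket :: "('i \<Rightarrow> complex) \<Rightarrow> 'i \<Rightarrow> real" where
  "bracket lam \<xi> = sqrt (1 + cmod (lam \<xi>))"

definition hat :: "('i \<Rightarrow> real ^ 'n \<Rightarrow> complex) \<Rightarrow> (real ^ 'n \<Rightarrow> complex) \<Rightarrow> 'i \<Rightarrow> complex" where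
  "hat v f \<xi> = (\<integral>x. f x * cnj (v \<xi> x) \<partial>lebesgue)"


section \<open>Gevrey spaces and their inductive limit topology\<close>

definition gevrey_step ::
    "'i set \<Rightarrow> ('i \<Rightarrow> complex) \<Rightarrow> ('i \<Rightarrow> real ^ 'n \<Rightarrow> complex) \<Rightarrow> real \<Rightarrow> real \<Rightarrow> (real ^ 'n \<Rightarrow> complex) set" where
  "gevrey_step I lam v s A = {f \<in> L2.
     (\<lambda>\<xi>. exp (2 * A * bracket lam \<xi> powr (1 / s)) * (cmod (hat v f \<xi>))\<^sup>2) summable_on I}"

definition gevrey_norm ::
    "'i set \<Rightarrow> ('i \<Rightarrow> complex) \<Rightarrow> ('i \<Rightarrow> real ^ 'n \<Rightarrow> complex) \<Rightarrow> real \<Rightarrow> real \<Rightarrow> (real ^ 'n \<Rightarrow> complex) \<Rightarrow> real" where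
  "gevrey_norm I lam v s A f =
     sqrt (\<Sum>\<^sub>\<infinity>\<xi>\<in>I. exp (2 * A * bracket lam \<xi> powr (1 / s)) * (cmod (hat v f \<xi>))\<^sup>2)"

definition gevrey ::
    "'i set \<Rightarrow> ('i \<Rightarrow> complex) \<Rightarrow> ('i \<Rightarrow> real ^ 'n \<Rightarrow> complex) \<Rightarrow> real \<Rightarrow> (real ^ 'n \<Rightarrow> complex) set" where
  "gevrey I lam v s = (\<Union>A\<in>{0<..}. gevrey_step I lam v s A)"

text \<open>Base of zero neighbourhoods of the locally convex inductive limit: the absolutely convex sets
  whose trace on every step is a zero neighbourhood of that step.\<close>

definition gevrey_nbhds ::
    "'i set \<Rightarrow> ('i \<Rightarrow> complex) \<Rightarrow> ('i \<Rightarrow> real ^ 'n \<Rightarrow> complex) \<Rightarrow> real \<Rightarrow> (real ^ 'n \<Rightarrow> complex) set set" where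
  "gevrey_nbhds I lam v s = {W. W \<subseteq> gevrey I lam v s \<and>
     (\<forall>f\<in>W. \<forall>g\<in>W. \<forall>\<alpha> \<beta>. cmod \<alpha> + cmod \<beta> \<le> 1 \<longrightarrow> (\<lambda>x. \<alpha> * f x + \<beta> * g x) \<in> W) \<and>
     (\<forall>A>0. \<exists>e>0. \<forall>f\<in>gevrey_step I lam v s A. gevrey_norm I lam v s A f < e \<longrightarrow> f \<in> W)}"

definition gevrey_open ::
    "'i set \<Rightarrow> ('i \<Rightarrow> complex) \<Rightarrow> ('i \<Rightarrow> real ^ 'n \<Rightarrow> complex) \<Rightarrow> real \<Rightarrow> (real ^ 'n \<Rightarrow> complex) set \<Rightarrow> bool" where
  "gevrey_open I lam v s U \<longleftrightarrow> U \<subseteq> gevrey I lam v s \<and>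
     (\<forall>f\<in>U. \<exists>W\<in>gevrey_nbhds I lam v s. \<forall>w\<in>W. (\<lambda>x. f x + w x) \<in> U)"

definition gevrey_topology ::
    "'i set \<Rightarrow> ('i \<Rightarrow> complex) \<Rightarrow> ('i \<Rightarrow> real ^ 'n \<Rightarrow> complex) \<Rightarrow> real \<Rightarrow> (real ^ 'n \<Rightarrow> complex) topology" where
  "gevrey_topology I lam v s = topology (gevrey_open I lam v s)"

lemma gevrey_nbhds_Int:
  assumes "W \<in> gevrey_nbhds I lam v s" "W' \<in> gevrey_nbhds I lam v s"
  shows "W \<inter> W' \<in> gevrey_nbhds I lam v s"
  unfolding gevrey_nbhds_def
proof (intro CollectI conjI)
  show "W \<inter> W' \<subseteq> gevrey I lam v s"
    "\<forall>f\<in>W \<inter> W'. \<forall>g\<in>W \<inter> W'. \<forall>\<alpha> \<beta>. cmod \<alpha> + cmod \<beta> \<le> 1 \<longrightarrow> (\<lambda>x. \<alpha> * f x + \<beta> * g x) \<in> W \<inter> W'"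
    using assms unfolding gevrey_nbhds_def by auto
  show "\<forall>A>0. \<exists>e>0. \<forall>f\<in>gevrey_step I lam v s A. gevrey_norm I lam v s A f < e \<longrightarrow> f \<in> W \<inter> W'"
  proof (intro allI impI)
    fix A :: real assume A: "A > 0"
    obtain e where e: "e > 0" "\<forall>f\<in>gevrey_step I lam v s A. gevrey_norm I lam v s A f < e \<longrightarrow> f \<in> W"
      using A assms(1) unfolding gevrey_nbhds_def by auto
    obtain e' where e': "e' > 0" "\<forall>f\<in>gevrey_step I lam v s A. gevrey_norm I lam v s A f < e' \<longrightarrow> f \<in> W'"
      using A assms(2) unfolding gevrey_nbhds_def by auto
    show "\<exists>e>0. \<forall>f\<in>gevrey_step I lam v s A. gevrey_norm I lam v s A f < e \<longrightarrow> f \<in> W \<inter> W'"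
      using e e' by (intro exI[of _ "min e e'"]) auto
  qed
qed

lemma istopology_gevrey_open: "istopology (gevrey_open I lam v s)"
  unfolding istopology_def
proof (intro conjI allI impI)
  fix S T assume S: "gevrey_open I lam v s S" and T: "gevrey_open I lam v s T"
  show "gevrey_open I lam v s (S \<inter> T)"
    unfolding gevrey_open_def
  proof (intro conjI ballI)
    show "S \<inter> T \<subseteq> gevrey I lam v s" using S unfolding gevrey_open_def by auto
    fix f assume f: "f \<in> S \<inter> T"
    obtain W where W: "W \<in> gevrey_nbhds I lam v s" "\<forall>w\<in>W. (\<lambda>x. f x + w x) \<in> S"
      using S f unfolding gevrey_open_def by blast
    obtain W' where W': "W' \<in> gevrey_nbhds I lam v s" "\<forall>w\<in>W'. (\<lambda>x. f x + w x) \<in> T"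
      using T f unfolding gevrey_open_def by blast
    show "\<exists>W\<in>gevrey_nbhds I lam v s. \<forall>w\<in>W. (\<lambda>x. f x + w x) \<in> S \<inter> T"
      using W W' gevrey_nbhds_Int[OF W(1) W'(1)] by blast
  qed
next
  fix K assume K: "\<forall>S\<in>K. gevrey_open I lam v s S"
  show "gevrey_open I lam v s (\<Union>K)"
    unfolding gevrey_open_def
  proof (intro conjI ballI)
    show "\<Union>K \<subseteq> gevrey I lam v s" using K unfolding gevrey_open_def by auto
    fix f assume "f \<in> \<Union>K"
    then obtain S where S: "S \<in> K" "f \<in> S" by blast
    then obtain W where "W \<in> gevrey_nbhds I lam v s" "\<forall>w\<in>W. (\<lambda>x. f x + w x) \<in> S"
      using K unfolding gevrey_open_def by meson
    then show "\<exists>W\<in>gevrey_nbhds I lam v s. \<forall>w\<in>W. (\<lambda>x. f x + w x) \<in> \<Union>K"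
      using S by blast
  qed
qed

lemma openin_gevrey_topology: "openin (gevrey_topology I lam v s) = gevrey_open I lam v s"
  unfolding gevrey_topology_def using istopology_gevrey_open by (rule topology_inverse')

lemma L2_integrable_mult_cnj:
  assumes "f \<in> L2" "g \<in> L2"
  shows "integrable lebesgue (\<lambda>x. f x * cnj (g x))"
proof (rule Bochner_Integration.integrable_bound)
  show "integrable lebesgue (\<lambda>x. (cmod (f x))\<^sup>2 + (cmod (g x))\<^sup>2)"
    using assms unfolding L2_def by auto
  show "(\<lambda>x. f x * cnj (g x)) \<in> borel_measurable lebesgue"
    using assms unfolding L2_def by (auto intro!: borel_measurable_times borel_measurable_continuous_on[of cnj] continuous_intros)
  show "AE x in lebesgue. norm (f x * cnj (g x)) \<le> norm ((cmod (f x))\<^sup>2 + (cmod (g x))\<^sup>2)"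
  proof (rule AE_I2)
    fix x
    have "2 * (cmod (f x) * cmod (g x)) \<le> (cmod (f x))\<^sup>2 + (cmod (g x))\<^sup>2"
      using sum_squares_bound[of "cmod (f x)" "cmod (g x)"] by simp
    moreover have "0 \<le> cmod (f x) * cmod (g x)" by simp
    ultimately have "cmod (f x) * cmod (g x) \<le> (cmod (f x))\<^sup>2 + (cmod (g x))\<^sup>2" by linarith
    then show "norm (f x * cnj (g x)) \<le> norm ((cmod (f x))\<^sup>2 + (cmod (g x))\<^sup>2)"
      by (simp add: norm_mult)
  qed
qed

lemma norm_lincomb_square_le:
  "(cmod (\<alpha> * z + \<beta> * w))\<^sup>2 \<le> 2 * (cmod \<alpha>)\<^sup>2 * (cmod z)\<^sup>2 + 2 * (cmod \<beta>)\<^sup>2 * (cmod w)\<^sup>2"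
proof -
  have "cmod (\<alpha> * z + \<beta> * w) \<le> cmod (\<alpha> * z) + cmod (\<beta> * w)" by (rule norm_triangle_ineq)
  then have "(cmod (\<alpha> * z + \<beta> * w))\<^sup>2 \<le> (cmod (\<alpha> * z) + cmod (\<beta> * w))\<^sup>2"
    by (intro power_mono) auto
  also have "\<dots> \<le> 2 * (cmod (\<alpha> * z))\<^sup>2 + 2 * (cmod (\<beta> * w))\<^sup>2"
    using sum_squares_bound[of "cmod (\<alpha> * z)" "cmod (\<beta> * w)"] by (simp add: power2_sum)
  finally show ?thesis by (simp add: norm_mult power_mult_distrib mult_ac)
qed

lemma L2_lincomb:
  assumes "f \<in> L2" "g \<in> L2"
  shows "(\<lambda>x. \<alpha> * f x + \<beta> * g x) \<in> L2"
proof -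
  have [measurable]: "f \<in> borel_measurable lebesgue" "g \<in> borel_measurable lebesgue"
    using assms unfolding L2_def by auto
  have "integrable lebesgue (\<lambda>x. (cmod (\<alpha> * f x + \<beta> * g x))\<^sup>2)"
  proof (rule Bochner_Integration.integrable_bound)
    show "integrable lebesgue (\<lambda>x. 2 * (cmod \<alpha>)\<^sup>2 * (cmod (f x))\<^sup>2 + 2 * (cmod \<beta>)\<^sup>2 * (cmod (g x))\<^sup>2)"
      using assms unfolding L2_def by auto
    show "AE x in lebesgue. norm ((cmod (\<alpha> * f x + \<beta> * g x))\<^sup>2)
        \<le> norm (2 * (cmod \<alpha>)\<^sup>2 * (cmod (f x))\<^sup>2 + 2 * (cmod \<beta>)\<^sup>2 * (cmod (g x))\<^sup>2)"
      using norm_lincomb_square_le by (intro AE_I2) (auto intro!: order_trans[OF _ abs_ge_self])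
  qed measurable
  then show ?thesis unfolding L2_def by auto
qed

lemma hat_lincomb:
  assumes "f \<in> L2" "g \<in> L2" "v \<xi> \<in> L2"
  shows "hat v (\<lambda>x. \<alpha> * f x + \<beta> * g x) \<xi> = \<alpha> * hat v f \<xi> + \<beta> * hat v g \<xi>"
  unfolding hat_def
  using L2_integrable_mult_cnj[OF assms(1,3)] L2_integrable_mult_cnj[OF assms(2,3)]
  by (simp add: distrib_right mult.assoc)

lemma gevrey_step_mono:
  assumes "A \<le> B" "f \<in> gevrey_step I lam v s B"
  shows "f \<in> gevrey_step I lam v s A"
proof -
  have "(\<lambda>\<xi>. exp (2 * A * bracket lam \<xi> powr (1 / s)) * (cmod (hat v f \<xi>))\<^sup>2) summable_on I"
    by (rule summable_on_comparison_test[where f="\<lambda>\<xi>. exp (2 * B * bracket lam \<xi> powr (1 / s)) * (cmod (hat v f \<xi>))\<^sup>2"])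
      (use assms in \<open>auto simp: gevrey_step_def intro!: mult_right_mono\<close>)
  then show ?thesis using assms unfolding gevrey_step_def by auto
qed

lemma gevrey_lincomb:
  assumes "\<forall>\<xi>\<in>I. v \<xi> \<in> L2" "f \<in> gevrey I lam v s" "g \<in> gevrey I lam v s"
  shows "(\<lambda>x. \<alpha> * f x + \<beta> * g x) \<in> gevrey I lam v s"
proof -
  obtain A B where AB: "A > 0" "f \<in> gevrey_step I lam v s A" "B > 0" "g \<in> gevrey_step I lam v s B"
    using assms unfolding gevrey_def by auto
  define C where "C = min A B"
  have C: "C > 0" "f \<in> gevrey_step I lam v s C" "g \<in> gevrey_step I lam v s C"
    using AB gevrey_step_mono[of C A f] gevrey_step_mono[of C B g] unfolding C_def by auto
  let ?e = "\<lambda>\<xi>. exp (2 * C * bracket lam \<xi> powr (1 / s))"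
  have L: "f \<in> L2" "g \<in> L2" using C unfolding gevrey_step_def by auto
  have "(\<lambda>\<xi>. ?e \<xi> * (cmod (hat v (\<lambda>x. \<alpha> * f x + \<beta> * g x) \<xi>))\<^sup>2) summable_on I"
  proof (rule summable_on_comparison_test)
    show "(\<lambda>\<xi>. 2 * (cmod \<alpha>)\<^sup>2 * (?e \<xi> * (cmod (hat v f \<xi>))\<^sup>2)
        + 2 * (cmod \<beta>)\<^sup>2 * (?e \<xi> * (cmod (hat v g \<xi>))\<^sup>2)) summable_on I"
      using C unfolding gevrey_step_def by (intro summable_on_add summable_on_cmult_right) auto
    fix \<xi> assume \<xi>: "\<xi> \<in> I"
    show "?e \<xi> * (cmod (hat v (\<lambda>x. \<alpha> * f x + \<beta> * g x) \<xi>))\<^sup>2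
       \<le> 2 * (cmod \<alpha>)\<^sup>2 * (?e \<xi> * (cmod (hat v f \<xi>))\<^sup>2) + 2 * (cmod \<beta>)\<^sup>2 * (?e \<xi> * (cmod (hat v g \<xi>))\<^sup>2)"
      using mult_left_mono[OF norm_lincomb_square_le[of \<alpha> "hat v f \<xi>" \<beta> "hat v g \<xi>"], of "?e \<xi>"]
      by (simp add: hat_lincomb[where v=v and \<xi>=\<xi>, OF L] assms(1) \<xi> algebra_simps)
  qed auto
  then show ?thesis using C(1) L2_lincomb[OF L] unfolding gevrey_def gevrey_step_def by auto
qed

lemma topspace_gevrey_topology:
  assumes "\<forall>\<xi>\<in>I. v \<xi> \<in> L2"
  shows "topspace (gevrey_topology I lam v s) = gevrey I lam v s"
proof -
  have nb: "gevrey I lam v s \<in> gevrey_nbhds I lam v s"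
    unfolding gevrey_nbhds_def
  proof (intro CollectI conjI allI impI ballI)
    fix A :: real assume "A > 0"
    then show "\<exists>e>0. \<forall>f\<in>gevrey_step I lam v s A. gevrey_norm I lam v s A f < e \<longrightarrow> f \<in> gevrey I lam v s"
      unfolding gevrey_def by (intro exI[of _ 1]) auto
  qed (rule subset_refl, rule gevrey_lincomb[OF assms])
  have "gevrey_open I lam v s (gevrey I lam v s)"
    unfolding gevrey_open_def
  proof (intro conjI ballI subset_refl)
    fix f assume f: "f \<in> gevrey I lam v s"
    have "(\<lambda>x. f x + w x) \<in> gevrey I lam v s" if "w \<in> gevrey I lam v s" for w
      using gevrey_lincomb[OF assms f that, of 1 1] by simp
    then show "\<exists>W\<in>gevrey_nbhds I lam v s. \<forall>w\<in>W. (\<lambda>x. f x + w x) \<in> gevrey I lam v s"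
      using nb by (intro bexI[of _ "gevrey I lam v s"]) simp_all
  qed
  then have "gevrey I lam v s \<subseteq> topspace (gevrey_topology I lam v s)"
    by (intro openin_subset) (simp add: openin_gevrey_topology)
  moreover have "topspace (gevrey_topology I lam v s) \<subseteq> gevrey I lam v s"
    unfolding topspace_def openin_gevrey_topology gevrey_open_def by auto
  ultimately show ?thesis by auto
qed

text \<open>Boundedness in the sense of topological vector spaces: absorbed by every zero neighbourhood.\<close>

definition gevrey_bounded ::
    "'i set \<Rightarrow> ('i \<Rightarrow> complex) \<Rightarrow> ('i \<Rightarrow> real ^ 'n \<Rightarrow> complex) \<Rightarrow> real \<Rightarrow> (real ^ 'n \<Rightarrow> complex) set \<Rightarrow> bool" where
  "gevrey_bounded I lam v s B \<longleftrightarrow> B \<subseteq> gevrey I lam v s \<and>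
     (\<forall>W\<in>gevrey_nbhds I lam v s. \<exists>K>0. \<forall>f\<in>B. (\<lambda>x. f x / complex_of_real K) \<in> W)"


section \<open>Regularity in time\<close>

definition Cl_scalar :: "nat \<Rightarrow> real \<Rightarrow> (real \<Rightarrow> real) \<Rightarrow> bool" where
  "Cl_scalar l T a \<longleftrightarrow> (\<exists>d :: nat \<Rightarrow> real \<Rightarrow> real. d 0 = a \<and>
     (\<forall>j\<le>l. continuous_on {0..T} (d j)) \<and>
     (\<forall>j<l. \<forall>t\<in>{0..T}. (d j has_real_derivative d (Suc j) t) (at t within {0..T})))"

definition Linf :: "real \<Rightarrow> (real \<Rightarrow> real) \<Rightarrow> bool" where
  "Linf T q \<longleftrightarrow> q \<in> borel_measurable (lebesgue_on {0..T}) \<and>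
     (\<exists>M. AE t in lebesgue_on {0..T}. \<bar>q t\<bar> \<le> M)"

definition diff_quotient :: "(real \<Rightarrow> real ^ 'n \<Rightarrow> complex) \<Rightarrow> real \<Rightarrow> real \<Rightarrow> real ^ 'n \<Rightarrow> complex" where
  "diff_quotient w t r = (\<lambda>x. (w r x - w t x) / complex_of_real (r - t))"

definition has_curve_derivative ::
    "(real ^ 'n \<Rightarrow> complex) topology \<Rightarrow> real \<Rightarrow> (real \<Rightarrow> real ^ 'n \<Rightarrow> complex) \<Rightarrow>
     (real ^ 'n \<Rightarrow> complex) \<Rightarrow> real \<Rightarrow> bool" where
  "has_curve_derivative X T w w' t \<longleftrightarrow> limitin X (diff_quotient w t) w' (at t within {0..T})"

definition C_curve ::
    "nat \<Rightarrow> (real ^ 'n \<Rightarrow> complex) topology \<Rightarrow> real \<Rightarrow> (real \<Rightarrow> real ^ 'n \<Rightarrow> complex) \<Rightarrow> bool" where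
  "C_curve k X T w \<longleftrightarrow> (\<exists>d :: nat \<Rightarrow> real \<Rightarrow> real ^ 'n \<Rightarrow> complex. d 0 = w \<and>
     (\<forall>j\<le>k. continuous_map (top_of_set {0..T}) X (d j)) \<and>
     (\<forall>j<k. \<forall>t\<in>{0..T}. has_curve_derivative X T (d j) (d (Suc j) t) t))"

text \<open>The class \<open>W\<^sup>2\<^sup>,\<^sup>\<infinity>([0,T]; \<gamma>\<^sup>s)\<close>: continuously differentiable curves whose derivative is Lipschitz
  (bounded set of difference quotients) and differentiable at almost every time. This is the
  regularity of solutions for a merely bounded \<open>q\<close>: a jump of \<open>q\<close> produces a jump of the second
  derivative, so that solutions are in general not of class \<open>C\<^sup>2\<close> in time.\<close>

definition W2inf_curve ::
    "'i set \<Rightarrow> ('i \<Rightarrow> complex) \<Rightarrow> ('i \<Rightarrow> real ^ 'n \<Rightarrow> complex) \<Rightarrow> real \<Rightarrow> real \<Rightarrow>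
     (real \<Rightarrow> real ^ 'n \<Rightarrow> complex) \<Rightarrow> bool" where
  "W2inf_curve I lam v s T w \<longleftrightarrow> (\<exists>w' w''.
     continuous_map (top_of_set {0..T}) (gevrey_topology I lam v s) w \<and>
     continuous_map (top_of_set {0..T}) (gevrey_topology I lam v s) w' \<and>
     (\<forall>t\<in>{0..T}. has_curve_derivative (gevrey_topology I lam v s) T w (w' t) t) \<and>
     gevrey_bounded I lam v s {diff_quotient w' t r | t r. t \<in> {0..T} \<and> r \<in> {0..T} \<and> r \<noteq> t} \<and>
     (AE t in lebesgue_on {0..T}.
        has_curve_derivative (gevrey_topology I lam v s) T w' (w'' t) t))"


section \<open>The Cauchy problem\<close>

text \<open>The equation, read coefficientwise after the \<open>\<H>\<close>-Fourier transform, is required at all times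
  outside the exceptional set \<open>N\<close>; \<open>mu'\<close> lists the eigenvalues of \<open>\<H>\<close>.\<close>

definition solves_off ::
    "real set \<Rightarrow> 'i set \<Rightarrow> ('i \<Rightarrow> real ^ 'n \<Rightarrow> complex) \<Rightarrow> ('i \<Rightarrow> real) \<Rightarrow> real \<Rightarrow>
     (real \<Rightarrow> real) \<Rightarrow> (real \<Rightarrow> real) \<Rightarrow> (real \<Rightarrow> real ^ 'n \<Rightarrow> complex) \<Rightarrow>
     (real ^ 'n \<Rightarrow> complex) \<Rightarrow> (real ^ 'n \<Rightarrow> complex) \<Rightarrow> (real \<Rightarrow> real ^ 'n \<Rightarrow> complex) \<Rightarrow> bool" where
  "solves_off N I v mu' T a q f w0 w1 w \<longleftrightarrow> (\<forall>\<xi>\<in>I. \<exists>y' y''.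
     (\<forall>t\<in>{0..T}. ((\<lambda>t. hat v (w t) \<xi>) has_vector_derivative y' t) (at t within {0..T})) \<and>
     (\<forall>t\<in>{0..T} - N. (y' has_vector_derivative y'' t) (at t within {0..T}) \<and>
        y'' t + of_real (a t * mu' \<xi>) * hat v (w t) \<xi> + of_real (q t) * hat v (w t) \<xi>
          = hat v (f t) \<xi>) \<and>
     hat v (w 0) \<xi> = hat v w0 \<xi> \<and> y' 0 = hat v w1 \<xi>)"

definition unique_curve ::
    "real \<Rightarrow> ((real \<Rightarrow> real ^ 'n \<Rightarrow> complex) \<Rightarrow> bool) \<Rightarrow> bool" where
  "unique_curve T P \<longleftrightarrow> (\<exists>w. P w \<and>
     (\<forall>z. P z \<longrightarrow> (\<forall>t\<in>{0..T}. AE x in lebesgue. z t x = w t x)))"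

end

theory Submission
  imports Defs
begin

text \<open>
  The Fourier transform turns the problem into the ordinary differential equations
  \<open>y'' + (a \<mu>\<^sub>\<xi> + q) y = f\<^sub>\<xi>\<close>, where \<open>\<mu>\<^sub>\<xi>\<close> is of order at most \<open>\<langle>\<xi>\<rangle>\<^sup>2\<close>. The theorem holds because, for every
  \<open>\<delta> > 0\<close>, \<open>|y|\<^sup>2 + |y'|\<^sup>2\<close> exceeds the square of the size of the data by at most a factor
  \<open>C exp (\<delta> \<langle>\<xi>\<rangle> powr (1 / s))\<close>. With \<open>\<delta> = A\<close> this loss is the passage from the Hilbert space with parameter \<open>A\<close>
  to the one with parameter \<open>A / 2\<close>, which the union over all \<open>A\<close> does not see.

  Since \<open>a\<close> may vanish, the loss is estimated with the energy \<open>|y'|\<^sup>2 + ((a + \<epsilon>) \<mu>\<^sub>\<xi> + 1) |y|\<^sup>2\<close>, whose logarithm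
  grows at the rate \<open>C + sqrt (\<epsilon> \<mu>\<^sub>\<xi>) + |a'| / (a + \<epsilon>)\<close> at most (\<open>energy_estimate\<close>). The heart of the matter is that the
  integral of \<open>|a'| / (a + \<epsilon>)\<close> is of order \<open>\<epsilon> powr (- 1 / l)\<close> up to a logarithm (\<open>integral_log_deriv_bound\<close>): on
  intervals of length \<open>\<epsilon> powr (1 / l)\<close> the function \<open>a\<close> is a polynomial of degree less than \<open>l\<close> up to an error of
  order \<open>\<epsilon>\<close>, and the logarithm of a positive polynomial has few monotone pieces. For \<open>\<epsilon> = \<langle>\<xi>\<rangle> powr (- p)\<close> the
  total growth is \<open>\<langle>\<xi>\<rangle> powr (1 - p / 2) + \<langle>\<xi>\<rangle> powr (p / l)\<close>, and both exponents can be made smaller than \<open>1 / s\<close>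
  exactly when \<open>s < 1 + l / 2\<close> (\<open>balanced_exponent\<close>). The inequality is strict, so the logarithm does no harm.

  To return to curves in the Gevrey space, one needs that a continuous curve in the inductive limit takes its values in
  a single step, boundedly and, after lowering the parameter, continuously (\<open>curve_coefficients_in_one_step\<close>,
  \<open>curve_continuous_in_one_step\<close>). The energy estimate then bounds all coefficients by a summable family independent of
  time, so that continuity and differentiability in the norm of a step follow from dominated convergence
  (\<open>coefficient_solution\<close>), and the theorem of Riesz and Fischer for the Riesz basis gives back functions
  (\<open>riesz_fischer\<close>). For a merely bounded \<open>q\<close> the second derivative exists at the times where the integral of \<open>q\<close> is
  differentiable, that is, outside one null set that serves all \<open>\<xi>\<close> (\<open>l2_tendsto_diff_quotient_integral\<close>); for continuous \<open>q\<close>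
  these are all times.

  Uniqueness is the energy estimate for the difference of two solutions. It only needs that \<open>y'\<close> is Lipschitz and that
  the equation holds almost everywhere (\<open>nonincreasing_if_deriv_nonpos_ae\<close>). Finally, a function is determined by its
  coefficients up to null sets (\<open>hat_determines\<close>).
\<close>

section \<open>Differential inequalities off a null set\<close>

text \<open>For real functions this local property is inherited by products and follows from
  differentiability, and it suffices for mapping null sets to null sets.\<close>

definition lipschitz_at :: "(real \<Rightarrow> real) \<Rightarrow> real \<Rightarrow> real set \<Rightarrow> bool" where
  "lipschitz_at f x S \<longleftrightarrow> (\<exists>B. \<forall>\<^sub>F y in at x within S. \<bar>f y - f x\<bar> \<le> B * \<bar>y - x\<bar>)"

lemma lipschitz_at_add:
  assumes "lipschitz_at f x S" "lipschitz_at g x S"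
  shows "lipschitz_at (\<lambda>t. f t + g t) x S"
proof -
  obtain B C where "\<forall>\<^sub>F y in at x within S. \<bar>f y - f x\<bar> \<le> B * \<bar>y - x\<bar>"
    "\<forall>\<^sub>F y in at x within S. \<bar>g y - g x\<bar> \<le> C * \<bar>y - x\<bar>"
    using assms unfolding lipschitz_at_def by blast
  then have "\<forall>\<^sub>F y in at x within S. \<bar>(f y + g y) - (f x + g x)\<bar> \<le> (B + C) * \<bar>y - x\<bar>"
    by eventually_elim (simp add: algebra_simps)
  then show ?thesis unfolding lipschitz_at_def by blast
qed

lemma lipschitz_at_mult:
  assumes "lipschitz_at f x S" "lipschitz_at g x S"
  shows "lipschitz_at (\<lambda>t. f t * g t) x S"
proof -
  obtain B C where f: "\<forall>\<^sub>F y in at x within S. \<bar>f y - f x\<bar> \<le> B * \<bar>y - x\<bar>"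
    and g: "\<forall>\<^sub>F y in at x within S. \<bar>g y - g x\<bar> \<le> C * \<bar>y - x\<bar>"
    using assms unfolding lipschitz_at_def by blast
  have near: "\<forall>\<^sub>F y in at x within S. \<bar>y - x\<bar> < 1"
    using eventually_at[of "\<lambda>y. \<bar>y - x\<bar> < 1" x S] by (auto simp: dist_real_def intro: exI[of _ 1])
  have "\<forall>\<^sub>F y in at x within S. \<bar>f y * g y - f x * g x\<bar> \<le> (\<bar>B\<bar> * (\<bar>g x\<bar> + \<bar>C\<bar>) + \<bar>f x\<bar> * \<bar>C\<bar>) * \<bar>y - x\<bar>"
    using f g near
  proof eventually_elim
    case (elim y)
    have fy: "\<bar>f y - f x\<bar> \<le> \<bar>B\<bar> * \<bar>y - x\<bar>" and gy: "\<bar>g y - g x\<bar> \<le> \<bar>C\<bar> * \<bar>y - x\<bar>"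
      using elim by (meson abs_ge_self abs_ge_zero mult_right_mono order_trans)+
    have "\<bar>C\<bar> * \<bar>y - x\<bar> \<le> \<bar>C\<bar>" using elim(3) by (simp add: mult_left_le)
    then have gb: "\<bar>g y\<bar> \<le> \<bar>g x\<bar> + \<bar>C\<bar>" using gy by linarith
    have "f y * g y - f x * g x = (f y - f x) * g y + f x * (g y - g x)" by (simp add: algebra_simps)
    then have "\<bar>f y * g y - f x * g x\<bar> \<le> \<bar>f y - f x\<bar> * \<bar>g y\<bar> + \<bar>f x\<bar> * \<bar>g y - g x\<bar>"
      by (metis abs_mult abs_triangle_ineq)
    also have "\<dots> \<le> (\<bar>B\<bar> * \<bar>y - x\<bar>) * (\<bar>g x\<bar> + \<bar>C\<bar>) + \<bar>f x\<bar> * (\<bar>C\<bar> * \<bar>y - x\<bar>)"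
      using fy gy gb by (intro add_mono mult_mono mult_left_mono) auto
    finally show ?case by (simp add: algebra_simps)
  qed
  then show ?thesis unfolding lipschitz_at_def by blast
qed

lemma has_real_derivative_imp_lipschitz_at:
  assumes "(f has_real_derivative D) (at x within S)"
  shows "lipschitz_at f x S"
proof -
  have "((\<lambda>y. \<bar>(f y - f x) / (y - x)\<bar>) \<longlongrightarrow> \<bar>D\<bar>) (at x within S)"
    using assms unfolding has_field_derivative_iff by (rule tendsto_rabs)
  then have "\<forall>\<^sub>F y in at x within S. \<bar>(f y - f x) / (y - x)\<bar> < \<bar>D\<bar> + 1"
    by (rule order_tendstoD) simp
  moreover have "\<forall>\<^sub>F y in at x within S. y \<noteq> x"
    by (auto simp: eventually_at_filter)
  ultimately have "\<forall>\<^sub>F y in at x within S. \<bar>f y - f x\<bar> \<le> (\<bar>D\<bar> + 1) * \<bar>y - x\<bar>"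
    by eventually_elim (simp add: abs_divide divide_less_eq)
  then show ?thesis unfolding lipschitz_at_def by blast
qed

text \<open>If \<open>F\<close> increased, tilting it slightly downwards would give \<open>G\<close> with \<open>G a < G b\<close> and a strictly
  negative derivative off \<open>N\<close>. The image of \<open>N\<close> is a null set, so some level between \<open>G a\<close> and \<open>G b\<close> is
  attained only where \<open>G\<close> strictly decreases; but after the last time below that level \<open>G\<close> stays above it.
  The lemma takes the place of absolute continuity: for a bounded measurable potential the derivative of a
  solution is Lipschitz and only almost everywhere differentiable.\<close>

lemma nonincreasing_if_deriv_nonpos_ae:
  fixes F :: "real \<Rightarrow> real"
  assumes ab: "a \<le> b"
    and lip: "\<And>x. x \<in> {a..b} \<Longrightarrow> lipschitz_at F x {a..b}"
    and N: "negligible N"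
    and der: "\<And>t. t \<in> {a..b} - N \<Longrightarrow> \<exists>D\<le>0. (F has_real_derivative D) (at t within {a..b})"
  shows "F b \<le> F a"
proof (rule ccontr)
  assume "\<not> F b \<le> F a"
  then have lt: "F a < F b" by simp
  then have ab': "a < b" using ab by (cases "a = b") auto
  define e where "e = (F b - F a) / (2 * (b - a))"
  have e: "e > 0" using lt ab' by (simp add: e_def)
  define G where "G t = F t - e * t" for t
  have "e * (b - a) = (F b - F a) / 2"
    using ab' unfolding e_def by (simp add: divide_simps)
  then have "G b - G a = (F b - F a) / 2"
    unfolding G_def by (simp add: algebra_simps)
  then have Gab: "G a < G b" using lt by simp
  have Glip: "lipschitz_at G x {a..b}" if "x \<in> {a..b}" for x
  proof -
    have "((\<lambda>t. - e * t) has_real_derivative - e) (at x within {a..b})"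
      by (auto intro!: derivative_eq_intros)
    from lipschitz_at_add[OF lip[OF that] has_real_derivative_imp_lipschitz_at[OF this]]
    show ?thesis unfolding G_def[abs_def] by simp
  qed
  have Gcont: "continuous_on {a..b} G"
    unfolding continuous_on
  proof
    fix x assume "x \<in> {a..b}"
    then obtain B where B: "\<forall>\<^sub>F y in at x within {a..b}. \<bar>G y - G x\<bar> \<le> B * \<bar>y - x\<bar>"
      using Glip unfolding lipschitz_at_def by blast
    have "((\<lambda>y. B * \<bar>y - x\<bar>) \<longlongrightarrow> B * \<bar>x - x\<bar>) (at x within {a..b})"
      by (intro tendsto_intros)
    then have lim: "((\<lambda>y. B * \<bar>y - x\<bar>) \<longlongrightarrow> 0) (at x within {a..b})" by simp
    have "((\<lambda>y. G y - G x) \<longlongrightarrow> 0) (at x within {a..b})"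
      by (rule Lim_null_comparison[OF _ lim]) (use B in simp)
    then show "(G \<longlongrightarrow> G x) (at x within {a..b})" using LIM_zero_iff by blast
  qed
  have neg: "negligible (G ` (N \<inter> {a..b}))"
  proof (rule negligible_locally_Lipschitz_image)
    show "negligible (N \<inter> {a..b})" using N negligible_subset by blast
    fix x assume "x \<in> N \<inter> {a..b}"
    then obtain B where "\<forall>\<^sub>F y in at x within {a..b}. \<bar>G y - G x\<bar> \<le> B * \<bar>y - x\<bar>"
      using Glip unfolding lipschitz_at_def by blast
    then obtain U where "open U" "x \<in> U" "\<forall>y\<in>{a..b} \<inter> U. y \<noteq> x \<longrightarrow> \<bar>G y - G x\<bar> \<le> B * \<bar>y - x\<bar>"
      unfolding eventually_at_topological by blast
    then show "\<exists>T B. open T \<and> x \<in> T \<and> (\<forall>y\<in>N \<inter> {a..b} \<inter> T. norm (G y - G x) \<le> B * norm (y - x))"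
      by (intro exI[of _ U] exI[of _ B]) (metis IntE IntI diff_self mult_zero_right norm_zero order.refl real_norm_def)
  qed simp
  \<comment> \<open>a level \<open>y\<close> that \<open>G\<close> attains only off \<open>N\<close>, and the last time \<open>x\<close> with \<open>G x \<le> y\<close>\<close>
  have "\<not> negligible {G a<..<G b}" using Gab by (intro open_not_negligible) auto
  then have "\<not> {G a<..<G b} \<subseteq> G ` (N \<inter> {a..b})" using neg negligible_subset by blast
  then obtain y where y: "G a < y" "y < G b" "y \<notin> G ` (N \<inter> {a..b})"
    by (meson greaterThanLessThan_iff subsetI)
  define S where "S = {t \<in> {a..b}. G t \<le> y}"
  have aS: "a \<in> S" using y ab unfolding S_def by auto
  have "closed S"
    unfolding S_def using continuous_on_closed_Collect_le[OF Gcont continuous_on_const] by auto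
  then have SS: "Sup S \<in> S"
    using aS by (intro closed_contains_Sup) (auto simp: S_def intro!: bdd_aboveI[of _ b])
  define x where "x = Sup S"
  have x: "x \<in> {a..b}" "G x \<le> y" using SS unfolding x_def S_def by auto
  have up: "t \<le> x" if "t \<in> S" for t
    unfolding x_def using that by (intro cSup_upper) (auto simp: S_def intro!: bdd_aboveI[of _ b])
  have "continuous_on {x..b} G" using Gcont x(1) by (auto intro: continuous_on_subset)
  then obtain z where z: "x \<le> z" "z \<le> b" "G z = y"
    using IVT'[of G x y b] x y by auto
  then have "z \<in> S" using x unfolding S_def by auto
  then have "z = x" using up z by force
  then have Gx: "G x = y" using z by simp
  then have "x \<notin> N" using y x by auto
  then obtain D where D: "D \<le> 0" "(F has_real_derivative D) (at x within {a..b})" using der x by blast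
  have "(G has_real_derivative D - e) (at x within {a..b})"
    unfolding G_def by (auto intro!: derivative_eq_intros D)
  then obtain d where d: "d > 0" "\<forall>h>0. x + h \<in> {a..b} \<longrightarrow> h < d \<longrightarrow> G (x + h) < G x"
    using has_real_derivative_neg_dec_right[of G "D - e" x "{a..b}"] D e by auto
  have xb: "x < b" using x y Gx by (cases "x = b") auto
  define h where "h = min (d / 2) (b - x)"
  have h: "h > 0" "h < d" "x + h \<in> {a..b}" using d xb x unfolding h_def by auto
  then have "G (x + h) < y" using d Gx by auto
  then have "x + h \<in> S" using h unfolding S_def by auto
  then show False using up h by fastforce
qed

section \<open>The logarithmic derivative of a nonnegative smooth function\<close>

text \<open>The zeros of \<open>g'\<close> cut the interval into pieces on which \<open>g\<close> is monotone, and on each of them \<open>g\<close>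
  varies by at most \<open>hi - lo\<close>.\<close>

lemma integral_abs_deriv_le:
  fixes g g' :: "real \<Rightarrow> real"
  assumes "a \<le> b" "continuous_on {a..b} g'"
    and "\<And>t. t \<in> {a..b} \<Longrightarrow> (g has_real_derivative g' t) (at t within {a..b})"
    and "\<And>t. t \<in> {a..b} \<Longrightarrow> g t \<in> {lo..hi}"
    and "finite {t \<in> {a<..<b}. g' t = 0}"
  shows "integral {a..b} (\<lambda>t. \<bar>g' t\<bar>) \<le> (real (card {t \<in> {a<..<b}. g' t = 0}) + 1) * (hi - lo)"
  using assms
proof (induction "card {t \<in> {a<..<b}. g' t = 0}" arbitrary: a b rule: less_induct)
  case less
  let ?Z = "\<lambda>a b. {t \<in> {a<..<b}. g' t = 0}"
  have lohi: "lo \<le> hi" using less.prems(1) less.prems(4)[of a] by auto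
  have intg: "g' integrable_on {a..b}" "(\<lambda>t. \<bar>g' t\<bar>) integrable_on {a..b}"
    using less.prems(2) by (auto intro!: integrable_continuous_real continuous_intros)
  show ?case
  proof (cases "?Z a b = {}")
    case True
    have ftc: "(g' has_integral (g b - g a)) {a..b}"
      using less.prems(1,3) by (intro fundamental_theorem_of_calculus)
        (auto simp: has_real_derivative_iff_has_vector_derivative)
    have "(\<forall>t\<in>{a<..<b}. g' t > 0) \<or> (\<forall>t\<in>{a<..<b}. g' t < 0)"
    proof (rule ccontr)
      assume "\<not> ?thesis"
      then obtain p r where pr: "p \<in> {a<..<b}" "r \<in> {a<..<b}" "g' p \<le> 0" "g' r \<ge> 0" by force
      have "is_interval (g' ` {a<..<b})"
        by (intro is_interval_connected_1[THEN iffD2] connected_continuous_image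
            continuous_on_subset[OF less.prems(2)]) auto
      then have "0 \<in> g' ` {a<..<b}" using pr unfolding is_interval_1 by blast
      then show False using True by auto
    qed
    then have "integral {a..b} (\<lambda>t. \<bar>g' t\<bar>) \<le> \<bar>g b - g a\<bar>"
    proof
      assume p: "\<forall>t\<in>{a<..<b}. g' t > 0"
      have "integral {a..b} (\<lambda>t. \<bar>g' t\<bar>) = integral {a..b} g'"
        proof (rule integral_spike[of "{a,b}"])
        fix t assume "t \<in> {a..b} - {a, b}"
        then have "t \<in> {a<..<b}" by auto
        with p show "g' t = \<bar>g' t\<bar>" by fastforce
      qed simp
      then show ?thesis using integral_unique[OF ftc] by simp
    next
      assume p: "\<forall>t\<in>{a<..<b}. g' t < 0"
      have "integral {a..b} (\<lambda>t. \<bar>g' t\<bar>) = integral {a..b} (\<lambda>t. - g' t)"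
        proof (rule integral_spike[of "{a,b}"])
        fix t assume "t \<in> {a..b} - {a, b}"
        then have "t \<in> {a<..<b}" by auto
        with p show "- g' t = \<bar>g' t\<bar>" by fastforce
      qed simp
      then show ?thesis using integral_unique[OF ftc] by simp
    qed
    also have "\<dots> \<le> hi - lo" using less.prems(1) less.prems(4)[of a] less.prems(4)[of b] by auto
    finally show ?thesis unfolding True by simp
  next
    case False
    then obtain z where z: "a < z" "z < b" "g' z = 0" by auto
    have fin: "finite (?Z a z)" "finite (?Z z b)"
      by (rule finite_subset[OF _ less.prems(5)]; use z in auto)+
    have "?Z a b = insert z (?Z a z \<union> ?Z z b)" using z by auto
    then have card: "card (?Z a b) = Suc (card (?Z a z) + card (?Z z b))"
      using fin by (simp add: card_Un_disjoint disjoint_iff)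
    have sub: "{a..z} \<subseteq> {a..b}" "{z..b} \<subseteq> {a..b}" using z by auto
    have sub_bound: "integral {p..r} (\<lambda>t. \<bar>g' t\<bar>) \<le> (real (card (?Z p r)) + 1) * (hi - lo)"
      if pr: "p \<le> r" "{p..r} \<subseteq> {a..b}" "card (?Z p r) < card (?Z a b)" "finite (?Z p r)" for p r
    proof (rule less.hyps[OF pr(3,1) _ _ _ pr(4)])
      show "continuous_on {p..r} g'" using less.prems(2) pr(2) by (rule continuous_on_subset)
      show "(g has_real_derivative g' t) (at t within {p..r})" if "t \<in> {p..r}" for t
        using DERIV_subset[OF less.prems(3) pr(2)] that pr(2) by blast
      show "g t \<in> {lo..hi}" if "t \<in> {p..r}" for t
        using less.prems(4) that pr(2) by blast
    qed
    have 1: "integral {a..z} (\<lambda>t. \<bar>g' t\<bar>) \<le> (real (card (?Z a z)) + 1) * (hi - lo)"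
      by (rule sub_bound) (use z sub fin card in auto)
    have 2: "integral {z..b} (\<lambda>t. \<bar>g' t\<bar>) \<le> (real (card (?Z z b)) + 1) * (hi - lo)"
      by (rule sub_bound) (use z sub fin card in auto)
    have "integral {a..b} (\<lambda>t. \<bar>g' t\<bar>) = integral {a..z} (\<lambda>t. \<bar>g' t\<bar>) + integral {z..b} (\<lambda>t. \<bar>g' t\<bar>)"
      using Henstock_Kurzweil_Integration.integral_combine[of a z b "\<lambda>t. \<bar>g' t\<bar>"] z intg by auto
    also have "\<dots> \<le> (real (card (?Z a z)) + 1) * (hi - lo) + (real (card (?Z z b)) + 1) * (hi - lo)"
      using 1 2 by simp
    also have "\<dots> = (real (card (?Z a b)) + 1) * (hi - lo)" unfolding card by (simp add: algebra_simps)
    finally show ?thesis .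
  qed
qed

text \<open>The length \<open>h\<close> of the interval satisfies \<open>h ^ l \<le> \<epsilon>\<close>, so the Taylor polynomial of degree \<open>l - 1\<close>
  approximates \<open>d 0\<close> up to \<open>L * \<epsilon>\<close> and, after adding a multiple of \<open>\<epsilon>\<close>, is comparable to \<open>d 0 + \<epsilon>\<close>. The
  logarithm of that polynomial has at most \<open>l - 2\<close> critical points and lies between \<open>ln \<epsilon>\<close> and a constant,
  which bounds its total variation. The remainder of the first derivative is at most \<open>L * h ^ (l - 1)\<close> and
  contributes at most \<open>L * h ^ l / \<epsilon> \<le> L\<close>.\<close>

lemma log_deriv_piece:
  fixes d :: "nat \<Rightarrow> real \<Rightarrow> real" and l :: nat
  assumes l: "l \<ge> 2" and \<alpha>\<beta>: "\<alpha> < \<beta>" and eps: "0 < \<epsilon>" "\<epsilon> \<le> 1" "(\<beta> - \<alpha>) ^ l \<le> \<epsilon>"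
    and cont: "\<And>j. j \<le> l \<Longrightarrow> continuous_on {\<alpha>..\<beta>} (d j)"
    and der: "\<And>j t. j < l \<Longrightarrow> t \<in> {\<alpha>..\<beta>} \<Longrightarrow> (d j has_real_derivative d (Suc j) t) (at t within {\<alpha>..\<beta>})"
    and nonneg: "\<And>t. t \<in> {\<alpha>..\<beta>} \<Longrightarrow> d 0 t \<ge> 0"
    and L: "\<And>t. t \<in> {\<alpha>..\<beta>} \<Longrightarrow> \<bar>d l t\<bar> \<le> L" and A: "\<And>t. t \<in> {\<alpha>..\<beta>} \<Longrightarrow> d 0 t \<le> A"
  shows "integral {\<alpha>..\<beta>} (\<lambda>t. \<bar>d 1 t\<bar> / (d 0 t + \<epsilon>))
           \<le> (2 * L + 1) * l * (ln ((2 * L + 1) * (A + 1)) - ln \<epsilon>) + L"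
proof -
  let ?J = "{\<alpha>..\<beta>}" and ?h = "\<beta> - \<alpha>"
  have L0: "L \<ge> 0" using L[of \<alpha>] \<alpha>\<beta> by auto
  have A0: "A \<ge> 0" using A[of \<alpha>] nonneg[of \<alpha>] \<alpha>\<beta> by auto
  \<comment> \<open>\<open>Suc m\<close> is the degree of the Taylor polynomial \<open>p\<close>, \<open>m\<close> that of its derivative\<close>
  obtain m where m: "l = Suc (Suc m)" using l by (metis Suc_eq_plus1 add_2_eq_Suc le_iff_add)
  define p where "p = (\<Sum>j\<le>Suc m. smult (d j \<alpha> / fact j) ([:-\<alpha>, 1:] ^ j))"
  have pp: "poly p t = (\<Sum>j\<le>Suc m. d j \<alpha> * (t - \<alpha>) ^ j / fact j)" for t
    unfolding p_def by (simp only: poly_sum poly_smult poly_power) (simp add: algebra_simps)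
  have "degree p \<le> Suc m"
    unfolding p_def
  proof (intro degree_sum_le)
    fix j assume j: "j \<in> {..Suc m}"
    have "degree (smult (d j \<alpha> / fact j) ([:-\<alpha>, 1:] ^ j)) \<le> degree ([:-\<alpha>, 1:] ^ j)"
      by (rule degree_smult_le)
    also have "\<dots> \<le> j" using degree_power_le[of "[:-\<alpha>, 1:]" j] by simp
    finally show "degree (smult (d j \<alpha> / fact j) ([:-\<alpha>, 1:] ^ j)) \<le> Suc m"
      using j by simp
  qed simp
  then have deg: "degree (pderiv p) \<le> m" by (simp add: degree_pderiv)
  have pd: "poly (pderiv p) t = (\<Sum>j\<le>m. d (Suc j) \<alpha> * (t - \<alpha>) ^ j / fact j)" for t
  proof (rule DERIV_unique)
    show "(poly p has_real_derivative poly (pderiv p) t) (at t)" by (rule poly_DERIV)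
    have "((\<lambda>t. \<Sum>j\<le>Suc m. d j \<alpha> * (t - \<alpha>) ^ j / fact j) has_real_derivative
        (\<Sum>j\<le>Suc m. d j \<alpha> * (real j * (t - \<alpha>) ^ (j - 1)) / fact j)) (at t)"
    proof (rule DERIV_sum)
      show "((\<lambda>t. d j \<alpha> * (t - \<alpha>) ^ j / fact j) has_real_derivative
          d j \<alpha> * (real j * (t - \<alpha>) ^ (j - 1)) / fact j) (at t)" for j
        by (auto intro!: derivative_eq_intros)
    qed
    also have "(\<Sum>j\<le>Suc m. d j \<alpha> * (real j * (t - \<alpha>) ^ (j - 1)) / fact j)
        = (\<Sum>j\<le>m. d (Suc j) \<alpha> * (t - \<alpha>) ^ j / fact j)"
    proof -
      have "x * (real (Suc i) * y) / fact (Suc i) = x * y / fact i" for x y :: real and i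
        by (simp add: divide_simps del: of_nat_Suc)
      then show ?thesis unfolding sum.atMost_Suc_shift by simp
    qed
    finally show "(poly p has_real_derivative (\<Sum>j\<le>m. d (Suc j) \<alpha> * (t - \<alpha>) ^ j / fact j)) (at t)"
      unfolding pp[abs_def] .
  qed
  have \<alpha>J: "\<alpha> \<in> ?J" using \<alpha>\<beta> by simp
  have e0: "\<bar>d 0 t - poly p t\<bar> \<le> L * \<epsilon>" if t: "t \<in> ?J" for t
  proof -
    have "\<bar>d 0 t - poly p t\<bar> \<le> L * \<bar>t - \<alpha>\<bar> ^ Suc (Suc m) / fact (Suc m)"
      unfolding pp real_norm_def[symmetric]
    proof (rule field_Taylor)
      show "norm (d (Suc (Suc m)) x) \<le> L" if "x \<in> ?J" for x using L[OF that] unfolding m by simp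
      show "(d i has_real_derivative d (Suc i) x) (at x within ?J)" if "x \<in> ?J" "i \<le> Suc m" for i x
        using der[of i x] that unfolding m by simp
    qed (use \<alpha>J t in auto)
    also have "\<dots> \<le> L * \<bar>t - \<alpha>\<bar> ^ Suc (Suc m) / 1"
      using L0 by (intro divide_left_mono mult_nonneg_nonneg) (auto simp del: fact_Suc intro: fact_ge_1)
    also have "\<dots> \<le> L * ?h ^ l"
      using t L0 unfolding m by (simp del: power_Suc) (intro mult_left_mono power_mono, auto)
    also have "\<dots> \<le> L * \<epsilon>" using eps(3) L0 by (intro mult_left_mono)
    finally show ?thesis .
  qed
  have e1: "\<bar>d 1 t - poly (pderiv p) t\<bar> \<le> L * ?h ^ (l - 1)" if t: "t \<in> ?J" for t
  proof -
    have "\<bar>d 1 t - poly (pderiv p) t\<bar> \<le> L * \<bar>t - \<alpha>\<bar> ^ Suc m / fact m"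
      unfolding pd real_norm_def[symmetric] One_nat_def
    proof (rule field_Taylor[where f = "\<lambda>j. d (Suc j)"])
      show "norm (d (Suc (Suc m)) x) \<le> L" if "x \<in> ?J" for x using L[OF that] unfolding m by simp
      show "(d (Suc i) has_real_derivative d (Suc (Suc i)) x) (at x within ?J)" if "x \<in> ?J" "i \<le> m" for i x
        using der[of "Suc i" x] that unfolding m by simp
    qed (use \<alpha>J t in auto)
    also have "\<dots> \<le> L * \<bar>t - \<alpha>\<bar> ^ Suc m / 1"
      using L0 by (intro divide_left_mono mult_nonneg_nonneg) (auto simp del: fact_Suc intro: fact_ge_1)
    also have "\<dots> \<le> L * ?h ^ Suc m"
      using t L0 unfolding div_by_1 by (intro mult_left_mono power_mono) auto
    finally show ?thesis unfolding m by simp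
  qed
  \<comment> \<open>the factor \<open>L + 1\<close> outweighs the Taylor remainder \<open>L * \<epsilon>\<close>\<close>
  define Q where "Q t = poly p t + (L + 1) * \<epsilon>" for t
  have Q1: "d 0 t + \<epsilon> \<le> Q t" and Q2: "Q t \<le> (2 * L + 1) * (d 0 t + \<epsilon>)" if t: "t \<in> ?J" for t
  proof -
    show "d 0 t + \<epsilon> \<le> Q t" using e0[OF t] unfolding Q_def by (simp add: algebra_simps)
    have "Q t \<le> d 0 t + (2 * L + 1) * \<epsilon>" using e0[OF t] unfolding Q_def by (simp add: algebra_simps)
    also have "\<dots> \<le> (2 * L + 1) * (d 0 t + \<epsilon>)" using L0 nonneg[OF t] by (simp add: algebra_simps)
    finally show "Q t \<le> (2 * L + 1) * (d 0 t + \<epsilon>)" .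
  qed
  have Qe: "\<epsilon> \<le> Q t" and Qh: "Q t \<le> (2 * L + 1) * (A + 1)" if t: "t \<in> ?J" for t
  proof -
    show "\<epsilon> \<le> Q t" using Q1[OF t] nonneg[OF t] by simp
    have "(2 * L + 1) * (d 0 t + \<epsilon>) \<le> (2 * L + 1) * (A + 1)"
      using L0 A[OF t] eps by (intro mult_left_mono) auto
    then show "Q t \<le> (2 * L + 1) * (A + 1)" using Q2[OF t] by simp
  qed
  let ?g = "\<lambda>t. poly (pderiv p) t / Q t" and ?lo = "ln \<epsilon>" and ?hi = "ln ((2 * L + 1) * (A + 1))"
  have Qpos: "Q t > 0" if "t \<in> ?J" for t using Qe[OF that] eps by linarith
  have gcont: "continuous_on ?J ?g"
  proof (intro continuous_intros)
    show "\<forall>t\<in>?J. Q t \<noteq> 0" using Qpos by force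
    show "continuous_on ?J Q" unfolding Q_def by (intro continuous_intros)
  qed
  have lohi: "?lo \<le> ?hi" using Qe[OF \<alpha>J] Qh[OF \<alpha>J] eps by (subst ln_le_cancel_iff) auto
  have gint: "integral ?J (\<lambda>t. \<bar>?g t\<bar>) \<le> l * (?hi - ?lo)"
  proof (cases "pderiv p = 0")
    case True
    then show ?thesis using lohi by simp
  next
    case False
    have eq: "{t \<in> {\<alpha><..<\<beta>}. ?g t = 0} \<subseteq> {t. poly (pderiv p) t = 0}"
    proof
      fix t assume "t \<in> {t \<in> {\<alpha><..<\<beta>}. ?g t = 0}"
      then show "t \<in> {t. poly (pderiv p) t = 0}" using Qpos[of t] by simp
    qed
    have fin: "finite {t. poly (pderiv p) t = 0}" using False poly_roots_finite by blast
    have "card {t \<in> {\<alpha><..<\<beta>}. ?g t = 0} \<le> card {t. poly (pderiv p) t = 0}"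
      using eq fin card_mono by blast
    also have "\<dots> \<le> m" using card_poly_roots_bound[OF False] deg by linarith
    finally have card: "card {t \<in> {\<alpha><..<\<beta>}. ?g t = 0} \<le> m" .
    have "integral ?J (\<lambda>t. \<bar>?g t\<bar>) \<le> (real (card {t \<in> {\<alpha><..<\<beta>}. ?g t = 0}) + 1) * (?hi - ?lo)"
    proof (rule integral_abs_deriv_le[where g = "\<lambda>t. ln (Q t)"])
      fix t assume t: "t \<in> ?J"
      have "(Q has_real_derivative poly (pderiv p) t) (at t within ?J)"
        unfolding Q_def[abs_def] by (auto intro!: derivative_eq_intros DERIV_subset[OF poly_DERIV])
      then show "((\<lambda>t. ln (Q t)) has_real_derivative ?g t) (at t within ?J)"
        using Qpos[OF t] by (auto intro!: derivative_eq_intros)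
      show "ln (Q t) \<in> {?lo..?hi}" using Qe[OF t] Qh[OF t] Qpos[OF t] eps by (auto intro!: ln_mono)
    qed (use \<alpha>\<beta> gcont finite_subset[OF eq fin] in auto)
    also have "\<dots> \<le> l * (?hi - ?lo)" using card lohi m by (intro mult_right_mono) auto
    finally show ?thesis .
  qed
  have dc: "continuous_on ?J (d 0)" "continuous_on ?J (d 1)" using cont l by auto
  have "integral ?J (\<lambda>t. \<bar>d 1 t\<bar> / (d 0 t + \<epsilon>))
      \<le> integral ?J (\<lambda>t. (2 * L + 1) * \<bar>?g t\<bar> + L * ?h ^ (l - 1) / \<epsilon>)"
  proof (rule integral_le)
    show "(\<lambda>t. \<bar>d 1 t\<bar> / (d 0 t + \<epsilon>)) integrable_on ?J"
      using nonneg eps by (intro integrable_continuous_real continuous_intros dc) force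
    show "(\<lambda>t. (2 * L + 1) * \<bar>?g t\<bar> + L * ?h ^ (l - 1) / \<epsilon>) integrable_on ?J"
      by (intro integrable_continuous_real continuous_intros gcont)
    fix t assume t: "t \<in> ?J"
    have pos: "d 0 t + \<epsilon> > 0" using nonneg[OF t] eps by linarith
    have "\<bar>d 1 t\<bar> / (d 0 t + \<epsilon>) \<le> (\<bar>poly (pderiv p) t\<bar> + L * ?h ^ (l - 1)) / (d 0 t + \<epsilon>)"
      using e1[OF t] pos by (intro divide_right_mono) auto
    also have "\<dots> = \<bar>poly (pderiv p) t\<bar> / (d 0 t + \<epsilon>) + L * ?h ^ (l - 1) / (d 0 t + \<epsilon>)"
      by (simp add: add_divide_distrib)
    also have "\<dots> \<le> \<bar>poly (pderiv p) t\<bar> / (Q t / (2 * L + 1)) + L * ?h ^ (l - 1) / \<epsilon>"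
    proof (intro add_mono divide_left_mono mult_pos_pos mult_nonneg_nonneg)
      show "Q t / (2 * L + 1) \<le> d 0 t + \<epsilon>"
        using Q2[OF t] L0 by (subst pos_divide_le_eq) (simp_all add: mult.commute)
    qed (use Qpos[OF t] pos L0 \<alpha>\<beta> eps nonneg[OF t] in auto)
    also have "\<bar>poly (pderiv p) t\<bar> / (Q t / (2 * L + 1)) = (2 * L + 1) * \<bar>?g t\<bar>"
      using Qpos[OF t] by (simp add: abs_divide)
    finally show "\<bar>d 1 t\<bar> / (d 0 t + \<epsilon>) \<le> (2 * L + 1) * \<bar>?g t\<bar> + L * ?h ^ (l - 1) / \<epsilon>" .
  qed
  also have "\<dots> = (2 * L + 1) * integral ?J (\<lambda>t. \<bar>?g t\<bar>) + L * ?h ^ l / \<epsilon>"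
  proof -
    have "(\<lambda>t. (2 * L + 1) * \<bar>?g t\<bar>) integrable_on ?J"
      by (intro integrable_continuous_real continuous_intros gcont)
    then have "integral ?J (\<lambda>t. (2 * L + 1) * \<bar>?g t\<bar> + L * ?h ^ (l - 1) / \<epsilon>)
        = integral ?J (\<lambda>t. (2 * L + 1) * \<bar>?g t\<bar>) + integral ?J (\<lambda>t. L * ?h ^ (l - 1) / \<epsilon>)"
      by (rule integral_add) (rule integrable_const_ivl)
    moreover have "integral ?J (\<lambda>t. L * ?h ^ (l - 1) / \<epsilon>) = L * ?h ^ l / \<epsilon>"
      using \<alpha>\<beta> m by simp
    ultimately show ?thesis by (simp only: integral_mult_right)
  qed
  also have "\<dots> \<le> (2 * L + 1) * (l * (?hi - ?lo)) + L"
  proof (rule add_mono)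
    show "(2 * L + 1) * integral ?J (\<lambda>t. \<bar>?g t\<bar>) \<le> (2 * L + 1) * (l * (?hi - ?lo))"
      using gint L0 by (intro mult_left_mono) auto
    show "L * ?h ^ l / \<epsilon> \<le> L"
      using eps L0 by (simp add: divide_le_eq mult_left_mono)
  qed
  finally show ?thesis by (simp only: mult.assoc)
qed

text \<open>Cut \<open>[0,T]\<close> into about \<open>\<epsilon> powr (- 1 / l)\<close> pieces of length at most \<open>\<epsilon> powr (1 / l)\<close>. The logarithm
  on the right could be removed, since the \<open>l\<close>-th root of a nonnegative function of class \<open>C\<^sup>l\<close> is absolutely
  continuous, but it costs nothing below because the condition on \<open>s\<close> is a strict inequality.\<close>

lemma integral_log_deriv_bound:
  fixes d :: "nat \<Rightarrow> real \<Rightarrow> real" and l :: nat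
  assumes l: "l \<ge> 2" and T: "T > 0"
    and cont: "\<And>j. j \<le> l \<Longrightarrow> continuous_on {0..T} (d j)"
    and der: "\<And>j t. j < l \<Longrightarrow> t \<in> {0..T} \<Longrightarrow> (d j has_real_derivative d (Suc j) t) (at t within {0..T})"
    and nonneg: "\<And>t. t \<in> {0..T} \<Longrightarrow> d 0 t \<ge> 0"
  shows "\<exists>C\<ge>0. \<forall>\<epsilon>. 0 < \<epsilon> \<longrightarrow> \<epsilon> \<le> 1 \<longrightarrow>
      integral {0..T} (\<lambda>t. \<bar>d 1 t\<bar> / (d 0 t + \<epsilon>)) \<le> C * \<epsilon> powr (- 1 / l) * (1 - ln \<epsilon>)"
proof -
  have "bounded (d j ` {0..T})" if "j \<le> l" for j
    using that by (intro compact_imp_bounded compact_continuous_image cont) simp_all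
  then have bd: "\<exists>B. \<forall>t\<in>{0..T}. \<bar>d j t\<bar> \<le> B" if "j \<le> l" for j
    using that unfolding bounded_iff by simp
  obtain L where LA1: "\<forall>t\<in>{0..T}. \<bar>d l t\<bar> \<le> L" using bd[of l] by blast
  obtain A where LA2: "\<forall>t\<in>{0..T}. \<bar>d 0 t\<bar> \<le> A" using bd[of 0] by blast
  note LA = bspec[OF LA1] bspec[OF LA2]
  have L0: "L \<ge> 0" using LA(1)[of 0] T by auto
  have A0: "A \<ge> 0" using LA(2)[of 0] T by auto
  define c where "c = (2 * L + 1) * l"
  define C0 where "C0 = c * ln ((2 * L + 1) * (A + 1)) + c + L"
  have c0: "c \<ge> 0" unfolding c_def using L0 by simp
  have "1 * 1 \<le> (2 * L + 1) * (A + 1)" using L0 A0 by (intro mult_mono) auto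
  then have hi0: "ln ((2 * L + 1) * (A + 1)) \<ge> 0" by simp
  have C00: "C0 \<ge> 0" unfolding C0_def using c0 hi0 L0 by simp
  show ?thesis
  proof (intro exI[of _ "C0 * (T + 1)"] conjI allI impI)
    show "C0 * (T + 1) \<ge> 0" using C00 T by simp
    fix \<epsilon> :: real assume eps: "0 < \<epsilon>" "\<epsilon> \<le> 1"
    let ?r = "\<epsilon> powr (- 1 / l)"
    have r: "?r \<ge> 1" using eps l powr_mono2'[of "- 1 / l" \<epsilon> 1] by simp
    define n where "n = nat \<lceil>T * ?r\<rceil>"
    have n1: "T * ?r \<le> n" unfolding n_def using T by (simp add: le_nat_iff real_nat_ceiling_ge)
    have "0 < T * ?r" using T r by (intro mult_pos_pos) auto
    then have n0: "n > 0" using n1 by linarith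
    have "real n \<le> T * ?r + 1" unfolding n_def using \<open>0 < T * ?r\<close> by linarith
    then have n2: "real n \<le> (T + 1) * ?r" using r by (simp add: algebra_simps)
    define h where "h = T / n"
    have h0: "h > 0" unfolding h_def using T n0 by simp
    have "h \<le> T / (T * ?r)" unfolding h_def using n1 n0 T \<open>0 < T * ?r\<close> by (intro divide_left_mono) auto
    also have "\<dots> = \<epsilon> powr (1 / l)" using T by (simp add: powr_minus_divide)
    finally have "h ^ l \<le> (\<epsilon> powr (1 / l)) ^ l" using h0 by (intro power_mono) auto
    also have "\<dots> = \<epsilon>" using eps l by (simp add: powr_powr flip: powr_realpow)
    finally have hl: "h ^ l \<le> \<epsilon>" .
    define B where "B = c * (ln ((2 * L + 1) * (A + 1)) - ln \<epsilon>) + L"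
    let ?f = "\<lambda>t. \<bar>d 1 t\<bar> / (d 0 t + \<epsilon>)"
    have fc: "continuous_on {0..T} ?f"
    proof (intro continuous_intros cont)
      show "1 \<le> l" "0 \<le> l" using l by auto
      show "\<forall>x\<in>{0..T}. d 0 x + \<epsilon> \<noteq> 0" using nonneg eps by force
    qed
    have nh: "real n * h = T" unfolding h_def using n0 by simp
    have step: "integral {0..real k * h} ?f \<le> k * B" if "k \<le> n" for k
      using that
    proof (induction k)
      case (Suc k)
      have le: "real (Suc k) * h \<le> T"
        using Suc.prems h0 nh by (metis mult_right_mono less_imp_le of_nat_mono)
      have kh: "0 \<le> real k * h" "real k * h < real (Suc k) * h" using h0 by auto
      have sub: "{real k * h..real (Suc k) * h} \<subseteq> {0..T}" using le kh by auto
      have "integral {0..real (Suc k) * h} ?f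
          = integral {0..real k * h} ?f + integral {real k * h..real (Suc k) * h} ?f"
        using kh le by (intro Henstock_Kurzweil_Integration.integral_combine[symmetric]
          integrable_continuous_real continuous_on_subset[OF fc]) auto
      also have "integral {real k * h..real (Suc k) * h} ?f \<le> B"
        unfolding B_def c_def
      proof (rule log_deriv_piece[OF l kh(2) eps])
        show "(real (Suc k) * h - real k * h) ^ l \<le> \<epsilon>" using hl by (simp add: algebra_simps)
        show "continuous_on {real k * h..real (Suc k) * h} (d j)" if "j \<le> l" for j
          using cont[OF that] sub continuous_on_subset by blast
        show "(d j has_real_derivative d (Suc j) t) (at t within {real k * h..real (Suc k) * h})"
          if "j < l" "t \<in> {real k * h..real (Suc k) * h}" for j t
          using der[OF that(1), of t] that(2) sub by (meson DERIV_subset subsetD)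
        show "d 0 t \<ge> 0" "\<bar>d l t\<bar> \<le> L" "d 0 t \<le> A"
          if "t \<in> {real k * h..real (Suc k) * h}" for t
          using nonneg[of t] LA(1)[of t] LA(2)[of t] that sub by auto
      qed
      also have "integral {0..real k * h} ?f \<le> k * B" using Suc by simp
      finally show ?case by (simp add: algebra_simps)
    qed simp
    have "B \<le> C0 * (1 - ln \<epsilon>)"
    proof -
      have "ln \<epsilon> \<le> 0" using eps by simp
      then have "0 \<le> (c * ln ((2 * L + 1) * (A + 1)) + L) * (- ln \<epsilon>)"
        using c0 hi0 L0 by (intro mult_nonneg_nonneg) auto
      then show ?thesis unfolding B_def C0_def using c0 by (simp add: algebra_simps)
    qed
    moreover have "ln \<epsilon> \<le> 0" using eps by simp
    then have "0 \<le> C0 * (1 - ln \<epsilon>)" using C00 by (intro mult_nonneg_nonneg) auto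
    ultimately have "real n * B \<le> (T + 1) * ?r * (C0 * (1 - ln \<epsilon>))"
      using n2 by (meson mult_left_mono mult_right_mono of_nat_0_le_iff order_trans)
    then show "integral {0..T} ?f \<le> C0 * (T + 1) * \<epsilon> powr (- 1 / l) * (1 - ln \<epsilon>)"
      using step[of n] nh by (simp add: mult_ac)
  qed
qed

section \<open>Energy estimate for one mode\<close>

text \<open>The energy is \<open>|y'|\<^sup>2 + ((a + \<epsilon>) m + 1) |y|\<^sup>2\<close>: adding \<open>\<epsilon>\<close> keeps it positive definite where \<open>a\<close>
  vanishes, and the summand \<open>1\<close> controls \<open>y\<close> when \<open>m\<close> is small. In its derivative the terms with \<open>a m\<close>
  cancel. What remains of the principal part is \<open>a' m |y|\<^sup>2\<close>, at most \<open>|a'| / (a + \<epsilon>)\<close> times the energy, and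
  \<open>2 \<epsilon> m Re (y' cnj y)\<close>, at most \<open>sqrt (\<epsilon> m)\<close> times the energy. Gronwall's argument then applies, with the
  monotonicity lemma for functions differentiable off a null set.\<close>

lemma energy_estimate:
  fixes y y' g :: "real \<Rightarrow> complex" and a a' q :: "real \<Rightarrow> real" and m M \<epsilon> T :: real
  assumes y: "\<And>t. t \<in> {0..T} \<Longrightarrow> (y has_vector_derivative y' t) (at t within {0..T})"
    and lip: "L-lipschitz_on {0..T} y'" and N: "negligible N"
    and y': "\<And>t. t \<in> {0..T} - N \<Longrightarrow>
        (y' has_vector_derivative (g t - of_real (a t * m + q t) * y t)) (at t within {0..T})"
    and q: "\<And>t. t \<in> {0..T} - N \<Longrightarrow> \<bar>q t\<bar> \<le> M"
    and a: "\<And>t. t \<in> {0..T} \<Longrightarrow> (a has_real_derivative a' t) (at t within {0..T})"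
    and a'c: "continuous_on {0..T} a'" and a0: "\<And>t. t \<in> {0..T} \<Longrightarrow> a t \<ge> 0"
    and g: "continuous_on {0..T} g" and m: "m \<ge> 0" and \<epsilon>: "\<epsilon> > 0" and M: "M \<ge> 0"
    and \<tau>: "\<tau> \<in> {0..T}"
  shows "(cmod (y' \<tau>))\<^sup>2 + (cmod (y \<tau>))\<^sup>2
     \<le> exp ((M + 2 + sqrt (\<epsilon> * m)) * T + integral {0..T} (\<lambda>t. \<bar>a' t\<bar> / (a t + \<epsilon>)))
        * ((cmod (y' 0))\<^sup>2 + ((a 0 + \<epsilon>) * m + 1) * (cmod (y 0))\<^sup>2
            + integral {0..T} (\<lambda>t. (cmod (g t))\<^sup>2))"
proof -
  define c where "c t = (a t + \<epsilon>) * m + 1" for t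
  define E where "E t = y' t \<bullet> y' t + c t * (y t \<bullet> y t)" for t
  define K where "K = M + 2 + sqrt (\<epsilon> * m)"
  define \<phi> where "\<phi> t = K + \<bar>a' t\<bar> / (a t + \<epsilon>)" for t
  define \<Phi> where "\<Phi> t = integral {0..t} \<phi>" for t
  define G where "G t = integral {0..t} (\<lambda>t. (cmod (g t))\<^sup>2)" for t
  \<comment> \<open>the quantity that Gronwall's argument shows to be nonincreasing\<close>
  define F where "F t = exp (- \<Phi> t) * E t - G t" for t
  have T0: "T \<ge> 0" using \<tau> by auto
  have K0: "K \<ge> 0" unfolding K_def using M m \<epsilon> by simp
  have ac: "continuous_on {0..T} a" using a by (rule DERIV_continuous_on)
  have ap: "a t + \<epsilon> > 0" if "t \<in> {0..T}" for t using a0[OF that] \<epsilon> by linarith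
  have \<phi>c': "continuous_on {0..T} (\<lambda>t. \<bar>a' t\<bar> / (a t + \<epsilon>))"
  proof (intro continuous_intros a'c ac)
    show "\<forall>t\<in>{0..T}. a t + \<epsilon> \<noteq> 0" using ap by force
  qed
  then have \<phi>c: "continuous_on {0..T} \<phi>" unfolding \<phi>_def by (intro continuous_on_add continuous_on_const)
  have \<phi>0: "\<phi> t \<ge> 0" if "t \<in> {0..T}" for t
    unfolding \<phi>_def using K0 ap[OF that] by simp
  have gc: "continuous_on {0..T} (\<lambda>t. (cmod (g t))\<^sup>2)" by (intro continuous_intros g)
  have c1: "c t \<ge> 1" if "t \<in> {0..T}" for t
    unfolding c_def using m ap[OF that] by simp
  have \<Phi>d: "(\<Phi> has_real_derivative \<phi> t) (at t within {0..T})" if "t \<in> {0..T}" for t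
    unfolding \<Phi>_def[abs_def] using integral_has_real_derivative[OF \<phi>c that] .
  have Gd: "(G has_real_derivative (cmod (g t))\<^sup>2) (at t within {0..T})" if "t \<in> {0..T}" for t
    unfolding G_def[abs_def] using integral_has_real_derivative[OF gc that] .
  have yy: "((\<lambda>t. y t \<bullet> y t) has_real_derivative 2 * (y t \<bullet> y' t)) (at t within {0..T})" if "t \<in> {0..T}" for t
    using bounded_bilinear.has_vector_derivative[OF bounded_bilinear_inner y[OF that] y[OF that]]
    by (simp add: has_real_derivative_iff_has_vector_derivative inner_commute)
  have cd: "(c has_real_derivative a' t * m) (at t within {0..T})" if "t \<in> {0..T}" for t
    unfolding c_def[abs_def] by (auto intro!: derivative_eq_intros a[OF that])
  have y'y': "lipschitz_at (\<lambda>t. y' t \<bullet> y' t) x {0..T}" if x: "x \<in> {0..T}" for x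
  proof -
    obtain B where B: "\<forall>t\<in>{0..T}. cmod (y' t) \<le> B"
      using compact_imp_bounded[OF compact_continuous_image[OF lipschitz_on_continuous_on[OF lip]]]
      unfolding bounded_iff by auto
    have "\<bar>y' t \<bullet> y' t - y' x \<bullet> y' x\<bar> \<le> 2 * B * L * \<bar>t - x\<bar>" if t: "t \<in> {0..T}" for t
    proof -
      have "y' t \<bullet> y' t - y' x \<bullet> y' x = (y' t - y' x) \<bullet> (y' t + y' x)"
        by (simp add: inner_diff_left inner_diff_right inner_add_left inner_add_right inner_commute)
      also have "\<bar>\<dots>\<bar> \<le> norm (y' t - y' x) * norm (y' t + y' x)" by (rule Cauchy_Schwarz_ineq2)
      also have "\<dots> \<le> (L * \<bar>t - x\<bar>) * (2 * B)"
      proof (intro mult_mono)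
        show "norm (y' t - y' x) \<le> L * \<bar>t - x\<bar>" using lipschitz_on_normD[OF lip t x] by simp
        show "norm (y' t + y' x) \<le> 2 * B"
          using norm_triangle_ineq[of "y' t" "y' x"] bspec[OF B t] bspec[OF B x] by linarith
        show "0 \<le> L * \<bar>t - x\<bar>" using lipschitz_on_nonneg[OF lip] by simp
      qed simp
      finally show ?thesis by (simp add: mult_ac)
    qed
    then show ?thesis
      unfolding lipschitz_at_def eventually_at_filter by (intro exI[of _ "2 * B * L"] always_eventually) auto
  qed
  have Flip: "lipschitz_at F t {0..T}" if t: "t \<in> {0..T}" for t
  proof -
    have 1: "((\<lambda>t. exp (- \<Phi> t)) has_real_derivative exp (- \<Phi> t) * (- \<phi> t)) (at t within {0..T})"
      by (auto intro!: derivative_eq_intros \<Phi>d[OF t])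
    have 2: "lipschitz_at (\<lambda>t. c t * (y t \<bullet> y t)) t {0..T}"
      using lipschitz_at_mult has_real_derivative_imp_lipschitz_at[OF cd[OF t]] has_real_derivative_imp_lipschitz_at[OF yy[OF t]] by blast
    have 3: "((\<lambda>t. - G t) has_real_derivative - (cmod (g t))\<^sup>2) (at t within {0..T})"
      by (auto intro!: derivative_eq_intros Gd[OF t])
    have "lipschitz_at (\<lambda>t. exp (- \<Phi> t) * (y' t \<bullet> y' t + c t * (y t \<bullet> y t)) + - G t) t {0..T}"
      by (intro lipschitz_at_add lipschitz_at_mult has_real_derivative_imp_lipschitz_at[OF 1]
          has_real_derivative_imp_lipschitz_at[OF 3] y'y' t 2 has_real_derivative_imp_lipschitz_at[OF cd[OF t]]
          has_real_derivative_imp_lipschitz_at[OF yy[OF t]])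
    then show ?thesis unfolding F_def[abs_def] E_def[abs_def] by simp
  qed
  have Fd: "\<exists>D\<le>0. (F has_real_derivative D) (at t within {0..T})" if t: "t \<in> {0..T} - N" for t
  proof -
    have t': "t \<in> {0..T}" using t by simp
    let ?y'' = "g t - of_real (a t * m + q t) * y t"
    let ?E' = "2 * (y' t \<bullet> ?y'') + (a' t * m * (y t \<bullet> y t) + c t * (2 * (y t \<bullet> y' t)))"
    have "((\<lambda>t. y' t \<bullet> y' t) has_real_derivative 2 * (y' t \<bullet> ?y'')) (at t within {0..T})"
      using bounded_bilinear.has_vector_derivative[OF bounded_bilinear_inner y'[OF t] y'[OF t]]
      unfolding has_real_derivative_iff_has_vector_derivative by (simp only: inner_commute[of ?y''] mult_2)
    then have Ed: "(E has_real_derivative ?E') (at t within {0..T})"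
      unfolding E_def[abs_def]
      by (auto intro!: derivative_eq_intros cd[OF t'] yy[OF t'])
    have Fd: "(F has_real_derivative exp (- \<Phi> t) * (- \<phi> t) * E t + exp (- \<Phi> t) * ?E' - (cmod (g t))\<^sup>2) (at t within {0..T})"
      unfolding F_def[abs_def]
      by (rule derivative_eq_intros \<Phi>d[OF t'] Ed Gd[OF t'] refl)+ (simp add: algebra_simps)
    let ?P = "cmod (y' t)" and ?Y = "cmod (y t)" and ?G = "cmod (g t)" and ?r = "\<bar>a' t\<bar> / (a t + \<epsilon>)"
    let ?w = "sqrt (\<epsilon> * m)"
    have w2: "?w\<^sup>2 = \<epsilon> * m" using \<epsilon> m by simp
    have w0: "?w \<ge> 0" using \<epsilon> m by simp
    have E: "E t = ?P\<^sup>2 + c t * ?Y\<^sup>2" unfolding E_def by (simp add: power2_norm_eq_inner)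
    have "?E' = 2 * (y' t \<bullet> g t) - 2 * q t * (y' t \<bullet> y t) + 2 * (\<epsilon> * m + 1) * (y' t \<bullet> y t) + a' t * m * ?Y\<^sup>2"
    proof -
      have "y' t \<bullet> (of_real (a t * m + q t) * y t) = (a t * m + q t) * (y' t \<bullet> y t)"
        by (metis inner_scaleR_right scaleR_conv_of_real)
      then show ?thesis
        unfolding c_def by (simp add: inner_diff_right power2_norm_eq_inner inner_commute[of "y t" "y' t"] algebra_simps)
    qed
    also have "\<dots> \<le> (?P\<^sup>2 + ?G\<^sup>2) + M * (?P\<^sup>2 + ?Y\<^sup>2) + (?P\<^sup>2 + ?Y\<^sup>2 + ?w * (?P\<^sup>2 + \<epsilon> * m * ?Y\<^sup>2)) + ?r * ((a t + \<epsilon>) * m * ?Y\<^sup>2)"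
    proof (rule add_mono, rule add_mono)
      have PY: "\<bar>y' t \<bullet> y t\<bar> \<le> ?P * ?Y" by (rule Cauchy_Schwarz_ineq2)
      have PY2: "2 * (?P * ?Y) \<le> ?P\<^sup>2 + ?Y\<^sup>2" using sum_squares_bound[of ?P ?Y] by simp
      have "y' t \<bullet> g t \<le> ?P * ?G" by (rule norm_cauchy_schwarz)
      then have 1: "2 * (y' t \<bullet> g t) \<le> ?P\<^sup>2 + ?G\<^sup>2" using sum_squares_bound[of ?P ?G] by simp
      have "- (2 * q t * (y' t \<bullet> y t)) \<le> \<bar>2 * q t * (y' t \<bullet> y t)\<bar>" by (rule abs_ge_minus_self)
      also have "\<dots> = \<bar>q t\<bar> * (2 * \<bar>y' t \<bullet> y t\<bar>)" by (simp only: abs_mult abs_numeral mult_ac)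
      also have "\<dots> \<le> M * (?P\<^sup>2 + ?Y\<^sup>2)"
        using q[OF t] PY PY2 M by (intro mult_mono) linarith+
      finally show "2 * (y' t \<bullet> g t) - 2 * q t * (y' t \<bullet> y t) \<le> ?P\<^sup>2 + ?G\<^sup>2 + M * (?P\<^sup>2 + ?Y\<^sup>2)"
        using 1 by linarith
      have "2 * (?P * (?w * ?Y)) \<le> ?P\<^sup>2 + (?w * ?Y)\<^sup>2" using sum_squares_bound[of ?P "?w * ?Y"] by simp
      then have "?w * (2 * (?P * (?w * ?Y))) \<le> ?w * (?P\<^sup>2 + (?w * ?Y)\<^sup>2)" using w0 by (rule mult_left_mono)
      then have wPY: "2 * (?w\<^sup>2 * (?P * ?Y)) \<le> ?w * (?P\<^sup>2 + ?w\<^sup>2 * ?Y\<^sup>2)"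
        by (simp add: power_mult_distrib power2_eq_square mult_ac)
      have "2 * (\<epsilon> * m + 1) * (y' t \<bullet> y t) \<le> 2 * (?w\<^sup>2 + 1) * (?P * ?Y)"
        unfolding w2 using PY \<epsilon> m by (intro mult_left_mono) auto
      also have "\<dots> = 2 * (?P * ?Y) + 2 * (?w\<^sup>2 * (?P * ?Y))" by (simp add: algebra_simps)
      also have "\<dots> \<le> ?P\<^sup>2 + ?Y\<^sup>2 + ?w * (?P\<^sup>2 + ?w\<^sup>2 * ?Y\<^sup>2)" using wPY PY2 by linarith
      finally show "2 * (\<epsilon> * m + 1) * (y' t \<bullet> y t) \<le> ?P\<^sup>2 + ?Y\<^sup>2 + ?w * (?P\<^sup>2 + \<epsilon> * m * ?Y\<^sup>2)"
        unfolding w2 by simp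
      have "a' t * m * ?Y\<^sup>2 \<le> \<bar>a' t\<bar> * m * ?Y\<^sup>2" using m by (intro mult_right_mono) auto
      also have "\<dots> = ?r * ((a t + \<epsilon>) * m * ?Y\<^sup>2)" using ap[OF t'] by simp
      finally show "a' t * m * ?Y\<^sup>2 \<le> ?r * ((a t + \<epsilon>) * m * ?Y\<^sup>2)" .
    qed
    also have "\<dots> \<le> (E t + ?G\<^sup>2) + M * E t + (E t + ?w * E t) + ?r * E t"
    proof -
      have pos: "0 \<le> (a t) * m * ?Y\<^sup>2" "0 \<le> \<epsilon> * m * ?Y\<^sup>2" using a0[OF t'] m \<epsilon> by auto
      have r0: "?r \<ge> 0" using ap[OF t'] by simp
      have "?P\<^sup>2 \<le> E t" "?P\<^sup>2 + ?Y\<^sup>2 \<le> E t" "?P\<^sup>2 + \<epsilon> * m * ?Y\<^sup>2 \<le> E t" "(a t + \<epsilon>) * m * ?Y\<^sup>2 \<le> E t"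
        unfolding E c_def using pos by (auto simp: algebra_simps)
      then show ?thesis using M w0 r0 by (intro add_mono mult_left_mono) auto
    qed
    also have "\<dots> = \<phi> t * E t + ?G\<^sup>2" unfolding \<phi>_def K_def by (simp add: algebra_simps)
    finally have E': "?E' \<le> \<phi> t * E t + ?G\<^sup>2" .
    have sub: "{0..t} \<subseteq> {0..T}" using t' by auto
    then have "0 \<le> \<Phi> t"
      unfolding \<Phi>_def using \<phi>0 by (intro integral_nonneg integrable_continuous_real continuous_on_subset[OF \<phi>c]) auto
    then have "exp (- \<Phi> t) \<le> 1" by simp
    then have "exp (- \<Phi> t) * ?G\<^sup>2 \<le> ?G\<^sup>2" by (simp add: mult_left_le_one_le)
    moreover have "exp (- \<Phi> t) * ?E' \<le> exp (- \<Phi> t) * (\<phi> t * E t + ?G\<^sup>2)" using E' by (intro mult_left_mono) auto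
    ultimately have "exp (- \<Phi> t) * (- \<phi> t) * E t + exp (- \<Phi> t) * ?E' - ?G\<^sup>2 \<le> 0"
      by (simp add: algebra_simps)
    then show ?thesis using Fd by blast
  qed
  have sub: "{0..\<tau>} \<subseteq> {0..T}" using \<tau> by auto
  have "F \<tau> \<le> F 0"
  proof (rule nonincreasing_if_deriv_nonpos_ae[where F = F and a = 0 and b = \<tau>, OF _ _ N])
    show "lipschitz_at F x {0..\<tau>}" if "x \<in> {0..\<tau>}" for x
    proof -
      obtain B where "\<forall>\<^sub>F y in at x within {0..T}. \<bar>F y - F x\<bar> \<le> B * \<bar>y - x\<bar>"
        using Flip[of x] \<open>x \<in> {0..\<tau>}\<close> sub unfolding lipschitz_at_def by blast
      then have "\<forall>\<^sub>F y in at x within {0..\<tau>}. \<bar>F y - F x\<bar> \<le> B * \<bar>y - x\<bar>"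
        using at_le[OF sub, of x] filter_leD by blast
      then show ?thesis unfolding lipschitz_at_def by blast
    qed
    show "\<exists>D\<le>0. (F has_real_derivative D) (at t within {0..\<tau>})" if "t \<in> {0..\<tau>} - N" for t
      using Fd[of t] that sub by (meson DERIV_subset Diff_iff subsetD)
  qed (use \<tau> in auto)
  also have "F 0 = E 0" unfolding F_def \<Phi>_def G_def by simp
  finally have "exp (- \<Phi> \<tau>) * E \<tau> \<le> E 0 + G \<tau>" unfolding F_def by simp
  then have "E \<tau> \<le> exp (\<Phi> \<tau>) * (E 0 + G \<tau>)"
    by (simp add: exp_minus field_simps)
  also have "\<dots> \<le> exp (\<Phi> T) * (E 0 + G T)"
  proof (intro mult_mono add_mono order_refl)
    show "exp (\<Phi> \<tau>) \<le> exp (\<Phi> T)"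
      unfolding \<Phi>_def exp_le_cancel_iff using \<phi>0 sub
      by (intro integral_subset_le integrable_continuous_real \<phi>c continuous_on_subset[OF \<phi>c sub]) auto
    show "G \<tau> \<le> G T"
      unfolding G_def using sub
      by (intro integral_subset_le integrable_continuous_real gc continuous_on_subset[OF gc sub]) auto
    have "0 \<le> G \<tau>"
      unfolding G_def by (intro integral_nonneg integrable_continuous_real continuous_on_subset[OF gc sub]) auto
    moreover have "0 \<le> E 0"
      unfolding E_def using c1[of 0] T0 by (intro add_nonneg_nonneg mult_nonneg_nonneg) auto
    ultimately show "0 \<le> E 0 + G \<tau>" by simp
  qed simp
  also have "\<Phi> T = K * T + integral {0..T} (\<lambda>t. \<bar>a' t\<bar> / (a t + \<epsilon>))"
  proof -
    have "\<Phi> T = integral {0..T} (\<lambda>t. K) + integral {0..T} (\<lambda>t. \<bar>a' t\<bar> / (a t + \<epsilon>))"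
      unfolding \<Phi>_def \<phi>_def[abs_def] using \<phi>c' by (intro integral_add integrable_continuous_real) auto
    then show ?thesis using T0 by simp
  qed
  finally have "E \<tau> \<le> exp (K * T + integral {0..T} (\<lambda>t. \<bar>a' t\<bar> / (a t + \<epsilon>))) * (E 0 + G T)" .
  moreover have "(cmod (y' \<tau>))\<^sup>2 + (cmod (y \<tau>))\<^sup>2 \<le> E \<tau>"
    unfolding E_def power2_norm_eq_inner using c1[OF \<tau>] mult_right_mono[of 1 "c \<tau>" "y \<tau> \<bullet> y \<tau>"] by simp
  ultimately show ?thesis unfolding E_def G_def K_def c_def power2_norm_eq_inner by simp
qed

lemma powr_absorb:
  fixes \<alpha> \<rho> \<delta> :: real
  assumes "\<alpha> < \<rho>" "\<delta> > 0"
  shows "\<exists>C\<ge>0. \<forall>X\<ge>1. X powr \<alpha> \<le> C + \<delta> * X powr \<rho>"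
proof -
  define Y where "Y = (1 / \<delta>) powr (1 / (\<rho> - \<alpha>))"
  have Y: "Y > 0" "Y powr (\<rho> - \<alpha>) = 1 / \<delta>" unfolding Y_def using assms by (auto simp: powr_powr)
  have "X powr \<alpha> \<le> (1 + Y powr \<alpha>) + \<delta> * X powr \<rho>" if X: "X \<ge> 1" for X :: real
  proof (cases "X \<ge> Y")
    case True
    then have "Y powr (\<rho> - \<alpha>) \<le> X powr (\<rho> - \<alpha>)" using assms Y by (intro powr_mono2) auto
    then have "1 \<le> \<delta> * X powr (\<rho> - \<alpha>)" unfolding Y(2) using assms(2) by (simp add: field_simps)
    then have "1 * X powr \<alpha> \<le> \<delta> * X powr (\<rho> - \<alpha>) * X powr \<alpha>" by (rule mult_right_mono) simp
    also have "\<dots> = \<delta> * X powr \<rho>" using X by (simp add: mult.assoc powr_add[symmetric])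
    finally have "X powr \<alpha> \<le> \<delta> * X powr \<rho>" by simp
    moreover have "0 \<le> Y powr \<alpha>" by simp
    ultimately show ?thesis by linarith
  next
    case False
    have "X powr \<alpha> \<le> 1 + Y powr \<alpha>"
    proof (cases "\<alpha> \<ge> 0")
      case True
      then have "X powr \<alpha> \<le> Y powr \<alpha>" using X False by (intro powr_mono2) auto
      then show ?thesis by simp
    next
      case False
      then have "X powr \<alpha> \<le> 1 powr \<alpha>" using X by (intro powr_mono2') auto
      moreover have "0 \<le> Y powr \<alpha>" by simp
      ultimately show ?thesis unfolding powr_one_eq_one by linarith
    qed
    moreover have "0 \<le> \<delta> * X powr \<rho>" using assms by simp
    ultimately show ?thesis by linarith
  qed
  then show ?thesis by (intro exI[of _ "1 + Y powr \<alpha>"]) auto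
qed

text \<open>Here \<open>X\<close> stands for \<open>\<langle>\<xi>\<rangle>\<close> and \<open>\<rho>\<close> for \<open>1 / s\<close>. For \<open>\<epsilon> = X powr (- p)\<close> the two competing terms are of
  order \<open>X powr (1 - p / 2)\<close> and \<open>X powr (p / l) * ln X\<close>. A choice of \<open>p\<close> that makes both exponents smaller
  than \<open>\<rho>\<close> exists if and only if \<open>2 * (1 - \<rho>) < \<rho> * l\<close>, which is \<open>s < 1 + l / 2\<close>.\<close>

lemma balanced_exponent:
  fixes d :: "nat \<Rightarrow> real \<Rightarrow> real" and l :: nat and \<rho> \<delta> M c T :: real
  assumes l: "l \<ge> 2" and T: "T > 0"
    and cont: "\<And>j. j \<le> l \<Longrightarrow> continuous_on {0..T} (d j)"
    and der: "\<And>j t. j < l \<Longrightarrow> t \<in> {0..T} \<Longrightarrow> (d j has_real_derivative d (Suc j) t) (at t within {0..T})"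
    and nonneg: "\<And>t. t \<in> {0..T} \<Longrightarrow> d 0 t \<ge> 0"
    and \<rho>: "0 < \<rho>" "\<rho> \<le> 1" "2 < \<rho> * (real l + 2)" and \<delta>: "\<delta> > 0" and M: "M \<ge> 0" and c: "c \<ge> 0"
  shows "\<exists>C\<ge>0. \<forall>X\<ge>1. \<forall>m. 0 \<le> m \<and> m \<le> c * X\<^sup>2 \<longrightarrow> (\<exists>\<epsilon>. 0 < \<epsilon> \<and> \<epsilon> \<le> 1 \<and>
      (M + 2 + sqrt (\<epsilon> * m)) * T + integral {0..T} (\<lambda>t. \<bar>d 1 t\<bar> / (d 0 t + \<epsilon>)) \<le> C + \<delta> * X powr \<rho>)"
proof -
  obtain K where K: "K \<ge> 0" and KI: "\<forall>\<epsilon>. 0 < \<epsilon> \<longrightarrow> \<epsilon> \<le> 1 \<longrightarrow>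
      integral {0..T} (\<lambda>t. \<bar>d 1 t\<bar> / (d 0 t + \<epsilon>)) \<le> K * \<epsilon> powr (- 1 / l) * (1 - ln \<epsilon>)"
    using integral_log_deriv_bound[of l T d, OF l T cont der nonneg] by blast
  \<comment> \<open>the midpoint between \<open>2 * (1 - \<rho>)\<close> and \<open>\<rho> * l\<close>\<close>
  define p where "p = (2 * (1 - \<rho>) + \<rho> * l) / 2"
  have p1: "2 * (1 - \<rho>) < p" "p < \<rho> * l" unfolding p_def using \<rho> by (auto simp: algebra_simps)
  have p0: "p > 0" using p1(1) \<rho>(2) by simp
  have l0: "real l > 0" using l by simp
  have pl: "p / l < \<rho>" using p1 l0 by (simp add: divide_less_eq)
  obtain \<eta> where \<eta>: "\<eta> > 0" "p / l + \<eta> < \<rho>"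
    using dense[OF pl] by (metis add_diff_cancel_left' add_diff_eq diff_gt_0_iff_gt)
  define \<alpha> where "\<alpha> = max (1 - p / 2) (p / l + \<eta>)"
  have \<alpha>: "\<alpha> < \<rho>" unfolding \<alpha>_def using p1 \<eta> by simp
  define B where "B = sqrt c * T + K * (1 + p / \<eta>)"
  have B: "B \<ge> 0" unfolding B_def using c T K p0 \<eta> by simp
  obtain C where C: "C \<ge> 0" "\<forall>X\<ge>1. X powr \<alpha> \<le> C + \<delta> / (B + 1) * X powr \<rho>"
    using powr_absorb[OF \<alpha>, of "\<delta> / (B + 1)"] \<delta> B by auto
  show ?thesis
  proof (rule exI[of _ "(M + 2) * T + B * C"], intro conjI allI impI)
    show "0 \<le> (M + 2) * T + B * C" using M T B C by simp
    fix X m :: real assume X: "X \<ge> 1" and m: "0 \<le> m \<and> m \<le> c * X\<^sup>2"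
    define \<epsilon> where "\<epsilon> = X powr (- p)"
    have \<epsilon>: "0 < \<epsilon>" "\<epsilon> \<le> 1" unfolding \<epsilon>_def using X p0 powr_mono2'[of "- p" 1 X] by auto
    have mon: "X powr q \<le> X powr \<alpha>" if "q \<le> \<alpha>" for q using that X by (intro powr_mono)
    have "sqrt (\<epsilon> * m) \<le> sqrt (X powr (- p) * (c * X\<^sup>2))"
      unfolding \<epsilon>_def using m by (intro real_sqrt_le_mono mult_left_mono) auto
    also have "X powr (- p) * (c * X\<^sup>2) = c * (X powr (1 - p / 2))\<^sup>2"
    proof -
      have "(X powr (1 - p / 2))\<^sup>2 = X powr (2 - p)"
        using X by (simp add: power2_eq_square powr_add[symmetric])
      also have "\<dots> = X powr (- p) * X\<^sup>2"
        using X powr_add[of X "- p" 2] by (simp add: powr_numeral)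
      finally show ?thesis by simp
    qed
    also have "sqrt (c * (X powr (1 - p / 2))\<^sup>2) = sqrt c * X powr (1 - p / 2)"
      by (simp add: real_sqrt_mult)
    also have "\<dots> \<le> sqrt c * X powr \<alpha>" using c mon[of "1 - p / 2"] unfolding \<alpha>_def by (intro mult_left_mono) auto
    finally have 1: "sqrt (\<epsilon> * m) \<le> sqrt c * X powr \<alpha>" .
    have X\<eta>: "X powr \<eta> \<ge> 1" using X \<eta> by (simp add: ge_one_powr_ge_zero)
    have "ln X \<le> X powr \<eta> / \<eta>" using X \<eta> by (intro ln_powr_bound)
    then have "p * ln X \<le> p * (X powr \<eta> / \<eta>)" using p0 by (intro mult_left_mono) auto
    moreover have "- ln \<epsilon> = p * ln X" unfolding \<epsilon>_def using X by (simp add: ln_powr)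
    ultimately have ln: "1 - ln \<epsilon> \<le> X powr \<eta> * (1 + p / \<eta>)" using X\<eta> by (simp add: algebra_simps)
    have e1: "\<epsilon> powr (- 1 / l) = X powr (p / l)" unfolding \<epsilon>_def by (simp add: powr_powr)
    have "integral {0..T} (\<lambda>t. \<bar>d 1 t\<bar> / (d 0 t + \<epsilon>)) \<le> K * \<epsilon> powr (- 1 / l) * (1 - ln \<epsilon>)"
      using KI \<epsilon> by simp
    also have "\<dots> \<le> K * X powr (p / l) * (X powr \<eta> * (1 + p / \<eta>))"
      unfolding e1 using ln K by (intro mult_left_mono) auto
    also have "\<dots> = K * (1 + p / \<eta>) * X powr (p / l + \<eta>)" using X by (simp add: powr_add)
    also have "\<dots> \<le> K * (1 + p / \<eta>) * X powr \<alpha>"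
      using K p0 \<eta> mon[of "p / l + \<eta>"] unfolding \<alpha>_def by (intro mult_left_mono) auto
    finally have 2: "integral {0..T} (\<lambda>t. \<bar>d 1 t\<bar> / (d 0 t + \<epsilon>)) \<le> K * (1 + p / \<eta>) * X powr \<alpha>" .
    have "(M + 2 + sqrt (\<epsilon> * m)) * T \<le> (M + 2 + sqrt c * X powr \<alpha>) * T"
      using 1 T by (intro mult_right_mono) auto
    then have "(M + 2 + sqrt (\<epsilon> * m)) * T + integral {0..T} (\<lambda>t. \<bar>d 1 t\<bar> / (d 0 t + \<epsilon>)) \<le> (M + 2) * T + B * X powr \<alpha>"
      using 2 unfolding B_def by (simp add: algebra_simps)
    also have "B * X powr \<alpha> \<le> B * (C + \<delta> / (B + 1) * X powr \<rho>)" using C X B by (intro mult_left_mono) auto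
    also have "\<dots> = B * C + (B / (B + 1)) * (\<delta> * X powr \<rho>)" by (simp add: algebra_simps)
    also have "(B / (B + 1)) * (\<delta> * X powr \<rho>) \<le> 1 * (\<delta> * X powr \<rho>)"
      using B \<delta> by (intro mult_right_mono) auto
    finally have "(M + 2 + sqrt (\<epsilon> * m)) * T + integral {0..T} (\<lambda>t. \<bar>d 1 t\<bar> / (d 0 t + \<epsilon>))
        \<le> (M + 2) * T + B * C + \<delta> * X powr \<rho>" by simp
    then show "\<exists>\<epsilon>>0. \<epsilon> \<le> 1 \<and> (M + 2 + sqrt (\<epsilon> * m)) * T + integral {0..T} (\<lambda>t. \<bar>d 1 t\<bar> / (d 0 t + \<epsilon>))
        \<le> (M + 2) * T + B * C + \<delta> * X powr \<rho>" using \<epsilon> by blast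
  qed
qed

text \<open>The Lipschitz condition on \<open>y'\<close> excludes singular parts of \<open>y''\<close> concentrated on \<open>N\<close>, such as
  those of Cantor's function, without which the equation off \<open>N\<close> would not determine \<open>y\<close>.\<close>

definition mode_solution ::
    "real set \<Rightarrow> real \<Rightarrow> (real \<Rightarrow> real) \<Rightarrow> real \<Rightarrow> (real \<Rightarrow> real) \<Rightarrow> (real \<Rightarrow> complex) \<Rightarrow>
     (real \<Rightarrow> complex) \<Rightarrow> (real \<Rightarrow> complex) \<Rightarrow> bool" where
  "mode_solution N T a m q g y y' \<longleftrightarrow>
     (\<forall>t\<in>{0..T}. (y has_vector_derivative y' t) (at t within {0..T})) \<and>
     (\<exists>L. L-lipschitz_on {0..T} y') \<and>
     (\<forall>t\<in>{0..T} - N. (y' has_vector_derivative g t - of_real (a t * m + q t) * y t) (at t within {0..T}))"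

text \<open>The factor \<open>X ^ 4\<close> makes the bound strong enough for \<open>m * y\<close> as well, because \<open>m\<^sup>2\<close> is of order \<open>X ^ 4\<close>; powers
  of \<open>X\<close> are absorbed by the exponential.\<close>

lemma gevrey_mode_bound:
  fixes d :: "nat \<Rightarrow> real \<Rightarrow> real" and l :: nat and \<rho> \<delta> M c T :: real
  assumes l: "l \<ge> 2" and T: "T > 0"
    and cont: "\<And>j. j \<le> l \<Longrightarrow> continuous_on {0..T} (d j)"
    and der: "\<And>j t. j < l \<Longrightarrow> t \<in> {0..T} \<Longrightarrow> (d j has_real_derivative d (Suc j) t) (at t within {0..T})"
    and nonneg: "\<And>t. t \<in> {0..T} \<Longrightarrow> d 0 t \<ge> 0"
    and \<rho>: "0 < \<rho>" "\<rho> \<le> 1" "2 < \<rho> * (real l + 2)" and \<delta>: "\<delta> > 0" and M: "M \<ge> 0" and c: "c \<ge> 0"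
  shows "\<exists>C\<ge>0. \<forall>X m q g y y' N t. 1 \<le> X \<longrightarrow> 0 \<le> m \<longrightarrow> m \<le> c * X\<^sup>2 \<longrightarrow> continuous_on {0..T} g \<longrightarrow>
      negligible N \<longrightarrow> (\<forall>t\<in>{0..T} - N. \<bar>q t\<bar> \<le> M) \<longrightarrow> mode_solution N T (d 0) m q g y y' \<longrightarrow> t \<in> {0..T} \<longrightarrow>
      X ^ 4 * ((cmod (y' t))\<^sup>2 + (cmod (y t))\<^sup>2)
        \<le> C * exp (\<delta> * X powr \<rho>) * ((cmod (y 0))\<^sup>2 + (cmod (y' 0))\<^sup>2 + integral {0..T} (\<lambda>t. (cmod (g t))\<^sup>2))"
proof -
  obtain C1 where C1: "C1 \<ge> 0" "\<forall>X\<ge>1. \<forall>m. 0 \<le> m \<and> m \<le> c * X\<^sup>2 \<longrightarrow> (\<exists>\<epsilon>. 0 < \<epsilon> \<and> \<epsilon> \<le> 1 \<and>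
      (M + 2 + sqrt (\<epsilon> * m)) * T + integral {0..T} (\<lambda>t. \<bar>d 1 t\<bar> / (d 0 t + \<epsilon>)) \<le> C1 + \<delta> / 2 * X powr \<rho>)"
    using balanced_exponent[of l T d \<rho> "\<delta> / 2" M c, OF l T cont der nonneg \<rho> _ M c] \<delta> by auto
  obtain C2 where C2: "C2 \<ge> 0" "\<forall>X\<ge>1. X powr (\<rho> / 2) \<le> C2 + \<delta> * \<rho> / 24 * X powr \<rho>"
    using powr_absorb[of "\<rho> / 2" \<rho> "\<delta> * \<rho> / 24"] \<rho> \<delta> by auto
  \<comment> \<open>polynomial factors are absorbed by the exponential\<close>
  have poly: "X ^ 6 \<le> exp (12 / \<rho> * C2) * exp (\<delta> / 2 * X powr \<rho>)" if X: "X \<ge> 1" for X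
  proof -
    have "ln X \<le> X powr (\<rho> / 2) / (\<rho> / 2)" using X \<rho> by (intro ln_powr_bound) auto
    also have "\<dots> \<le> (C2 + \<delta> * \<rho> / 24 * X powr \<rho>) / (\<rho> / 2)"
      using C2 X \<rho> by (intro divide_right_mono) auto
    finally have "6 * ln X \<le> 12 / \<rho> * C2 + \<delta> / 2 * X powr \<rho>" using \<rho> by (simp add: field_simps)
    moreover have "X ^ 6 = exp (6 * ln X)" using X by (simp add: exp_of_nat_mult[of 6, simplified])
    ultimately show ?thesis by (simp add: exp_add[symmetric])
  qed
  have "bounded (d 0 ` {0..T})" using cont[of 0] by (intro compact_imp_bounded compact_continuous_image) auto
  then obtain A where A: "\<forall>t\<in>{0..T}. \<bar>d 0 t\<bar> \<le> A" unfolding bounded_iff by auto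
  have A0: "d 0 0 \<le> A" "A \<ge> 0" using bspec[OF A, of 0] nonneg[of 0] T by auto
  define D where "D = (A + 1) * c + 1"
  have D: "D \<ge> 1" unfolding D_def using A0 c by simp
  show ?thesis
  proof (intro exI[of _ "exp C1 * D * exp (12 / \<rho> * C2)"] conjI allI impI)
    show "0 \<le> exp C1 * D * exp (12 / \<rho> * C2)" using D by simp
    fix X m t :: real and g y y' :: "real \<Rightarrow> complex" and q :: "real \<Rightarrow> real" and N
    assume X: "1 \<le> X" and m: "0 \<le> m" "m \<le> c * X\<^sup>2" and g: "continuous_on {0..T} g"
      and N: "negligible N" and q: "\<forall>t\<in>{0..T} - N. \<bar>q t\<bar> \<le> M"
      and sol: "mode_solution N T (d 0) m q g y y'" and t: "t \<in> {0..T}"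
    obtain L where L: "L-lipschitz_on {0..T} y'" using sol unfolding mode_solution_def by blast
    obtain \<epsilon> where \<epsilon>: "0 < \<epsilon>" "\<epsilon> \<le> 1"
      "(M + 2 + sqrt (\<epsilon> * m)) * T + integral {0..T} (\<lambda>t. \<bar>d 1 t\<bar> / (d 0 t + \<epsilon>)) \<le> C1 + \<delta> / 2 * X powr \<rho>"
      using C1 X m by blast
    let ?G = "integral {0..T} (\<lambda>t. (cmod (g t))\<^sup>2)" and ?R = "(cmod (y 0))\<^sup>2 + (cmod (y' 0))\<^sup>2 + integral {0..T} (\<lambda>t. (cmod (g t))\<^sup>2)"
    have G0: "?G \<ge> 0" by (intro integral_nonneg integrable_continuous_real continuous_intros g) auto
    have "(cmod (y' t))\<^sup>2 + (cmod (y t))\<^sup>2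
      \<le> exp ((M + 2 + sqrt (\<epsilon> * m)) * T + integral {0..T} (\<lambda>t. \<bar>d 1 t\<bar> / (d 0 t + \<epsilon>)))
        * ((cmod (y' 0))\<^sup>2 + ((d 0 0 + \<epsilon>) * m + 1) * (cmod (y 0))\<^sup>2 + ?G)"
    proof (rule energy_estimate[OF _ L N])
      show "(d 0 has_real_derivative d 1 t) (at t within {0..T})" if "t \<in> {0..T}" for t
        using der[of 0 t] l that by simp
      show "continuous_on {0..T} (d 1)" using cont[of 1] l by simp
    qed (use sol q g m \<epsilon> M t nonneg in \<open>auto simp: mode_solution_def\<close>)
    also have "\<dots> \<le> exp (C1 + \<delta> / 2 * X powr \<rho>) * (D * X\<^sup>2 * ?R)"
    proof (rule mult_mono)
      show "exp ((M + 2 + sqrt (\<epsilon> * m)) * T + integral {0..T} (\<lambda>t. \<bar>d 1 t\<bar> / (d 0 t + \<epsilon>))) \<le> exp (C1 + \<delta> / 2 * X powr \<rho>)"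
        using \<epsilon> by simp
      have X2: "1 \<le> X\<^sup>2" using X by (simp add: one_le_power)
      have "1 * 1 \<le> D * X\<^sup>2" using D X2 by (intro mult_mono) auto
      then have DX: "1 \<le> D * X\<^sup>2" by simp
      have "(d 0 0 + \<epsilon>) * m \<le> (A + 1) * (c * X\<^sup>2)" using A0 \<epsilon> m nonneg[of 0] T by (intro mult_mono) auto
      then have "(d 0 0 + \<epsilon>) * m + 1 \<le> D * X\<^sup>2" unfolding D_def using X2 by (simp add: algebra_simps)
      then have "((d 0 0 + \<epsilon>) * m + 1) * (cmod (y 0))\<^sup>2 \<le> D * X\<^sup>2 * (cmod (y 0))\<^sup>2" by (rule mult_right_mono) simp
      moreover have "1 * (cmod (y' 0))\<^sup>2 \<le> D * X\<^sup>2 * (cmod (y' 0))\<^sup>2" using DX by (rule mult_right_mono) simp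
      moreover have "1 * ?G \<le> D * X\<^sup>2 * ?G" using DX G0 by (rule mult_right_mono)
      ultimately show "(cmod (y' 0))\<^sup>2 + ((d 0 0 + \<epsilon>) * m + 1) * (cmod (y 0))\<^sup>2 + ?G \<le> D * X\<^sup>2 * ?R"
        by (simp add: distrib_left)
      show "0 \<le> (cmod (y' 0))\<^sup>2 + ((d 0 0 + \<epsilon>) * m + 1) * (cmod (y 0))\<^sup>2 + ?G"
        using G0 m \<epsilon> nonneg[of 0] T by (intro add_nonneg_nonneg mult_nonneg_nonneg) auto
    qed simp
    finally have "X ^ 4 * ((cmod (y' t))\<^sup>2 + (cmod (y t))\<^sup>2) \<le> X ^ 4 * (exp (C1 + \<delta> / 2 * X powr \<rho>) * (D * X\<^sup>2 * ?R))"
      using X by (intro mult_left_mono) auto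
    also have "\<dots> = X ^ 6 * (exp C1 * D * exp (\<delta> / 2 * X powr \<rho>) * ?R)"
      by (simp add: exp_add power_numeral_reduce)
    also have "\<dots> \<le> exp (12 / \<rho> * C2) * exp (\<delta> / 2 * X powr \<rho>) * (exp C1 * D * exp (\<delta> / 2 * X powr \<rho>) * ?R)"
      using poly[OF X] D G0 by (intro mult_right_mono mult_nonneg_nonneg add_nonneg_nonneg) auto
    also have "\<dots> = exp C1 * D * exp (12 / \<rho> * C2) * exp (\<delta> / 2 * X powr \<rho> + \<delta> / 2 * X powr \<rho>) * ?R"
      by (simp only: exp_add mult_ac)
    finally show "X ^ 4 * ((cmod (y' t))\<^sup>2 + (cmod (y t))\<^sup>2) \<le> exp C1 * D * exp (12 / \<rho> * C2) * exp (\<delta> * X powr \<rho>) * ?R"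
      by simp
  qed
qed

text \<open>The energy estimate, applied to the difference of the two solutions.\<close>

lemma mode_solution_unique:
  fixes a a' q :: "real \<Rightarrow> real"
  assumes a: "\<And>t. t \<in> {0..T} \<Longrightarrow> (a has_real_derivative a' t) (at t within {0..T})"
    and a'c: "continuous_on {0..T} a'" and a0: "\<And>t. t \<in> {0..T} \<Longrightarrow> a t \<ge> 0" and m: "m \<ge> 0"
    and N: "negligible N1" "negligible N2" "negligible N3" and q: "\<And>t. t \<in> {0..T} - N3 \<Longrightarrow> \<bar>q t\<bar> \<le> M"
    and y1: "mode_solution N1 T a m q g y y'" and y2: "mode_solution N2 T a m q g z z'"
    and init: "y 0 = z 0" "y' 0 = z' 0" and t: "t \<in> {0..T}"
  shows "y t = z t"
proof -
  define N where "N = N1 \<union> N2 \<union> N3"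
  obtain L1 L2 where L: "L1-lipschitz_on {0..T} y'" "L2-lipschitz_on {0..T} z'"
    using y1 y2 unfolding mode_solution_def by blast
  have "(cmod ((\<lambda>t. y' t - z' t) t))\<^sup>2 + (cmod ((\<lambda>t. y t - z t) t))\<^sup>2
     \<le> exp ((\<bar>M\<bar> + 2 + sqrt (1 * m)) * T + integral {0..T} (\<lambda>t. \<bar>a' t\<bar> / (a t + 1)))
        * ((cmod ((\<lambda>t. y' t - z' t) 0))\<^sup>2 + ((a 0 + 1) * m + 1) * (cmod ((\<lambda>t. y t - z t) 0))\<^sup>2
            + integral {0..T} (\<lambda>t. (cmod ((\<lambda>t. 0::complex) t))\<^sup>2))"
  proof (rule energy_estimate[where L = "L1 + L2" and N = N])
    show "(L1 + L2)-lipschitz_on {0..T} (\<lambda>t. y' t - z' t)" using L by (rule lipschitz_on_diff)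
    show "negligible N" unfolding N_def using N by simp
    fix t assume "t \<in> {0..T} - N"
    then have t: "t \<in> {0..T} - N1" "t \<in> {0..T} - N2" "t \<in> {0..T} - N3" unfolding N_def by auto
    have "((\<lambda>t. y' t - z' t) has_vector_derivative
        (g t - of_real (a t * m + q t) * y t) - (g t - of_real (a t * m + q t) * z t)) (at t within {0..T})"
      using y1 y2 t unfolding mode_solution_def by (intro has_vector_derivative_diff) auto
    then show "((\<lambda>t. y' t - z' t) has_vector_derivative 0 - of_real (a t * m + q t) * (y t - z t)) (at t within {0..T})"
      by (simp add: algebra_simps)
    show "\<bar>q t\<bar> \<le> \<bar>M\<bar>" using q[OF t(3)] by simp
  next
    fix t assume "t \<in> {0..T}"
    then show "((\<lambda>t. y t - z t) has_vector_derivative y' t - z' t) (at t within {0..T})"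
      using y1 y2 unfolding mode_solution_def by (intro has_vector_derivative_diff) auto
  qed (use a a'c a0 m t in auto)
  also have "\<dots> = 0" using init by simp
  finally show ?thesis by (simp add: sum_power2_le_zero_iff)
qed

section \<open>Bessel inequality and Riesz-Fischer theorem for Riesz bases\<close>

lemma L2_zero: "(\<lambda>x. 0) \<in> L2" unfolding L2_def by simp

lemma L2_diff: "f \<in> L2 \<Longrightarrow> g \<in> L2 \<Longrightarrow> (\<lambda>x. f x - g x) \<in> L2"
  using L2_lincomb[of f g 1 "-1"] by simp

lemma L2_add: "f \<in> L2 \<Longrightarrow> g \<in> L2 \<Longrightarrow> (\<lambda>x. f x + g x) \<in> L2"
  using L2_lincomb[of f g 1 1] by simp

lemma L2_cmult: "f \<in> L2 \<Longrightarrow> (\<lambda>x. c * f x) \<in> L2"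
  using L2_lincomb[of f f c 0] by simp

lemma L2_sum:
  assumes "\<And>i. i \<in> F \<Longrightarrow> f i \<in> L2"
  shows "(\<lambda>x. \<Sum>i\<in>F. c i * f i x) \<in> L2"
  using assms by (induction F rule: infinite_finite_induct) (auto intro!: L2_zero L2_add L2_cmult)

lemma l2norm_nonneg [simp]: "l2norm f \<ge> 0"
  unfolding l2norm_def by (simp add: integral_nonneg_AE)

lemma l2norm_square: "(l2norm f)\<^sup>2 = (\<integral>x. (cmod (f x))\<^sup>2 \<partial>lebesgue)"
  unfolding l2norm_def by (simp add: integral_nonneg_AE)

lemma l2norm_minus: "l2norm (\<lambda>x. g x - f x) = l2norm (\<lambda>x. f x - g x)"
  unfolding l2norm_def by (simp add: norm_minus_commute)

lemma l2norm_add_square_le: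
  assumes "f \<in> L2" "g \<in> L2"
  shows "(l2norm (\<lambda>x. f x + g x))\<^sup>2 \<le> 2 * (l2norm f)\<^sup>2 + 2 * (l2norm g)\<^sup>2"
proof -
  have "(\<integral>x. (cmod (f x + g x))\<^sup>2 \<partial>lebesgue) \<le> (\<integral>x. 2 * (cmod (f x))\<^sup>2 + 2 * (cmod (g x))\<^sup>2 \<partial>lebesgue)"
  proof (rule integral_mono)
    show "integrable lebesgue (\<lambda>x. (cmod (f x + g x))\<^sup>2)" using L2_add[OF assms] unfolding L2_def by simp
    show "integrable lebesgue (\<lambda>x. 2 * (cmod (f x))\<^sup>2 + 2 * (cmod (g x))\<^sup>2)" using assms unfolding L2_def by simp
    show "(cmod (f x + g x))\<^sup>2 \<le> 2 * (cmod (f x))\<^sup>2 + 2 * (cmod (g x))\<^sup>2" for x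
      using norm_lincomb_square_le[of 1 "f x" 1 "g x"] by simp
  qed
  also have "\<dots> = 2 * (l2norm f)\<^sup>2 + 2 * (l2norm g)\<^sup>2"
    unfolding l2norm_square using assms unfolding L2_def by simp
  finally show ?thesis unfolding l2norm_square .
qed

lemma l2norm_eq_0:
  assumes "f \<in> L2" "l2norm f = 0"
  shows "AE x in lebesgue. f x = 0"
proof -
  have "(\<integral>x. (cmod (f x))\<^sup>2 \<partial>lebesgue) = 0" using assms(2) l2norm_square[of f] by simp
  then have "AE x in lebesgue. (cmod (f x))\<^sup>2 = 0"
    using assms(1) unfolding L2_def by (subst (asm) integral_nonneg_eq_0_iff_AE) auto
  then show ?thesis by simp
qed

text \<open>The Cauchy-Schwarz inequality up to the summand \<open>1\<close>, which permits division by the last factor when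
  \<open>t\<close> is optimised in \<open>2 t |f| |v| \<le> |f|\<^sup>2 + t\<^sup>2 |v|\<^sup>2\<close>.\<close>

lemma hat_square_le:
  assumes f: "f \<in> L2" and v: "v \<xi> \<in> L2"
  shows "(cmod (hat v f \<xi>))\<^sup>2 \<le> (l2norm f)\<^sup>2 * ((l2norm (v \<xi>))\<^sup>2 + 1)"
proof -
  let ?h = "cmod (hat v f \<xi>)" and ?B = "(l2norm (v \<xi>))\<^sup>2 + 1"
  have B: "?B > 0" by (simp add: add_nonneg_pos)
  define t where "t = ?h / ?B"
  have t: "t \<ge> 0" unfolding t_def using B by simp
  have int: "integrable lebesgue (\<lambda>x. f x * cnj (v \<xi> x))" by (rule L2_integrable_mult_cnj[OF f v])
  have "?h \<le> (\<integral>x. cmod (f x * cnj (v \<xi> x)) \<partial>lebesgue)"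
    unfolding hat_def by (rule integral_norm_bound)
  then have "2 * t * ?h \<le> (\<integral>x. 2 * t * cmod (f x * cnj (v \<xi> x)) \<partial>lebesgue)"
    using t by (simp add: mult_left_mono)
  also have "\<dots> \<le> (\<integral>x. (cmod (f x))\<^sup>2 + t\<^sup>2 * (cmod (v \<xi> x))\<^sup>2 \<partial>lebesgue)"
  proof (rule integral_mono)
    show "integrable lebesgue (\<lambda>x. 2 * t * cmod (f x * cnj (v \<xi> x)))" using int by simp
    show "integrable lebesgue (\<lambda>x. (cmod (f x))\<^sup>2 + t\<^sup>2 * (cmod (v \<xi> x))\<^sup>2)"
      using f v unfolding L2_def by simp
    show "2 * t * cmod (f x * cnj (v \<xi> x)) \<le> (cmod (f x))\<^sup>2 + t\<^sup>2 * (cmod (v \<xi> x))\<^sup>2" for x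
      using sum_squares_bound[of "cmod (f x)" "t * cmod (v \<xi> x)"]
      by (simp add: norm_mult power_mult_distrib mult_ac)
  qed
  also have "\<dots> = (l2norm f)\<^sup>2 + t\<^sup>2 * (l2norm (v \<xi>))\<^sup>2"
    unfolding l2norm_square using f v unfolding L2_def by simp
  also have "\<dots> \<le> (l2norm f)\<^sup>2 + t\<^sup>2 * ?B" by (simp add: mult_left_mono)
  finally have "2 * t * ?h \<le> (l2norm f)\<^sup>2 + t\<^sup>2 * ?B" .
  moreover have "t\<^sup>2 * ?B = t * (t * ?B)" by (simp add: power2_eq_square)
  moreover have tB: "t * ?B = ?h" unfolding t_def using B by simp
  ultimately have "t * ?h \<le> (l2norm f)\<^sup>2" by simp
  then have "t * ?h * ?B \<le> (l2norm f)\<^sup>2 * ?B" using B by (intro mult_right_mono) auto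
  moreover have "t * ?h * ?B = ?h\<^sup>2" using tB by (simp add: power2_eq_square mult_ac)
  ultimately show ?thesis by simp
qed

lemma hat_diff:
  assumes "f \<in> L2" "g \<in> L2" "v \<xi> \<in> L2"
  shows "hat v (\<lambda>x. f x - g x) \<xi> = hat v f \<xi> - hat v g \<xi>"
  using hat_lincomb[where v = v and \<xi> = \<xi>, OF assms, of 1 "-1"] by simp

lemma hat_add:
  assumes "f \<in> L2" "g \<in> L2" "v \<xi> \<in> L2"
  shows "hat v (\<lambda>x. f x + g x) \<xi> = hat v f \<xi> + hat v g \<xi>"
  using hat_lincomb[where v = v and \<xi> = \<xi>, OF assms, of 1 1] by simp

lemma hat_cmult:
  assumes "f \<in> L2" "v \<xi> \<in> L2"
  shows "hat v (\<lambda>x. c * f x) \<xi> = c * hat v f \<xi>"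
  using hat_lincomb[where v = v and \<xi> = \<xi>, OF assms(1,1,2), of c 0] by simp

lemma hat_span:
  assumes "finite F" "F \<subseteq> I" "\<xi> \<in> I" "\<forall>\<xi>\<in>I. u \<xi> \<in> L2" "biorthogonal I u v"
  shows "hat v (\<lambda>x. \<Sum>\<eta>\<in>F. c \<eta> * u \<eta> x) \<xi> = (if \<xi> \<in> F then c \<xi> else 0)"
proof -
  have v: "v \<xi> \<in> L2" and bi: "\<And>\<eta>. \<eta> \<in> I \<Longrightarrow> hat v (u \<eta>) \<xi> = (if \<eta> = \<xi> then 1 else 0)"
    using assms(3,5) unfolding biorthogonal_def hat_def l2inner_def by auto
  have "hat v (\<lambda>x. \<Sum>\<eta>\<in>F. c \<eta> * u \<eta> x) \<xi> = (\<Sum>\<eta>\<in>F. c \<eta> * hat v (u \<eta>) \<xi>)"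
    using assms(1,2)
  proof (induction F rule: finite_induct)
    case empty
    then show ?case by (simp add: hat_def)
  next
    case (insert \<eta> F)
    have "hat v (\<lambda>x. c \<eta> * u \<eta> x + (\<Sum>\<eta>\<in>F. c \<eta> * u \<eta> x)) \<xi>
        = hat v (\<lambda>x. c \<eta> * u \<eta> x) \<xi> + hat v (\<lambda>x. \<Sum>\<eta>\<in>F. c \<eta> * u \<eta> x) \<xi>"
      using insert.prems assms(4) v by (intro hat_add L2_cmult L2_sum) auto
    then show ?case using insert assms(4) v by (simp add: hat_cmult)
  qed
  also have "\<dots> = (\<Sum>\<eta>\<in>F. if \<eta> = \<xi> then c \<eta> else 0)"
    using bi assms(2) by (intro sum.cong) auto
  also have "\<dots> = (if \<xi> \<in> F then c \<xi> else 0)" using assms(1) by simp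
  finally show ?thesis .
qed

lemma riesz_basis_bounds:
  assumes "riesz_basis I u"
  obtains m M where "m > 0"
    "\<forall>F c. finite F \<longrightarrow> F \<subseteq> I \<longrightarrow>
       m * (\<Sum>\<xi>\<in>F. (cmod (c \<xi>))\<^sup>2) \<le> (l2norm (\<lambda>x. \<Sum>\<xi>\<in>F. c \<xi> * u \<xi> x))\<^sup>2"
    "M > 0" "\<forall>F c. finite F \<longrightarrow> F \<subseteq> I \<longrightarrow>
       (l2norm (\<lambda>x. \<Sum>\<xi>\<in>F. c \<xi> * u \<xi> x))\<^sup>2 \<le> M * (\<Sum>\<xi>\<in>F. (cmod (c \<xi>))\<^sup>2)"
proof -
  have "\<exists>m>0. \<exists>M>0. \<forall>F c. finite F \<and> F \<subseteq> I \<longrightarrow>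
        m * (\<Sum>\<xi>\<in>F. (cmod (c \<xi>))\<^sup>2) \<le> (l2norm (\<lambda>x. \<Sum>\<xi>\<in>F. c \<xi> * u \<xi> x))\<^sup>2 \<and>
        (l2norm (\<lambda>x. \<Sum>\<xi>\<in>F. c \<xi> * u \<xi> x))\<^sup>2 \<le> M * (\<Sum>\<xi>\<in>F. (cmod (c \<xi>))\<^sup>2)"
    using assms unfolding riesz_basis_def by (elim conjE) assumption
  then obtain m M where "m > 0" "M > 0" and b: "\<forall>F c. finite F \<and> F \<subseteq> I \<longrightarrow>
        m * (\<Sum>\<xi>\<in>F. (cmod (c \<xi>))\<^sup>2) \<le> (l2norm (\<lambda>x. \<Sum>\<xi>\<in>F. c \<xi> * u \<xi> x))\<^sup>2 \<and>
        (l2norm (\<lambda>x. \<Sum>\<xi>\<in>F. c \<xi> * u \<xi> x))\<^sup>2 \<le> M * (\<Sum>\<xi>\<in>F. (cmod (c \<xi>))\<^sup>2)"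
    by (elim exE conjE)
  then show ?thesis by (intro that[of m M]) simp_all
qed

lemma riesz_basis_dense:
  assumes "riesz_basis I u" "f \<in> L2" "e > 0"
  obtains F c where "finite F" "F \<subseteq> I" "l2norm (\<lambda>x. f x - (\<Sum>\<xi>\<in>F. c \<xi> * u \<xi> x)) < e"
proof -
  have "\<forall>f\<in>L2. \<forall>e>0. \<exists>F c. finite F \<and> F \<subseteq> I \<and> l2norm (\<lambda>x. f x - (\<Sum>\<xi>\<in>F. c \<xi> * u \<xi> x)) < e"
    using assms unfolding riesz_basis_def by (elim conjE) assumption
  then have "\<exists>F c. finite F \<and> F \<subseteq> I \<and> l2norm (\<lambda>x. f x - (\<Sum>\<xi>\<in>F. c \<xi> * u \<xi> x)) < e"
    using assms(2,3) by blast
  then show ?thesis using that by (elim exE conjE)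
qed

text \<open>Bessel's inequality for the dual system. For \<open>f\<close> in the span of the \<open>u \<xi>\<close> it is the lower Riesz bound;
  it extends by density because, for fixed finite \<open>F\<close>, the left-hand side is continuous in \<open>f\<close>.\<close>

lemma hat_bessel:
  fixes u v :: "'i \<Rightarrow> real ^ 'n \<Rightarrow> complex"
  assumes rb: "riesz_basis I u" and bi: "biorthogonal I u v"
  shows "\<exists>C>0. \<forall>f F. f \<in> L2 \<longrightarrow> finite F \<longrightarrow> F \<subseteq> I \<longrightarrow>
    (\<Sum>\<xi>\<in>F. (cmod (hat v f \<xi>))\<^sup>2) \<le> C * (l2norm f)\<^sup>2"
proof -
  have u: "\<forall>\<xi>\<in>I. u \<xi> \<in> L2" and v: "\<forall>\<xi>\<in>I. v \<xi> \<in> L2"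
    using rb bi unfolding riesz_basis_def biorthogonal_def by auto
  obtain m M where m: "m > 0" "\<forall>F c. finite F \<longrightarrow> F \<subseteq> I \<longrightarrow>
        m * (\<Sum>\<xi>\<in>F. (cmod (c \<xi>))\<^sup>2) \<le> (l2norm (\<lambda>x. \<Sum>\<xi>\<in>F. c \<xi> * u \<xi> x))\<^sup>2"
    and M: "M > 0" "\<forall>F c. finite F \<longrightarrow> F \<subseteq> I \<longrightarrow>
       (l2norm (\<lambda>x. \<Sum>\<xi>\<in>F. c \<xi> * u \<xi> x))\<^sup>2 \<le> M * (\<Sum>\<xi>\<in>F. (cmod (c \<xi>))\<^sup>2)"
    using riesz_basis_bounds[OF rb] .
  show ?thesis
  proof (intro exI[of _ "4 / m"] conjI allI impI)
    show "4 / m > 0" using m by simp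
    fix f :: "real ^ 'n \<Rightarrow> complex" and F assume f: "f \<in> L2" and F: "finite F" "F \<subseteq> I"
    define b where "b = (\<Sum>\<xi>\<in>F. (l2norm (v \<xi>))\<^sup>2 + 1)"
    have b0: "b \<ge> 0" unfolding b_def by (simp add: sum_nonneg)
    have approx: "(\<Sum>\<xi>\<in>F. (cmod (hat v f \<xi>))\<^sup>2) \<le> 4 / m * (l2norm f)\<^sup>2 + (2 * b + 4 / m) * e\<^sup>2" if e: "e > 0" for e
    proof -
      obtain G c where G: "finite G" "G \<subseteq> I" and ge: "l2norm (\<lambda>x. f x - (\<Sum>\<xi>\<in>G. c \<xi> * u \<xi> x)) < e"
        using riesz_basis_dense[OF rb f e] .
      define g where "g x = (\<Sum>\<xi>\<in>G. c \<xi> * u \<xi> x)" for x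
      have g: "g \<in> L2" unfolding g_def[abs_def] using u G by (intro L2_sum) auto
      have fg: "(\<lambda>x. f x - g x) \<in> L2" using f g by (rule L2_diff)
      have fge: "(l2norm (\<lambda>x. f x - g x))\<^sup>2 \<le> e\<^sup>2"
        using ge unfolding g_def by (intro power_mono) auto
      have gh: "hat v g \<xi> = (if \<xi> \<in> G then c \<xi> else 0)" if "\<xi> \<in> I" for \<xi>
        unfolding g_def[abs_def] using hat_span[OF G that u bi] .
      have "(\<Sum>\<xi>\<in>F. (cmod (hat v g \<xi>))\<^sup>2) = (\<Sum>\<xi>\<in>F \<inter> G. (cmod (c \<xi>))\<^sup>2)"
      proof -
        have "(\<Sum>\<xi>\<in>F. (cmod (hat v g \<xi>))\<^sup>2) = (\<Sum>\<xi>\<in>F. if \<xi> \<in> G then (cmod (c \<xi>))\<^sup>2 else 0)"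
        proof (rule sum.cong)
          fix \<xi> assume "\<xi> \<in> F"
          then have "\<xi> \<in> I" using F by auto
          then show "(cmod (hat v g \<xi>))\<^sup>2 = (if \<xi> \<in> G then (cmod (c \<xi>))\<^sup>2 else 0)"
            using gh[of \<xi>] by simp
        qed simp
        then show ?thesis using F by (simp add: sum.inter_restrict)
      qed
      also have "\<dots> \<le> (\<Sum>\<xi>\<in>G. (cmod (c \<xi>))\<^sup>2)" using G by (intro sum_mono2) auto
      also have "\<dots> \<le> (l2norm g)\<^sup>2 / m"
        using m(2)[rule_format, OF G, of c] m(1) unfolding g_def[abs_def] by (simp add: field_simps)
      also have "\<dots> \<le> (2 * (l2norm f)\<^sup>2 + 2 * e\<^sup>2) / m"
      proof -
        have "(l2norm (\<lambda>x. f x + (g x - f x)))\<^sup>2 \<le> 2 * (l2norm f)\<^sup>2 + 2 * (l2norm (\<lambda>x. g x - f x))\<^sup>2"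
          using f g by (intro l2norm_add_square_le L2_diff)
        then have "(l2norm g)\<^sup>2 \<le> 2 * (l2norm f)\<^sup>2 + 2 * e\<^sup>2" using fge unfolding l2norm_minus[of g f] by simp
        then show ?thesis using m(1) by (intro divide_right_mono) auto
      qed
      finally have 1: "(\<Sum>\<xi>\<in>F. (cmod (hat v g \<xi>))\<^sup>2) \<le> (2 * (l2norm f)\<^sup>2 + 2 * e\<^sup>2) / m" .
      have 2: "(\<Sum>\<xi>\<in>F. (cmod (hat v (\<lambda>x. f x - g x) \<xi>))\<^sup>2) \<le> e\<^sup>2 * b"
        unfolding b_def sum_distrib_left
      proof (rule sum_mono)
        fix \<xi> assume "\<xi> \<in> F"
        then have "v \<xi> \<in> L2" using F v by auto
        from hat_square_le[OF fg, of v \<xi>, OF this]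
        show "(cmod (hat v (\<lambda>x. f x - g x) \<xi>))\<^sup>2 \<le> e\<^sup>2 * ((l2norm (v \<xi>))\<^sup>2 + 1)"
          using mult_right_mono[OF fge, of "(l2norm (v \<xi>))\<^sup>2 + 1"] by auto
      qed
      have "(\<Sum>\<xi>\<in>F. (cmod (hat v f \<xi>))\<^sup>2)
          \<le> (\<Sum>\<xi>\<in>F. 2 * (cmod (hat v g \<xi>))\<^sup>2 + 2 * (cmod (hat v (\<lambda>x. f x - g x) \<xi>))\<^sup>2)"
      proof (rule sum_mono)
        fix \<xi> assume "\<xi> \<in> F"
        then have "hat v (\<lambda>x. f x - g x) \<xi> = hat v f \<xi> - hat v g \<xi>"
          using F v f g by (intro hat_diff) auto
        then show "(cmod (hat v f \<xi>))\<^sup>2 \<le> 2 * (cmod (hat v g \<xi>))\<^sup>2 + 2 * (cmod (hat v (\<lambda>x. f x - g x) \<xi>))\<^sup>2"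
          using norm_lincomb_square_le[of 1 "hat v g \<xi>" 1 "hat v f \<xi> - hat v g \<xi>"] by simp
      qed
      also have "\<dots> \<le> 2 * ((2 * (l2norm f)\<^sup>2 + 2 * e\<^sup>2) / m) + 2 * (e\<^sup>2 * b)"
        unfolding sum.distrib sum_distrib_left[symmetric] using 1 2 by (intro add_mono mult_left_mono) simp_all
      finally show ?thesis by (simp add: add_divide_distrib algebra_simps)
    qed
    have lim: "((\<lambda>e. 4 / m * (l2norm f)\<^sup>2 + (2 * b + 4 / m) * e\<^sup>2) \<longlongrightarrow> 4 / m * (l2norm f)\<^sup>2 + (2 * b + 4 / m) * 0\<^sup>2) (at_right 0)"
      by (intro tendsto_intros)
    show "(\<Sum>\<xi>\<in>F. (cmod (hat v f \<xi>))\<^sup>2) \<le> 4 / m * (l2norm f)\<^sup>2"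
    proof -
      have "\<forall>\<^sub>F e in at_right 0. (\<Sum>\<xi>\<in>F. (cmod (hat v f \<xi>))\<^sup>2) \<le> 4 / m * (l2norm f)\<^sup>2 + (2 * b + 4 / m) * e\<^sup>2"
        using eventually_at_right_less[of 0] by (rule eventually_mono) (rule approx)
      from tendsto_lowerbound[OF lim this] show ?thesis by simp
    qed
  qed
qed

text \<open>Let \<open>g\<close> in the span of the \<open>u \<xi>\<close> be close to \<open>f\<close>. The coefficients of \<open>g\<close> are minus those of \<open>f - g\<close>,
  hence small by Bessel's inequality, so \<open>g\<close> is small by the upper Riesz bound, and with it \<open>f\<close>.\<close>

lemma hat_determines:
  fixes u v :: "'i \<Rightarrow> real ^ 'n \<Rightarrow> complex"
  assumes rb: "riesz_basis I u" and bi: "biorthogonal I u v"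
    and f: "f \<in> L2" and 0: "\<And>\<xi>. \<xi> \<in> I \<Longrightarrow> hat v f \<xi> = 0"
  shows "AE x in lebesgue. f x = 0"
proof -
  have u: "\<forall>\<xi>\<in>I. u \<xi> \<in> L2" and v: "\<forall>\<xi>\<in>I. v \<xi> \<in> L2"
    using rb bi unfolding riesz_basis_def biorthogonal_def by auto
  obtain m M where m: "m > 0" "\<forall>F c. finite F \<longrightarrow> F \<subseteq> I \<longrightarrow>
        m * (\<Sum>\<xi>\<in>F. (cmod (c \<xi>))\<^sup>2) \<le> (l2norm (\<lambda>x. \<Sum>\<xi>\<in>F. c \<xi> * u \<xi> x))\<^sup>2"
    and M: "M > 0" "\<forall>F c. finite F \<longrightarrow> F \<subseteq> I \<longrightarrow>
       (l2norm (\<lambda>x. \<Sum>\<xi>\<in>F. c \<xi> * u \<xi> x))\<^sup>2 \<le> M * (\<Sum>\<xi>\<in>F. (cmod (c \<xi>))\<^sup>2)"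
    using riesz_basis_bounds[OF rb] .
  obtain C where C: "C > 0" "\<forall>f F. f \<in> L2 \<longrightarrow> finite F \<longrightarrow> F \<subseteq> I \<longrightarrow>
      (\<Sum>\<xi>\<in>F. (cmod (hat v f \<xi>))\<^sup>2) \<le> C * (l2norm f)\<^sup>2"
    using hat_bessel[OF rb bi] by blast
  have approx: "(l2norm f)\<^sup>2 \<le> (2 + 2 * M * C) * e\<^sup>2" if e: "e > 0" for e
  proof -
    obtain G c where G: "finite G" "G \<subseteq> I" and ge: "l2norm (\<lambda>x. f x - (\<Sum>\<xi>\<in>G. c \<xi> * u \<xi> x)) < e"
      using riesz_basis_dense[OF rb f e] .
    define g where "g x = (\<Sum>\<xi>\<in>G. c \<xi> * u \<xi> x)" for x
    have g: "g \<in> L2" unfolding g_def[abs_def] using u G by (intro L2_sum) auto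
    have fg: "(\<lambda>x. f x - g x) \<in> L2" using f g by (rule L2_diff)
    have fge: "(l2norm (\<lambda>x. f x - g x))\<^sup>2 \<le> e\<^sup>2"
      using ge unfolding g_def by (intro power_mono) auto
    have ch: "cmod (hat v (\<lambda>x. f x - g x) \<xi>) = cmod (c \<xi>)" if "\<xi> \<in> G" for \<xi>
    proof -
      have \<xi>: "\<xi> \<in> I" using that G by auto
      have "hat v g \<xi> = c \<xi>" unfolding g_def[abs_def] using hat_span[OF G \<xi> u bi] that by simp
      then show ?thesis using hat_diff[OF f g, of v \<xi>] v \<xi> 0[OF \<xi>] by simp
    qed
    have "(l2norm g)\<^sup>2 \<le> M * (\<Sum>\<xi>\<in>G. (cmod (c \<xi>))\<^sup>2)" unfolding g_def[abs_def] by (rule M(2)[rule_format, OF G])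
    also have "\<dots> = M * (\<Sum>\<xi>\<in>G. (cmod (hat v (\<lambda>x. f x - g x) \<xi>))\<^sup>2)" using ch by simp
    also have "\<dots> \<le> M * (C * (l2norm (\<lambda>x. f x - g x))\<^sup>2)"
      using M(1) C(2)[rule_format, OF fg G] by (intro mult_left_mono) auto
    also have "\<dots> \<le> M * (C * e\<^sup>2)" using M(1) C(1) fge by (intro mult_left_mono) auto
    finally have 1: "(l2norm g)\<^sup>2 \<le> M * (C * e\<^sup>2)" .
    have "(l2norm (\<lambda>x. (f x - g x) + g x))\<^sup>2 \<le> 2 * (l2norm (\<lambda>x. f x - g x))\<^sup>2 + 2 * (l2norm g)\<^sup>2"
      using fg g by (rule l2norm_add_square_le)
    then show ?thesis using 1 fge by (simp add: algebra_simps)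
  qed
  have lim: "((\<lambda>e. (2 + 2 * M * C) * e\<^sup>2) \<longlongrightarrow> (2 + 2 * M * C) * 0\<^sup>2) (at_right 0)"
    by (intro tendsto_intros)
  have "\<forall>\<^sub>F e in at_right 0. (l2norm f)\<^sup>2 \<le> (2 + 2 * M * C) * e\<^sup>2"
    using eventually_at_right_less[of 0] by (rule eventually_mono) (rule approx)
  from tendsto_lowerbound[OF lim this] have "(l2norm f)\<^sup>2 \<le> 0" by simp
  then show ?thesis using l2norm_eq_0[OF f] by simp
qed

text \<open>Completeness of \<open>L\<^sup>2\<close> for rapidly convergent series. The sum \<open>h\<close> of \<open>2 ^ k * |d k|\<^sup>2\<close> is integrable, hence
  finite almost everywhere, and by the Cauchy-Schwarz inequality \<open>2 * h\<close> bounds the squares of all partial sums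
  of the series, so that dominated convergence applies.\<close>

lemma L2_series_limit:
  fixes d :: "nat \<Rightarrow> real ^ 'n \<Rightarrow> complex"
  assumes d: "\<And>k. d k \<in> L2" and sm: "summable (\<lambda>k. 2 ^ k * (l2norm (d k))\<^sup>2)"
  obtains g where "g \<in> L2" "(\<lambda>n. (l2norm (\<lambda>x. g x - (\<Sum>k<n. d k x)))\<^sup>2) \<longlonglongrightarrow> 0"
proof -
  have [measurable]: "d k \<in> borel_measurable lebesgue" for k using d[of k] unfolding L2_def by simp
  define f where "f k x = 2 ^ k * (cmod (d k x))\<^sup>2" for k x
  have f0: "f k x \<ge> 0" for k x unfolding f_def by simp
  have fint: "integrable lebesgue (f k)" for k
    unfolding f_def[abs_def] using d[of k] unfolding L2_def by simp
  have fI: "(\<integral>x. f k x \<partial>lebesgue) = 2 ^ k * (l2norm (d k))\<^sup>2" for k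
    unfolding f_def l2norm_square by simp
  have "(\<integral>\<^sup>+x. (\<Sum>k. ennreal (f k x)) \<partial>lebesgue) = (\<Sum>k. \<integral>\<^sup>+x. ennreal (f k x) \<partial>lebesgue)"
    using fint by (intro nn_integral_suminf) auto
  also have "\<dots> = (\<Sum>k. ennreal (2 ^ k * (l2norm (d k))\<^sup>2))"
    using fint f0 by (simp add: nn_integral_eq_integral fI)
  also have "\<dots> = ennreal (\<Sum>k. 2 ^ k * (l2norm (d k))\<^sup>2)"
    by (rule suminf_ennreal2[OF _ sm]) simp
  finally have "(\<integral>\<^sup>+x. (\<Sum>k. ennreal (f k x)) \<partial>lebesgue) \<noteq> \<infinity>" by simp
  moreover have "(\<lambda>x. \<Sum>k. ennreal (f k x)) \<in> borel_measurable lebesgue"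
    using fint by (intro borel_measurable_suminf_order) auto
  ultimately have "AE x in lebesgue. (\<Sum>k. ennreal (f k x)) \<noteq> \<infinity>"
    by (rule nn_integral_PInf_AE[rotated])
  then have fsum: "AE x in lebesgue. summable (\<lambda>k. f k x)"
    by eventually_elim (rule summable_suminf_not_top, auto simp: f0)
  define h where "h x = (\<Sum>k. f k x)" for x
  have hint: "integrable lebesgue h"
    unfolding h_def[abs_def]
  proof (rule integrable_suminf[OF fint])
    show "AE x in lebesgue. summable (\<lambda>k. norm (f k x))" using fsum f0 by simp
    show "summable (\<lambda>k. \<integral>x. norm (f k x) \<partial>lebesgue)" using sm f0 by (simp add: fI)
  qed
  define g where "g x = (\<Sum>k. d k x)" for x
  have [measurable]: "g \<in> borel_measurable lebesgue" unfolding g_def[abs_def] by measurable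
  have part: "(cmod (\<Sum>k<n. d k x))\<^sup>2 \<le> 2 * h x" if x: "summable (\<lambda>k. f k x)" for n x
  proof -
    have "cmod (\<Sum>k<n. d k x) \<le> (\<Sum>k<n. sqrt ((1/2) ^ k) * sqrt (f k x))"
    proof (rule order_trans[OF norm_sum], rule sum_mono)
      fix k
      have "sqrt ((1/2) ^ k) * sqrt (f k x) = sqrt (((1/2) ^ k * 2 ^ k) * (cmod (d k x))\<^sup>2)"
        unfolding f_def by (simp add: real_sqrt_mult[symmetric] mult.assoc)
      also have "(1/2::real) ^ k * 2 ^ k = 1" by (simp add: power_mult_distrib[symmetric])
      finally show "cmod (d k x) \<le> sqrt ((1/2) ^ k) * sqrt (f k x)" by simp
    qed
    then have "(cmod (\<Sum>k<n. d k x))\<^sup>2 \<le> (\<Sum>k<n. sqrt ((1/2) ^ k) * sqrt (f k x))\<^sup>2"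
      by (intro power_mono) auto
    also have "\<dots> \<le> (\<Sum>k<n. (sqrt ((1/2) ^ k))\<^sup>2) * (\<Sum>k<n. (sqrt (f k x))\<^sup>2)"
      by (rule Cauchy_Schwarz_ineq_sum)
    also have "\<dots> = (\<Sum>k<n. (1/2) ^ k) * (\<Sum>k<n. f k x)" using f0 by simp
    also have "\<dots> \<le> 2 * h x"
    proof (rule mult_mono)
      have "(\<Sum>k<n. (1/2::real) ^ k) \<le> (\<Sum>k. (1/2) ^ k)" by (rule sum_le_suminf) auto
      also have "\<dots> = 2" by (simp add: suminf_geometric)
      finally show "(\<Sum>k<n. (1/2::real) ^ k) \<le> 2" .
      show "(\<Sum>k<n. f k x) \<le> h x" unfolding h_def using x f0 by (intro sum_le_suminf) auto
    qed (auto intro: sum_nonneg f0)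
    finally show ?thesis .
  qed
  have conv: "(\<lambda>n. \<Sum>k<n. d k x) \<longlonglongrightarrow> g x" if x: "summable (\<lambda>k. f k x)" for x
  proof -
    have "summable (\<lambda>k. norm (d k x))"
    proof (rule summable_comparison_test')
      show "summable (\<lambda>k. (1/2) ^ k + f k x)" using x by (intro summable_add) auto
      fix k
      have "(1/2::real) ^ k * 2 ^ k = 1" by (simp add: power_mult_distrib[symmetric])
      then have "cmod (d k x) = sqrt ((1/2) ^ k) * (sqrt (2 ^ k) * cmod (d k x))"
        by (simp add: mult.assoc[symmetric] real_sqrt_mult[symmetric])
      also have "\<dots> \<le> (sqrt ((1/2) ^ k))\<^sup>2 + (sqrt (2 ^ k) * cmod (d k x))\<^sup>2"
      proof -
        have xy: "x * y \<le> x\<^sup>2 + y\<^sup>2" if "x \<ge> 0" "y \<ge> 0" for x y :: real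
          using sum_squares_bound[of x y] mult_nonneg_nonneg[OF that] unfolding mult.assoc by linarith
        show ?thesis by (rule xy) simp_all
      qed
      also have "\<dots> = (1/2) ^ k + f k x" unfolding f_def by (simp add: power_mult_distrib)
      finally show "norm (norm (d k x)) \<le> (1/2) ^ k + f k x" by simp
    qed
    then have "summable (\<lambda>k. d k x)" by (rule summable_norm_cancel)
    then show ?thesis unfolding g_def by (rule summable_LIMSEQ)
  qed
  have gb: "(cmod (g x))\<^sup>2 \<le> 2 * h x" if x: "summable (\<lambda>k. f k x)" for x
  proof (rule tendsto_upperbound)
    show "(\<lambda>n. (cmod (\<Sum>k<n. d k x))\<^sup>2) \<longlonglongrightarrow> (cmod (g x))\<^sup>2"
      by (intro tendsto_intros conv x)
    show "\<forall>\<^sub>F n in sequentially. (cmod (\<Sum>k<n. d k x))\<^sup>2 \<le> 2 * h x" using part[OF x] by simp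
  qed simp
  have gL: "g \<in> L2"
    unfolding L2_def
  proof (intro CollectI conjI)
    show "integrable lebesgue (\<lambda>x. (cmod (g x))\<^sup>2)"
    proof (rule Bochner_Integration.integrable_bound)
      show "integrable lebesgue (\<lambda>x. 2 * h x)" using hint by simp
      show "AE x in lebesgue. norm ((cmod (g x))\<^sup>2) \<le> norm (2 * h x)"
        using fsum
      proof eventually_elim
        case (elim x)
        have "(cmod (g x))\<^sup>2 \<le> 2 * h x" by (rule gb[OF elim])
        then show ?case by (simp add: abs_of_nonneg)
      qed
    qed measurable
  qed measurable
  have "(\<lambda>n. \<integral>x. (cmod (g x - (\<Sum>k<n. d k x)))\<^sup>2 \<partial>lebesgue) \<longlonglongrightarrow> (\<integral>x. 0 \<partial>(lebesgue :: (real ^ 'n) measure))"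
  proof (rule integral_dominated_convergence[where w = "\<lambda>x. 8 * h x"])
    show "integrable lebesgue (\<lambda>x. 8 * h x)" using hint by simp
    show "AE x in lebesgue. (\<lambda>n. (cmod (g x - (\<Sum>k<n. d k x)))\<^sup>2) \<longlonglongrightarrow> 0"
      using fsum
    proof eventually_elim
      case (elim x)
      have "(\<lambda>n. (cmod (g x - (\<Sum>k<n. d k x)))\<^sup>2) \<longlonglongrightarrow> (cmod (g x - g x))\<^sup>2"
        by (intro tendsto_intros conv elim)
      then show ?case by simp
    qed
    show "AE x in lebesgue. norm ((cmod (g x - (\<Sum>k<n. d k x)))\<^sup>2) \<le> 8 * h x" for n
      using fsum
    proof eventually_elim
      case (elim x)
      have "(cmod (1 * g x + (-1) * (\<Sum>k<n. d k x)))\<^sup>2 \<le> 2 * (cmod (g x))\<^sup>2 + 2 * (cmod (\<Sum>k<n. d k x))\<^sup>2"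
        using norm_lincomb_square_le[of 1 "g x" "-1"] by simp
      then show ?case using gb[OF elim] part[OF elim, of n] by simp
    qed
  qed measurable
  then have "(\<lambda>n. (l2norm (\<lambda>x. g x - (\<Sum>k<n. d k x)))\<^sup>2) \<longlonglongrightarrow> 0"
    unfolding l2norm_square by simp
  with gL show ?thesis by (rule that)
qed

lemma summable_on_tail:
  fixes f :: "'i \<Rightarrow> real"
  assumes "f summable_on I" "e > 0"
  shows "\<exists>F. finite F \<and> F \<subseteq> I \<and> (\<forall>G. finite G \<longrightarrow> G \<subseteq> I - F \<longrightarrow> sum f G \<le> e)"
proof -
  obtain S where "(f has_sum S) I" using assms(1) summable_on_def by blast
  then have "\<forall>\<^sub>F F in finite_subsets_at_top I. dist (sum f F) S < e / 2"
    using assms(2) unfolding has_sum_def by (auto dest: tendstoD[where e = "e / 2"])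
  then have "\<exists>F. finite F \<and> F \<subseteq> I \<and> (\<forall>G. finite G \<and> F \<subseteq> G \<and> G \<subseteq> I \<longrightarrow> dist (sum f G) S < e / 2)"
    unfolding eventually_finite_subsets_at_top .
  then obtain F where F': "finite F \<and> F \<subseteq> I \<and> (\<forall>G. finite G \<and> F \<subseteq> G \<and> G \<subseteq> I \<longrightarrow> dist (sum f G) S < e / 2)" ..
  have F: "finite F" "F \<subseteq> I" "finite G \<Longrightarrow> F \<subseteq> G \<Longrightarrow> G \<subseteq> I \<Longrightarrow> dist (sum f G) S < e / 2" for G
    using F' by simp_all
  show ?thesis
  proof (intro exI[of _ F] conjI F(1,2) allI impI)
    fix G assume G: "finite G" "G \<subseteq> I - F"
    have "sum f (F \<union> G) = sum f F + sum f G" using F G by (intro sum.union_disjoint) auto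
    moreover have "dist (sum f (F \<union> G)) S < e / 2" "dist (sum f F) S < e / 2"
      by (rule F(3); use F G in auto)+
    ultimately show "sum f G \<le> e" unfolding dist_real_def by linarith
  qed
qed

text \<open>Exhaust \<open>I\<close> by finite sets \<open>F n\<close> whose complements carry at most \<open>(1/4) ^ n\<close> of the square sum. The upper
  Riesz bound turns this into a rapidly convergent series in \<open>L\<^sup>2\<close>.\<close>

lemma riesz_fischer:
  fixes u v :: "'i \<Rightarrow> real ^ 'n \<Rightarrow> complex"
  assumes rb: "riesz_basis I u" and bi: "biorthogonal I u v"
    and c: "(\<lambda>\<xi>. (cmod (c \<xi>))\<^sup>2) summable_on I"
  obtains g where "g \<in> L2" "\<And>\<xi>. \<xi> \<in> I \<Longrightarrow> hat v g \<xi> = c \<xi>"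
proof -
  have u: "\<forall>\<xi>\<in>I. u \<xi> \<in> L2" and v: "\<forall>\<xi>\<in>I. v \<xi> \<in> L2"
    using rb bi unfolding riesz_basis_def biorthogonal_def by auto
  obtain m M where m: "m > 0" "\<forall>F c. finite F \<longrightarrow> F \<subseteq> I \<longrightarrow>
        m * (\<Sum>\<xi>\<in>F. (cmod (c \<xi>))\<^sup>2) \<le> (l2norm (\<lambda>x. \<Sum>\<xi>\<in>F. c \<xi> * u \<xi> x))\<^sup>2"
    and M: "M > 0" "\<forall>F c. finite F \<longrightarrow> F \<subseteq> I \<longrightarrow>
       (l2norm (\<lambda>x. \<Sum>\<xi>\<in>F. c \<xi> * u \<xi> x))\<^sup>2 \<le> M * (\<Sum>\<xi>\<in>F. (cmod (c \<xi>))\<^sup>2)"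
    using riesz_basis_bounds[OF rb] .
  let ?s = "\<lambda>\<xi>. (cmod (c \<xi>))\<^sup>2"
  have "\<forall>k::nat. \<exists>F. finite F \<and> F \<subseteq> I \<and> (\<forall>G. finite G \<longrightarrow> G \<subseteq> I - F \<longrightarrow> sum ?s G \<le> (1/4) ^ k)"
    by (intro allI summable_on_tail[OF c]) simp
  from choice[OF this] obtain A where A': "\<forall>k::nat. finite (A k) \<and> A k \<subseteq> I \<and>
      (\<forall>G. finite G \<longrightarrow> G \<subseteq> I - A k \<longrightarrow> sum ?s G \<le> (1/4) ^ k)" ..
  have A: "finite (A k)" "A k \<subseteq> I" "finite G \<Longrightarrow> G \<subseteq> I - A k \<Longrightarrow> sum ?s G \<le> (1/4) ^ k" for k G
    using A' by simp_all
  define F where "F n = (\<Union>k<n. A k)" for n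
  have F: "finite (F n)" "F n \<subseteq> I" for n unfolding F_def using A by auto
  define d where "d n x = (\<Sum>\<xi>\<in>F (Suc n) - F n. c \<xi> * u \<xi> x)" for n x
  have dL: "d n \<in> L2" for n unfolding d_def[abs_def] using F u by (intro L2_sum) blast
  have S: "(\<Sum>k<n. d k x) = (\<Sum>\<xi>\<in>F n. c \<xi> * u \<xi> x)" for n x
  proof (induction n)
    case 0
    then show ?case by (simp add: F_def)
  next
    case (Suc n)
    have "F n \<subseteq> F (Suc n)" unfolding F_def by (auto simp: less_Suc_eq)
    then show ?case using Suc sum.subset_diff[of "F n" "F (Suc n)" "\<lambda>\<xi>. c \<xi> * u \<xi> x"] F
      by (simp add: d_def)
  qed
  have dn: "(l2norm (d (Suc n)))\<^sup>2 \<le> M * (1/4) ^ n" for n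
  proof -
    have "(l2norm (d (Suc n)))\<^sup>2 \<le> M * (\<Sum>\<xi>\<in>F (Suc (Suc n)) - F (Suc n). ?s \<xi>)"
      unfolding d_def[abs_def] using F by (intro M(2)[rule_format]) blast+
    also have "\<dots> \<le> M * (1/4) ^ n"
    proof (intro mult_left_mono A(3))
      have "A n \<subseteq> F (Suc n)" unfolding F_def by (rule UN_upper) simp
      then show "F (Suc (Suc n)) - F (Suc n) \<subseteq> I - A n" using F(2)[of "Suc (Suc n)"] by blast
    qed (use F M in auto)
    finally show ?thesis .
  qed
  have "summable (\<lambda>k. 2 ^ Suc k * (l2norm (d (Suc k)))\<^sup>2)"
  proof (rule summable_comparison_test')
    show "summable (\<lambda>k. 2 * M * (1/2) ^ k)" by (intro summable_mult) simp
    fix k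
    have "2 ^ Suc k * (l2norm (d (Suc k)))\<^sup>2 \<le> 2 ^ Suc k * (M * (1/4) ^ k)"
      using dn by (intro mult_left_mono) auto
    also have "\<dots> = 2 * M * (2 ^ k * (1/4) ^ k)" by simp
    also have "(2::real) ^ k * (1/4) ^ k = (1/2) ^ k" unfolding power_mult_distrib[symmetric] by simp
    finally show "norm (2 ^ Suc k * (l2norm (d (Suc k)))\<^sup>2) \<le> 2 * M * (1/2) ^ k" by simp
  qed
  then have "summable (\<lambda>k. 2 ^ k * (l2norm (d k))\<^sup>2)"
    by (subst (asm) summable_Suc_iff)
  from L2_series_limit[of d, OF dL this] obtain g where
    g: "g \<in> L2" "(\<lambda>n. (l2norm (\<lambda>x. g x - (\<Sum>k<n. d k x)))\<^sup>2) \<longlonglongrightarrow> 0" .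
  have "hat v g \<xi> = c \<xi>" if \<xi>: "\<xi> \<in> I" for \<xi>
  proof -
    let ?S = "\<lambda>n x. \<Sum>\<eta>\<in>F n. c \<eta> * u \<eta> x"
    have SL: "?S n \<in> L2" for n using F u by (intro L2_sum) blast
    have hS: "hat v (?S n) \<xi> = (if \<xi> \<in> F n then c \<xi> else 0)" for n
      using F \<xi> u bi by (intro hat_span)
    have b: "(cmod (hat v g \<xi> - c \<xi>))\<^sup>2 \<le> 2 * ((l2norm (\<lambda>x. g x - (\<Sum>k<Suc n. d k x)))\<^sup>2 * ((l2norm (v \<xi>))\<^sup>2 + 1)) + 2 * (1/4) ^ n" for n
    proof -
      let ?n = "Suc n"
      have "(cmod (hat v (?S ?n) \<xi> - c \<xi>))\<^sup>2 \<le> (1/4) ^ n"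
      proof (cases "\<xi> \<in> F ?n")
        case False
        then have "sum ?s {\<xi>} \<le> (1/4) ^ n" using \<xi> unfolding F_def by (intro A(3)) auto
        then show ?thesis using False hS by simp
      qed (simp add: hS)
      moreover have "(cmod (hat v (\<lambda>x. g x - ?S ?n x) \<xi>))\<^sup>2 \<le> (l2norm (\<lambda>x. g x - ?S ?n x))\<^sup>2 * ((l2norm (v \<xi>))\<^sup>2 + 1)"
        using g(1) SL v \<xi> by (intro hat_square_le L2_diff) auto
      moreover have "hat v (\<lambda>x. g x - ?S ?n x) \<xi> = hat v g \<xi> - hat v (?S ?n) \<xi>"
        using g(1) SL v \<xi> by (intro hat_diff) auto
      moreover have "(cmod (hat v g \<xi> - c \<xi>))\<^sup>2 \<le> 2 * (cmod (hat v g \<xi> - hat v (?S ?n) \<xi>))\<^sup>2 + 2 * (cmod (hat v (?S ?n) \<xi> - c \<xi>))\<^sup>2"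
        using norm_lincomb_square_le[of 1 "hat v g \<xi> - hat v (?S ?n) \<xi>" 1 "hat v (?S ?n) \<xi> - c \<xi>"] by simp
      ultimately show ?thesis unfolding S by simp
    qed
    have "(\<lambda>n. 2 * ((l2norm (\<lambda>x. g x - (\<Sum>k<Suc n. d k x)))\<^sup>2 * ((l2norm (v \<xi>))\<^sup>2 + 1)) + 2 * (1/4) ^ n) \<longlonglongrightarrow> 2 * (0 * ((l2norm (v \<xi>))\<^sup>2 + 1)) + 2 * 0"
      by (intro tendsto_intros LIMSEQ_Suc[OF g(2)] LIMSEQ_power_zero) simp
    then have "(cmod (hat v g \<xi> - c \<xi>))\<^sup>2 \<le> 2 * (0 * ((l2norm (v \<xi>))\<^sup>2 + 1)) + 2 * 0"
      by (rule LIMSEQ_le_const) (use b in auto)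
    then show ?thesis by simp
  qed
  with g(1) show ?thesis by (rule that)
qed

section \<open>Existence for one mode with a bounded measurable potential\<close>

lemma absolutely_integrable_bounded_mult:
  fixes p :: "real \<Rightarrow> real" and h :: "real \<Rightarrow> complex"
  assumes p: "p \<in> borel_measurable (lebesgue_on {0..T})" "\<And>t. t \<in> {0..T} \<Longrightarrow> \<bar>p t\<bar> \<le> B"
    and h: "continuous_on {0..T} h"
  shows "(\<lambda>t. of_real (p t) * h t) absolutely_integrable_on {0..T}"
proof -
  have "(\<lambda>t. p t *\<^sub>R h t) absolutely_integrable_on {0..T}"
  proof (rule absolutely_integrable_bounded_measurable_product[where h = "\<lambda>(x::real) (y::complex). x *\<^sub>R y", OF _ p(1)])
    show "bilinear (\<lambda>(x::real) (y::complex). x *\<^sub>R y)"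
      using bilinear_conv_bounded_bilinear bounded_bilinear_scaleR by blast
    show "bounded (p ` {0..T})" using p(2) by (intro boundedI[of _ B]) auto
    show "h absolutely_integrable_on {0..T}" using h by (rule absolutely_integrable_continuous_real)
  qed simp
  then show ?thesis by (simp add: scaleR_conv_of_real)
qed

lemma integrable_bounded_mult:
  fixes p :: "real \<Rightarrow> real" and h :: "real \<Rightarrow> complex"
  assumes p: "p \<in> borel_measurable (lebesgue_on {0..T})" "\<And>t. t \<in> {0..T} \<Longrightarrow> \<bar>p t\<bar> \<le> B"
    and h: "continuous_on {0..T} h" and sub: "0 \<le> a" "b \<le> T"
  shows "(\<lambda>t. of_real (p t) * h t) integrable_on {a..b}"
proof -
  have "(\<lambda>t. of_real (p t) * h t) integrable_on {0..T}"
    using absolutely_integrable_bounded_mult[OF p h] by (rule absolutely_integrable_on_def[THEN iffD1, THEN conjunct1])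
  then show ?thesis by (rule integrable_on_subinterval) (use sub in auto)
qed

text \<open>Picard's method. The integrated equation is a fixed point equation for \<open>z t = exp (- K * t) * y t\<close>, and the
  exponential weight makes the map a contraction on the whole interval at once: each of the two integrations
  gains a factor \<open>1 / K\<close>.\<close>

lemma mode_exists:
  fixes p :: "real \<Rightarrow> real" and g :: "real \<Rightarrow> complex"
  assumes T: "T > 0" and p: "p \<in> borel_measurable (lebesgue_on {0..T})" "\<And>t. t \<in> {0..T} \<Longrightarrow> \<bar>p t\<bar> \<le> B"
    and g: "continuous_on {0..T} g"
  shows "\<exists>y y'. continuous_on {0..T} y \<and> continuous_on {0..T} y' \<and>
     (\<forall>t\<in>{0..T}. y t = y0 + integral {0..t} y') \<and>
     (\<forall>t\<in>{0..T}. y' t = y1 + integral {0..t} (\<lambda>\<sigma>. g \<sigma> - of_real (p \<sigma>) * y \<sigma>))"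
proof -
  have B: "B \<ge> 0" using p(2)[of 0] T by auto
  define K where "K = B + 1"
  have K: "K > 0" unfolding K_def using B by simp
  \<comment> \<open>\<open>Y z\<close> is the candidate for \<open>y\<close>, \<open>P z\<close> and \<open>R z\<close> are the right-hand sides of the equations for \<open>y'\<close> and \<open>y\<close>\<close>
  define Y where "Y z \<sigma> = of_real (exp (K * \<sigma>)) * apply_bcontfun z \<sigma>" for z :: "real \<Rightarrow>\<^sub>C complex" and \<sigma>
  define P where "P z r = y1 + integral {0..r} (\<lambda>\<sigma>. g \<sigma> - of_real (p \<sigma>) * Y z \<sigma>)" for z r
  define R where "R z t = y0 + integral {0..t} (P z)" for z t
  \<comment> \<open>projection to \<open>[0,T]\<close>: the complete space of bounded continuous functions lives on the whole line\<close>
  define cl where "cl \<tau> = max 0 (min \<tau> T)" for \<tau>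
  have cl: "cl \<tau> \<in> {0..T}" for \<tau> unfolding cl_def using T by auto
  have Yc: "continuous_on {0..T} (Y z)" for z unfolding Y_def by (intro continuous_intros) auto
  have int: "(\<lambda>\<sigma>. g \<sigma> - of_real (p \<sigma>) * Y z \<sigma>) integrable_on {0..r}" if "r \<in> {0..T}" for z r
  proof (rule integrable_diff)
    show "g integrable_on {0..r}"
      using that by (intro integrable_continuous_real continuous_on_subset[OF g]) auto
    show "(\<lambda>\<sigma>. of_real (p \<sigma>) * Y z \<sigma>) integrable_on {0..r}"
      using that by (intro integrable_bounded_mult[OF p Yc]) auto
  qed
  have Pc: "continuous_on {0..T} (P z)" for z
    unfolding P_def using int[of T z] T by (intro continuous_intros indefinite_integral_continuous_1) auto
  have Pint: "P z integrable_on {0..t}" if "t \<in> {0..T}" for z t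
    using that by (intro integrable_continuous_real continuous_on_subset[OF Pc]) auto
  have Rc: "continuous_on {0..T} (R z)" for z
    unfolding R_def using Pint[of T z] T by (intro continuous_intros indefinite_integral_continuous_1) auto
  define f where "f z \<tau> = of_real (exp (- K * cl \<tau>)) * R z (cl \<tau>)" for z \<tau>
  have fb: "f z \<in> bcontfun" for z
  proof -
    have clc: "continuous_on UNIV cl" unfolding cl_def by (intro continuous_intros)
    have "continuous_on UNIV (\<lambda>\<tau>. R z (cl \<tau>))"
      by (rule continuous_on_compose2[OF Rc clc]) (use cl in auto)
    then have fc: "continuous_on UNIV (f z)"
      unfolding f_def by (intro continuous_intros clc)
    have "bounded ((\<lambda>t. of_real (exp (- K * t)) * R z t) ` {0..T})"
      by (intro compact_imp_bounded compact_continuous_image continuous_intros Rc) auto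
    then obtain b where b: "\<forall>t\<in>{0..T}. cmod (of_real (exp (- K * t)) * R z t) \<le> b"
      unfolding bounded_iff by auto
    show ?thesis by (rule bcontfun_normI[OF fc, of b]) (use b cl in \<open>simp add: f_def\<close>)
  qed
  define \<Psi> where "\<Psi> z = Bcontfun (f z)" for z
  have \<Psi>: "apply_bcontfun (\<Psi> z) = f z" for z unfolding \<Psi>_def using fb by (rule Bcontfun_inverse)
  have expint: "((\<lambda>\<sigma>. exp (K * \<sigma>)) has_integral (exp (K * r) - 1) / K) {0..r}" if "r \<ge> 0" for r
  proof -
    have "((\<lambda>\<sigma>. exp (K * \<sigma>)) has_integral (exp (K * r) / K - exp (K * 0) / K)) {0..r}"
      using that K by (intro fundamental_theorem_of_calculus)
        (auto intro!: derivative_eq_intros simp: has_real_derivative_iff_has_vector_derivative[symmetric])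
    then show ?thesis by (simp add: diff_divide_distrib)
  qed
  have expint': "(\<lambda>\<sigma>. exp (K * \<sigma>)) integrable_on {0..r}" "integral {0..r} (\<lambda>\<sigma>. exp (K * \<sigma>)) \<le> exp (K * r) / K"
    if "r \<ge> 0" for r
    using expint[OF that] K by (auto simp: integral_unique divide_right_mono)
  have contr: "dist (\<Psi> z) (\<Psi> w) \<le> (1/2) * dist z w" for z w
  proof (rule dist_bound)
    fix \<tau>
    define t where "t = cl \<tau>"
    have t: "t \<in> {0..T}" unfolding t_def by (rule cl)
    let ?D = "dist z w"
    have zw: "cmod (apply_bcontfun z \<sigma> - apply_bcontfun w \<sigma>) \<le> ?D" for \<sigma>
      using dist_bounded[of z \<sigma> w] by (simp add: dist_norm)
    have Pd: "cmod (P z r - P w r) \<le> B * ?D / K * exp (K * r)" if r: "r \<in> {0..T}" for r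
    proof -
      have "P z r - P w r = integral {0..r} (\<lambda>\<sigma>. (g \<sigma> - of_real (p \<sigma>) * Y z \<sigma>) - (g \<sigma> - of_real (p \<sigma>) * Y w \<sigma>))"
        unfolding P_def integral_diff[OF int[OF r, where z = z] int[OF r, where z = w]] by simp
      also have "cmod \<dots> \<le> integral {0..r} (\<lambda>\<sigma>. B * ?D * exp (K * \<sigma>))"
      proof (rule integral_norm_bound_integral)
        show "(\<lambda>\<sigma>. (g \<sigma> - of_real (p \<sigma>) * Y z \<sigma>) - (g \<sigma> - of_real (p \<sigma>) * Y w \<sigma>)) integrable_on {0..r}"
          by (rule integrable_diff[OF int[OF r] int[OF r]])
        show "(\<lambda>\<sigma>. B * ?D * exp (K * \<sigma>)) integrable_on {0..r}"
          using expint'(1)[of r] r by (intro integrable_on_mult_right) auto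
        fix \<sigma> assume \<sigma>: "\<sigma> \<in> {0..r}"
        have "(g \<sigma> - of_real (p \<sigma>) * Y z \<sigma>) - (g \<sigma> - of_real (p \<sigma>) * Y w \<sigma>)
            = - (of_real (p \<sigma>) * of_real (exp (K * \<sigma>)) * (apply_bcontfun z \<sigma> - apply_bcontfun w \<sigma>))"
          unfolding Y_def by (simp add: algebra_simps)
        also have "cmod \<dots> = \<bar>p \<sigma>\<bar> * exp (K * \<sigma>) * cmod (apply_bcontfun z \<sigma> - apply_bcontfun w \<sigma>)"
          by (simp only: norm_minus_cancel norm_mult norm_of_real abs_exp_cancel)
        also have "\<dots> \<le> B * exp (K * \<sigma>) * ?D"
          using p(2)[of \<sigma>] \<sigma> r zw B by (intro mult_mono) auto
        finally show "cmod ((g \<sigma> - of_real (p \<sigma>) * Y z \<sigma>) - (g \<sigma> - of_real (p \<sigma>) * Y w \<sigma>)) \<le> B * ?D * exp (K * \<sigma>)"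
          by (simp add: mult_ac)
      qed
      also have "\<dots> \<le> B * ?D * (exp (K * r) / K)"
        using expint'(2)[of r] r B unfolding integral_mult_right by (intro mult_left_mono) auto
      finally show ?thesis by (simp add: mult_ac)
    qed
    have "R z t - R w t = integral {0..t} (\<lambda>r. P z r - P w r)"
      unfolding R_def integral_diff[OF Pint[OF t, where z = z] Pint[OF t, where z = w]] by simp
    also have "cmod \<dots> \<le> integral {0..t} (\<lambda>r. B * ?D / K * exp (K * r))"
    proof (rule integral_norm_bound_integral)
      show "(\<lambda>r. P z r - P w r) integrable_on {0..t}" using Pint[OF t] by (intro integrable_diff)
      show "(\<lambda>\<sigma>. B * ?D / K * exp (K * \<sigma>)) integrable_on {0..t}"
        using expint'(1)[of t] t by (intro integrable_on_mult_right) auto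
    qed (use Pd t in auto)
    also have "\<dots> \<le> B * ?D / K * (exp (K * t) / K)"
      using expint'(2)[of t] t B K unfolding integral_mult_right by (intro mult_left_mono) auto
    finally have Rd: "cmod (R z t - R w t) \<le> B * ?D / K * (exp (K * t) / K)" .
    have "dist (apply_bcontfun (\<Psi> z) \<tau>) (apply_bcontfun (\<Psi> w) \<tau>) = cmod (of_real (exp (- K * t)) * (R z t - R w t))"
      unfolding \<Psi> f_def t_def[symmetric] dist_norm by (simp add: right_diff_distrib)
    also have "\<dots> = exp (- K * t) * cmod (R z t - R w t)"
      by (simp only: norm_mult norm_of_real abs_exp_cancel)
    also have "\<dots> \<le> exp (- K * t) * (B * ?D / K * (exp (K * t) / K))"
      using Rd by (intro mult_left_mono) auto
    also have "\<dots> = (exp (- K * t) * exp (K * t)) * (B / K\<^sup>2 * ?D)" by (simp add: power2_eq_square)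
    also have "\<dots> = B / K\<^sup>2 * ?D" by (simp add: exp_minus)
    also have "\<dots> \<le> 1/2 * ?D"
    proof (rule mult_right_mono)
      have "2 * B \<le> K\<^sup>2" unfolding K_def by (simp add: power2_sum)
      then show "B / K\<^sup>2 \<le> 1/2" using K by (simp add: divide_le_eq)
    qed simp
    finally show "dist (apply_bcontfun (\<Psi> z) \<tau>) (apply_bcontfun (\<Psi> w) \<tau>) \<le> 1/2 * ?D" .
  qed
  obtain z where z: "\<Psi> z = z" using banach_fix_type[of "1/2" \<Psi>] contr by auto
  have eq: "Y z t = R z t" if t: "t \<in> {0..T}" for t
  proof -
    have "cl t = t" using t unfolding cl_def by auto
    then have "apply_bcontfun z t = of_real (exp (- K * t)) * R z t"
      using \<Psi>[of z] unfolding z f_def by simp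
    then show ?thesis unfolding Y_def
      by (simp add: exp_minus mult.assoc[symmetric] of_real_mult[symmetric] del: of_real_mult)
  qed
  show ?thesis
    by (intro exI[of _ "Y z"] exI[of _ "P z"] conjI Yc Pc ballI) (simp_all add: eq R_def P_def)
qed

lemma bounded_measurable_integrable:
  fixes q :: "real \<Rightarrow> real"
  assumes q: "q \<in> borel_measurable (lebesgue_on {0..T})" "\<And>t. t \<in> {0..T} \<Longrightarrow> \<bar>q t\<bar> \<le> M"
  shows "q integrable_on {0..T}"
  by (rule measurable_bounded_by_integrable_imp_integrable[OF q(1), where g = "\<lambda>_. M"])
    (use q(2) in auto)

text \<open>Lebesgue's differentiation theorem on the line, from its version for right-hand means applied to \<open>q\<close> and to
  the reflection of \<open>q\<close>.\<close>

lemma bounded_measurable_differentiation: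
  fixes q :: "real \<Rightarrow> real"
  assumes q: "q \<in> borel_measurable (lebesgue_on {0..T})" "\<And>t. t \<in> {0..T} \<Longrightarrow> \<bar>q t\<bar> \<le> M"
  shows "\<exists>N. negligible N \<and> (\<forall>t\<in>{0..T} - N.
     ((\<lambda>t. integral {0..t} q) has_real_derivative q t) (at t within {0..T}))"
proof -
  define f where "f x = (if x \<in> {0..T} then q x else 0)" for x
  have qint: "q integrable_on {a..b}" if "0 \<le> a" "b \<le> T" for a b
    by (rule integrable_on_subinterval[OF bounded_measurable_integrable[OF q]]) (use that in auto)
  have fU: "f integrable_on UNIV"
    unfolding f_def[abs_def] integrable_restrict_UNIV by (rule bounded_measurable_integrable[OF q])
  then have fint: "f integrable_on cbox a b" for a b by (rule integrable_on_subcbox) simp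
  have fint': "(\<lambda>x. f (- x)) integrable_on cbox a b" for a b
    using fint[of "-b" "-a"] Henstock_Kurzweil_Integration.integrable_reflect_real[where f = f and a = "-b" and b = "-a"] by simp
  obtain N1 where N1: "negligible N1" "\<And>x e. \<lbrakk>x \<notin> N1; 0 < e\<rbrakk> \<Longrightarrow>
      \<exists>d>0. \<forall>h. 0 < h \<and> h < d \<longrightarrow> norm (integral (cbox x (x + h *\<^sub>R One)) f /\<^sub>R h ^ DIM(real) - f x) < e"
    using integrable_ccontinuous_explicit[OF fint] by metis
  obtain N2 where N2: "negligible N2" "\<And>x e. \<lbrakk>x \<notin> N2; 0 < e\<rbrakk> \<Longrightarrow>
      \<exists>d>0. \<forall>h. 0 < h \<and> h < d \<longrightarrow> norm (integral (cbox x (x + h *\<^sub>R One)) (\<lambda>x. f (- x)) /\<^sub>R h ^ DIM(real) - f (- x)) < e"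
    using integrable_ccontinuous_explicit[OF fint'] by metis
  have "negligible (uminus ` N2)"
    using N2(1)
    by (intro negligible_differentiable_image_negligible bounded_linear_imp_differentiable_on
        bounded_linear_minus bounded_linear_ident) auto
  then have N: "negligible (N1 \<union> uminus ` N2)" using N1(1) by simp
  have "((\<lambda>t. integral {0..t} q) has_real_derivative q t) (at t within {0..T})" if t: "t \<in> {0..T} - (N1 \<union> uminus ` N2)" for t
    unfolding has_field_derivative_iff
  proof (rule tendstoI)
    fix e :: real assume e: "e > 0"
    have tT: "t \<in> {0..T}" and "t \<notin> N1" "- t \<notin> N2" using t by force+
    obtain d1 where d1: "d1 > 0" "\<forall>h. 0 < h \<and> h < d1 \<longrightarrow> norm (integral (cbox t (t + h *\<^sub>R One)) f /\<^sub>R h ^ DIM(real) - f t) < e"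
      using N1(2)[OF \<open>t \<notin> N1\<close> e] by blast
    obtain d2 where d2: "d2 > 0" "\<forall>h. 0 < h \<and> h < d2 \<longrightarrow> norm (integral (cbox (-t) (-t + h *\<^sub>R One)) (\<lambda>x. f (- x)) /\<^sub>R h ^ DIM(real) - f (- (- t))) < e"
      using N2(2)[OF \<open>- t \<notin> N2\<close> e] by blast
    have ft: "f t = q t" unfolding f_def using tT by simp
    have fq: "integral {a..b} f = integral {a..b} q" if "0 \<le> a" "b \<le> T" for a b
      using that by (intro integral_cong) (auto simp: f_def)
    have main: "dist ((integral {0..s} q - integral {0..t} q) / (s - t)) (q t) < e"
      if s: "s \<in> {0..T}" "s \<noteq> t" "\<bar>s - t\<bar> < min d1 d2" for s
    proof (cases "s > t")
      case True
      have "integral {0..t} q + integral {t..s} q = integral {0..s} q"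
        using True tT s by (intro Henstock_Kurzweil_Integration.integral_combine qint) auto
      then have eq: "(integral {0..s} q - integral {0..t} q) / (s - t) = integral {t..s} f / (s - t)"
        using fq[of t s] tT s by auto
      have "norm (integral (cbox t (t + (s - t) *\<^sub>R One)) f /\<^sub>R (s - t) ^ DIM(real) - f t) < e"
        by (rule d1(2)[rule_format]) (use True s in auto)
      then show ?thesis unfolding eq dist_norm ft by (simp add: divide_inverse mult.commute)
    next
      case False
      then have less: "s < t" using s by simp
      have "integral {0..s} q + integral {s..t} q = integral {0..t} q"
        using less tT s by (intro Henstock_Kurzweil_Integration.integral_combine qint) auto
      then have "integral {0..s} q - integral {0..t} q = - integral {s..t} f"
        using fq[of s t] tT s by auto
      then have eq: "(integral {0..s} q - integral {0..t} q) / (s - t) = integral {s..t} f / (t - s)"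
        by (metis minus_diff_eq minus_divide_left minus_divide_right minus_minus)
      have "norm (integral (cbox (-t) (-t + (t - s) *\<^sub>R One)) (\<lambda>x. f (- x)) /\<^sub>R (t - s) ^ DIM(real) - f (- (- t))) < e"
        by (rule d2(2)[rule_format]) (use less s in auto)
      moreover have "integral (cbox (-t) (-t + (t - s) *\<^sub>R One)) (\<lambda>x. f (- x)) = integral {s..t} f"
        using integral_reflect_real[where f = f and a = s and b = t] by simp
      ultimately show ?thesis unfolding eq dist_norm using ft by (simp add: divide_inverse mult.commute)
    qed
    show "\<forall>\<^sub>F s in at t within {0..T}. dist ((integral {0..s} q - integral {0..t} q) / (s - t)) (q t) < e"
      unfolding eventually_at using main d1(1) d2(1)
      by (intro exI[of _ "min d1 d2"]) (auto simp: dist_real_def)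
  qed
  then show ?thesis using N by (intro exI[of _ "N1 \<union> uminus ` N2"]) simp
qed

section \<open>Weighted square sums and difference quotients\<close>

text \<open>A bound for the square of a weighted \<open>l\<^sup>2\<close> norm; since only finite sums occur, it includes summability.\<close>

definition l2_bounded :: "'i set \<Rightarrow> ('i \<Rightarrow> real) \<Rightarrow> real \<Rightarrow> ('i \<Rightarrow> complex) \<Rightarrow> bool" where
  "l2_bounded I w B g \<longleftrightarrow> (\<forall>F. finite F \<longrightarrow> F \<subseteq> I \<longrightarrow> (\<Sum>\<xi>\<in>F. w \<xi> * (cmod (g \<xi>))\<^sup>2) \<le> B)"

definition l2_tendsto ::
    "'i set \<Rightarrow> ('i \<Rightarrow> real) \<Rightarrow> ('a \<Rightarrow> 'i \<Rightarrow> complex) \<Rightarrow> ('i \<Rightarrow> complex) \<Rightarrow> 'a filter \<Rightarrow> bool" where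
  "l2_tendsto I w Y L F \<longleftrightarrow> (\<forall>\<epsilon>>0. \<forall>\<^sub>F r in F. l2_bounded I w \<epsilon> (\<lambda>\<xi>. Y r \<xi> - L \<xi>))"

lemma l2_bounded_mono: "l2_bounded I w B g \<Longrightarrow> B \<le> C \<Longrightarrow> l2_bounded I w C g"
  unfolding l2_bounded_def by force

lemma l2_bounded_nonneg: "l2_bounded I w B g \<Longrightarrow> 0 \<le> B"
  unfolding l2_bounded_def by (drule spec[of _ "{}"]) simp

lemma l2_bounded_lincomb:
  assumes w: "\<And>\<xi>. \<xi> \<in> I \<Longrightarrow> w \<xi> \<ge> 0" and f: "l2_bounded I w B f" and g: "l2_bounded I w C g"
  shows "l2_bounded I w (2 * (cmod \<alpha>)\<^sup>2 * B + 2 * (cmod \<beta>)\<^sup>2 * C) (\<lambda>\<xi>. \<alpha> * f \<xi> + \<beta> * g \<xi>)"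
  unfolding l2_bounded_def
proof (intro allI impI)
  fix F assume F: "finite F" "F \<subseteq> I"
  have "(\<Sum>\<xi>\<in>F. w \<xi> * (cmod (\<alpha> * f \<xi> + \<beta> * g \<xi>))\<^sup>2)
      \<le> (\<Sum>\<xi>\<in>F. 2 * (cmod \<alpha>)\<^sup>2 * (w \<xi> * (cmod (f \<xi>))\<^sup>2) + 2 * (cmod \<beta>)\<^sup>2 * (w \<xi> * (cmod (g \<xi>))\<^sup>2))"
  proof (rule sum_mono)
    fix \<xi> assume "\<xi> \<in> F"
    then have "w \<xi> \<ge> 0" using w F by auto
    from mult_left_mono[OF norm_lincomb_square_le this, of \<alpha> "f \<xi>" \<beta> "g \<xi>"]
    show "w \<xi> * (cmod (\<alpha> * f \<xi> + \<beta> * g \<xi>))\<^sup>2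
      \<le> 2 * (cmod \<alpha>)\<^sup>2 * (w \<xi> * (cmod (f \<xi>))\<^sup>2) + 2 * (cmod \<beta>)\<^sup>2 * (w \<xi> * (cmod (g \<xi>))\<^sup>2)"
      by (simp only: distrib_left mult_ac)
  qed
  also have "\<dots> = 2 * (cmod \<alpha>)\<^sup>2 * (\<Sum>\<xi>\<in>F. w \<xi> * (cmod (f \<xi>))\<^sup>2) + 2 * (cmod \<beta>)\<^sup>2 * (\<Sum>\<xi>\<in>F. w \<xi> * (cmod (g \<xi>))\<^sup>2)"
    by (simp add: sum.distrib sum_distrib_left)
  also have "\<dots> \<le> 2 * (cmod \<alpha>)\<^sup>2 * B + 2 * (cmod \<beta>)\<^sup>2 * C"
    using f g F unfolding l2_bounded_def by (intro add_mono mult_left_mono) auto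
  finally show "(\<Sum>\<xi>\<in>F. w \<xi> * (cmod (\<alpha> * f \<xi> + \<beta> * g \<xi>))\<^sup>2) \<le> 2 * (cmod \<alpha>)\<^sup>2 * B + 2 * (cmod \<beta>)\<^sup>2 * C" .
qed

lemma l2_bounded_cong: "(\<And>\<xi>. \<xi> \<in> I \<Longrightarrow> f \<xi> = g \<xi>) \<Longrightarrow> l2_bounded I w B f = l2_bounded I w B g"
  unfolding l2_bounded_def by (intro all_cong imp_cong refl arg_cong2[where f = "(\<le>)"] sum.cong) (auto dest: subsetD)

lemma l2_bounded_add:
  assumes "\<And>\<xi>. \<xi> \<in> I \<Longrightarrow> w \<xi> \<ge> 0" "l2_bounded I w B f" "l2_bounded I w C g"
  shows "l2_bounded I w (2 * B + 2 * C) (\<lambda>\<xi>. f \<xi> + g \<xi>)"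
  using l2_bounded_lincomb[OF assms, of 1 1] by simp

lemma l2_bounded_cmult:
  assumes g: "l2_bounded I w B g"
  shows "l2_bounded I w ((cmod k)\<^sup>2 * B) (\<lambda>\<xi>. k * g \<xi>)"
  unfolding l2_bounded_def
proof (intro allI impI)
  fix F assume F: "finite F" "F \<subseteq> I"
  have "(\<Sum>\<xi>\<in>F. w \<xi> * (cmod (k * g \<xi>))\<^sup>2) = (cmod k)\<^sup>2 * (\<Sum>\<xi>\<in>F. w \<xi> * (cmod (g \<xi>))\<^sup>2)"
    by (simp add: norm_mult power_mult_distrib sum_distrib_left mult_ac)
  also have "\<dots> \<le> (cmod k)\<^sup>2 * B" using g F unfolding l2_bounded_def by (intro mult_left_mono) auto
  finally show "(\<Sum>\<xi>\<in>F. w \<xi> * (cmod (k * g \<xi>))\<^sup>2) \<le> (cmod k)\<^sup>2 * B" .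
qed

lemma l2_bounded_if_dominated:
  assumes "\<And>\<xi>. \<xi> \<in> I \<Longrightarrow> w \<xi> * (cmod (g \<xi>))\<^sup>2 \<le> D \<xi>" and D: "D summable_on I" "\<And>\<xi>. \<xi> \<in> I \<Longrightarrow> D \<xi> \<ge> 0"
  shows "l2_bounded I w (infsum D I) g"
  unfolding l2_bounded_def
proof (intro allI impI)
  fix F assume F: "finite F" "F \<subseteq> I"
  have "(\<Sum>\<xi>\<in>F. w \<xi> * (cmod (g \<xi>))\<^sup>2) \<le> sum D F" using assms(1) F by (intro sum_mono) auto
  also have "\<dots> \<le> infsum D I" using F D by (intro finite_sum_le_infsum) auto
  finally show "(\<Sum>\<xi>\<in>F. w \<xi> * (cmod (g \<xi>))\<^sup>2) \<le> infsum D I" .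
qed

lemma l2_tendsto_add:
  assumes w: "\<And>\<xi>. \<xi> \<in> I \<Longrightarrow> w \<xi> \<ge> 0" and f: "l2_tendsto I w f f0 F" and g: "l2_tendsto I w g g0 F"
  shows "l2_tendsto I w (\<lambda>r \<xi>. f r \<xi> + g r \<xi>) (\<lambda>\<xi>. f0 \<xi> + g0 \<xi>) F"
  unfolding l2_tendsto_def
proof (intro allI impI)
  fix \<epsilon> :: real assume \<epsilon>: "\<epsilon> > 0"
  have "\<forall>\<^sub>F r in F. l2_bounded I w (\<epsilon> / 4) (\<lambda>\<xi>. f r \<xi> - f0 \<xi>)" "\<forall>\<^sub>F r in F. l2_bounded I w (\<epsilon> / 4) (\<lambda>\<xi>. g r \<xi> - g0 \<xi>)"
    using f g \<epsilon> unfolding l2_tendsto_def by simp_all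
  then show "\<forall>\<^sub>F r in F. l2_bounded I w \<epsilon> (\<lambda>\<xi>. (f r \<xi> + g r \<xi>) - (f0 \<xi> + g0 \<xi>))"
  proof eventually_elim
    case (elim r)
    from l2_bounded_add[OF w elim] show ?case by (simp add: algebra_simps)
  qed
qed

lemma l2_tendsto_scale:
  fixes k :: "'a \<Rightarrow> complex"
  assumes w: "\<And>\<xi>. \<xi> \<in> I \<Longrightarrow> w \<xi> \<ge> 0" and k: "(k \<longlongrightarrow> k0) F" and Y: "l2_tendsto I w Y L F" and L: "l2_bounded I w B L"
  shows "l2_tendsto I w (\<lambda>r \<xi>. k r * Y r \<xi>) (\<lambda>\<xi>. k0 * L \<xi>) F"
  unfolding l2_tendsto_def
proof (intro allI impI)
  fix \<epsilon> :: real assume \<epsilon>: "\<epsilon> > 0"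
  have B: "B \<ge> 0" using l2_bounded_nonneg[OF L] .
  define K where "K = cmod k0 + 1"
  have K: "K > 0" unfolding K_def by (simp add: add_nonneg_pos)
  have 1: "\<forall>\<^sub>F r in F. l2_bounded I w (\<epsilon> / (4 * K\<^sup>2)) (\<lambda>\<xi>. Y r \<xi> - L \<xi>)"
    using Y \<epsilon> K unfolding l2_tendsto_def by simp
  have 2: "\<forall>\<^sub>F r in F. cmod (k r) < K"
    using tendsto_norm[OF k] by (rule order_tendstoD) (simp add: K_def)
  have "((\<lambda>r. (cmod (k r - k0))\<^sup>2 * B) \<longlongrightarrow> (cmod (k0 - k0))\<^sup>2 * B) F" by (intro tendsto_intros k)
  then have 3: "\<forall>\<^sub>F r in F. (cmod (k r - k0))\<^sup>2 * B < \<epsilon> / 4" by (rule order_tendstoD) (use \<epsilon> in simp)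
  show "\<forall>\<^sub>F r in F. l2_bounded I w \<epsilon> (\<lambda>\<xi>. k r * Y r \<xi> - k0 * L \<xi>)"
    using 1 2 3
  proof eventually_elim
    case (elim r)
    have sq: "l2_bounded I w (2 * ((cmod (k r))\<^sup>2 * (\<epsilon> / (4 * K\<^sup>2))) + 2 * ((cmod (k r - k0))\<^sup>2 * B))
        (\<lambda>\<xi>. k r * (Y r \<xi> - L \<xi>) + (k r - k0) * L \<xi>)"
      by (intro l2_bounded_add w l2_bounded_cmult elim(1) L)
    have "(cmod (k r))\<^sup>2 * (\<epsilon> / (4 * K\<^sup>2)) \<le> K\<^sup>2 * (\<epsilon> / (4 * K\<^sup>2))"
      using elim(2) \<epsilon> by (intro mult_right_mono power_mono) auto
    moreover have "K\<^sup>2 * (\<epsilon> / (4 * K\<^sup>2)) = \<epsilon> / 4" using K by simp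
    ultimately have "2 * ((cmod (k r))\<^sup>2 * (\<epsilon> / (4 * K\<^sup>2))) + 2 * ((cmod (k r - k0))\<^sup>2 * B) \<le> \<epsilon>"
      using elim(3) by linarith
    with sq have "l2_bounded I w \<epsilon> (\<lambda>\<xi>. k r * (Y r \<xi> - L \<xi>) + (k r - k0) * L \<xi>)" by (rule l2_bounded_mono)
    then show ?case by (simp add: algebra_simps)
  qed
qed

text \<open>The tail of the summable majorant \<open>D\<close> controls all indices outside a finite set, uniformly in \<open>r\<close>.\<close>

lemma l2_tendsto_dominated:
  assumes w: "\<And>\<xi>. \<xi> \<in> I \<Longrightarrow> w \<xi> \<ge> 0" and D: "D summable_on I"
    and lim: "\<And>\<xi>. \<xi> \<in> I \<Longrightarrow> ((\<lambda>r. Y r \<xi>) \<longlongrightarrow> L \<xi>) F"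
    and Y: "\<forall>\<^sub>F r in F. \<forall>\<xi>\<in>I. w \<xi> * (cmod (Y r \<xi>))\<^sup>2 \<le> D \<xi>"
    and L: "\<And>\<xi>. \<xi> \<in> I \<Longrightarrow> w \<xi> * (cmod (L \<xi>))\<^sup>2 \<le> D \<xi>"
  shows "l2_tendsto I w Y L F"
  unfolding l2_tendsto_def
proof (intro allI impI)
  fix \<epsilon> :: real assume \<epsilon>: "\<epsilon> > 0"
  have "\<exists>G. finite G \<and> G \<subseteq> I \<and> (\<forall>H. finite H \<longrightarrow> H \<subseteq> I - G \<longrightarrow> sum D H \<le> \<epsilon> / 8)"
    using D \<epsilon> by (intro summable_on_tail) auto
  then obtain G where G: "finite G" "G \<subseteq> I" "\<forall>H. finite H \<longrightarrow> H \<subseteq> I - G \<longrightarrow> sum D H \<le> \<epsilon> / 8" by blast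
  have "((\<lambda>r. \<Sum>\<xi>\<in>G. w \<xi> * (cmod (Y r \<xi> - L \<xi>))\<^sup>2) \<longlongrightarrow> (\<Sum>\<xi>\<in>G. w \<xi> * (cmod (L \<xi> - L \<xi>))\<^sup>2)) F"
    using G(2) by (intro tendsto_intros lim) auto
  then have "\<forall>\<^sub>F r in F. (\<Sum>\<xi>\<in>G. w \<xi> * (cmod (Y r \<xi> - L \<xi>))\<^sup>2) < \<epsilon> / 2"
    by (rule order_tendstoD) (use \<epsilon> in simp)
  with Y show "\<forall>\<^sub>F r in F. l2_bounded I w \<epsilon> (\<lambda>\<xi>. Y r \<xi> - L \<xi>)"
  proof eventually_elim
    case (elim r)
    show ?case
      unfolding l2_bounded_def
    proof (intro allI impI)
      fix H assume H: "finite H" "H \<subseteq> I"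
      let ?s = "\<lambda>\<xi>. w \<xi> * (cmod (Y r \<xi> - L \<xi>))\<^sup>2"
      have s0: "?s \<xi> \<ge> 0" if "\<xi> \<in> I" for \<xi> using w[OF that] by simp
      have "sum ?s H = sum ?s (H \<inter> G) + sum ?s (H - G)" using H by (subst sum.Int_Diff[of H _ G]) auto
      also have "sum ?s (H \<inter> G) \<le> sum ?s G" using G H s0 by (intro sum_mono2) auto
      also have "sum ?s (H - G) \<le> (\<Sum>\<xi>\<in>H - G. 4 * D \<xi>)"
      proof (rule sum_mono)
        fix \<xi> assume "\<xi> \<in> H - G"
        then have \<xi>: "\<xi> \<in> I" using H by auto
        have "?s \<xi> \<le> w \<xi> * (2 * (cmod (Y r \<xi>))\<^sup>2 + 2 * (cmod (L \<xi>))\<^sup>2)"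
          using norm_lincomb_square_le[of 1 "Y r \<xi>" "-1" "L \<xi>"] w[OF \<xi>] by (intro mult_left_mono) auto
        also have "\<dots> = 2 * (w \<xi> * (cmod (Y r \<xi>))\<^sup>2) + 2 * (w \<xi> * (cmod (L \<xi>))\<^sup>2)" by (simp add: distrib_left)
        also have "\<dots> \<le> 4 * D \<xi>" using elim(1) L[OF \<xi>] \<xi> by force
        finally show "?s \<xi> \<le> 4 * D \<xi>" .
      qed
      also have "\<dots> = 4 * sum D (H - G)" by (simp add: sum_distrib_left)
      also have "\<dots> \<le> \<epsilon> / 2"
      proof -
        have "sum D (H - G) \<le> \<epsilon> / 8" using H by (intro G(3)[rule_format]) auto
        then show ?thesis by simp
      qed
      finally show "sum ?s H \<le> \<epsilon>" using elim(2) by linarith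
    qed
  qed
qed

text \<open>Jensen's inequality: integrate \<open>|g - c|\<^sup>2 \<ge> 0\<close>, where \<open>c\<close> is the mean of \<open>g\<close>.\<close>

lemma mean_square_le:
  fixes g :: "real \<Rightarrow> complex" and k :: "real \<Rightarrow> real"
  assumes ab: "a < b" and g: "g integrable_on {a..b}" and k: "k integrable_on {a..b}"
    and le: "\<And>t. t \<in> {a..b} \<Longrightarrow> (cmod (g t))\<^sup>2 \<le> k t"
  shows "(cmod (integral {a..b} g / of_real (b - a)))\<^sup>2 \<le> integral {a..b} k / (b - a)"
proof -
  let ?h = "b - a"
  define c where "c = integral {a..b} g / of_real ?h"
  have gc: "integral {a..b} g = ?h *\<^sub>R c" unfolding c_def using ab by (simp add: scaleR_conv_of_real)
  have "((\<lambda>t. g t \<bullet> c) has_integral (integral {a..b} g \<bullet> c)) {a..b}"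
    using has_integral_linear[OF integrable_integral[OF g] bounded_linear_inner_left[of c]] by (simp add: o_def)
  then have 1: "((\<lambda>t. g t \<bullet> c) has_integral ?h * (cmod c)\<^sup>2) {a..b}"
    unfolding gc by (simp add: power2_norm_eq_inner)
  have "((\<lambda>t. 2 * (g t \<bullet> c) - (cmod c)\<^sup>2) has_integral (2 * (?h * (cmod c)\<^sup>2) - ?h * (cmod c)\<^sup>2)) {a..b}"
    using ab has_integral_const_real[of "(cmod c)\<^sup>2" a b]
    by (intro has_integral_diff has_integral_mult_right 1) auto
  then have "2 * (?h * (cmod c)\<^sup>2) - ?h * (cmod c)\<^sup>2 \<le> integral {a..b} k"
  proof (rule has_integral_le)
    show "(k has_integral integral {a..b} k) {a..b}" using k by (rule integrable_integral)
    fix t assume "t \<in> {a..b}"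
    have "0 \<le> (cmod (g t - c))\<^sup>2" by simp
    also have "(cmod (g t - c))\<^sup>2 = (cmod (g t))\<^sup>2 - 2 * (g t \<bullet> c) + (cmod c)\<^sup>2"
      by (simp add: power2_norm_eq_inner inner_diff_left inner_diff_right inner_commute)
    finally show "2 * (g t \<bullet> c) - (cmod c)\<^sup>2 \<le> k t" using le[OF \<open>t \<in> {a..b}\<close>] by linarith
  qed
  then have "(cmod c)\<^sup>2 \<le> integral {a..b} k / ?h" using ab by (simp add: field_simps)
  then show ?thesis unfolding c_def .
qed

lemma l2_bounded_mean:
  fixes Z :: "real \<Rightarrow> 'i \<Rightarrow> complex" and q :: "real \<Rightarrow> real"
  assumes w: "\<And>\<xi>. \<xi> \<in> I \<Longrightarrow> w \<xi> \<ge> 0" and ab: "a < b"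
    and Z: "\<And>\<xi>. \<xi> \<in> I \<Longrightarrow> continuous_on {a..b} (\<lambda>t. Z t \<xi>)"
    and q: "\<And>t. t \<in> {a..b} \<Longrightarrow> \<bar>q t\<bar> \<le> M"
    and int: "\<And>\<xi>. \<xi> \<in> I \<Longrightarrow> (\<lambda>t. of_real (q t) * Z t \<xi>) integrable_on {a..b}"
    and sq: "\<And>t. t \<in> {a..b} \<Longrightarrow> l2_bounded I w \<epsilon> (Z t)"
  shows "l2_bounded I w (M\<^sup>2 * \<epsilon>) (\<lambda>\<xi>. integral {a..b} (\<lambda>t. of_real (q t) * Z t \<xi>) / of_real (b - a))"
  unfolding l2_bounded_def
proof (intro allI impI)
  fix F assume F: "finite F" "F \<subseteq> I"
  let ?k = "\<lambda>\<xi> t. M\<^sup>2 * (cmod (Z t \<xi>))\<^sup>2"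
  have kint: "?k \<xi> integrable_on {a..b}" if "\<xi> \<in> I" for \<xi>
    by (intro integrable_continuous_real continuous_intros Z that)
  have "(\<Sum>\<xi>\<in>F. w \<xi> * (cmod (integral {a..b} (\<lambda>t. of_real (q t) * Z t \<xi>) / of_real (b - a)))\<^sup>2)
      \<le> (\<Sum>\<xi>\<in>F. w \<xi> * (integral {a..b} (?k \<xi>) / (b - a)))"
  proof (intro sum_mono mult_left_mono mean_square_le ab kint int)
    fix \<xi> t assume "\<xi> \<in> F" and t: "t \<in> {a..b}"
    show "(cmod (of_real (q t) * Z t \<xi>))\<^sup>2 \<le> M\<^sup>2 * (cmod (Z t \<xi>))\<^sup>2"
    proof -
      have "(q t)\<^sup>2 \<le> M\<^sup>2" using q[OF t] by (simp add: abs_le_square_iff[symmetric])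
      then show ?thesis by (simp add: norm_mult power_mult_distrib mult_right_mono)
    qed
  qed (use F w in auto)
  also have "\<dots> = integral {a..b} (\<lambda>t. \<Sum>\<xi>\<in>F. w \<xi> * ?k \<xi> t) / (b - a)"
  proof -
    have "integral {a..b} (\<lambda>t. \<Sum>\<xi>\<in>F. w \<xi> * ?k \<xi> t) = (\<Sum>\<xi>\<in>F. integral {a..b} (\<lambda>t. w \<xi> * ?k \<xi> t))"
      using F by (intro integral_sum integrable_on_mult_right[OF kint]) auto
    also have "\<dots> = (\<Sum>\<xi>\<in>F. w \<xi> * integral {a..b} (?k \<xi>))" by (simp only: integral_mult_right)
    finally show ?thesis by (simp add: sum_divide_distrib)
  qed
  also have "\<dots> \<le> integral {a..b} (\<lambda>t. M\<^sup>2 * \<epsilon>) / (b - a)"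
  proof (intro divide_right_mono integral_le)
    show "(\<lambda>t. \<Sum>\<xi>\<in>F. w \<xi> * ?k \<xi> t) integrable_on {a..b}"
      using F by (intro integrable_sum integrable_on_mult_right[OF kint]) auto
    fix t assume t: "t \<in> {a..b}"
    have "(\<Sum>\<xi>\<in>F. w \<xi> * ?k \<xi> t) = M\<^sup>2 * (\<Sum>\<xi>\<in>F. w \<xi> * (cmod (Z t \<xi>))\<^sup>2)"
      by (simp add: sum_distrib_left mult_ac)
    also have "\<dots> \<le> M\<^sup>2 * \<epsilon>" using sq[OF t] F unfolding l2_bounded_def by (intro mult_left_mono) auto
    finally show "(\<Sum>\<xi>\<in>F. w \<xi> * ?k \<xi> t) \<le> M\<^sup>2 * \<epsilon>" .
  qed (use ab in auto)
  also have "\<dots> = M\<^sup>2 * \<epsilon>" using ab by simp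
  finally show "(\<Sum>\<xi>\<in>F. w \<xi> * (cmod (integral {a..b} (\<lambda>t. of_real (q t) * Z t \<xi>) / of_real (b - a)))\<^sup>2) \<le> M\<^sup>2 * \<epsilon>" .
qed

lemma increment_quotient:
  fixes f :: "real \<Rightarrow> complex"
  assumes rt: "r \<in> {0..T}" "t \<in> {0..T}" "r \<noteq> t"
    and f: "\<And>a b. 0 \<le> a \<Longrightarrow> b \<le> T \<Longrightarrow> f integrable_on {a..b}"
  shows "(integral {0..r} f - integral {0..t} f) / of_real (r - t)
    = integral {min r t..max r t} f / of_real (max r t - min r t)"
proof -
  define a b where "a = min r t" and "b = max r t"
  have ab: "a < b" "0 \<le> a" "b \<le> T" using rt unfolding a_def b_def by auto
  have "integral {0..a} f + integral {a..b} f = integral {0..b} f"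
    using ab by (intro Henstock_Kurzweil_Integration.integral_combine f) auto
  then have "integral {a..b} f = integral {0..b} f - integral {0..a} f"
    by (metis add_diff_cancel_left')
  moreover have "x / of_real (r - t) = - x / of_real (t - r)" for x :: complex
    by (metis minus_diff_eq minus_divide_right minus_divide_left of_real_minus minus_minus)
  then have "(integral {0..r} f - integral {0..t} f) / of_real (r - t)
      = (integral {0..t} f - integral {0..r} f) / of_real (t - r)"
    by (metis minus_diff_eq)
  ultimately show ?thesis
    unfolding a_def b_def by (cases "r < t") (auto simp: min_def max_def)
qed

text \<open>The difference quotient is the mean of \<open>q * (Z - Z t)\<close> plus the mean of \<open>q\<close> times \<open>Z t\<close>. The first is small
  in norm since \<open>Z\<close> is continuous in norm, the second converges since \<open>t\<close> is a point of differentiability of the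
  integral of \<open>q\<close>. Thus the exceptional times depend on \<open>q\<close> only and are the same for all indices.\<close>

lemma l2_tendsto_diff_quotient_integral:
  fixes Z :: "real \<Rightarrow> 'i \<Rightarrow> complex" and q :: "real \<Rightarrow> real"
  assumes w: "\<And>\<xi>. \<xi> \<in> I \<Longrightarrow> w \<xi> \<ge> 0"
    and Z: "\<And>\<xi>. \<xi> \<in> I \<Longrightarrow> continuous_on {0..T} (\<lambda>t. Z t \<xi>)"
    and q: "q \<in> borel_measurable (lebesgue_on {0..T})" "\<And>t. t \<in> {0..T} \<Longrightarrow> \<bar>q t\<bar> \<le> M"
    and t: "t \<in> {0..T}"
    and Q: "((\<lambda>t. integral {0..t} q) has_real_derivative q t) (at t within {0..T})"
    and lim: "l2_tendsto I w Z (Z t) (at t within {0..T})" and B: "l2_bounded I w B (Z t)"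
  shows "l2_tendsto I w (\<lambda>r \<xi>. (integral {0..r} (\<lambda>\<sigma>. of_real (q \<sigma>) * Z \<sigma> \<xi>) - integral {0..t} (\<lambda>\<sigma>. of_real (q \<sigma>) * Z \<sigma> \<xi>)) / of_real (r - t))
           (\<lambda>\<xi>. of_real (q t) * Z t \<xi>) (at t within {0..T})"
  unfolding l2_tendsto_def
proof (intro allI impI)
  fix \<epsilon> :: real assume \<epsilon>: "\<epsilon> > 0"
  have B0: "B \<ge> 0" using l2_bounded_nonneg[OF B] .
  define \<delta> where "\<delta> = \<epsilon> / (4 * (M\<^sup>2 + 1))"
  have M1: "M\<^sup>2 + 1 > 0" by (simp add: add_nonneg_pos)
  have \<delta>: "\<delta> > 0" unfolding \<delta>_def using \<epsilon> M1 by simp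
  have M\<delta>: "M\<^sup>2 * \<delta> \<le> \<epsilon> / 4"
  proof -
    have "M\<^sup>2 * \<delta> \<le> (M\<^sup>2 + 1) * \<delta>" using \<delta> by simp
    also have "\<dots> = \<epsilon> / 4"
    proof -
      have "c * (\<epsilon> / (4 * c)) = \<epsilon> / 4" if "c > 0" for c using that by simp
      from this[OF M1] show ?thesis unfolding \<delta>_def .
    qed
    finally show ?thesis .
  qed
  obtain d1 where d1: "d1 > 0" "\<forall>s\<in>{0..T}. s \<noteq> t \<and> dist s t < d1 \<longrightarrow> l2_bounded I w \<delta> (\<lambda>\<xi>. Z s \<xi> - Z t \<xi>)"
    using lim \<delta> unfolding l2_tendsto_def eventually_at by blast
  have near: "l2_bounded I w \<delta> (\<lambda>\<xi>. Z s \<xi> - Z t \<xi>)" if "s \<in> {0..T}" "dist s t < d1" for s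
  proof (cases "s = t")
    case True
    then show ?thesis using \<delta> by (simp add: l2_bounded_def)
  qed (use d1 that in blast)
  let ?qd = "\<lambda>r. (integral {0..r} q - integral {0..t} q) / (r - t)"
  have "(?qd \<longlongrightarrow> q t) (at t within {0..T})" using Q unfolding has_field_derivative_iff .
  then have "((\<lambda>r. (?qd r - q t)\<^sup>2 * B) \<longlongrightarrow> (q t - q t)\<^sup>2 * B) (at t within {0..T})" by (intro tendsto_intros)
  then have ev2: "\<forall>\<^sub>F r in at t within {0..T}. (?qd r - q t)\<^sup>2 * B < \<epsilon> / 4"
    by (rule order_tendstoD) (use \<epsilon> in simp)
  have ev1: "\<forall>\<^sub>F r in at t within {0..T}. r \<in> {0..T} \<and> r \<noteq> t \<and> dist r t < d1"
    unfolding eventually_at using d1(1) by blast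
  have qint: "q integrable_on {a..b}" if "0 \<le> a" "b \<le> T" for a b
    by (rule integrable_on_subinterval[OF bounded_measurable_integrable[OF q]]) (use that in auto)
  have qZ: "(\<lambda>\<sigma>. of_real (q \<sigma>) * h \<sigma>) integrable_on {a..b}" if "continuous_on {0..T} h" "0 \<le> a" "b \<le> T" for a b and h :: "real \<Rightarrow> complex"
    using integrable_bounded_mult[OF q that] .
  show "\<forall>\<^sub>F r in at t within {0..T}. l2_bounded I w \<epsilon> (\<lambda>\<xi>.
      (integral {0..r} (\<lambda>\<sigma>. of_real (q \<sigma>) * Z \<sigma> \<xi>) - integral {0..t} (\<lambda>\<sigma>. of_real (q \<sigma>) * Z \<sigma> \<xi>)) / of_real (r - t)
        - of_real (q t) * Z t \<xi>)"
    using ev1 ev2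
  proof eventually_elim
    case (elim r)
    define a b where "a = min r t" and "b = max r t"
    have ab: "a < b" "0 \<le> a" "b \<le> T" using elim(1) t unfolding a_def b_def by auto
    note inc = increment_quotient[of r T t, folded a_def b_def]
    have incq: "of_real (?qd r) = integral {a..b} (\<lambda>\<sigma>. of_real (q \<sigma>)) / complex_of_real (b - a)"
    proof -
      have cq: "integral {c..d} (\<lambda>\<sigma>. of_real (q \<sigma>) :: complex) = of_real (integral {c..d} q)" if "0 \<le> c" "d \<le> T" for c d
        using integral_linear[OF qint[OF that] bounded_linear_of_real] by (simp add: o_def)
      have "(integral {0..r} (\<lambda>\<sigma>. of_real (q \<sigma>)) - integral {0..t} (\<lambda>\<sigma>. of_real (q \<sigma>))) / complex_of_real (r - t)
         = integral {a..b} (\<lambda>\<sigma>. of_real (q \<sigma>)) / complex_of_real (b - a)"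
        by (rule inc) (use elim(1) t qZ[of "\<lambda>_. 1"] in auto)
      then show ?thesis using cq[of 0 r] cq[of 0 t] elim(1) t by simp
    qed
    have "l2_bounded I w (M\<^sup>2 * \<delta>) (\<lambda>\<xi>. integral {a..b} (\<lambda>\<sigma>. of_real (q \<sigma>) * (Z \<sigma> \<xi> - Z t \<xi>)) / of_real (b - a))"
    proof (rule l2_bounded_mean[OF w ab(1)])
      fix \<xi> assume \<xi>: "\<xi> \<in> I"
      show "continuous_on {a..b} (\<lambda>\<sigma>. Z \<sigma> \<xi> - Z t \<xi>)"
        using ab by (intro continuous_intros continuous_on_subset[OF Z[OF \<xi>]]) auto
      show "(\<lambda>\<sigma>. of_real (q \<sigma>) * (Z \<sigma> \<xi> - Z t \<xi>)) integrable_on {a..b}"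
        using ab by (intro qZ continuous_intros Z[OF \<xi>]) auto
    next
      fix \<sigma> assume \<sigma>: "\<sigma> \<in> {a..b}"
      then have "\<bar>\<sigma> - t\<bar> \<le> \<bar>r - t\<bar>" unfolding a_def b_def by auto
      then show "l2_bounded I w \<delta> (\<lambda>\<xi>. Z \<sigma> \<xi> - Z t \<xi>)"
        using \<sigma> ab elim(1) by (intro near) (auto simp: dist_real_def)
      show "\<bar>q \<sigma>\<bar> \<le> M" using \<sigma> ab by (intro q(2)) auto
    qed
    from l2_bounded_add[OF w this l2_bounded_cmult[OF B, of "of_real (?qd r - q t)"]]
    have "l2_bounded I w (2 * (M\<^sup>2 * \<delta>) + 2 * ((?qd r - q t)\<^sup>2 * B))
      (\<lambda>\<xi>. integral {a..b} (\<lambda>\<sigma>. of_real (q \<sigma>) * (Z \<sigma> \<xi> - Z t \<xi>)) / of_real (b - a) + of_real (?qd r - q t) * Z t \<xi>)"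
      by (simp only: norm_of_real power2_abs)
    then have "l2_bounded I w \<epsilon> (\<lambda>\<xi>. integral {a..b} (\<lambda>\<sigma>. of_real (q \<sigma>) * (Z \<sigma> \<xi> - Z t \<xi>)) / of_real (b - a) + of_real (?qd r - q t) * Z t \<xi>)"
      by (rule l2_bounded_mono) (use M\<delta> elim(2) in linarith)
    also have "?this \<longleftrightarrow> ?case"
    proof (rule l2_bounded_cong)
      fix \<xi> assume \<xi>: "\<xi> \<in> I"
      have "integral {a..b} (\<lambda>\<sigma>. of_real (q \<sigma>) * (Z \<sigma> \<xi> - Z t \<xi>))
          = integral {a..b} (\<lambda>\<sigma>. of_real (q \<sigma>) * Z \<sigma> \<xi>) - integral {a..b} (\<lambda>\<sigma>. of_real (q \<sigma>)) * Z t \<xi>"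
      proof -
        have "integral {a..b} (\<lambda>\<sigma>. of_real (q \<sigma>) * Z \<sigma> \<xi> - of_real (q \<sigma>) * Z t \<xi>)
          = integral {a..b} (\<lambda>\<sigma>. of_real (q \<sigma>) * Z \<sigma> \<xi>) - integral {a..b} (\<lambda>\<sigma>. of_real (q \<sigma>) * Z t \<xi>)"
          using ab by (intro integral_diff qZ Z[OF \<xi>] continuous_on_const) auto
        then show ?thesis by (simp only: right_diff_distrib integral_mult_left)
      qed
      then have "integral {a..b} (\<lambda>\<sigma>. of_real (q \<sigma>) * (Z \<sigma> \<xi> - Z t \<xi>)) / of_real (b - a)
        = integral {a..b} (\<lambda>\<sigma>. of_real (q \<sigma>) * Z \<sigma> \<xi>) / of_real (b - a) - of_real (?qd r) * Z t \<xi>"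
        unfolding incq by (simp add: diff_divide_distrib)
      moreover have "(integral {0..r} (\<lambda>\<sigma>. of_real (q \<sigma>) * Z \<sigma> \<xi>) - integral {0..t} (\<lambda>\<sigma>. of_real (q \<sigma>) * Z \<sigma> \<xi>)) / of_real (r - t)
        = integral {a..b} (\<lambda>\<sigma>. of_real (q \<sigma>) * Z \<sigma> \<xi>) / of_real (b - a)"
        by (rule inc) (use elim(1) t qZ[OF Z[OF \<xi>]] in auto)
      ultimately show "integral {a..b} (\<lambda>\<sigma>. of_real (q \<sigma>) * (Z \<sigma> \<xi> - Z t \<xi>)) / of_real (b - a) + of_real (?qd r - q t) * Z t \<xi>
        = (integral {0..r} (\<lambda>\<sigma>. of_real (q \<sigma>) * Z \<sigma> \<xi>) - integral {0..t} (\<lambda>\<sigma>. of_real (q \<sigma>) * Z \<sigma> \<xi>)) / of_real (r - t)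
          - of_real (q t) * Z t \<xi>"
        by (simp only: of_real_diff left_diff_distrib) simp
    qed
    finally show ?case .
  qed
qed

section \<open>Curves in the inductive limit topology\<close>

abbreviation gevrey_weight :: "('i \<Rightarrow> complex) \<Rightarrow> real \<Rightarrow> real \<Rightarrow> 'i \<Rightarrow> real" where
  "gevrey_weight lam s A \<equiv> \<lambda>\<xi>. exp (2 * A * bracket lam \<xi> powr (1 / s))"

lemma bracket_ge_1: "bracket lam \<xi> \<ge> 1"
  unfolding bracket_def by simp

lemma gevrey_weight_ge_1: "A \<ge> 0 \<Longrightarrow> gevrey_weight lam s A \<xi> \<ge> 1"
  by simp

lemma gevrey_weight_mono: "A \<le> B \<Longrightarrow> gevrey_weight lam s A \<xi> \<le> gevrey_weight lam s B \<xi>"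
  by (simp add: mult_right_mono)

lemma l2_bounded_weight_mono:
  assumes "l2_bounded I w B g" "\<And>\<xi>. \<xi> \<in> I \<Longrightarrow> w' \<xi> \<le> C * w \<xi>" "C \<ge> 0"
  shows "l2_bounded I w' (C * B) g"
  unfolding l2_bounded_def
proof (intro allI impI)
  fix F assume F: "finite F" "F \<subseteq> I"
  have "(\<Sum>\<xi>\<in>F. w' \<xi> * (cmod (g \<xi>))\<^sup>2) \<le> (\<Sum>\<xi>\<in>F. (C * w \<xi>) * (cmod (g \<xi>))\<^sup>2)"
    using F assms(2) by (intro sum_mono mult_right_mono) auto
  also have "\<dots> = C * (\<Sum>\<xi>\<in>F. w \<xi> * (cmod (g \<xi>))\<^sup>2)" by (simp add: sum_distrib_left mult.assoc)
  also have "\<dots> \<le> C * B" using assms(1,3) F unfolding l2_bounded_def by (intro mult_left_mono) auto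
  finally show "(\<Sum>\<xi>\<in>F. w' \<xi> * (cmod (g \<xi>))\<^sup>2) \<le> C * B" .
qed

lemma l2_bounded_triangle:
  assumes w: "\<And>\<xi>. \<xi> \<in> I \<Longrightarrow> w \<xi> \<ge> 0" and f: "l2_bounded I w (r\<^sup>2) f" "r \<ge> 0" and g: "l2_bounded I w (p\<^sup>2) g" "p \<ge> 0"
  shows "l2_bounded I w ((cmod \<alpha> * r + cmod \<beta> * p)\<^sup>2) (\<lambda>\<xi>. \<alpha> * f \<xi> + \<beta> * g \<xi>)"
  unfolding l2_bounded_def
proof (intro allI impI)
  fix F assume F: "finite F" "F \<subseteq> I"
  let ?n = "\<lambda>h. L2_set (\<lambda>\<xi>. sqrt (w \<xi>) * cmod (h \<xi>)) F"
  have n: "(\<Sum>\<xi>\<in>F. w \<xi> * (cmod (h \<xi>))\<^sup>2) = (?n h)\<^sup>2" for h :: "'a \<Rightarrow> complex"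
  proof -
    have "(\<Sum>\<xi>\<in>F. (sqrt (w \<xi>) * cmod (h \<xi>))\<^sup>2) = (\<Sum>\<xi>\<in>F. w \<xi> * (cmod (h \<xi>))\<^sup>2)"
    proof (rule sum.cong)
      fix \<xi> assume "\<xi> \<in> F"
      then have "w \<xi> \<ge> 0" using w F by auto
      then show "(sqrt (w \<xi>) * cmod (h \<xi>))\<^sup>2 = w \<xi> * (cmod (h \<xi>))\<^sup>2" by (simp add: power_mult_distrib)
    qed simp
    then show ?thesis unfolding L2_set_def using sum_nonneg[of F "\<lambda>\<xi>. (sqrt (w \<xi>) * cmod (h \<xi>))\<^sup>2"] by simp
  qed
  have nr: "?n f \<le> r" using f F n[of f] unfolding l2_bounded_def by (auto intro: power2_le_imp_le)
  have np: "?n g \<le> p" using g F n[of g] unfolding l2_bounded_def by (auto intro: power2_le_imp_le)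
  have "?n (\<lambda>\<xi>. \<alpha> * f \<xi> + \<beta> * g \<xi>)
      \<le> L2_set (\<lambda>\<xi>. cmod \<alpha> * (sqrt (w \<xi>) * cmod (f \<xi>)) + cmod \<beta> * (sqrt (w \<xi>) * cmod (g \<xi>))) F"
  proof (rule L2_set_mono)
    fix \<xi> assume "\<xi> \<in> F"
    then have w0: "sqrt (w \<xi>) \<ge> 0" using w F by auto
    have "cmod (\<alpha> * f \<xi> + \<beta> * g \<xi>) \<le> cmod \<alpha> * cmod (f \<xi>) + cmod \<beta> * cmod (g \<xi>)"
      using norm_triangle_ineq[of "\<alpha> * f \<xi>" "\<beta> * g \<xi>"] by (simp add: norm_mult)
    from mult_left_mono[OF this w0]
    show "sqrt (w \<xi>) * cmod (\<alpha> * f \<xi> + \<beta> * g \<xi>)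
        \<le> cmod \<alpha> * (sqrt (w \<xi>) * cmod (f \<xi>)) + cmod \<beta> * (sqrt (w \<xi>) * cmod (g \<xi>))"
      by (simp add: algebra_simps)
    show "0 \<le> sqrt (w \<xi>) * cmod (\<alpha> * f \<xi> + \<beta> * g \<xi>)" using w0 by simp
  qed
  also have "\<dots> \<le> L2_set (\<lambda>\<xi>. cmod \<alpha> * (sqrt (w \<xi>) * cmod (f \<xi>))) F + L2_set (\<lambda>\<xi>. cmod \<beta> * (sqrt (w \<xi>) * cmod (g \<xi>))) F"
    by (rule L2_set_triangle_ineq)
  also have "\<dots> = cmod \<alpha> * ?n f + cmod \<beta> * ?n g" by (simp add: L2_set_right_distrib)
  also have "\<dots> \<le> cmod \<alpha> * r + cmod \<beta> * p" using nr np by (intro add_mono mult_left_mono) auto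
  finally show "(\<Sum>\<xi>\<in>F. w \<xi> * (cmod (\<alpha> * f \<xi> + \<beta> * g \<xi>))\<^sup>2) \<le> (cmod \<alpha> * r + cmod \<beta> * p)\<^sup>2"
    unfolding n by (intro power_mono) auto
qed

lemma gevrey_step_if_l2_bounded:
  assumes f: "f \<in> L2" and B: "l2_bounded I (gevrey_weight lam s A) B (hat v f)"
  shows "f \<in> gevrey_step I lam v s A" "gevrey_norm I lam v s A f \<le> sqrt B"
proof -
  let ?g = "\<lambda>\<xi>. exp (2 * A * bracket lam \<xi> powr (1 / s)) * (cmod (hat v f \<xi>))\<^sup>2"
  have le: "sum ?g F \<le> B" if "finite F" "F \<subseteq> I" for F using B that unfolding l2_bounded_def by simp
  have sm: "?g summable_on I"
    by (rule nonneg_bdd_above_summable_on) (auto intro!: bdd_aboveI[of _ B] le)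
  then show "f \<in> gevrey_step I lam v s A" using f unfolding gevrey_step_def by simp
  show "gevrey_norm I lam v s A f \<le> sqrt B"
    unfolding gevrey_norm_def by (intro real_sqrt_le_mono infsum_le_finite_sums sm le)
qed

lemma l2_bounded_if_gevrey_step:
  assumes "f \<in> gevrey_step I lam v s A"
  shows "l2_bounded I (gevrey_weight lam s A) ((gevrey_norm I lam v s A f)\<^sup>2) (hat v f)"
proof -
  let ?g = "\<lambda>\<xi>. exp (2 * A * bracket lam \<xi> powr (1 / s)) * (cmod (hat v f \<xi>))\<^sup>2"
  have sm: "?g summable_on I" using assms unfolding gevrey_step_def by simp
  have "infsum ?g I \<ge> 0" by (rule infsum_nonneg) simp
  then have "(gevrey_norm I lam v s A f)\<^sup>2 = infsum ?g I" unfolding gevrey_norm_def by simp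
  then show ?thesis unfolding l2_bounded_def using sm by (auto intro!: finite_sum_le_infsum)
qed

lemma gevrey_L2: "f \<in> gevrey I lam v s \<Longrightarrow> f \<in> L2"
  unfolding gevrey_def gevrey_step_def by auto

text \<open>A zero neighbourhood of the inductive limit contains a ball of every step.\<close>

lemma limitin_gevrey_if_l2_tendsto:
  fixes h :: "'a \<Rightarrow> real ^ 'n \<Rightarrow> complex"
  assumes v: "\<forall>\<xi>\<in>I. v \<xi> \<in> L2" and A: "A > 0" and L: "L \<in> gevrey I lam v s"
    and h: "\<forall>\<^sub>F r in F. h r \<in> L2"
    and lim: "l2_tendsto I (gevrey_weight lam s A) (\<lambda>r. hat v (h r)) (hat v L) F"
  shows "limitin (gevrey_topology I lam v s) h L F"
  unfolding limitin_def topspace_gevrey_topology[OF v]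
proof (intro conjI L allI impI)
  fix U assume "openin (gevrey_topology I lam v s) U \<and> L \<in> U"
  then have "gevrey_open I lam v s U" "L \<in> U" by (simp_all add: openin_gevrey_topology)
  then obtain W where W: "W \<in> gevrey_nbhds I lam v s" "\<forall>w\<in>W. (\<lambda>x. L x + w x) \<in> U"
    unfolding gevrey_open_def by blast
  obtain e where e: "e > 0" "\<forall>f\<in>gevrey_step I lam v s A. gevrey_norm I lam v s A f < e \<longrightarrow> f \<in> W"
    using W(1) A unfolding gevrey_nbhds_def by blast
  have "\<forall>\<^sub>F r in F. l2_bounded I (gevrey_weight lam s A) ((e/2)\<^sup>2) (\<lambda>\<xi>. hat v (h r) \<xi> - hat v L \<xi>)"
    using lim e(1) unfolding l2_tendsto_def by simp
  with h show "\<forall>\<^sub>F r in F. h r \<in> U"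
  proof eventually_elim
    case (elim r)
    define w where "w x = h r x - L x" for x
    have LL: "L \<in> L2" using L by (rule gevrey_L2)
    have wL: "w \<in> L2" unfolding w_def[abs_def] using elim(1) LL by (rule L2_diff)
    have "hat v w \<xi> = hat v (h r) \<xi> - hat v L \<xi>" if "\<xi> \<in> I" for \<xi>
      unfolding w_def[abs_def] using elim(1) LL v that by (intro hat_diff) auto
    then have "l2_bounded I (gevrey_weight lam s A) ((e/2)\<^sup>2) (hat v w)"
      using elim(2) by (subst l2_bounded_cong) auto
    from gevrey_step_if_l2_bounded[OF wL this] have "w \<in> W" using e by auto
    then have "(\<lambda>x. L x + w x) \<in> U" using W(2) by blast
    then show "h r \<in> U" unfolding w_def by simp
  qed
qed

lemma atin_top_of_set: "t \<in> S \<Longrightarrow> atin (top_of_set S) t = at t within S"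
proof -
  assume t: "t \<in> S"
  have "eventually P (atin (top_of_set S) t) \<longleftrightarrow> eventually P (at t within S)" for P
    unfolding atin_subtopology_within[OF t] eventually_atin_within eventually_at_topological by auto
  then show ?thesis by (simp add: filter_eq_iff)
qed

lemma continuous_map_gevrey_iff:
  "continuous_map (top_of_set {0..T::real}) X d \<longleftrightarrow> (\<forall>t\<in>{0..T}. limitin X d (d t) (at t within {0..T}))"
  unfolding continuous_map_atin by (simp add: atin_top_of_set)

text \<open>A weight dominated by the weights of all steps has a square sum that is a continuous seminorm on the
  inductive limit. These seminorms, rather than the neighbourhoods themselves, are used to extract information
  from convergence in the inductive limit.\<close>

definition admissible_weight :: "'i set \<Rightarrow> ('i \<Rightarrow> complex) \<Rightarrow> real \<Rightarrow> ('i \<Rightarrow> real) \<Rightarrow> bool" where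
  "admissible_weight I lam s w \<longleftrightarrow> (\<forall>\<xi>\<in>I. w \<xi> \<ge> 0) \<and>
     (\<forall>A>0. \<exists>C\<ge>0. \<forall>\<xi>\<in>I. w \<xi> \<le> C * gevrey_weight lam s A \<xi>)"

lemma admissible_ball_nbhd:
  assumes v: "\<forall>\<xi>\<in>I. v \<xi> \<in> L2" and w: "admissible_weight I lam s w" and r: "r > 0"
  shows "{f \<in> gevrey I lam v s. l2_bounded I w (r\<^sup>2) (hat v f)} \<in> gevrey_nbhds I lam v s" (is "?W \<in> _")
  unfolding gevrey_nbhds_def
proof (rule CollectI, intro conjI ballI allI impI)
  have w0: "\<And>\<xi>. \<xi> \<in> I \<Longrightarrow> w \<xi> \<ge> 0" using w unfolding admissible_weight_def by blast
  show "?W \<subseteq> gevrey I lam v s" by auto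
  fix f g and \<alpha> \<beta> :: complex assume f: "f \<in> ?W" and g: "g \<in> ?W" and ab: "cmod \<alpha> + cmod \<beta> \<le> 1"
  have fg: "f \<in> gevrey I lam v s" "g \<in> gevrey I lam v s" using f g by auto
  have "l2_bounded I w ((cmod \<alpha> * r + cmod \<beta> * r)\<^sup>2) (\<lambda>\<xi>. \<alpha> * hat v f \<xi> + \<beta> * hat v g \<xi>)"
    using f g r by (intro l2_bounded_triangle w0) auto
  moreover have "(cmod \<alpha> * r + cmod \<beta> * r)\<^sup>2 \<le> r\<^sup>2"
    using ab r mult_right_mono[OF ab, of r] by (intro power_mono) (auto simp: distrib_right)
  ultimately have "l2_bounded I w (r\<^sup>2) (\<lambda>\<xi>. \<alpha> * hat v f \<xi> + \<beta> * hat v g \<xi>)" by (rule l2_bounded_mono)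
  moreover have "hat v (\<lambda>x. \<alpha> * f x + \<beta> * g x) \<xi> = \<alpha> * hat v f \<xi> + \<beta> * hat v g \<xi>" if "\<xi> \<in> I" for \<xi>
    using gevrey_L2[OF fg(1)] gevrey_L2[OF fg(2)] v that by (intro hat_lincomb) auto
  ultimately have "l2_bounded I w (r\<^sup>2) (hat v (\<lambda>x. \<alpha> * f x + \<beta> * g x))" by (subst l2_bounded_cong) auto
  then show "(\<lambda>x. \<alpha> * f x + \<beta> * g x) \<in> ?W" using gevrey_lincomb[OF v fg] by simp
next
  fix A :: real assume A: "A > 0"
  then obtain C where C: "C \<ge> 0" "\<forall>\<xi>\<in>I. w \<xi> \<le> C * gevrey_weight lam s A \<xi>"
    using w unfolding admissible_weight_def by blast
  show "\<exists>e>0. \<forall>f\<in>gevrey_step I lam v s A. gevrey_norm I lam v s A f < e \<longrightarrow> f \<in> ?W"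
  proof (intro exI[of _ "r / sqrt (C + 1)"] conjI ballI impI)
    show "r / sqrt (C + 1) > 0" using r C by simp
    fix f assume f: "f \<in> gevrey_step I lam v s A" and n: "gevrey_norm I lam v s A f < r / sqrt (C + 1)"
    have n0: "gevrey_norm I lam v s A f \<ge> 0" unfolding gevrey_norm_def by (simp add: infsum_nonneg)
    have "l2_bounded I w (C * (gevrey_norm I lam v s A f)\<^sup>2) (hat v f)"
      using l2_bounded_weight_mono[OF l2_bounded_if_gevrey_step[OF f], of w C] C by blast
    moreover have "C * (gevrey_norm I lam v s A f)\<^sup>2 \<le> r\<^sup>2"
    proof -
      have "(gevrey_norm I lam v s A f)\<^sup>2 \<le> (r / sqrt (C + 1))\<^sup>2" using n n0 by (intro power_mono) auto
      also have "\<dots> = r\<^sup>2 / (C + 1)" using C by (simp add: power_divide)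
      finally have "(C + 1) * (gevrey_norm I lam v s A f)\<^sup>2 \<le> r\<^sup>2" using C by (simp add: field_simps)
      moreover have "0 \<le> (gevrey_norm I lam v s A f)\<^sup>2" by simp
      ultimately show ?thesis unfolding distrib_right mult_1 by linarith
    qed
    ultimately have "l2_bounded I w (r\<^sup>2) (hat v f)" by (rule l2_bounded_mono)
    then show "f \<in> ?W" using f A unfolding gevrey_def by blast
  qed
qed

lemma l2_tendsto_if_limitin_gevrey:
  fixes h :: "'a \<Rightarrow> real ^ 'n \<Rightarrow> complex"
  assumes v: "\<forall>\<xi>\<in>I. v \<xi> \<in> L2" and w: "admissible_weight I lam s w"
    and lim: "limitin (gevrey_topology I lam v s) h L F"
  shows "l2_tendsto I w (\<lambda>r. hat v (h r)) (hat v L) F"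
  unfolding l2_tendsto_def
proof (intro allI impI)
  fix \<epsilon> :: real assume \<epsilon>: "\<epsilon> > 0"
  have w0: "\<And>\<xi>. \<xi> \<in> I \<Longrightarrow> w \<xi> \<ge> 0" using w unfolding admissible_weight_def by blast
  have L: "L \<in> gevrey I lam v s" using lim unfolding limitin_def topspace_gevrey_topology[OF v] by blast
  define r where "r = sqrt \<epsilon>"
  have r: "r > 0" unfolding r_def using \<epsilon> by simp
  define U where "U = {f \<in> gevrey I lam v s. \<exists>\<rho>\<ge>0. \<rho> < r \<and> l2_bounded I w (\<rho>\<^sup>2) (\<lambda>\<xi>. hat v f \<xi> - hat v L \<xi>)}"
  have "gevrey_open I lam v s U"
    unfolding gevrey_open_def
  proof (intro conjI ballI)
    show "U \<subseteq> gevrey I lam v s" unfolding U_def by auto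
    fix f assume "f \<in> U"
    then obtain \<rho> where f: "f \<in> gevrey I lam v s" and \<rho>: "\<rho> \<ge> 0" "\<rho> < r" "l2_bounded I w (\<rho>\<^sup>2) (\<lambda>\<xi>. hat v f \<xi> - hat v L \<xi>)"
      unfolding U_def by blast
    let ?W = "{g \<in> gevrey I lam v s. l2_bounded I w (((r - \<rho>) / 2)\<^sup>2) (hat v g)}"
    have "?W \<in> gevrey_nbhds I lam v s" using admissible_ball_nbhd[OF v w] \<rho> by simp
    moreover have "(\<lambda>x. f x + g x) \<in> U" if g: "g \<in> ?W" for g
    proof -
      have gg: "g \<in> gevrey I lam v s" using g by simp
      have "l2_bounded I w ((cmod 1 * \<rho> + cmod 1 * ((r - \<rho>) / 2))\<^sup>2) (\<lambda>\<xi>. 1 * (hat v f \<xi> - hat v L \<xi>) + 1 * hat v g \<xi>)"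
        using \<rho> g by (intro l2_bounded_triangle w0) auto
      moreover have "1 * (hat v f \<xi> - hat v L \<xi>) + 1 * hat v g \<xi> = hat v (\<lambda>x. f x + g x) \<xi> - hat v L \<xi>" if "\<xi> \<in> I" for \<xi>
        using hat_add[of f g v \<xi>] gevrey_L2[OF f] gevrey_L2[OF gg] v that by simp
      ultimately have "l2_bounded I w ((cmod 1 * \<rho> + cmod 1 * ((r - \<rho>) / 2))\<^sup>2) (\<lambda>\<xi>. hat v (\<lambda>x. f x + g x) \<xi> - hat v L \<xi>)"
        by (subst (asm) l2_bounded_cong) auto
      moreover have "(\<lambda>x. f x + g x) \<in> gevrey I lam v s"
        using gevrey_lincomb[OF v f gg, of 1 1] by simp
      moreover have "cmod 1 * \<rho> + cmod 1 * ((r - \<rho>) / 2) < r" using \<rho> by (simp add: field_simps)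
      ultimately show ?thesis
        unfolding U_def using \<rho> by (intro CollectI conjI exI[of _ "cmod 1 * \<rho> + cmod 1 * ((r - \<rho>) / 2)"]) auto
    qed
    ultimately show "\<exists>W\<in>gevrey_nbhds I lam v s. \<forall>g\<in>W. (\<lambda>x. f x + g x) \<in> U" by blast
  qed
  moreover have "L \<in> U" unfolding U_def using L r by (auto intro!: exI[of _ 0] simp: l2_bounded_def)
  ultimately have "\<forall>\<^sub>F s in F. h s \<in> U"
    using lim unfolding limitin_def openin_gevrey_topology by blast
  then show "\<forall>\<^sub>F s in F. l2_bounded I w \<epsilon> (\<lambda>\<xi>. hat v (h s) \<xi> - hat v L \<xi>)"
  proof eventually_elim
    case (elim s)
    then obtain \<rho> where \<rho>: "\<rho> \<ge> 0" "\<rho> < r" "l2_bounded I w (\<rho>\<^sup>2) (\<lambda>\<xi>. hat v (h s) \<xi> - hat v L \<xi>)"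
      unfolding U_def by blast
    have "\<rho>\<^sup>2 \<le> r\<^sup>2" using \<rho> by (intro power_mono) auto
    then show ?case using l2_bounded_mono[OF \<rho>(3)] \<epsilon> unfolding r_def by simp
  qed
qed

lemma admissible_bounded:
  assumes "\<And>\<xi>. \<xi> \<in> I \<Longrightarrow> 0 \<le> w \<xi>" "\<And>\<xi>. \<xi> \<in> I \<Longrightarrow> w \<xi> \<le> C"
  shows "admissible_weight I lam s w"
  unfolding admissible_weight_def
proof (intro conjI ballI allI impI)
  fix A :: real assume A: "A > 0"
  show "\<exists>C\<ge>0. \<forall>\<xi>\<in>I. w \<xi> \<le> C * gevrey_weight lam s A \<xi>"
  proof (intro exI[of _ "\<bar>C\<bar>"] conjI ballI)
    fix \<xi> assume "\<xi> \<in> I"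
    then have "w \<xi> \<le> \<bar>C\<bar> * 1" using assms(2)[of \<xi>] by simp
    also have "\<dots> \<le> \<bar>C\<bar> * gevrey_weight lam s A \<xi>" using A by (intro mult_left_mono gevrey_weight_ge_1) auto
    finally show "w \<xi> \<le> \<bar>C\<bar> * gevrey_weight lam s A \<xi>" .
  qed simp
qed (use assms in auto)

lemma admissible_coordinate: "admissible_weight I lam s (\<lambda>\<xi>. if \<xi> = \<eta> then 1 else 0)"
  by (rule admissible_bounded[where C = 1]) auto

lemma l2_bounded_coordinate:
  "\<eta> \<in> I \<Longrightarrow> l2_bounded I (\<lambda>\<xi>. if \<xi> = \<eta> then 1 else 0) B g \<Longrightarrow> (cmod (g \<eta>))\<^sup>2 \<le> B"
  unfolding l2_bounded_def by (drule spec[of _ "{\<eta>}"]) auto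

lemma tendsto_hat_if_limitin_gevrey:
  assumes v: "\<forall>\<xi>\<in>I. v \<xi> \<in> L2" and lim: "limitin (gevrey_topology I lam v s) h L F" and \<eta>: "\<eta> \<in> I"
  shows "((\<lambda>r. hat v (h r) \<eta>) \<longlongrightarrow> hat v L \<eta>) F"
proof (rule tendstoI)
  fix e :: real assume e: "e > 0"
  have "\<forall>\<^sub>F r in F. l2_bounded I (\<lambda>\<xi>. if \<xi> = \<eta> then 1 else 0) ((e/2)\<^sup>2) (\<lambda>\<xi>. hat v (h r) \<xi> - hat v L \<xi>)"
    using l2_tendsto_if_limitin_gevrey[OF v admissible_coordinate lim] e unfolding l2_tendsto_def by simp
  then show "\<forall>\<^sub>F r in F. dist (hat v (h r) \<eta>) (hat v L \<eta>) < e"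
  proof eventually_elim
    case (elim r)
    from l2_bounded_coordinate[OF \<eta> this] have "cmod (hat v (h r) \<eta> - hat v L \<eta>) \<le> e/2"
      by (rule power2_le_imp_le) (use e in simp)
    then show ?case using e unfolding dist_norm by simp
  qed
qed

text \<open>A single coefficient is a continuous functional: its seminorm comes from the weight that is the indicator
  of one index.\<close>

lemma hat_bounded_if_gevrey_bounded:
  assumes v: "\<forall>\<xi>\<in>I. v \<xi> \<in> L2" and B: "gevrey_bounded I lam v s B" and \<eta>: "\<eta> \<in> I"
  shows "\<exists>K>0. \<forall>f\<in>B. cmod (hat v f \<eta>) \<le> K"
proof -
  let ?W = "{f \<in> gevrey I lam v s. l2_bounded I (\<lambda>\<xi>. if \<xi> = \<eta> then 1 else 0) (1\<^sup>2) (hat v f)}"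
  have "?W \<in> gevrey_nbhds I lam v s" by (rule admissible_ball_nbhd[OF v admissible_coordinate]) simp
  then obtain K where K: "K > 0" "\<forall>f\<in>B. (\<lambda>x. f x / complex_of_real K) \<in> ?W"
    using B unfolding gevrey_bounded_def by blast
  have "cmod (hat v f \<eta>) \<le> K" if f: "f \<in> B" for f
  proof -
    have fL: "f \<in> L2" using B f unfolding gevrey_bounded_def by (blast intro: gevrey_L2)
    have "l2_bounded I (\<lambda>\<xi>. if \<xi> = \<eta> then 1 else 0) (1\<^sup>2) (hat v (\<lambda>x. f x / complex_of_real K))" using K f by blast
    from l2_bounded_coordinate[OF \<eta> this] have "cmod (hat v (\<lambda>x. f x / complex_of_real K) \<eta>) \<le> 1"
      by (rule power2_le_imp_le) simp
    moreover have "hat v (\<lambda>x. f x / complex_of_real K) \<eta> = hat v f \<eta> / complex_of_real K"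
      using hat_cmult[of f v \<eta> "1 / complex_of_real K"] fL v \<eta> by simp
    ultimately show ?thesis using K by (simp add: norm_divide field_simps)
  qed
  then show ?thesis using K by blast
qed

lemma gevrey_l2_bounded_admissible:
  assumes "f \<in> gevrey I lam v s" "admissible_weight I lam s w"
  shows "\<exists>B. l2_bounded I w B (hat v f)"
proof -
  obtain A where A: "A > 0" "f \<in> gevrey_step I lam v s A" using assms(1) unfolding gevrey_def by auto
  then obtain C where "C \<ge> 0" "\<forall>\<xi>\<in>I. w \<xi> \<le> C * gevrey_weight lam s A \<xi>"
    using assms(2) unfolding admissible_weight_def by blast
  then show ?thesis using l2_bounded_weight_mono[OF l2_bounded_if_gevrey_step[OF A(2)], of w C] by blast
qed

text \<open>A continuous seminorm is locally bounded along the curve, and the time interval is compact.\<close>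

lemma curve_bounded_admissible:
  fixes d :: "real \<Rightarrow> real ^ 'n \<Rightarrow> complex"
  assumes v: "\<forall>\<xi>\<in>I. v \<xi> \<in> L2" and w: "admissible_weight I lam s w"
    and d: "continuous_map (top_of_set {0..T}) (gevrey_topology I lam v s) d"
  shows "\<exists>B. \<forall>t\<in>{0..T}. l2_bounded I w B (hat v (d t))"
proof -
  have w0: "\<And>\<xi>. \<xi> \<in> I \<Longrightarrow> w \<xi> \<ge> 0" using w unfolding admissible_weight_def by blast
  have "\<exists>U B. open U \<and> t \<in> U \<and> (\<forall>s\<in>U \<inter> {0..T}. l2_bounded I w B (hat v (d s)))" if t: "t \<in> {0..T}" for t
  proof -
    have lim: "limitin (gevrey_topology I lam v s) d (d t) (at t within {0..T})"
      using d t unfolding continuous_map_gevrey_iff by blast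
    then have "d t \<in> gevrey I lam v s" unfolding limitin_def topspace_gevrey_topology[OF v] by blast
    then obtain B where B: "l2_bounded I w B (hat v (d t))" using gevrey_l2_bounded_admissible[OF _ w] by blast
    have B0: "B \<ge> 0" using l2_bounded_nonneg[OF B] .
    have "\<forall>\<^sub>F s in at t within {0..T}. l2_bounded I w 1 (\<lambda>\<xi>. hat v (d s) \<xi> - hat v (d t) \<xi>)"
      using l2_tendsto_if_limitin_gevrey[OF v w lim] unfolding l2_tendsto_def by simp
    then obtain U where U: "open U" "t \<in> U"
      "\<forall>s\<in>U. s \<noteq> t \<longrightarrow> s \<in> {0..T} \<longrightarrow> l2_bounded I w 1 (\<lambda>\<xi>. hat v (d s) \<xi> - hat v (d t) \<xi>)"
      unfolding eventually_at_topological by blast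
    have "l2_bounded I w (2 * 1 + 2 * B) (hat v (d s))" if s: "s \<in> U \<inter> {0..T}" for s
    proof (cases "s = t")
      case True
      then show ?thesis using l2_bounded_mono[OF B, of "2 * 1 + 2 * B"] B0 by simp
    next
      case False
      then have "l2_bounded I w 1 (\<lambda>\<xi>. hat v (d s) \<xi> - hat v (d t) \<xi>)" using U s by blast
      from l2_bounded_add[OF w0 this B] show ?thesis by simp
    qed
    then show ?thesis using U by blast
  qed
  then have "\<forall>t\<in>{0..T}. \<exists>p. open (fst p) \<and> t \<in> fst p \<and> (\<forall>s\<in>fst p \<inter> {0..T}. l2_bounded I w (snd p) (hat v (d s)))"
    by (metis fst_conv snd_conv)
  from bchoice[OF this] obtain p where p: "\<forall>t\<in>{0..T}. open (fst (p t)) \<and> t \<in> fst (p t) \<and>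
      (\<forall>s\<in>fst (p t) \<inter> {0..T}. l2_bounded I w (snd (p t)) (hat v (d s)))" ..
  have "\<exists>C'\<subseteq>{0..T}. finite C' \<and> {0..T} \<subseteq> (\<Union>c\<in>C'. fst (p c))"
    by (rule compactE_image[of "{0..T}" "{0..T}" "\<lambda>t. fst (p t)"]) (use p in auto)
  then obtain C' where C': "C' \<subseteq> {0..T}" "finite C'" "{0..T} \<subseteq> (\<Union>c\<in>C'. fst (p c))" by blast
  have "l2_bounded I w (\<Sum>c\<in>C'. \<bar>snd (p c)\<bar>) (hat v (d t))" if t: "t \<in> {0..T}" for t
  proof -
    obtain c where c: "c \<in> C'" "t \<in> fst (p c)" using C'(3) t by blast
    then have "l2_bounded I w (snd (p c)) (hat v (d t))" using p C'(1) t by blast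
    moreover have "snd (p c) \<le> (\<Sum>c\<in>C'. \<bar>snd (p c)\<bar>)"
      using member_le_sum[OF c(1), of "\<lambda>c. \<bar>snd (p c)\<bar>"] C'(2) by simp
    ultimately show ?thesis by (rule l2_bounded_mono)
  qed
  then show ?thesis by blast
qed

text \<open>Otherwise the square sums are unbounded along the curve for every step, also after removing all \<open>\<xi>\<close> with
  \<open>\<langle>\<xi>\<rangle> \<le> R\<close>, because on these the weights are bounded. So there are bands \<open>R k < \<langle>\<xi>\<rangle> \<le> R (Suc k)\<close> on which
  the square sum for the parameter \<open>1 / (k + 1)\<close> exceeds \<open>k\<close> at some time. The weight that uses this parameter
  on the \<open>k\<close>-th band is admissible, and its seminorm is unbounded along the curve, contradicting compactness.\<close>

lemma curve_coefficients_in_one_step: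
  fixes d :: "real \<Rightarrow> real ^ 'n \<Rightarrow> complex"
  assumes v: "\<forall>\<xi>\<in>I. v \<xi> \<in> L2" and s: "s \<ge> 1"
    and d: "continuous_map (top_of_set {0..T}) (gevrey_topology I lam v s) d"
  shows "\<exists>A>0. \<exists>B. \<forall>t\<in>{0..T}. l2_bounded I (gevrey_weight lam s A) B (hat v (d t))"
proof (rule ccontr)
  assume neg: "\<not> ?thesis"
  let ?e = "\<lambda>k. gevrey_weight lam s (1 / (real k + 1))"
  let ?X = "bracket lam"
  have X1: "?X \<xi> \<ge> 1" for \<xi> by (rule bracket_ge_1)
  obtain B1 where B1: "\<forall>t\<in>{0..T}. l2_bounded I (\<lambda>_. 1) B1 (hat v (d t))"
    using curve_bounded_admissible[OF v _ d, of "\<lambda>_. 1"] admissible_bounded[of I "\<lambda>_. 1" 1 lam s] by auto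
  have step: "\<exists>R'. real (Suc k) \<le> R' \<and> (R + 1 \<le> R' \<and> (\<exists>t\<in>{0..T}. \<exists>G. finite G \<and> G \<subseteq> {\<xi>\<in>I. R < ?X \<xi> \<and> ?X \<xi> \<le> R'} \<and>
      (\<Sum>\<xi>\<in>G. ?e k \<xi> * (cmod (hat v (d t) \<xi>))\<^sup>2) > real k))" if R: "real k \<le> R" for k and R :: real
  proof -
    define b where "b = exp (2 * R powr (1 / s)) * B1"
    have "1 / (real k + 1) > 0" by simp
    then obtain t where t: "t \<in> {0..T}" "\<not> l2_bounded I (?e k) (real k + b) (hat v (d t))" using neg by blast
    then obtain F where F: "finite F" "F \<subseteq> I" "(\<Sum>\<xi>\<in>F. ?e k \<xi> * (cmod (hat v (d t) \<xi>))\<^sup>2) > real k + b"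
      unfolding l2_bounded_def by (auto simp: not_le)
    define G where "G = {\<xi>\<in>F. R < ?X \<xi>}"
    define R' where "R' = R + 1 + (\<Sum>\<xi>\<in>G. ?X \<xi>)"
    have G: "finite G" "G \<subseteq> F" unfolding G_def using F by auto
    let ?s = "\<lambda>\<xi>. ?e k \<xi> * (cmod (hat v (d t) \<xi>))\<^sup>2"
    have "sum ?s (F - G) \<le> (\<Sum>\<xi>\<in>F - G. exp (2 * R powr (1 / s)) * (1 * (cmod (hat v (d t) \<xi>))\<^sup>2))"
    proof (rule sum_mono)
      fix \<xi> assume "\<xi> \<in> F - G"
      then have "?X \<xi> \<le> R" unfolding G_def by auto
      then have "?X \<xi> powr (1 / s) \<le> R powr (1 / s)" using X1[of \<xi>] s by (intro powr_mono2) auto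
      moreover have "1 / (real k + 1) * ?X \<xi> powr (1 / s) \<le> 1 * ?X \<xi> powr (1 / s)"
        by (intro mult_right_mono) auto
      ultimately have "?e k \<xi> \<le> exp (2 * R powr (1 / s))" by simp
      then show "?s \<xi> \<le> exp (2 * R powr (1 / s)) * (1 * (cmod (hat v (d t) \<xi>))\<^sup>2)"
        unfolding mult_1 by (intro mult_right_mono) auto
    qed
    also have "\<dots> = exp (2 * R powr (1 / s)) * (\<Sum>\<xi>\<in>F - G. 1 * (cmod (hat v (d t) \<xi>))\<^sup>2)"
      by (simp add: sum_distrib_left)
    also have "\<dots> \<le> b"
    proof -
      have "(\<Sum>\<xi>\<in>F - G. 1 * (cmod (hat v (d t) \<xi>))\<^sup>2) \<le> B1"
        using B1[rule_format, OF t(1), unfolded l2_bounded_def, rule_format, of "F - G"] F by blast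
      then show ?thesis unfolding b_def by (intro mult_left_mono) auto
    qed
    finally have "sum ?s (F - G) \<le> b" .
    moreover have "sum ?s F = sum ?s (F - G) + sum ?s G" using sum.subset_diff[OF G(2) F(1)] .
    ultimately have "sum ?s G > real k" using F(3) by linarith
    moreover have "?X \<xi> \<le> R'" if "\<xi> \<in> G" for \<xi>
    proof -
      have "?X \<xi> \<le> (\<Sum>\<xi>\<in>G. ?X \<xi>)" using that G X1 by (intro member_le_sum) (auto intro: order_trans[OF zero_le_one])
      then show ?thesis unfolding R'_def using R by simp
    qed
    moreover have "0 \<le> (\<Sum>\<xi>\<in>G. ?X \<xi>)" using X1 by (intro sum_nonneg) (meson order_trans zero_le_one)
    ultimately show ?thesis
      using t(1) G F R by (intro exI[of _ R'] conjI bexI[of _ t] exI[of _ G]) (auto simp: G_def R'_def)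
  qed
  have "\<exists>R. \<forall>k. real k \<le> R k \<and> (R k + 1 \<le> R (Suc k) \<and> (\<exists>t\<in>{0..T}. \<exists>G. finite G \<and>
      G \<subseteq> {\<xi>\<in>I. R k < ?X \<xi> \<and> ?X \<xi> \<le> R (Suc k)} \<and>
      (\<Sum>\<xi>\<in>G. ?e k \<xi> * (cmod (hat v (d t) \<xi>))\<^sup>2) > real k))"
    by (rule dependent_nat_choice) (use step in auto)
  then obtain R where R: "\<forall>k. real k \<le> R k \<and> (R k + 1 \<le> R (Suc k) \<and> (\<exists>t\<in>{0..T}. \<exists>G. finite G \<and>
      G \<subseteq> {\<xi>\<in>I. R k < ?X \<xi> \<and> ?X \<xi> \<le> R (Suc k)} \<and>
      (\<Sum>\<xi>\<in>G. ?e k \<xi> * (cmod (hat v (d t) \<xi>))\<^sup>2) > real k))" ..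
  have Rmono: "R i \<le> R j" if "i \<le> j" for i j
    using that
  proof (rule lift_Suc_mono_le[rotated])
    show "R n \<le> R (Suc n)" for n using R[rule_format, of n] by linarith
  qed
  \<comment> \<open>the number of the band that contains \<open>\<langle>\<xi>\<rangle>\<close>\<close>
  define K where "K \<xi> = (LEAST k. ?X \<xi> \<le> R (Suc k))" for \<xi>
  have KX: "?X \<xi> \<le> R (Suc (K \<xi>))" for \<xi>
  proof -
    obtain k :: nat where "?X \<xi> \<le> real k" using real_arch_simple by blast
    then have "?X \<xi> \<le> R (Suc k)" using R[rule_format, of "Suc k"] by simp
    then show ?thesis unfolding K_def by (rule LeastI)
  qed
  have Keq: "K \<xi> = k" if "R k < ?X \<xi>" "?X \<xi> \<le> R (Suc k)" for k \<xi>
    unfolding K_def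
  proof (rule Least_equality[where x = k])
    show "?X \<xi> \<le> R (Suc k)" by fact
    fix j assume j: "?X \<xi> \<le> R (Suc j)"
    show "k \<le> j"
    proof (rule ccontr)
      assume "\<not> k \<le> j"
      then have "R (Suc j) \<le> R k" by (intro Rmono) simp
      then show False using that(1) j by linarith
    qed
  qed
  define w where "w \<xi> = ?e (K \<xi>) \<xi>" for \<xi>
  have w: "admissible_weight I lam s w"
    unfolding admissible_weight_def
  proof (intro conjI ballI allI impI)
    show "0 \<le> w \<xi>" for \<xi> unfolding w_def by simp
    fix A :: real assume A: "A > 0"
    obtain k :: nat where k: "1 / A \<le> real k" using real_arch_simple by blast
    define C where "C = exp (2 * R k powr (1 / s))"
    have C: "C \<ge> 1" unfolding C_def by simp
    show "\<exists>C\<ge>0. \<forall>\<xi>\<in>I. w \<xi> \<le> C * gevrey_weight lam s A \<xi>"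
    proof (intro exI[of _ C] conjI ballI)
      show "0 \<le> C" using C by simp
      fix \<xi>
      have g1: "gevrey_weight lam s A \<xi> \<ge> 1" using A by simp
      show "w \<xi> \<le> C * gevrey_weight lam s A \<xi>"
      proof (cases "K \<xi> \<ge> k")
        case True
        have "1 / A \<le> real (K \<xi>) + 1" using k True by linarith
        then have "1 / (real (K \<xi>) + 1) \<le> A" using A by (simp add: field_simps)
        then have "w \<xi> \<le> gevrey_weight lam s A \<xi>" unfolding w_def by (rule gevrey_weight_mono)
        also have "\<dots> \<le> C * gevrey_weight lam s A \<xi>" using C by simp
        finally show ?thesis .
      next
        case False
        then have "R (Suc (K \<xi>)) \<le> R k" by (intro Rmono) simp
        then have "?X \<xi> \<le> R k" using KX[of \<xi>] by linarith
        then have "?X \<xi> powr (1 / s) \<le> R k powr (1 / s)" using X1[of \<xi>] s by (intro powr_mono2) auto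
        moreover have "1 / (real (K \<xi>) + 1) * ?X \<xi> powr (1 / s) \<le> 1 * ?X \<xi> powr (1 / s)"
          by (intro mult_right_mono) auto
        ultimately have "w \<xi> \<le> C" unfolding w_def C_def by simp
        also have "C * 1 \<le> C * gevrey_weight lam s A \<xi>" using C g1 by (intro mult_left_mono) auto
        finally show ?thesis by simp
      qed
    qed
  qed
  obtain B where B: "\<forall>t\<in>{0..T}. l2_bounded I w B (hat v (d t))"
    using curve_bounded_admissible[OF v w d] by blast
  obtain k :: nat where k: "B \<le> real k" using real_arch_simple by blast
  obtain t G where t: "t \<in> {0..T}" and G: "finite G" "G \<subseteq> {\<xi>\<in>I. R k < ?X \<xi> \<and> ?X \<xi> \<le> R (Suc k)}"
    "(\<Sum>\<xi>\<in>G. ?e k \<xi> * (cmod (hat v (d t) \<xi>))\<^sup>2) > real k"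
    using R[rule_format, of k] by blast
  have "(\<Sum>\<xi>\<in>G. w \<xi> * (cmod (hat v (d t) \<xi>))\<^sup>2) = (\<Sum>\<xi>\<in>G. ?e k \<xi> * (cmod (hat v (d t) \<xi>))\<^sup>2)"
  proof (rule sum.cong)
    fix \<xi> assume "\<xi> \<in> G"
    then have "K \<xi> = k" using G(2) by (intro Keq) auto
    then show "w \<xi> * (cmod (hat v (d t) \<xi>))\<^sup>2 = ?e k \<xi> * (cmod (hat v (d t) \<xi>))\<^sup>2" unfolding w_def by simp
  qed simp
  moreover have "(\<Sum>\<xi>\<in>G. w \<xi> * (cmod (hat v (d t) \<xi>))\<^sup>2) \<le> B"
    using B t G(1,2) unfolding l2_bounded_def by blast
  ultimately show False using G(3) k by linarith
qed

text \<open>Passing from \<open>A\<close> to a smaller parameter makes the contribution of \<open>\<langle>\<xi>\<rangle> > R\<close> uniformly small, by the bound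
  for \<open>A\<close>. For \<open>\<langle>\<xi>\<rangle> \<le> R\<close> the weight is bounded, hence admissible, so continuity in the inductive limit
  suffices.\<close>

lemma curve_continuous_in_one_step:
  fixes d :: "real \<Rightarrow> real ^ 'n \<Rightarrow> complex"
  assumes v: "\<forall>\<xi>\<in>I. v \<xi> \<in> L2" and s: "s \<ge> 1"
    and d: "continuous_map (top_of_set {0..T}) (gevrey_topology I lam v s) d"
    and A: "0 < A'" "A' < A" and B: "\<forall>t\<in>{0..T}. l2_bounded I (gevrey_weight lam s A) B (hat v (d t))"
    and t: "t \<in> {0..T}"
  shows "l2_tendsto I (gevrey_weight lam s A') (\<lambda>r. hat v (d r)) (hat v (d t)) (at t within {0..T})"
  unfolding l2_tendsto_def
proof (intro allI impI)
  fix \<epsilon> :: real assume \<epsilon>: "\<epsilon> > 0"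
  let ?X = "bracket lam"
  have X1: "?X \<xi> \<ge> 1" for \<xi> by (rule bracket_ge_1)
  have B0: "B \<ge> 0" using B t l2_bounded_nonneg by blast
  \<comment> \<open>chosen such that \<open>exp (- 2 * (A - A') * E) * (4 * B) \<le> \<epsilon> / 2\<close>\<close>
  define E where "E = ln (8 * B / \<epsilon> + 1) / (2 * (A - A'))"
  have l0: "ln (8 * B / \<epsilon> + 1) \<ge> 0" using B0 \<epsilon> by simp
  have E0: "E \<ge> 0" unfolding E_def using l0 A by simp
  define R where "R = E powr s"
  have RE: "R powr (1 / s) = E" unfolding R_def using E0 s by (simp add: powr_powr)
  define w where "w \<xi> = (if ?X \<xi> \<le> R then gevrey_weight lam s A' \<xi> else 0)" for \<xi>
  have "admissible_weight I lam s w"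
  proof (rule admissible_bounded[where C = "exp (2 * A' * R powr (1 / s))"])
    fix \<xi>
    show "0 \<le> w \<xi>" unfolding w_def by simp
    show "w \<xi> \<le> exp (2 * A' * R powr (1 / s))"
    proof (cases "?X \<xi> \<le> R")
      case True
      then have "?X \<xi> powr (1 / s) \<le> R powr (1 / s)" using X1[of \<xi>] s by (intro powr_mono2) auto
      then show ?thesis unfolding w_def using True A by simp
    qed (simp add: w_def)
  qed
  then have "l2_tendsto I w (\<lambda>r. hat v (d r)) (hat v (d t)) (at t within {0..T})"
    using d t v unfolding continuous_map_gevrey_iff by (intro l2_tendsto_if_limitin_gevrey) auto
  then have 1: "\<forall>\<^sub>F r in at t within {0..T}. l2_bounded I w (\<epsilon> / 2) (\<lambda>\<xi>. hat v (d r) \<xi> - hat v (d t) \<xi>)"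
    using \<epsilon> unfolding l2_tendsto_def by simp
  have 2: "\<forall>\<^sub>F r in at t within {0..T}. r \<in> {0..T}"
    by (auto simp: eventually_at_filter)
  show "\<forall>\<^sub>F r in at t within {0..T}. l2_bounded I (gevrey_weight lam s A') \<epsilon> (\<lambda>\<xi>. hat v (d r) \<xi> - hat v (d t) \<xi>)"
    using 1 2
  proof eventually_elim
    case (elim r)
    let ?g = "\<lambda>\<xi>. hat v (d r) \<xi> - hat v (d t) \<xi>"
    have "l2_bounded I (gevrey_weight lam s A) (2 * (cmod 1)\<^sup>2 * B + 2 * (cmod (-1))\<^sup>2 * B) (\<lambda>\<xi>. 1 * hat v (d r) \<xi> + (-1) * hat v (d t) \<xi>)"
      using B t elim(2) by (intro l2_bounded_lincomb) auto
    then have gA: "l2_bounded I (gevrey_weight lam s A) (4 * B) ?g" by simp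
    define w2 where "w2 \<xi> = gevrey_weight lam s A' \<xi> - w \<xi>" for \<xi>
    have "l2_bounded I w2 (exp (- (2 * (A - A') * E)) * (4 * B)) ?g"
    proof (rule l2_bounded_weight_mono[OF gA])
      fix \<xi>
      show "w2 \<xi> \<le> exp (- (2 * (A - A') * E)) * gevrey_weight lam s A \<xi>"
      proof (cases "?X \<xi> \<le> R")
        case False
        then have "R powr (1 / s) \<le> ?X \<xi> powr (1 / s)" using s by (intro powr_mono2) (auto simp: R_def)
        then have "(A - A') * E \<le> (A - A') * ?X \<xi> powr (1 / s)" unfolding RE using A by (intro mult_left_mono) auto
        then have "2 * A' * ?X \<xi> powr (1 / s) \<le> - (2 * (A - A') * E) + 2 * A * ?X \<xi> powr (1 / s)"
          by (simp add: algebra_simps)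
        then show ?thesis unfolding w2_def w_def using False by (simp add: exp_add[symmetric])
      qed (simp add: w2_def w_def)
    qed simp
    moreover have "exp (- (2 * (A - A') * E)) * (4 * B) \<le> \<epsilon> / 2"
    proof -
      have "2 * (A - A') * E = ln (8 * B / \<epsilon> + 1)" unfolding E_def using A by simp
      moreover have pos: "8 * B / \<epsilon> + 1 > 0" using B0 \<epsilon> by (simp add: add_nonneg_pos)
      ultimately have "exp (- (2 * (A - A') * E)) = 1 / (8 * B / \<epsilon> + 1)"
        by (simp only: exp_minus exp_ln inverse_eq_divide)
      moreover have "4 * B \<le> \<epsilon> / 2 * (8 * B / \<epsilon> + 1)" using \<epsilon> by (simp add: field_simps)
      ultimately show ?thesis using pos by (simp add: divide_le_eq)
    qed
    ultimately have w2: "l2_bounded I w2 (\<epsilon> / 2) ?g" by (rule l2_bounded_mono)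
    show ?case
      unfolding l2_bounded_def
    proof (intro allI impI)
      fix F assume F: "finite F" "F \<subseteq> I"
      have "(\<Sum>\<xi>\<in>F. gevrey_weight lam s A' \<xi> * (cmod (?g \<xi>))\<^sup>2)
          = (\<Sum>\<xi>\<in>F. w \<xi> * (cmod (?g \<xi>))\<^sup>2) + (\<Sum>\<xi>\<in>F. w2 \<xi> * (cmod (?g \<xi>))\<^sup>2)"
        unfolding sum.distrib[symmetric] w2_def by (intro sum.cong) (auto simp: algebra_simps)
      also have "\<dots> \<le> \<epsilon> / 2 + \<epsilon> / 2"
        using elim(1) w2 F unfolding l2_bounded_def by (intro add_mono) blast+
      finally show "(\<Sum>\<xi>\<in>F. gevrey_weight lam s A' \<xi> * (cmod (?g \<xi>))\<^sup>2) \<le> \<epsilon>" by simp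
    qed
  qed
qed

section \<open>All modes together\<close>

lemma l2_tendsto_cong:
  assumes "\<forall>\<^sub>F r in F. \<forall>\<xi>\<in>I. Y r \<xi> = Y' r \<xi>" "\<And>\<xi>. \<xi> \<in> I \<Longrightarrow> L \<xi> = L' \<xi>" "l2_tendsto I w Y L F"
  shows "l2_tendsto I w Y' L' F"
  unfolding l2_tendsto_def
proof (intro allI impI)
  fix \<epsilon> :: real assume "\<epsilon> > 0"
  then have "\<forall>\<^sub>F r in F. l2_bounded I w \<epsilon> (\<lambda>\<xi>. Y r \<xi> - L \<xi>)" using assms(3) unfolding l2_tendsto_def by simp
  with assms(1) show "\<forall>\<^sub>F r in F. l2_bounded I w \<epsilon> (\<lambda>\<xi>. Y' r \<xi> - L' \<xi>)"
  proof eventually_elim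
    case (elim r)
    have "l2_bounded I w \<epsilon> (\<lambda>\<xi>. Y' r \<xi> - L' \<xi>) = l2_bounded I w \<epsilon> (\<lambda>\<xi>. Y r \<xi> - L \<xi>)"
      by (rule l2_bounded_cong) (use elim(1) assms(2) in auto)
    then show ?case using elim(2) by simp
  qed
qed

lemma l2_bounded_unit:
  assumes "(cmod (g ()))\<^sup>2 \<le> B"
  shows "l2_bounded {()} (\<lambda>_. 1) B g"
  unfolding l2_bounded_def
proof (intro allI impI)
  fix F :: "unit set" assume "F \<subseteq> {()}"
  then consider "F = {}" | "F = {()}" by (auto dest: subset_singletonD)
  then show "(\<Sum>\<xi>\<in>F. 1 * (cmod (g \<xi>))\<^sup>2) \<le> B"
  proof cases
    case 1
    have "0 \<le> B" by (rule order_trans[OF zero_le_power2 assms])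
    then show ?thesis using 1 by simp
  next
    case 2
    then show ?thesis using assms by simp
  qed
qed

lemma tendsto_coordinate_if_l2_tendsto:
  assumes "l2_tendsto I w Y L F" "\<eta> \<in> I" "w \<eta> \<ge> 1"
  shows "((\<lambda>r. Y r \<eta>) \<longlongrightarrow> L \<eta>) F"
proof (rule tendstoI)
  fix e :: real assume e: "e > 0"
  have "\<forall>\<^sub>F r in F. l2_bounded I w ((e/2)\<^sup>2) (\<lambda>\<xi>. Y r \<xi> - L \<xi>)"
    using assms(1) e unfolding l2_tendsto_def by simp
  then show "\<forall>\<^sub>F r in F. dist (Y r \<eta>) (L \<eta>) < e"
  proof eventually_elim
    case (elim r)
    have "w \<eta> * (cmod (Y r \<eta> - L \<eta>))\<^sup>2 \<le> (e/2)\<^sup>2"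
      using elim[unfolded l2_bounded_def, rule_format, of "{\<eta>}"] assms(2) by simp
    moreover have "1 * (cmod (Y r \<eta> - L \<eta>))\<^sup>2 \<le> w \<eta> * (cmod (Y r \<eta> - L \<eta>))\<^sup>2"
      using assms(3) by (rule mult_right_mono) simp
    ultimately have "(cmod (Y r \<eta> - L \<eta>))\<^sup>2 \<le> (e/2)\<^sup>2" by linarith
    then have "cmod (Y r \<eta> - L \<eta>) \<le> e/2" by (rule power2_le_imp_le) (use e in simp)
    then show ?case using e unfolding dist_norm by simp
  qed
qed

lemma has_vector_derivative_quotient_iff:
  fixes f :: "real \<Rightarrow> complex"
  shows "(f has_vector_derivative D) (at t within S) \<longleftrightarrow>
     ((\<lambda>r. (f r - f t) / of_real (r - t)) \<longlongrightarrow> D) (at t within S)"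
proof -
  have eq: "cmod ((f r - f t) - (r - t) *\<^sub>R D) / norm (r - t) = cmod ((f r - f t) / of_real (r - t) - D)"
    if "r \<noteq> t" for r
  proof -
    have nz: "complex_of_real (r - t) \<noteq> 0" using that by simp
    have "((f r - f t) - (r - t) *\<^sub>R D) / of_real (r - t)
        = (f r - f t) / of_real (r - t) - of_real (r - t) * D / of_real (r - t)"
      by (simp only: diff_divide_distrib scaleR_conv_of_real)
    also have "of_real (r - t) * D / of_real (r - t) = D"
      using nz by (rule nonzero_mult_div_cancel_left)
    finally have "(f r - f t) / of_real (r - t) - D = ((f r - f t) - (r - t) *\<^sub>R D) / of_real (r - t)" ..
    then show ?thesis by (simp only: norm_divide norm_of_real real_norm_def)
  qed
  have "(f has_vector_derivative D) (at t within S) \<longleftrightarrow>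
      ((\<lambda>r. cmod ((f r - f t) - (r - t) *\<^sub>R D) / norm (r - t)) \<longlongrightarrow> 0) (at t within S)"
    unfolding has_vector_derivative_def has_derivative_iff_norm by (simp add: bounded_linear_scaleR_left)
  also have "\<dots> \<longleftrightarrow> ((\<lambda>r. cmod ((f r - f t) / of_real (r - t) - D)) \<longlongrightarrow> 0) (at t within S)"
    by (rule tendsto_cong, unfold eventually_at_filter) (intro always_eventually allI impI eq)
  also have "\<dots> \<longleftrightarrow> ((\<lambda>r. (f r - f t) / of_real (r - t) - D) \<longlongrightarrow> 0) (at t within S)"
    by (rule tendsto_norm_zero_iff)
  also have "\<dots> \<longleftrightarrow> ((\<lambda>r. (f r - f t) / of_real (r - t)) \<longlongrightarrow> D) (at t within S)"
    by (rule LIM_zero_iff)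
  finally show ?thesis .
qed

lemma lipschitz_if_integral:
  fixes h :: "real \<Rightarrow> complex"
  assumes h: "\<And>a b. 0 \<le> a \<Longrightarrow> b \<le> T \<Longrightarrow> h integrable_on {a..b}"
    and K: "\<And>t. t \<in> {0..T} \<Longrightarrow> cmod (h t) \<le> K" "K \<ge> 0"
  shows "K-lipschitz_on {0..T} (\<lambda>t. c + integral {0..t} h)"
proof (rule lipschitz_onI)
  fix r t assume rt: "r \<in> {0..T}" "t \<in> {0..T}"
  show "dist (c + integral {0..r} h) (c + integral {0..t} h) \<le> K * dist r t"
  proof (cases "r = t")
    case False
    let ?a = "min r t" and ?b = "max r t"
    have ab: "?a < ?b" "0 \<le> ?a" "?b \<le> T" using rt False by auto
    have "cmod (integral {?a..?b} h) \<le> integral {?a..?b} (\<lambda>_. K)"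
    proof (rule integral_norm_bound_integral)
      show "h integrable_on {?a..?b}" using ab by (intro h)
      fix x assume "x \<in> {?a..?b}"
      then have "x \<in> {0..T}" using ab(2,3) unfolding atLeastAtMost_iff by linarith
      then show "cmod (h x) \<le> K" by (rule K(1))
    qed (rule integrable_const_ivl)
    also have "\<dots> = K * (?b - ?a)" using ab by simp
    also have "?b - ?a = \<bar>r - t\<bar>" by auto
    finally have 1: "cmod (integral {?a..?b} h) \<le> K * \<bar>r - t\<bar>" .
    have "cmod ((integral {0..r} h - integral {0..t} h) / of_real (r - t))
        = cmod (integral {?a..?b} h / of_real (?b - ?a))"
      using increment_quotient[OF rt False h] by simp
    then have "cmod (integral {0..r} h - integral {0..t} h) / \<bar>r - t\<bar> = cmod (integral {?a..?b} h) / \<bar>?b - ?a\<bar>"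
      by (simp only: norm_divide norm_of_real)
    moreover have "\<bar>?b - ?a\<bar> = \<bar>r - t\<bar>" by auto
    ultimately have "cmod (integral {0..r} h - integral {0..t} h) = cmod (integral {?a..?b} h)"
      using False by simp
    then show ?thesis using 1 by (simp add: dist_norm)
  qed simp
qed (rule K)

text \<open>At a time where the integral of \<open>q\<close> is differentiable, so is the integral of \<open>q * y\<close>, by the result on
  difference quotients for a single index.\<close>

lemma mode_integral_solution:
  fixes a q :: "real \<Rightarrow> real" and m :: real and g :: "real \<Rightarrow> complex"
  assumes T: "T > 0" and a: "continuous_on {0..T} a"
    and q: "q \<in> borel_measurable (lebesgue_on {0..T})" "\<And>t. t \<in> {0..T} \<Longrightarrow> \<bar>q t\<bar> \<le> M"
    and g: "continuous_on {0..T} g"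
    and N: "\<And>t. t \<in> {0..T} - N \<Longrightarrow> ((\<lambda>t. integral {0..t} q) has_real_derivative q t) (at t within {0..T})"
  shows "\<exists>y y'. continuous_on {0..T} y \<and> continuous_on {0..T} y' \<and>
     (\<forall>t\<in>{0..T}. y t = y0 + integral {0..t} y') \<and>
     (\<forall>t\<in>{0..T}. y' t = y1 + integral {0..t} (\<lambda>\<sigma>. g \<sigma> - of_real (a \<sigma> * m) * y \<sigma>)
        - integral {0..t} (\<lambda>\<sigma>. of_real (q \<sigma>) * y \<sigma>)) \<and>
     mode_solution N T a m q g y y'"
proof -
  obtain A where A: "\<forall>t\<in>{0..T}. \<bar>a t\<bar> \<le> A"
    using compact_imp_bounded[OF compact_continuous_image[OF a compact_Icc]] unfolding bounded_iff by auto
  define p where "p t = a t * m + q t" for t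
  have am: "a \<in> borel_measurable (lebesgue_on {0..T})"
    using a by (intro continuous_imp_measurable_on_sets_lebesgue) auto
  have pm: "p \<in> borel_measurable (lebesgue_on {0..T})"
    unfolding p_def[abs_def] using am q(1) by (intro borel_measurable_add borel_measurable_times) auto
  have pb: "\<bar>p t\<bar> \<le> A * \<bar>m\<bar> + M" if t: "t \<in> {0..T}" for t
  proof -
    have "\<bar>p t\<bar> \<le> \<bar>a t\<bar> * \<bar>m\<bar> + \<bar>q t\<bar>" unfolding p_def by (metis abs_mult abs_triangle_ineq)
    also have "\<dots> \<le> A * \<bar>m\<bar> + M" using A t q(2)[OF t] by (intro add_mono mult_right_mono) auto
    finally show ?thesis .
  qed
  from mode_exists[OF T pm pb g, of y0 y1] obtain y y' where
    y: "continuous_on {0..T} y" "continuous_on {0..T} y'" "\<forall>t\<in>{0..T}. y t = y0 + integral {0..t} y'"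
    and y': "\<forall>t\<in>{0..T}. y' t = y1 + integral {0..t} (\<lambda>\<sigma>. g \<sigma> - of_real (p \<sigma>) * y \<sigma>)" by blast
  define Z where "Z \<sigma> = g \<sigma> - of_real (a \<sigma> * m) * y \<sigma>" for \<sigma>
  have Z: "continuous_on {0..T} Z" unfolding Z_def[abs_def] by (intro continuous_intros a g y)
  have Zint: "Z integrable_on {c..d}" if "0 \<le> c" "d \<le> T" for c d
    using that by (intro integrable_continuous_real continuous_on_subset[OF Z]) auto
  have qy: "(\<lambda>\<sigma>. of_real (q \<sigma>) * y \<sigma>) integrable_on {c..d}" if "0 \<le> c" "d \<le> T" for c d
    using integrable_bounded_mult[OF q y(1) that] .
  have Zq: "g \<sigma> - of_real (p \<sigma>) * y \<sigma> = Z \<sigma> - of_real (q \<sigma>) * y \<sigma>" for \<sigma>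
    unfolding Z_def p_def by (simp add: algebra_simps)
  have y'2: "y' t = y1 + integral {0..t} Z - integral {0..t} (\<lambda>\<sigma>. of_real (q \<sigma>) * y \<sigma>)" if "t \<in> {0..T}" for t
  proof -
    have "y' t = y1 + integral {0..t} (\<lambda>\<sigma>. Z \<sigma> - of_real (q \<sigma>) * y \<sigma>)" using y' that unfolding Zq by blast
    also have "integral {0..t} (\<lambda>\<sigma>. Z \<sigma> - of_real (q \<sigma>) * y \<sigma>) = integral {0..t} Z - integral {0..t} (\<lambda>\<sigma>. of_real (q \<sigma>) * y \<sigma>)"
      using that by (intro integral_diff Zint qy) auto
    finally show ?thesis by simp
  qed
  have yd: "(y has_vector_derivative y' t) (at t within {0..T})" if t: "t \<in> {0..T}" for t
  proof -
    have "((\<lambda>t. y0 + integral {0..t} y') has_vector_derivative 0 + y' t) (at t within {0..T})"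
      by (intro has_vector_derivative_add has_vector_derivative_const integral_has_vector_derivative y(2) t)
    then have "((\<lambda>t. y0 + integral {0..t} y') has_vector_derivative y' t) (at t within {0..T})" by simp
    then show ?thesis by (rule has_vector_derivative_transform[OF t, rotated]) (use y(3) in auto)
  qed
  have lip: "\<exists>L. L-lipschitz_on {0..T} y'"
  proof -
    obtain B where B: "\<forall>t\<in>{0..T}. cmod (y t) \<le> B"
      using compact_imp_bounded[OF compact_continuous_image[OF y(1) compact_Icc]] unfolding bounded_iff by auto
    obtain C where C: "\<forall>t\<in>{0..T}. cmod (Z t) \<le> C"
      using compact_imp_bounded[OF compact_continuous_image[OF Z compact_Icc]] unfolding bounded_iff by auto
    have bd: "cmod (g t - of_real (p t) * y t) \<le> C + M * B" if t: "t \<in> {0..T}" for t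
    proof -
      have "cmod (g t - of_real (p t) * y t) \<le> cmod (Z t) + \<bar>q t\<bar> * cmod (y t)"
        unfolding Zq using norm_triangle_ineq4[of "Z t" "of_real (q t) * y t"] by (simp add: norm_mult)
      also have "\<dots> \<le> C + M * B"
        using B C t q(2)[OF t] by (intro add_mono mult_mono) auto
      finally show ?thesis .
    qed
    have "(C + M * B)-lipschitz_on {0..T} (\<lambda>t. y1 + integral {0..t} (\<lambda>\<sigma>. g \<sigma> - of_real (p \<sigma>) * y \<sigma>))"
    proof (rule lipschitz_if_integral[OF _ bd])
      show "(\<lambda>\<sigma>. g \<sigma> - of_real (p \<sigma>) * y \<sigma>) integrable_on {c..d}" if "0 \<le> c" "d \<le> T" for c d
        unfolding Zq by (rule integrable_diff[OF Zint[OF that] qy[OF that]])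
      show "0 \<le> C + M * B" using bd[of 0] T by (meson atLeastAtMost_iff less_imp_le norm_ge_zero order.refl order_trans)
    qed
    then have "(C + M * B)-lipschitz_on {0..T} y'"
      by (rule lipschitz_on_transform) (use y' in auto)
    then show ?thesis by blast
  qed
  have y'd: "(y' has_vector_derivative g t - of_real (a t * m + q t) * y t) (at t within {0..T})" if t: "t \<in> {0..T} - N" for t
  proof -
    have t': "t \<in> {0..T}" using t by simp
    have "l2_tendsto {()} (\<lambda>_. 1) (\<lambda>r _. (integral {0..r} (\<lambda>\<sigma>. of_real (q \<sigma>) * y \<sigma>) - integral {0..t} (\<lambda>\<sigma>. of_real (q \<sigma>) * y \<sigma>)) / of_real (r - t))
           (\<lambda>_. of_real (q t) * y t) (at t within {0..T})"
    proof (rule l2_tendsto_diff_quotient_integral[where Z = "\<lambda>t _. y t", OF _ y(1) q t' N[OF t]])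
      have y0: "((\<lambda>r. y r) \<longlongrightarrow> y t) (at t within {0..T})" using y(1) t' unfolding continuous_on by blast
      show "l2_tendsto {()} (\<lambda>_. 1) (\<lambda>t _. y t) (\<lambda>_. y t) (at t within {0..T})"
        unfolding l2_tendsto_def
      proof (intro allI impI)
        fix \<epsilon> :: real assume \<epsilon>: "\<epsilon> > 0"
        have "((\<lambda>r. (cmod (y r - y t))\<^sup>2) \<longlongrightarrow> (cmod (y t - y t))\<^sup>2) (at t within {0..T})" by (intro tendsto_intros y0)
        then have "\<forall>\<^sub>F r in at t within {0..T}. (cmod (y r - y t))\<^sup>2 < \<epsilon>" by (rule order_tendstoD) (use \<epsilon> in simp)
        then show "\<forall>\<^sub>F r in at t within {0..T}. l2_bounded {()} (\<lambda>_. 1) \<epsilon> (\<lambda>\<xi>. y r - y t)"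
          by eventually_elim (rule l2_bounded_unit, simp)
      qed
      show "l2_bounded {()} (\<lambda>_. 1) ((cmod (y t))\<^sup>2) (\<lambda>_. y t)" by (rule l2_bounded_unit) simp
    qed auto
    from tendsto_coordinate_if_l2_tendsto[OF this, of "()"]
    have "((\<lambda>t. integral {0..t} (\<lambda>\<sigma>. of_real (q \<sigma>) * y \<sigma>)) has_vector_derivative of_real (q t) * y t) (at t within {0..T})"
      unfolding has_vector_derivative_quotient_iff by simp
    moreover have "((\<lambda>t. integral {0..t} Z) has_vector_derivative Z t) (at t within {0..T})"
      by (rule integral_has_vector_derivative[OF Z t'])
    ultimately have "((\<lambda>t. y1 + integral {0..t} Z - integral {0..t} (\<lambda>\<sigma>. of_real (q \<sigma>) * y \<sigma>)) has_vector_derivative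
        0 + Z t - of_real (q t) * y t) (at t within {0..T})"
      by (intro has_vector_derivative_diff has_vector_derivative_add has_vector_derivative_const)
    then have "(y' has_vector_derivative 0 + Z t - of_real (q t) * y t) (at t within {0..T})"
      by (rule has_vector_derivative_transform[OF t', rotated]) (use y'2 in auto)
    then show ?thesis unfolding Z_def by (simp add: algebra_simps)
  qed
  have "mode_solution N T a m q g y y'" unfolding mode_solution_def using yd lip y'd by blast
  then show ?thesis using y y'2 unfolding Z_def[abs_def] by blast
qed

text \<open>The energy estimate loses a factor \<open>exp (A * X \<xi> powr \<rho>)\<close>, which is the passage from
  the weight with parameter \<open>A\<close> to that with parameter \<open>A / 2\<close>, and it gives a summable majorant that does not
  depend on time. Dominated convergence then yields continuity of \<open>y\<close>, \<open>y'\<close> and \<open>\<mu> * y\<close> in the weighted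
  norm, and with it the convergence of difference quotients.\<close>

lemma coefficient_solution:
  fixes d :: "nat \<Rightarrow> real \<Rightarrow> real" and l :: nat and \<rho> M c T A :: real and q :: "real \<Rightarrow> real"
    and X \<mu> :: "'i \<Rightarrow> real" and \<Phi> :: "real \<Rightarrow> 'i \<Rightarrow> complex" and c0 c1 :: "'i \<Rightarrow> complex"
  defines "e \<equiv> (\<lambda>A \<xi>. exp (2 * A * X \<xi> powr \<rho>))"
  assumes l: "l \<ge> 2" and T: "T > 0"
    and cont: "\<And>j. j \<le> l \<Longrightarrow> continuous_on {0..T} (d j)"
    and der: "\<And>j t. j < l \<Longrightarrow> t \<in> {0..T} \<Longrightarrow> (d j has_real_derivative d (Suc j) t) (at t within {0..T})"
    and nonneg: "\<And>t. t \<in> {0..T} \<Longrightarrow> d 0 t \<ge> 0"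
    and \<rho>: "0 < \<rho>" "\<rho> \<le> 1" "2 < \<rho> * (real l + 2)" and c: "c \<ge> 0"
    and X: "\<And>\<xi>. \<xi> \<in> I \<Longrightarrow> X \<xi> \<ge> 1" and \<mu>: "\<And>\<xi>. \<xi> \<in> I \<Longrightarrow> 0 \<le> \<mu> \<xi> \<and> \<mu> \<xi> \<le> c * (X \<xi>)\<^sup>2"
    and q: "q \<in> borel_measurable (lebesgue_on {0..T})" "\<And>t. t \<in> {0..T} \<Longrightarrow> \<bar>q t\<bar> \<le> M"
    and N: "negligible N" "\<And>t. t \<in> {0..T} - N \<Longrightarrow> ((\<lambda>t. integral {0..t} q) has_real_derivative q t) (at t within {0..T})"
    and A: "A > 0" and c01: "l2_bounded I (e A) B0 c0" "l2_bounded I (e A) B1 c1"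
    and \<Phi>B: "\<And>t. t \<in> {0..T} \<Longrightarrow> l2_bounded I (e A) B (\<Phi> t)"
    and \<Phi>c: "\<And>\<xi>. \<xi> \<in> I \<Longrightarrow> continuous_on {0..T} (\<lambda>t. \<Phi> t \<xi>)"
    and \<Phi>l: "\<And>t. t \<in> {0..T} \<Longrightarrow> l2_tendsto I (e (A/2)) \<Phi> (\<Phi> t) (at t within {0..T})"
  shows "\<exists>y y' C. (\<forall>\<xi>\<in>I. mode_solution N T (d 0) (\<mu> \<xi>) q (\<lambda>t. \<Phi> t \<xi>) (\<lambda>t. y t \<xi>) (\<lambda>t. y' t \<xi>) \<and>
        y 0 \<xi> = c0 \<xi> \<and> y' 0 \<xi> = c1 \<xi>) \<and>
     (\<forall>t\<in>{0..T}. l2_bounded I (e (A/2)) C (y t) \<and> l2_bounded I (e (A/2)) C (y' t) \<and>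
        l2_bounded I (e (A/2)) C (\<lambda>\<xi>. \<Phi> t \<xi> - of_real (d 0 t * \<mu> \<xi> + q t) * y t \<xi>) \<and>
        l2_tendsto I (e (A/2)) y (y t) (at t within {0..T}) \<and> l2_tendsto I (e (A/2)) y' (y' t) (at t within {0..T}) \<and>
        l2_tendsto I (e (A/2)) (\<lambda>r \<xi>. (y r \<xi> - y t \<xi>) / of_real (r - t)) (y' t) (at t within {0..T})) \<and>
     (\<forall>t\<in>{0..T} - N. l2_tendsto I (e (A/2)) (\<lambda>r \<xi>. (y' r \<xi> - y' t \<xi>) / of_real (r - t))
        (\<lambda>\<xi>. \<Phi> t \<xi> - of_real (d 0 t * \<mu> \<xi> + q t) * y t \<xi>) (at t within {0..T})) \<and>
     (\<forall>t\<in>{0..T}. \<forall>r\<in>{0..T}. r \<noteq> t \<longrightarrow> l2_bounded I (e (A/2)) C (\<lambda>\<xi>. (y' r \<xi> - y' t \<xi>) / of_real (r - t))) \<and>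
     (continuous_on {0..T} q \<longrightarrow> (\<forall>t\<in>{0..T}. l2_tendsto I (e (A/2))
        (\<lambda>r \<xi>. \<Phi> r \<xi> - of_real (d 0 r * \<mu> \<xi> + q r) * y r \<xi>)
        (\<lambda>\<xi>. \<Phi> t \<xi> - of_real (d 0 t * \<mu> \<xi> + q t) * y t \<xi>) (at t within {0..T})))"
proof -
  let ?a = "d 0" and ?w = "e (A/2)"
  have w0: "\<And>\<xi>. \<xi> \<in> I \<Longrightarrow> ?w \<xi> \<ge> 0" unfolding e_def by simp
  have M0: "M \<ge> 0" using q(2)[of 0] T by auto
  have ac: "continuous_on {0..T} ?a" using cont[of 0] by simp
  have inT: "\<forall>\<^sub>F r in at t within {0..T}. r \<in> {0..T}" for t :: real by (auto simp: eventually_at_filter)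
  obtain Aa where Aa: "\<forall>t\<in>{0..T}. \<bar>?a t\<bar> \<le> Aa"
    using compact_imp_bounded[OF compact_continuous_image[OF ac compact_Icc]] unfolding bounded_iff by auto
  have "\<forall>\<xi>\<in>I. \<exists>p. continuous_on {0..T} (fst p) \<and> continuous_on {0..T} (snd p) \<and>
     (\<forall>t\<in>{0..T}. fst p t = c0 \<xi> + integral {0..t} (snd p)) \<and>
     (\<forall>t\<in>{0..T}. snd p t = c1 \<xi> + integral {0..t} (\<lambda>\<sigma>. \<Phi> \<sigma> \<xi> - of_real (?a \<sigma> * \<mu> \<xi>) * fst p \<sigma>)
        - integral {0..t} (\<lambda>\<sigma>. of_real (q \<sigma>) * fst p \<sigma>)) \<and>
     mode_solution N T ?a (\<mu> \<xi>) q (\<lambda>t. \<Phi> t \<xi>) (fst p) (snd p)"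
  proof
    fix \<xi> assume \<xi>: "\<xi> \<in> I"
    from mode_integral_solution[OF T ac q \<Phi>c[OF \<xi>] N(2), where ?y0.0 = "c0 \<xi>" and ?y1.0 = "c1 \<xi>" and m = "\<mu> \<xi>"]
    obtain y y' where "continuous_on {0..T} y \<and> continuous_on {0..T} y' \<and>
     (\<forall>t\<in>{0..T}. y t = c0 \<xi> + integral {0..t} y') \<and>
     (\<forall>t\<in>{0..T}. y' t = c1 \<xi> + integral {0..t} (\<lambda>\<sigma>. \<Phi> \<sigma> \<xi> - of_real (?a \<sigma> * \<mu> \<xi>) * y \<sigma>)
        - integral {0..t} (\<lambda>\<sigma>. of_real (q \<sigma>) * y \<sigma>)) \<and>
     mode_solution N T ?a (\<mu> \<xi>) q (\<lambda>t. \<Phi> t \<xi>) y y'" by blast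
    then show "\<exists>p. continuous_on {0..T} (fst p) \<and> continuous_on {0..T} (snd p) \<and>
     (\<forall>t\<in>{0..T}. fst p t = c0 \<xi> + integral {0..t} (snd p)) \<and>
     (\<forall>t\<in>{0..T}. snd p t = c1 \<xi> + integral {0..t} (\<lambda>\<sigma>. \<Phi> \<sigma> \<xi> - of_real (?a \<sigma> * \<mu> \<xi>) * fst p \<sigma>)
        - integral {0..t} (\<lambda>\<sigma>. of_real (q \<sigma>) * fst p \<sigma>)) \<and>
     mode_solution N T ?a (\<mu> \<xi>) q (\<lambda>t. \<Phi> t \<xi>) (fst p) (snd p)"
      by (intro exI[of _ "(y, y')"]) simp
  qed
  from bchoice[OF this] obtain p where p: "\<forall>\<xi>\<in>I. continuous_on {0..T} (fst (p \<xi>)) \<and> continuous_on {0..T} (snd (p \<xi>)) \<and>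
     (\<forall>t\<in>{0..T}. fst (p \<xi>) t = c0 \<xi> + integral {0..t} (snd (p \<xi>))) \<and>
     (\<forall>t\<in>{0..T}. snd (p \<xi>) t = c1 \<xi> + integral {0..t} (\<lambda>\<sigma>. \<Phi> \<sigma> \<xi> - of_real (?a \<sigma> * \<mu> \<xi>) * fst (p \<xi>) \<sigma>)
        - integral {0..t} (\<lambda>\<sigma>. of_real (q \<sigma>) * fst (p \<xi>) \<sigma>)) \<and>
     mode_solution N T ?a (\<mu> \<xi>) q (\<lambda>t. \<Phi> t \<xi>) (fst (p \<xi>)) (snd (p \<xi>))" ..
  define y where "y t \<xi> = fst (p \<xi>) t" for t \<xi>
  define y' where "y' t \<xi> = snd (p \<xi>) t" for t \<xi>
  have ye: "(\<lambda>t. y t \<xi>) = fst (p \<xi>)" "(\<lambda>t. y' t \<xi>) = snd (p \<xi>)" for \<xi> unfolding y_def y'_def by auto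
  have yc: "continuous_on {0..T} (\<lambda>t. y t \<xi>)" "continuous_on {0..T} (\<lambda>t. y' t \<xi>)" if "\<xi> \<in> I" for \<xi>
    unfolding ye using p that by blast+
  have yi: "y t \<xi> = c0 \<xi> + integral {0..t} (\<lambda>\<sigma>. y' \<sigma> \<xi>)" if "\<xi> \<in> I" "t \<in> {0..T}" for \<xi> t
    using p that unfolding ye unfolding y_def by blast
  define Z where "Z t \<xi> = \<Phi> t \<xi> - of_real (?a t * \<mu> \<xi>) * y t \<xi>" for t \<xi>
  have y'i: "y' t \<xi> = c1 \<xi> + integral {0..t} (\<lambda>\<sigma>. Z \<sigma> \<xi>) - integral {0..t} (\<lambda>\<sigma>. of_real (q \<sigma>) * y \<sigma> \<xi>)"
    if "\<xi> \<in> I" "t \<in> {0..T}" for \<xi> t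
    using p that unfolding Z_def y_def y'_def by blast
  have ms: "mode_solution N T ?a (\<mu> \<xi>) q (\<lambda>t. \<Phi> t \<xi>) (\<lambda>t. y t \<xi>) (\<lambda>t. y' t \<xi>)" if "\<xi> \<in> I" for \<xi>
    unfolding ye using p that by blast
  have init: "y 0 \<xi> = c0 \<xi>" "y' 0 \<xi> = c1 \<xi>" if "\<xi> \<in> I" for \<xi>
    using yi[OF that, of 0] y'i[OF that, of 0] T by auto
  have Zc: "continuous_on {0..T} (\<lambda>t. Z t \<xi>)" if "\<xi> \<in> I" for \<xi>
    unfolding Z_def by (intro continuous_intros \<Phi>c ac yc that)
  have y''Z: "\<Phi> t \<xi> - of_real (?a t * \<mu> \<xi> + q t) * y t \<xi> = Z t \<xi> + (-1) * (of_real (q t) * y t \<xi>)" for t \<xi>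
    unfolding Z_def by (simp add: algebra_simps)
  \<comment> \<open>a majorant that does not depend on time\<close>
  obtain C where C: "C \<ge> 0" and bound: "\<forall>X m q g y y' N t. 1 \<le> X \<longrightarrow> 0 \<le> m \<longrightarrow> m \<le> c * X\<^sup>2 \<longrightarrow> continuous_on {0..T} g \<longrightarrow>
      negligible N \<longrightarrow> (\<forall>t\<in>{0..T} - N. \<bar>q t\<bar> \<le> M) \<longrightarrow> mode_solution N T (d 0) m q g y y' \<longrightarrow> t \<in> {0..T} \<longrightarrow>
      X ^ 4 * ((cmod (y' t))\<^sup>2 + (cmod (y t))\<^sup>2)
        \<le> C * exp (A * X powr \<rho>) * ((cmod (y 0))\<^sup>2 + (cmod (y' 0))\<^sup>2 + integral {0..T} (\<lambda>t. (cmod (g t))\<^sup>2))"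
    using gevrey_mode_bound[of l T d \<rho> A M c, OF l T cont der nonneg \<rho> A M0 c] by blast
  define G where "G \<xi> = (cmod (c0 \<xi>))\<^sup>2 + (cmod (c1 \<xi>))\<^sup>2 + integral {0..T} (\<lambda>t. (cmod (\<Phi> t \<xi>))\<^sup>2)" for \<xi>
  define D0 where "D0 \<xi> = C * (e A \<xi> * G \<xi>)" for \<xi>
  define D where "D \<xi> = (1 + c\<^sup>2) * D0 \<xi>" for \<xi>
  have \<Phi>i: "(\<lambda>t. (cmod (\<Phi> t \<xi>))\<^sup>2) integrable_on {0..T}" if "\<xi> \<in> I" for \<xi>
    by (intro integrable_continuous_real continuous_intros \<Phi>c that)
  have G0: "G \<xi> \<ge> 0" if "\<xi> \<in> I" for \<xi>
    unfolding G_def using \<Phi>i[OF that] by (intro add_nonneg_nonneg integral_nonneg) auto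
  have D00: "D0 \<xi> \<ge> 0" if "\<xi> \<in> I" for \<xi> unfolding D0_def e_def using C G0[OF that] by simp
  have D0D: "D0 \<xi> \<le> D \<xi>" "c\<^sup>2 * D0 \<xi> \<le> D \<xi>" if "\<xi> \<in> I" for \<xi>
    unfolding D_def using D00[OF that] by (auto simp: distrib_right)
  have Dn: "D \<xi> \<ge> 0" if "\<xi> \<in> I" for \<xi> unfolding D_def using D00[OF that] by simp
  have "(\<lambda>\<xi>. e A \<xi> * G \<xi>) summable_on I"
  proof (rule nonneg_bdd_above_summable_on)
    show "0 \<le> e A \<xi> * G \<xi>" if "\<xi> \<in> I" for \<xi> unfolding e_def using G0[OF that] by simp
    have "(\<Sum>\<xi>\<in>F. e A \<xi> * G \<xi>) \<le> B0 + B1 + T * B" if F: "finite F" "F \<subseteq> I" for F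
    proof -
      have "(\<Sum>\<xi>\<in>F. e A \<xi> * integral {0..T} (\<lambda>t. (cmod (\<Phi> t \<xi>))\<^sup>2))
          = integral {0..T} (\<lambda>t. \<Sum>\<xi>\<in>F. e A \<xi> * (cmod (\<Phi> t \<xi>))\<^sup>2)"
        using F by (subst integral_sum) (auto intro!: integrable_on_mult_right \<Phi>i)
      also have "\<dots> \<le> integral {0..T} (\<lambda>t. B)"
      proof (rule integral_le)
        show "(\<lambda>t. \<Sum>\<xi>\<in>F. e A \<xi> * (cmod (\<Phi> t \<xi>))\<^sup>2) integrable_on {0..T}"
          using F by (intro integrable_sum integrable_on_mult_right[OF \<Phi>i]) auto
        show "(\<Sum>\<xi>\<in>F. e A \<xi> * (cmod (\<Phi> t \<xi>))\<^sup>2) \<le> B" if "t \<in> {0..T}" for t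
          using \<Phi>B[OF that, unfolded l2_bounded_def] F by blast
      qed (rule integrable_const_ivl)
      also have "\<dots> = T * B" using T by simp
      finally have 3: "(\<Sum>\<xi>\<in>F. e A \<xi> * integral {0..T} (\<lambda>t. (cmod (\<Phi> t \<xi>))\<^sup>2)) \<le> T * B" .
      have 1: "(\<Sum>\<xi>\<in>F. e A \<xi> * (cmod (c0 \<xi>))\<^sup>2) \<le> B0" using c01(1)[unfolded l2_bounded_def] F by blast
      have 2: "(\<Sum>\<xi>\<in>F. e A \<xi> * (cmod (c1 \<xi>))\<^sup>2) \<le> B1" using c01(2)[unfolded l2_bounded_def] F by blast
      show ?thesis unfolding G_def distrib_left sum.distrib using 1 2 3 by linarith
    qed
    then show "bdd_above (sum (\<lambda>\<xi>. e A \<xi> * G \<xi>) ` {F. F \<subseteq> I \<and> finite F})"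
      by (intro bdd_aboveI[of _ "B0 + B1 + T * B"]) auto
  qed
  then have Ds: "D summable_on I"
    unfolding D_def D0_def by (intro summable_on_cmult_right)
  have key: "?w \<xi> * ((X \<xi>) ^ 4 * ((cmod (y' t \<xi>))\<^sup>2 + (cmod (y t \<xi>))\<^sup>2)) \<le> D0 \<xi>" if \<xi>: "\<xi> \<in> I" and t: "t \<in> {0..T}" for \<xi> t
  proof -
    have "X \<xi> ^ 4 * ((cmod (y' t \<xi>))\<^sup>2 + (cmod (y t \<xi>))\<^sup>2) \<le> C * exp (A * X \<xi> powr \<rho>) *
        ((cmod (y 0 \<xi>))\<^sup>2 + (cmod (y' 0 \<xi>))\<^sup>2 + integral {0..T} (\<lambda>t. (cmod (\<Phi> t \<xi>))\<^sup>2))"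
    proof (rule bound[rule_format, where m = "\<mu> \<xi>" and q = q and N = N])
      show "mode_solution N T (d 0) (\<mu> \<xi>) q (\<lambda>t. \<Phi> t \<xi>) (\<lambda>t. y t \<xi>) (\<lambda>t. y' t \<xi>)" by (rule ms[OF \<xi>])
    qed (use X[OF \<xi>] \<mu>[OF \<xi>] \<Phi>c[OF \<xi>] N(1) q(2) t in auto)
    then have "X \<xi> ^ 4 * ((cmod (y' t \<xi>))\<^sup>2 + (cmod (y t \<xi>))\<^sup>2) \<le> C * exp (A * X \<xi> powr \<rho>) * G \<xi>"
      unfolding G_def init[OF \<xi>] .
    then have "?w \<xi> * (X \<xi> ^ 4 * ((cmod (y' t \<xi>))\<^sup>2 + (cmod (y t \<xi>))\<^sup>2)) \<le> ?w \<xi> * (C * exp (A * X \<xi> powr \<rho>) * G \<xi>)"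
      using w0[OF \<xi>] by (rule mult_left_mono)
    also have "\<dots> = C * ((exp (A * X \<xi> powr \<rho>) * exp (A * X \<xi> powr \<rho>)) * G \<xi>)"
      unfolding e_def by simp
    also have "exp (A * X \<xi> powr \<rho>) * exp (A * X \<xi> powr \<rho>) = e A \<xi>"
      unfolding e_def exp_add[symmetric] by simp
    finally show ?thesis unfolding D0_def .
  qed
  have X4: "1 \<le> (X \<xi>) ^ 4" if "\<xi> \<in> I" for \<xi> using X[OF that] by (rule one_le_power)
  have dy: "?w \<xi> * (cmod (y t \<xi>))\<^sup>2 \<le> D \<xi>" and dy': "?w \<xi> * (cmod (y' t \<xi>))\<^sup>2 \<le> D \<xi>"
    and dmy: "?w \<xi> * (cmod (of_real (\<mu> \<xi>) * y t \<xi>))\<^sup>2 \<le> D \<xi>" if \<xi>: "\<xi> \<in> I" and t: "t \<in> {0..T}" for \<xi> t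
  proof -
    let ?S = "(cmod (y' t \<xi>))\<^sup>2 + (cmod (y t \<xi>))\<^sup>2"
    have "1 * ?S \<le> X \<xi> ^ 4 * ?S" using X4[OF \<xi>] by (intro mult_right_mono) auto
    then have "?w \<xi> * ?S \<le> ?w \<xi> * (X \<xi> ^ 4 * ?S)" using w0[OF \<xi>] by (intro mult_left_mono) auto
    then have S: "?w \<xi> * ?S \<le> D \<xi>" using key[OF \<xi> t] D0D(1)[OF \<xi>] by linarith
    have "?w \<xi> * (cmod (y t \<xi>))\<^sup>2 \<le> ?w \<xi> * ?S" "?w \<xi> * (cmod (y' t \<xi>))\<^sup>2 \<le> ?w \<xi> * ?S"
      using w0[OF \<xi>] by (auto intro!: mult_left_mono)
    then show "?w \<xi> * (cmod (y t \<xi>))\<^sup>2 \<le> D \<xi>" "?w \<xi> * (cmod (y' t \<xi>))\<^sup>2 \<le> D \<xi>" using S by auto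
    have "(\<mu> \<xi>)\<^sup>2 \<le> (c * (X \<xi>)\<^sup>2)\<^sup>2" using \<mu>[OF \<xi>] by (intro power_mono) auto
    also have "\<dots> = c\<^sup>2 * X \<xi> ^ 4" by (simp add: power_mult_distrib)
    finally have \<mu>2: "(\<mu> \<xi>)\<^sup>2 \<le> c\<^sup>2 * X \<xi> ^ 4" .
    have "(cmod (of_real (\<mu> \<xi>) * y t \<xi>))\<^sup>2 = (\<mu> \<xi>)\<^sup>2 * (cmod (y t \<xi>))\<^sup>2"
      by (simp add: norm_mult power_mult_distrib)
    also have "\<dots> \<le> c\<^sup>2 * X \<xi> ^ 4 * ?S" using \<mu>2 X4[OF \<xi>] by (intro mult_mono) auto
    finally have "?w \<xi> * (cmod (of_real (\<mu> \<xi>) * y t \<xi>))\<^sup>2 \<le> ?w \<xi> * (c\<^sup>2 * X \<xi> ^ 4 * ?S)"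
      using w0[OF \<xi>] by (rule mult_left_mono)
    also have "\<dots> = c\<^sup>2 * (?w \<xi> * (X \<xi> ^ 4 * ?S))" by simp
    also have "\<dots> \<le> c\<^sup>2 * D0 \<xi>" using key[OF \<xi> t] by (rule mult_left_mono) simp
    also have "\<dots> \<le> D \<xi>" by (rule D0D(2)[OF \<xi>])
    finally show "?w \<xi> * (cmod (of_real (\<mu> \<xi>) * y t \<xi>))\<^sup>2 \<le> D \<xi>" .
  qed
  define BD where "BD = infsum D I"
  have bdy: "l2_bounded I ?w BD (y t)" and bdy': "l2_bounded I ?w BD (y' t)" and bmy: "l2_bounded I ?w BD (\<lambda>\<xi>. of_real (\<mu> \<xi>) * y t \<xi>)"
    if t: "t \<in> {0..T}" for t
    unfolding BD_def by (rule l2_bounded_if_dominated[OF _ Ds Dn]; use dy dy' dmy t in blast)+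
  have BD0: "BD \<ge> 0" using l2_bounded_nonneg[OF bdy[of 0]] T by simp
  have b\<Phi>: "l2_bounded I ?w B (\<Phi> t)" if t: "t \<in> {0..T}" for t
  proof -
    have "l2_bounded I ?w (1 * B) (\<Phi> t)"
      by (rule l2_bounded_weight_mono[OF \<Phi>B[OF t]]) (use A in \<open>simp_all add: e_def\<close>)
    then show ?thesis by simp
  qed
  have B00: "B \<ge> 0" using l2_bounded_nonneg[OF b\<Phi>[of 0]] T by simp
  define BZ where "BZ = 2 * B + 2 * Aa\<^sup>2 * BD"
  have Zl: "Z t = (\<lambda>\<xi>. 1 * \<Phi> t \<xi> + (- of_real (?a t)) * (of_real (\<mu> \<xi>) * y t \<xi>))" for t
    unfolding Z_def by (auto simp: algebra_simps)
  have bZ: "l2_bounded I ?w BZ (Z t)" if t: "t \<in> {0..T}" for t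
  proof -
    have "l2_bounded I ?w (2 * (cmod 1)\<^sup>2 * B + 2 * (cmod (- of_real (?a t)))\<^sup>2 * BD) (Z t)"
      unfolding Zl by (intro l2_bounded_lincomb w0 b\<Phi> bmy t)
    moreover have "(?a t)\<^sup>2 \<le> Aa\<^sup>2" using Aa t by (simp add: abs_le_square_iff[symmetric] abs_le_iff) force
    then have "2 * (cmod 1)\<^sup>2 * B + 2 * (cmod (- of_real (?a t)))\<^sup>2 * BD \<le> BZ"
      unfolding BZ_def using BD0 by (simp add: mult_right_mono)
    ultimately show ?thesis by (rule l2_bounded_mono)
  qed
  have BZ0: "BZ \<ge> 0" unfolding BZ_def using B00 BD0 by simp
  define CC where "CC = BD + (2 * BZ + 2 * (M\<^sup>2 * BD))"
  have CC: "BD \<le> CC" "2 * BZ + 2 * (M\<^sup>2 * BD) \<le> CC" unfolding CC_def using BZ0 BD0 by auto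
  have comb: "l2_bounded I ?w CC (\<lambda>\<xi>. f \<xi> + (-1) * g \<xi>)" if "l2_bounded I ?w BZ f" "l2_bounded I ?w (M\<^sup>2 * BD) g" for f g
  proof -
    have "l2_bounded I ?w (2 * (cmod 1)\<^sup>2 * BZ + 2 * (cmod (-1))\<^sup>2 * (M\<^sup>2 * BD)) (\<lambda>\<xi>. 1 * f \<xi> + (-1) * g \<xi>)"
      using that by (intro l2_bounded_lincomb w0)
    then have "l2_bounded I ?w (2 * BZ + 2 * (M\<^sup>2 * BD)) (\<lambda>\<xi>. f \<xi> + (-1) * g \<xi>)" by simp
    then show ?thesis using CC(2) by (rule l2_bounded_mono)
  qed
  have bqy: "l2_bounded I ?w (M\<^sup>2 * BD) (\<lambda>\<xi>. of_real (q t) * y t \<xi>)" if t: "t \<in> {0..T}" for t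
  proof -
    have "l2_bounded I ?w ((cmod (of_real (q t)))\<^sup>2 * BD) (\<lambda>\<xi>. of_real (q t) * y t \<xi>)" by (intro l2_bounded_cmult bdy t)
    moreover have "(q t)\<^sup>2 \<le> M\<^sup>2" using q(2)[OF t] M0 by (simp add: abs_le_square_iff[symmetric])
    then have "(cmod (of_real (q t)))\<^sup>2 * BD \<le> M\<^sup>2 * BD" using BD0 by (simp add: mult_right_mono)
    ultimately show ?thesis by (rule l2_bounded_mono)
  qed
  have bdy'': "l2_bounded I ?w CC (\<lambda>\<xi>. \<Phi> t \<xi> - of_real (?a t * \<mu> \<xi> + q t) * y t \<xi>)" if t: "t \<in> {0..T}" for t
    unfolding y''Z by (rule comb[OF bZ[OF t] bqy[OF t]])
  have ly: "l2_tendsto I ?w y (y t) (at t within {0..T})" and ly': "l2_tendsto I ?w y' (y' t) (at t within {0..T})"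
    and lmy: "l2_tendsto I ?w (\<lambda>r \<xi>. of_real (\<mu> \<xi>) * y r \<xi>) (\<lambda>\<xi>. of_real (\<mu> \<xi>) * y t \<xi>) (at t within {0..T})"
    if t: "t \<in> {0..T}" for t
  proof -
    have ty: "((\<lambda>r. y r \<xi>) \<longlongrightarrow> y t \<xi>) (at t within {0..T})" "((\<lambda>r. y' r \<xi>) \<longlongrightarrow> y' t \<xi>) (at t within {0..T})"
      if "\<xi> \<in> I" for \<xi> using yc[OF that] t unfolding continuous_on by blast+
    show "l2_tendsto I ?w y (y t) (at t within {0..T})"
      by (rule l2_tendsto_dominated[OF w0 Ds ty(1)]) (use inT[of t] in \<open>auto elim!: eventually_mono intro: dy t\<close>)
    show "l2_tendsto I ?w y' (y' t) (at t within {0..T})"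
      by (rule l2_tendsto_dominated[OF w0 Ds ty(2)]) (use inT[of t] in \<open>auto elim!: eventually_mono intro: dy' t\<close>)
    show "l2_tendsto I ?w (\<lambda>r \<xi>. of_real (\<mu> \<xi>) * y r \<xi>) (\<lambda>\<xi>. of_real (\<mu> \<xi>) * y t \<xi>) (at t within {0..T})"
      by (rule l2_tendsto_dominated[OF w0 Ds tendsto_mult_left[OF ty(1)]])
        (use inT[of t] in \<open>auto elim!: eventually_mono intro: dmy t\<close>)
  qed
  have lZ: "l2_tendsto I ?w Z (Z t) (at t within {0..T})" if t: "t \<in> {0..T}" for t
  proof -
    have "((\<lambda>r. - complex_of_real (?a r)) \<longlongrightarrow> - of_real (?a t)) (at t within {0..T})"
      using ac t unfolding continuous_on by (intro tendsto_intros) auto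
    from l2_tendsto_scale[OF w0 this lmy[OF t] bmy[OF t]]
    have "l2_tendsto I ?w (\<lambda>r \<xi>. \<Phi> r \<xi> + (- of_real (?a r)) * (of_real (\<mu> \<xi>) * y r \<xi>))
        (\<lambda>\<xi>. \<Phi> t \<xi> + (- of_real (?a t)) * (of_real (\<mu> \<xi>) * y t \<xi>)) (at t within {0..T})"
      by (intro l2_tendsto_add[OF w0 \<Phi>l[OF t]])
    then show ?thesis unfolding Zl mult_1 .
  qed
  have one: "(\<lambda>_. 1::real) \<in> borel_measurable (lebesgue_on {0..T})" "\<And>t. t \<in> {0..T} \<Longrightarrow> \<bar>1::real\<bar> \<le> 1"
    "((\<lambda>t. integral {0..t} (\<lambda>_. 1::real)) has_real_derivative 1) (at t within {0..T})" if "t \<in> {0..T}" for t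
    using integral_has_real_derivative[of 0 T "\<lambda>_. 1" t] that by auto
  have dqy: "l2_tendsto I ?w (\<lambda>r \<xi>. (y r \<xi> - y t \<xi>) / of_real (r - t)) (y' t) (at t within {0..T})" if t: "t \<in> {0..T}" for t
  proof -
    from l2_tendsto_diff_quotient_integral[OF w0 yc(2) one(1)[OF t] one(2)[OF t] t one(3)[OF t] ly'[OF t] bdy'[OF t]]
    have "l2_tendsto I ?w (\<lambda>r \<xi>. (integral {0..r} (\<lambda>\<sigma>. y' \<sigma> \<xi>) - integral {0..t} (\<lambda>\<sigma>. y' \<sigma> \<xi>)) / of_real (r - t)) (y' t) (at t within {0..T})"
      by simp
    then show ?thesis
      by (rule l2_tendsto_cong[rotated 2]) (use inT[of t] yi t in \<open>auto elim!: eventually_mono\<close>)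
  qed
  have dq: "(y' r \<xi> - y' t \<xi>) / of_real (r - t)
      = (integral {0..r} (\<lambda>\<sigma>. Z \<sigma> \<xi>) - integral {0..t} (\<lambda>\<sigma>. Z \<sigma> \<xi>)) / of_real (r - t)
       + (-1) * ((integral {0..r} (\<lambda>\<sigma>. of_real (q \<sigma>) * y \<sigma> \<xi>) - integral {0..t} (\<lambda>\<sigma>. of_real (q \<sigma>) * y \<sigma> \<xi>)) / of_real (r - t))"
    if "\<xi> \<in> I" "t \<in> {0..T}" "r \<in> {0..T}" for \<xi> t r
    unfolding y'i[OF that(1,2)] y'i[OF that(1,3)] by (simp add: diff_divide_distrib add_divide_distrib)
  have dqy': "l2_tendsto I ?w (\<lambda>r \<xi>. (y' r \<xi> - y' t \<xi>) / of_real (r - t))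
        (\<lambda>\<xi>. \<Phi> t \<xi> - of_real (?a t * \<mu> \<xi> + q t) * y t \<xi>) (at t within {0..T})" if tN: "t \<in> {0..T} - N" for t
  proof -
    have t: "t \<in> {0..T}" using tN by simp
    from l2_tendsto_diff_quotient_integral[OF w0 Zc one(1)[OF t] one(2)[OF t] t one(3)[OF t] lZ[OF t] bZ[OF t]]
    have 1: "l2_tendsto I ?w (\<lambda>r \<xi>. (integral {0..r} (\<lambda>\<sigma>. Z \<sigma> \<xi>) - integral {0..t} (\<lambda>\<sigma>. Z \<sigma> \<xi>)) / of_real (r - t)) (Z t) (at t within {0..T})"
      by simp
    have 2: "l2_tendsto I ?w (\<lambda>r \<xi>. (-1) * ((integral {0..r} (\<lambda>\<sigma>. of_real (q \<sigma>) * y \<sigma> \<xi>) - integral {0..t} (\<lambda>\<sigma>. of_real (q \<sigma>) * y \<sigma> \<xi>)) / of_real (r - t)))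
        (\<lambda>\<xi>. (-1) * (of_real (q t) * y t \<xi>)) (at t within {0..T})"
      by (rule l2_tendsto_scale[OF w0 tendsto_const l2_tendsto_diff_quotient_integral[OF w0 yc(1) q t N(2)[OF tN] ly[OF t] bdy[OF t]] bqy[OF t]])
    from l2_tendsto_add[OF w0 1 2] show ?thesis
      unfolding y''Z by (rule l2_tendsto_cong[rotated 2]) (use inT[of t] dq t in \<open>auto elim!: eventually_mono\<close>)
  qed
  have bdq: "l2_bounded I ?w CC (\<lambda>\<xi>. (y' r \<xi> - y' t \<xi>) / of_real (r - t))" if rt: "t \<in> {0..T}" "r \<in> {0..T}" "r \<noteq> t" for r t
  proof -
    let ?l = "min r t" and ?u = "max r t"
    have lu: "?l < ?u" "0 \<le> ?l" "?u \<le> T" using rt by auto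
    have sub: "{?l..?u} \<subseteq> {0..T}" using lu by auto
    have Zi: "(\<lambda>\<sigma>. Z \<sigma> \<xi>) integrable_on {a..b}" if "\<xi> \<in> I" "0 \<le> a" "b \<le> T" for \<xi> a b
      using that by (intro integrable_continuous_real continuous_on_subset[OF Zc]) auto
    have "l2_bounded I ?w (1\<^sup>2 * BZ) (\<lambda>\<xi>. integral {?l..?u} (\<lambda>\<sigma>. of_real 1 * Z \<sigma> \<xi>) / of_real (?u - ?l))"
    proof (rule l2_bounded_mean[OF w0 lu(1)])
      show "continuous_on {?l..?u} (\<lambda>t. Z t \<xi>)" if "\<xi> \<in> I" for \<xi> by (rule continuous_on_subset[OF Zc[OF that] sub])
      show "(\<lambda>\<sigma>. of_real 1 * Z \<sigma> \<xi>) integrable_on {?l..?u}" if "\<xi> \<in> I" for \<xi>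
        using Zi[OF that lu(2,3)] by simp
      show "l2_bounded I ?w BZ (Z t)" if "t \<in> {?l..?u}" for t using that sub by (intro bZ) blast
      show "\<bar>1::real\<bar> \<le> 1" by simp
    qed
    then have 1: "l2_bounded I ?w BZ (\<lambda>\<xi>. integral {?l..?u} (\<lambda>\<sigma>. Z \<sigma> \<xi>) / of_real (?u - ?l))"
      by (simp only: of_real_1 mult_1 one_power2)
    have 2: "l2_bounded I ?w (M\<^sup>2 * BD) (\<lambda>\<xi>. integral {?l..?u} (\<lambda>\<sigma>. of_real (q \<sigma>) * y \<sigma> \<xi>) / of_real (?u - ?l))"
    proof (rule l2_bounded_mean[OF w0 lu(1)])
      show "continuous_on {?l..?u} (\<lambda>t. y t \<xi>)" if "\<xi> \<in> I" for \<xi> by (rule continuous_on_subset[OF yc(1)[OF that] sub])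
      show "(\<lambda>\<sigma>. of_real (q \<sigma>) * y \<sigma> \<xi>) integrable_on {?l..?u}" if "\<xi> \<in> I" for \<xi>
        by (rule integrable_bounded_mult[OF q yc(1)[OF that] lu(2,3)])
      show "\<bar>q t\<bar> \<le> M" "l2_bounded I ?w BD (y t)" if "t \<in> {?l..?u}" for t using that sub by (auto intro!: q(2) bdy)
    qed
    have "l2_bounded I ?w CC (\<lambda>\<xi>. (y' r \<xi> - y' t \<xi>) / of_real (r - t)) =
      l2_bounded I ?w CC (\<lambda>\<xi>. integral {?l..?u} (\<lambda>\<sigma>. Z \<sigma> \<xi>) / of_real (?u - ?l) + (-1) * (integral {?l..?u} (\<lambda>\<sigma>. of_real (q \<sigma>) * y \<sigma> \<xi>) / of_real (?u - ?l)))"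
    proof (rule l2_bounded_cong)
      fix \<xi> assume \<xi>: "\<xi> \<in> I"
      show "(y' r \<xi> - y' t \<xi>) / of_real (r - t) = integral {?l..?u} (\<lambda>\<sigma>. Z \<sigma> \<xi>) / of_real (?u - ?l)
        + (-1) * (integral {?l..?u} (\<lambda>\<sigma>. of_real (q \<sigma>) * y \<sigma> \<xi>) / of_real (?u - ?l))"
      proof -
        have "(integral {0..r} (\<lambda>\<sigma>. Z \<sigma> \<xi>) - integral {0..t} (\<lambda>\<sigma>. Z \<sigma> \<xi>)) / of_real (r - t)
            = integral {?l..?u} (\<lambda>\<sigma>. Z \<sigma> \<xi>) / of_real (?u - ?l)"
          by (rule increment_quotient[OF rt(2,1,3)]) (rule Zi[OF \<xi>])
        moreover have "(integral {0..r} (\<lambda>\<sigma>. of_real (q \<sigma>) * y \<sigma> \<xi>) - integral {0..t} (\<lambda>\<sigma>. of_real (q \<sigma>) * y \<sigma> \<xi>)) / of_real (r - t)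
            = integral {?l..?u} (\<lambda>\<sigma>. of_real (q \<sigma>) * y \<sigma> \<xi>) / of_real (?u - ?l)"
          by (rule increment_quotient[OF rt(2,1,3)]) (rule integrable_bounded_mult[OF q yc(1)[OF \<xi>]])
        ultimately show ?thesis unfolding dq[OF \<xi> rt(1,2)] by (simp only:)
      qed
    qed
    then show ?thesis using comb[OF 1 2] by simp
  qed
  have ly'': "l2_tendsto I ?w (\<lambda>r \<xi>. \<Phi> r \<xi> - of_real (?a r * \<mu> \<xi> + q r) * y r \<xi>)
        (\<lambda>\<xi>. \<Phi> t \<xi> - of_real (?a t * \<mu> \<xi> + q t) * y t \<xi>) (at t within {0..T})"
    if qc: "continuous_on {0..T} q" and t: "t \<in> {0..T}" for t
  proof -
    have "((\<lambda>r. complex_of_real (q r)) \<longlongrightarrow> of_real (q t)) (at t within {0..T})"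
      using qc t unfolding continuous_on by (intro tendsto_intros) auto
    from l2_tendsto_scale[OF w0 this ly[OF t] bdy[OF t]]
    show ?thesis unfolding y''Z
      by (intro l2_tendsto_add[OF w0 lZ[OF t]] l2_tendsto_scale[OF w0 tendsto_const _ bqy[OF t]])
  qed
  show ?thesis
  proof (rule exI[of _ y], rule exI[of _ y'], rule exI[of _ CC], intro conjI ballI impI)
    fix t assume t: "t \<in> {0..T}"
    show "l2_bounded I ?w CC (y t)" by (rule l2_bounded_mono[OF bdy[OF t] CC(1)])
    show "l2_bounded I ?w CC (y' t)" by (rule l2_bounded_mono[OF bdy'[OF t] CC(1)])
  qed (use ms init bdy'' ly ly' dqy dqy' bdq ly'' in blast)+
qed

section \<open>Solutions of the Cauchy problem\<close>

lemma negligible_if_AE_lebesgue_on: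
  assumes "AE t in lebesgue_on S. P t" "S \<in> sets lebesgue"
  shows "\<exists>N. negligible N \<and> (\<forall>t\<in>S - N. P t)"
proof -
  have "AE t in lebesgue. t \<in> S \<longrightarrow> P t"
    using assms by (subst (asm) AE_restrict_space_iff) auto
  then obtain N where "N \<in> null_sets lebesgue" "{t \<in> space lebesgue. \<not> (t \<in> S \<longrightarrow> P t)} \<subseteq> N"
    unfolding eventually_ae_filter by blast
  then show ?thesis by (intro exI[of _ N]) (auto simp: negligible_iff_null_sets)
qed

lemma AE_lebesgue_on_if_negligible:
  assumes "negligible N" "\<And>t. t \<in> S - N \<Longrightarrow> P t" "S \<in> sets lebesgue"
  shows "AE t in lebesgue_on S. P t"
proof -
  have "AE t in lebesgue. t \<in> S \<longrightarrow> P t"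
    by (rule AE_I'[of N]) (use assms in \<open>auto simp: negligible_iff_null_sets\<close>)
  then show ?thesis using assms(3) by (subst AE_restrict_space_iff) auto
qed

text \<open>A function with prescribed coefficients. It exists for square-summable \<open>h\<close> and is then unique up to null sets.\<close>

definition synthesis :: "'i set \<Rightarrow> ('i \<Rightarrow> real ^ 'n \<Rightarrow> complex) \<Rightarrow> ('i \<Rightarrow> complex) \<Rightarrow> real ^ 'n \<Rightarrow> complex" where
  "synthesis I v h = (SOME g. g \<in> L2 \<and> (\<forall>\<xi>\<in>I. hat v g \<xi> = h \<xi>))"

lemma synthesis:
  assumes rb: "riesz_basis I u" and bi: "biorthogonal I u v" and h: "l2_bounded I w B h" and w: "\<And>\<xi>. \<xi> \<in> I \<Longrightarrow> w \<xi> \<ge> 1"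
  shows "synthesis I v h \<in> L2" "\<xi> \<in> I \<Longrightarrow> hat v (synthesis I v h) \<xi> = h \<xi>"
proof -
  have "(\<lambda>\<xi>. (cmod (h \<xi>))\<^sup>2) summable_on I"
  proof (rule nonneg_bdd_above_summable_on)
    have "(\<Sum>\<xi>\<in>F. (cmod (h \<xi>))\<^sup>2) \<le> B" if F: "finite F" "F \<subseteq> I" for F
    proof -
      have "(\<Sum>\<xi>\<in>F. (cmod (h \<xi>))\<^sup>2) \<le> (\<Sum>\<xi>\<in>F. w \<xi> * (cmod (h \<xi>))\<^sup>2)"
      proof (rule sum_mono)
        fix \<xi> assume "\<xi> \<in> F"
        then have "1 \<le> w \<xi>" using w F by blast
        then have "1 * (cmod (h \<xi>))\<^sup>2 \<le> w \<xi> * (cmod (h \<xi>))\<^sup>2" by (rule mult_right_mono) simp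
        then show "(cmod (h \<xi>))\<^sup>2 \<le> w \<xi> * (cmod (h \<xi>))\<^sup>2" by simp
      qed
      also have "\<dots> \<le> B" using h F unfolding l2_bounded_def by blast
      finally show ?thesis .
    qed
    then show "bdd_above (sum (\<lambda>\<xi>. (cmod (h \<xi>))\<^sup>2) ` {F. F \<subseteq> I \<and> finite F})"
      by (intro bdd_aboveI[of _ B]) auto
  qed simp
  from riesz_fischer[OF rb bi this] have "\<exists>g. g \<in> L2 \<and> (\<forall>\<xi>\<in>I. hat v g \<xi> = h \<xi>)" by metis
  then have "synthesis I v h \<in> L2 \<and> (\<forall>\<xi>\<in>I. hat v (synthesis I v h) \<xi> = h \<xi>)"
    unfolding synthesis_def by (rule someI_ex)
  then show "synthesis I v h \<in> L2" "\<xi> \<in> I \<Longrightarrow> hat v (synthesis I v h) \<xi> = h \<xi>" by auto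
qed

lemma diff_quotient_L2:
  assumes "w r \<in> L2" "w t \<in> L2"
  shows "diff_quotient w t r \<in> L2"
  using L2_cmult[OF L2_diff[OF assms], of "1 / complex_of_real (r - t)"] unfolding diff_quotient_def by simp

lemma hat_diff_quotient:
  assumes "w r \<in> L2" "w t \<in> L2" "v \<xi> \<in> L2"
  shows "hat v (diff_quotient w t r) \<xi> = (hat v (w r) \<xi> - hat v (w t) \<xi>) / complex_of_real (r - t)"
proof -
  let ?k = "1 / complex_of_real (r - t)"
  have "diff_quotient w t r = (\<lambda>x. ?k * (w r x - w t x))" unfolding diff_quotient_def by simp
  moreover have "hat v (\<lambda>x. ?k * (w r x - w t x)) \<xi> = ?k * hat v (\<lambda>x. w r x - w t x) \<xi>"
    by (rule hat_cmult[where v = v and \<xi> = \<xi>, OF L2_diff[OF assms(1,2)] assms(3)])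
  moreover have "hat v (\<lambda>x. w r x - w t x) \<xi> = hat v (w r) \<xi> - hat v (w t) \<xi>"
    by (rule hat_diff[where v = v and \<xi> = \<xi>, OF assms])
  ultimately show ?thesis by simp
qed

lemma gevrey_bounded_if_l2_bounded:
  fixes S :: "(real ^ 'n \<Rightarrow> complex) set"
  assumes v: "\<forall>\<xi>\<in>I. v \<xi> \<in> L2" and A: "A > 0"
    and S: "\<And>f. f \<in> S \<Longrightarrow> f \<in> L2 \<and> l2_bounded I (gevrey_weight lam s A) C (hat v f)"
  shows "gevrey_bounded I lam v s S"
  unfolding gevrey_bounded_def
proof (intro conjI ballI subsetI)
  fix f assume "f \<in> S"
  then have "f \<in> L2" "l2_bounded I (gevrey_weight lam s A) C (hat v f)" using S by blast+
  then have "f \<in> gevrey_step I lam v s A" by (rule gevrey_step_if_l2_bounded(1))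
  then show "f \<in> gevrey I lam v s" using A unfolding gevrey_def by blast
next
  fix W assume W: "W \<in> gevrey_nbhds I lam v s"
  then obtain e where e: "e > 0" "\<forall>f\<in>gevrey_step I lam v s A. gevrey_norm I lam v s A f < e \<longrightarrow> f \<in> W"
    using A unfolding gevrey_nbhds_def by blast
  define K where "K = (sqrt \<bar>C\<bar> + 1) / e"
  have "sqrt \<bar>C\<bar> + 1 > 0" by (simp add: add_nonneg_pos)
  then have K: "K > 0" unfolding K_def using e(1) by simp
  have "(\<lambda>x. f x / complex_of_real K) \<in> W" if "f \<in> S" for f
  proof -
    have f: "f \<in> L2" "l2_bounded I (gevrey_weight lam s A) C (hat v f)" using S[OF that] by auto
    let ?k = "1 / complex_of_real K"
    have kL: "(\<lambda>x. ?k * f x) \<in> L2" using f(1) by (rule L2_cmult)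
    have "l2_bounded I (gevrey_weight lam s A) ((cmod ?k)\<^sup>2 * C) (\<lambda>\<xi>. ?k * hat v f \<xi>)" using f(2) by (rule l2_bounded_cmult)
    moreover have "l2_bounded I (gevrey_weight lam s A) ((cmod ?k)\<^sup>2 * C) (hat v (\<lambda>x. ?k * f x))
        = l2_bounded I (gevrey_weight lam s A) ((cmod ?k)\<^sup>2 * C) (\<lambda>\<xi>. ?k * hat v f \<xi>)"
      by (rule l2_bounded_cong, rule hat_cmult[OF f(1)]) (use v in blast)
    ultimately have "l2_bounded I (gevrey_weight lam s A) ((cmod ?k)\<^sup>2 * C) (hat v (\<lambda>x. ?k * f x))" by blast
    then have "(\<lambda>x. ?k * f x) \<in> gevrey_step I lam v s A"
      "gevrey_norm I lam v s A (\<lambda>x. ?k * f x) \<le> sqrt ((cmod ?k)\<^sup>2 * C)"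
      using gevrey_step_if_l2_bounded[OF kL] by blast+
    moreover have "sqrt ((cmod ?k)\<^sup>2 * C) < e"
    proof -
      have "sqrt ((cmod ?k)\<^sup>2 * C) = sqrt C / K" using K by (simp add: real_sqrt_mult norm_divide)
      also have "\<dots> \<le> sqrt \<bar>C\<bar> / K" using K by (intro divide_right_mono real_sqrt_le_mono) auto
      also have "\<dots> < (sqrt \<bar>C\<bar> + 1) / K" using K by (intro divide_strict_right_mono) auto
      also have "\<dots> = e" unfolding K_def using e(1) \<open>sqrt \<bar>C\<bar> + 1 > 0\<close> by simp
      finally show ?thesis .
    qed
    ultimately have "(\<lambda>x. ?k * f x) \<in> W" using e(2) by auto
    then show ?thesis by simp
  qed
  then show "\<exists>K>0. \<forall>f\<in>S. (\<lambda>x. f x / complex_of_real K) \<in> W" using K by blast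
qed

text \<open>Besides changes of \<open>y\<close> outside the time interval, this permits changes of the potential on a null set.\<close>

lemma mode_solution_cong:
  assumes ms: "mode_solution N T a m q g y y'" and sub: "N \<subseteq> N'"
    and q: "\<And>t. t \<in> {0..T} - N' \<Longrightarrow> q t = q' t"
    and yz: "\<And>t. t \<in> {0..T} \<Longrightarrow> y t = z t" "\<And>t. t \<in> {0..T} \<Longrightarrow> y' t = z' t"
  shows "mode_solution N' T a m q' g z z'"
  unfolding mode_solution_def
proof (intro conjI ballI)
  fix t assume t: "t \<in> {0..T}"
  have "(y has_vector_derivative y' t) (at t within {0..T})" using ms t unfolding mode_solution_def by blast
  then have "(z has_vector_derivative y' t) (at t within {0..T})"
    by (rule has_vector_derivative_transform[OF t, rotated]) (use yz in auto)
  then show "(z has_vector_derivative z' t) (at t within {0..T})" using yz(2)[OF t] by simp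
next
  obtain L where "L-lipschitz_on {0..T} y'" using ms unfolding mode_solution_def by blast
  then have "L-lipschitz_on {0..T} z'" by (rule lipschitz_on_transform) (use yz in auto)
  then show "\<exists>L. L-lipschitz_on {0..T} z'" by blast
next
  fix t assume t': "t \<in> {0..T} - N'"
  then have t: "t \<in> {0..T}" "t \<in> {0..T} - N" using sub by auto
  have "(y' has_vector_derivative g t - of_real (a t * m + q t) * y t) (at t within {0..T})"
    using ms t(2) unfolding mode_solution_def by blast
  then have "(z' has_vector_derivative g t - of_real (a t * m + q t) * y t) (at t within {0..T})"
    by (rule has_vector_derivative_transform[OF t(1), rotated]) (use yz in auto)
  then show "(z' has_vector_derivative g t - of_real (a t * m + q' t) * z t) (at t within {0..T})"
    using yz(1)[OF t(1)] q[OF t'] by simp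
qed

lemma continuous_on_hat_curve:
  fixes T :: real
  assumes v: "\<forall>\<xi>\<in>I. v \<xi> \<in> L2" and f: "continuous_map (top_of_set {0..T}) (gevrey_topology I lam v s) f" and \<xi>: "\<xi> \<in> I"
  shows "continuous_on {0..T} (\<lambda>t. hat v (f t) \<xi>)"
  unfolding continuous_on
proof
  fix t assume "t \<in> {0..T}"
  then have "limitin (gevrey_topology I lam v s) f (f t) (at t within {0..T})"
    using f unfolding continuous_map_gevrey_iff by blast
  then show "((\<lambda>t. hat v (f t) \<xi>) \<longlongrightarrow> hat v (f t) \<xi>) (at t within {0..T})"
    using \<xi> by (rule tendsto_hat_if_limitin_gevrey[OF v])
qed

text \<open>The coefficients found above are those of curves in the Gevrey space, and norm convergence in one step
  carries continuity, derivatives and boundedness over to the inductive limit.\<close>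

lemma gevrey_solution_exists:
  fixes d :: "nat \<Rightarrow> real \<Rightarrow> real" and l :: nat and M c T s :: real and q :: "real \<Rightarrow> real"
    and u v :: "'i \<Rightarrow> real ^ 'n \<Rightarrow> complex" and f :: "real \<Rightarrow> real ^ 'n \<Rightarrow> complex"
  assumes rb: "riesz_basis I u" and bi: "biorthogonal I u v" and l: "l \<ge> 2" and T: "T > 0"
    and d: "\<forall>j\<le>l. continuous_on {0..T} (d j)"
      "\<forall>j<l. \<forall>t\<in>{0..T}. (d j has_real_derivative d (Suc j) t) (at t within {0..T})"
      "\<forall>t\<in>{0..T}. d 0 t \<ge> 0"
    and s: "1 \<le> s" "s < 1 + real l / 2" and c: "c \<ge> 0"
    and mu_bound: "\<forall>\<xi>\<in>I. 0 \<le> \<mu> \<xi> \<and> \<mu> \<xi> \<le> c * (bracket lam \<xi>)\<^sup>2"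
    and q_bound: "q \<in> borel_measurable (lebesgue_on {0..T})" "\<forall>t\<in>{0..T}. \<bar>q t\<bar> \<le> M"
    and q_diff: "negligible N" "\<forall>t\<in>{0..T} - N. ((\<lambda>t. integral {0..t} q) has_real_derivative q t) (at t within {0..T})"
    and f: "continuous_map (top_of_set {0..T}) (gevrey_topology I lam v s) f"
    and v01: "v0 \<in> gevrey I lam v s" "v1 \<in> gevrey I lam v s"
  shows "\<exists>w w' w''. continuous_map (top_of_set {0..T}) (gevrey_topology I lam v s) w \<and>
     continuous_map (top_of_set {0..T}) (gevrey_topology I lam v s) w' \<and>
     (\<forall>t\<in>{0..T}. has_curve_derivative (gevrey_topology I lam v s) T w (w' t) t) \<and>
     gevrey_bounded I lam v s {diff_quotient w' t r | t r. t \<in> {0..T} \<and> r \<in> {0..T} \<and> r \<noteq> t} \<and>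
     (\<forall>t\<in>{0..T} - N. has_curve_derivative (gevrey_topology I lam v s) T w' (w'' t) t) \<and>
     (continuous_on {0..T} q \<longrightarrow> continuous_map (top_of_set {0..T}) (gevrey_topology I lam v s) w'') \<and>
     (\<forall>\<xi>\<in>I. mode_solution N T (d 0) (\<mu> \<xi>) q (\<lambda>t. hat v (f t) \<xi>) (\<lambda>t. hat v (w t) \<xi>) (\<lambda>t. hat v (w' t) \<xi>) \<and>
        hat v (w 0) \<xi> = hat v v0 \<xi> \<and> hat v (w' 0) \<xi> = hat v v1 \<xi>)"
proof -
  let ?X = "gevrey_topology I lam v s"
  note cont = d(1)[rule_format] and der = d(2)[rule_format] and nonneg = d(3)[rule_format]
    and \<mu> = mu_bound[rule_format] and q = q_bound(1) q_bound(2)[rule_format]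
    and N = q_diff(1) q_diff(2)[rule_format]
  have v: "\<forall>\<xi>\<in>I. v \<xi> \<in> L2" using bi unfolding biorthogonal_def by blast
  have \<rho>: "0 < 1 / s" "1 / s \<le> 1" "2 < 1 / s * (real l + 2)" using s by (auto simp: field_simps)
  obtain A1 B where A1: "A1 > 0" "\<forall>t\<in>{0..T}. l2_bounded I (gevrey_weight lam s A1) B (hat v (f t))"
    using curve_coefficients_in_one_step[OF v s(1) f] by blast
  obtain A2 where A2: "A2 > 0" "v0 \<in> gevrey_step I lam v s A2" using v01(1) unfolding gevrey_def by auto
  obtain A3 where A3: "A3 > 0" "v1 \<in> gevrey_step I lam v s A3" using v01(2) unfolding gevrey_def by auto
  define A where "A = min A1 (min A2 A3)"
  have A: "A > 0" "A \<le> A1" "A \<le> A2" "A \<le> A3" unfolding A_def using A1 A2 A3 by auto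
  have c01: "l2_bounded I (gevrey_weight lam s A) ((gevrey_norm I lam v s A v0)\<^sup>2) (hat v v0)"
    "l2_bounded I (gevrey_weight lam s A) ((gevrey_norm I lam v s A v1)\<^sup>2) (hat v v1)"
    by (rule l2_bounded_if_gevrey_step, rule gevrey_step_mono[OF _ A2(2)], rule A)
      (rule l2_bounded_if_gevrey_step, rule gevrey_step_mono[OF _ A3(2)], rule A)
  have fB: "l2_bounded I (gevrey_weight lam s A) B (hat v (f t))" if "t \<in> {0..T}" for t
  proof -
    have "l2_bounded I (gevrey_weight lam s A) (1 * B) (hat v (f t))"
    proof (rule l2_bounded_weight_mono[OF A1(2)[rule_format, OF that]])
      show "gevrey_weight lam s A \<xi> \<le> 1 * gevrey_weight lam s A1 \<xi>" for \<xi>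
        unfolding mult_1 by (rule gevrey_weight_mono[OF A(2)])
    qed simp
    then show ?thesis by simp
  qed
  have fc: "continuous_on {0..T} (\<lambda>t. hat v (f t) \<xi>)" if "\<xi> \<in> I" for \<xi>
    by (rule continuous_on_hat_curve[OF v f that])
  have fl: "l2_tendsto I (gevrey_weight lam s (A/2)) (\<lambda>t. hat v (f t)) (hat v (f t)) (at t within {0..T})" if "t \<in> {0..T}" for t
    by (rule curve_continuous_in_one_step[OF v s(1) f _ _ A1(2) that]) (use A in auto)
  let ?W = "gevrey_weight lam s (A/2)"
  let ?y'' = "\<lambda>y t \<xi>. hat v (f t) \<xi> - of_real (d 0 t * \<mu> \<xi> + q t) * y t \<xi>"
  have "\<exists>y y' C. (\<forall>\<xi>\<in>I. mode_solution N T (d 0) (\<mu> \<xi>) q (\<lambda>t. hat v (f t) \<xi>) (\<lambda>t. y t \<xi>) (\<lambda>t. y' t \<xi>) \<and>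
        y 0 \<xi> = hat v v0 \<xi> \<and> y' 0 \<xi> = hat v v1 \<xi>) \<and>
     (\<forall>t\<in>{0..T}. l2_bounded I ?W C (y t) \<and> l2_bounded I ?W C (y' t) \<and>
        l2_bounded I ?W C (\<lambda>\<xi>. ?y'' y t \<xi>) \<and>
        l2_tendsto I ?W y (y t) (at t within {0..T}) \<and> l2_tendsto I ?W y' (y' t) (at t within {0..T}) \<and>
        l2_tendsto I ?W (\<lambda>r \<xi>. (y r \<xi> - y t \<xi>) / of_real (r - t)) (y' t) (at t within {0..T})) \<and>
     (\<forall>t\<in>{0..T} - N. l2_tendsto I ?W (\<lambda>r \<xi>. (y' r \<xi> - y' t \<xi>) / of_real (r - t))
        (\<lambda>\<xi>. ?y'' y t \<xi>) (at t within {0..T})) \<and>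
     (\<forall>t\<in>{0..T}. \<forall>r\<in>{0..T}. r \<noteq> t \<longrightarrow> l2_bounded I ?W C (\<lambda>\<xi>. (y' r \<xi> - y' t \<xi>) / of_real (r - t))) \<and>
     (continuous_on {0..T} q \<longrightarrow> (\<forall>t\<in>{0..T}. l2_tendsto I ?W (\<lambda>r \<xi>. ?y'' y r \<xi>) (\<lambda>\<xi>. ?y'' y t \<xi>) (at t within {0..T})))"
    by (rule coefficient_solution[where X = "bracket lam" and \<rho> = "1 / s" and \<Phi> = "\<lambda>t. hat v (f t)",
          OF l T cont der nonneg \<rho> c bracket_ge_1 \<mu> q N A(1) c01 fB fc fl])
  then obtain y y' C where
    ms: "\<forall>\<xi>\<in>I. mode_solution N T (d 0) (\<mu> \<xi>) q (\<lambda>t. hat v (f t) \<xi>) (\<lambda>t. y t \<xi>) (\<lambda>t. y' t \<xi>) \<and>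
        y 0 \<xi> = hat v v0 \<xi> \<and> y' 0 \<xi> = hat v v1 \<xi>"
    and yb: "\<forall>t\<in>{0..T}. l2_bounded I ?W C (y t) \<and> l2_bounded I ?W C (y' t) \<and>
        l2_bounded I ?W C (\<lambda>\<xi>. ?y'' y t \<xi>) \<and>
        l2_tendsto I ?W y (y t) (at t within {0..T}) \<and> l2_tendsto I ?W y' (y' t) (at t within {0..T}) \<and>
        l2_tendsto I ?W (\<lambda>r \<xi>. (y r \<xi> - y t \<xi>) / of_real (r - t)) (y' t) (at t within {0..T})"
    and yd: "\<forall>t\<in>{0..T} - N. l2_tendsto I ?W (\<lambda>r \<xi>. (y' r \<xi> - y' t \<xi>) / of_real (r - t))
        (\<lambda>\<xi>. ?y'' y t \<xi>) (at t within {0..T})"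
    and yq: "\<forall>t\<in>{0..T}. \<forall>r\<in>{0..T}. r \<noteq> t \<longrightarrow> l2_bounded I ?W C (\<lambda>\<xi>. (y' r \<xi> - y' t \<xi>) / of_real (r - t))"
    and yc: "continuous_on {0..T} q \<longrightarrow> (\<forall>t\<in>{0..T}. l2_tendsto I ?W (\<lambda>r \<xi>. ?y'' y r \<xi>) (\<lambda>\<xi>. ?y'' y t \<xi>) (at t within {0..T}))"
    by (elim exE conjE)
  have W1: "\<And>\<xi>. ?W \<xi> \<ge> 1" using A(1) by (intro gevrey_weight_ge_1) simp
  have A2': "A / 2 > 0" using A(1) by simp
  define w where "w t = synthesis I v (y t)" for t
  define w' where "w' t = synthesis I v (y' t)" for t
  define w'' where "w'' t = synthesis I v (?y'' y t)" for t
  have inT: "\<forall>\<^sub>F r in at t within {0..T}. r \<in> {0..T}" for t :: real by (auto simp: eventually_at_filter)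
  have good: "g t \<in> L2 \<and> g t \<in> gevrey I lam v s \<and> (\<forall>\<xi>\<in>I. hat v (g t) \<xi> = h t \<xi>)"
    if g: "\<And>t. g t = synthesis I v (h t)" and h: "\<forall>t\<in>{0..T}. l2_bounded I ?W C (h t)" and t: "t \<in> {0..T}" for g h t
  proof -
    have ht: "l2_bounded I ?W C (h t)" using h t by blast
    have 1: "g t \<in> L2" and 2: "\<And>\<xi>. \<xi> \<in> I \<Longrightarrow> hat v (g t) \<xi> = h t \<xi>"
      unfolding g by (rule synthesis[OF rb bi ht W1], rule synthesis(2)[OF rb bi ht W1])
    have "l2_bounded I ?W C (hat v (g t))" using ht by (subst l2_bounded_cong[OF 2]) auto
    then have "g t \<in> gevrey_step I lam v s (A/2)" by (rule gevrey_step_if_l2_bounded[OF 1])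
    then show ?thesis using 1 2 A2' unfolding gevrey_def by blast
  qed
  have gw: "w t \<in> L2 \<and> w t \<in> gevrey I lam v s \<and> (\<forall>\<xi>\<in>I. hat v (w t) \<xi> = y t \<xi>)" if "t \<in> {0..T}" for t
    by (rule good[OF w_def _ that]) (use yb in blast)
  have gw': "w' t \<in> L2 \<and> w' t \<in> gevrey I lam v s \<and> (\<forall>\<xi>\<in>I. hat v (w' t) \<xi> = y' t \<xi>)" if "t \<in> {0..T}" for t
    by (rule good[OF w'_def _ that]) (use yb in blast)
  have gw'': "w'' t \<in> L2 \<and> w'' t \<in> gevrey I lam v s \<and> (\<forall>\<xi>\<in>I. hat v (w'' t) \<xi> = ?y'' y t \<xi>)" if "t \<in> {0..T}" for t
    by (rule good[OF w''_def _ that]) (use yb in blast)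
  have limit: "limitin ?X g L (at t within {0..T})"
    if t: "t \<in> {0..T}" and g: "\<And>r. r \<in> {0..T} \<Longrightarrow> g r \<in> L2 \<and> (\<forall>\<xi>\<in>I. hat v (g r) \<xi> = h r \<xi>)"
      and L: "L \<in> gevrey I lam v s \<and> (\<forall>\<xi>\<in>I. hat v L \<xi> = k \<xi>)"
      and lim: "l2_tendsto I ?W h k (at t within {0..T})" for t g h L k
  proof (rule limitin_gevrey_if_l2_tendsto[OF v A2'])
    show "L \<in> gevrey I lam v s" using L by blast
    show "\<forall>\<^sub>F r in at t within {0..T}. g r \<in> L2" using inT by (rule eventually_mono) (use g in blast)
    show "l2_tendsto I ?W (\<lambda>r. hat v (g r)) (hat v L) (at t within {0..T})"
    proof (rule l2_tendsto_cong[OF _ _ lim])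
      show "\<forall>\<^sub>F r in at t within {0..T}. \<forall>\<xi>\<in>I. h r \<xi> = hat v (g r) \<xi>"
        using inT by (rule eventually_mono) (use g in auto)
    qed (use L in auto)
  qed
  have dq: "diff_quotient g t r \<in> L2 \<and> (\<forall>\<xi>\<in>I. hat v (diff_quotient g t r) \<xi> = (h r \<xi> - h t \<xi>) / of_real (r - t))"
    if g: "\<And>r. r \<in> {0..T} \<Longrightarrow> g r \<in> L2 \<and> g r \<in> gevrey I lam v s \<and> (\<forall>\<xi>\<in>I. hat v (g r) \<xi> = h r \<xi>)"
      and t: "t \<in> {0..T}" and r: "r \<in> {0..T}" for g h t r
  proof (intro conjI ballI)
    show "diff_quotient g t r \<in> L2" by (rule diff_quotient_L2) (use g[OF t] g[OF r] in auto)
    fix \<xi> assume \<xi>: "\<xi> \<in> I"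
    have "hat v (diff_quotient g t r) \<xi> = (hat v (g r) \<xi> - hat v (g t) \<xi>) / complex_of_real (r - t)"
      by (rule hat_diff_quotient) (use g[OF t] g[OF r] v \<xi> in auto)
    then show "hat v (diff_quotient g t r) \<xi> = (h r \<xi> - h t \<xi>) / of_real (r - t)"
      using g[OF t] g[OF r] \<xi> by simp
  qed
  have cw: "continuous_map (top_of_set {0..T}) ?X w"
    unfolding continuous_map_gevrey_iff
  proof
    fix t assume t: "t \<in> {0..T}"
    show "limitin ?X w (w t) (at t within {0..T})"
      by (rule limit[OF t, where h = y and k = "y t"]) (use gw t yb in blast)+
  qed
  have cw': "continuous_map (top_of_set {0..T}) ?X w'"
    unfolding continuous_map_gevrey_iff
  proof
    fix t assume t: "t \<in> {0..T}"
    show "limitin ?X w' (w' t) (at t within {0..T})"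
      by (rule limit[OF t, where h = y' and k = "y' t"]) (use gw' t yb in blast)+
  qed
  have cw'': "continuous_map (top_of_set {0..T}) ?X w''" if "continuous_on {0..T} q"
    unfolding continuous_map_gevrey_iff
  proof
    fix t assume t: "t \<in> {0..T}"
    show "limitin ?X w'' (w'' t) (at t within {0..T})"
      by (rule limit[OF t, where h = "?y'' y" and k = "?y'' y t"]) (use gw'' t yc that in blast)+
  qed
  have dw: "has_curve_derivative ?X T w (w' t) t" if t: "t \<in> {0..T}" for t
    unfolding has_curve_derivative_def
  proof (rule limit[OF t])
    show "diff_quotient w t r \<in> L2 \<and> (\<forall>\<xi>\<in>I. hat v (diff_quotient w t r) \<xi> = (y r \<xi> - y t \<xi>) / of_real (r - t))"
      if "r \<in> {0..T}" for r by (rule dq[OF gw t that])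
    show "w' t \<in> gevrey I lam v s \<and> (\<forall>\<xi>\<in>I. hat v (w' t) \<xi> = y' t \<xi>)" using gw'[OF t] by blast
    show "l2_tendsto I ?W (\<lambda>r \<xi>. (y r \<xi> - y t \<xi>) / of_real (r - t)) (y' t) (at t within {0..T})" using yb t by blast
  qed
  have dw': "has_curve_derivative ?X T w' (w'' t) t" if tN: "t \<in> {0..T} - N" for t
    unfolding has_curve_derivative_def
  proof -
    have t: "t \<in> {0..T}" using tN by simp
    show "limitin ?X (diff_quotient w' t) (w'' t) (at t within {0..T})"
    proof (rule limit[OF t])
      show "diff_quotient w' t r \<in> L2 \<and> (\<forall>\<xi>\<in>I. hat v (diff_quotient w' t r) \<xi> = (y' r \<xi> - y' t \<xi>) / of_real (r - t))"
        if "r \<in> {0..T}" for r by (rule dq[OF gw' t that])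
      show "w'' t \<in> gevrey I lam v s \<and> (\<forall>\<xi>\<in>I. hat v (w'' t) \<xi> = ?y'' y t \<xi>)" using gw''[OF t] by blast
      show "l2_tendsto I ?W (\<lambda>r \<xi>. (y' r \<xi> - y' t \<xi>) / of_real (r - t)) (?y'' y t) (at t within {0..T})" using yd tN by blast
    qed
  qed
  have bd: "gevrey_bounded I lam v s {diff_quotient w' t r | t r. t \<in> {0..T} \<and> r \<in> {0..T} \<and> r \<noteq> t}"
  proof (rule gevrey_bounded_if_l2_bounded[OF v A2', where C = C])
    fix h assume "h \<in> {diff_quotient w' t r | t r. t \<in> {0..T} \<and> r \<in> {0..T} \<and> r \<noteq> t}"
    then obtain t r where h: "h = diff_quotient w' t r" and tr: "t \<in> {0..T}" "r \<in> {0..T}" "r \<noteq> t" by blast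
    have D: "h \<in> L2 \<and> (\<forall>\<xi>\<in>I. hat v h \<xi> = (y' r \<xi> - y' t \<xi>) / of_real (r - t))"
      unfolding h by (rule dq[OF gw' tr(1,2)])
    have "l2_bounded I ?W C (\<lambda>\<xi>. (y' r \<xi> - y' t \<xi>) / of_real (r - t))" using yq tr by blast
    then have "l2_bounded I ?W C (hat v h)" by (subst l2_bounded_cong) (use D in auto)
    then show "h \<in> L2 \<and> l2_bounded I ?W C (hat v h)" using D by blast
  qed
  have modes: "mode_solution N T (d 0) (\<mu> \<xi>) q (\<lambda>t. hat v (f t) \<xi>) (\<lambda>t. hat v (w t) \<xi>) (\<lambda>t. hat v (w' t) \<xi>) \<and>
        hat v (w 0) \<xi> = hat v v0 \<xi> \<and> hat v (w' 0) \<xi> = hat v v1 \<xi>" if \<xi>: "\<xi> \<in> I" for \<xi>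
  proof (intro conjI)
    have m: "mode_solution N T (d 0) (\<mu> \<xi>) q (\<lambda>t. hat v (f t) \<xi>) (\<lambda>t. y t \<xi>) (\<lambda>t. y' t \<xi>)" using ms \<xi> by blast
    show "mode_solution N T (d 0) (\<mu> \<xi>) q (\<lambda>t. hat v (f t) \<xi>) (\<lambda>t. hat v (w t) \<xi>) (\<lambda>t. hat v (w' t) \<xi>)"
      by (rule mode_solution_cong[OF m]) (use gw gw' \<xi> in auto)
    have "(0::real) \<in> {0..T}" using T by simp
    then show "hat v (w 0) \<xi> = hat v v0 \<xi>" "hat v (w' 0) \<xi> = hat v v1 \<xi>"
      using gw gw' ms \<xi> by auto
  qed
  show ?thesis
    by (rule exI[of _ w], rule exI[of _ w'], rule exI[of _ w'']) (use cw cw' dw bd dw' cw'' modes in blast)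
qed

text \<open>Each coefficient is determined by the energy estimate, and the coefficients determine the function.\<close>

lemma hat_modes_determine:
  fixes d :: "nat \<Rightarrow> real \<Rightarrow> real" and q :: "real \<Rightarrow> real"
    and u v :: "'i \<Rightarrow> real ^ 'n \<Rightarrow> complex" and f w z :: "real \<Rightarrow> real ^ 'n \<Rightarrow> complex"
  assumes rb: "riesz_basis I u" and bi: "biorthogonal I u v"
    and a: "\<forall>t\<in>{0..T}. (a has_real_derivative a' t) (at t within {0..T})"
    and a'c: "continuous_on {0..T} a'" and a0: "\<forall>t\<in>{0..T}. a t \<ge> 0" and \<mu>: "\<forall>\<xi>\<in>I. \<mu> \<xi> \<ge> 0"
    and N: "negligible N1" "negligible N2" "negligible N3" and q: "\<forall>t\<in>{0..T} - N3. \<bar>q t\<bar> \<le> M"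
    and w: "\<forall>\<xi>\<in>I. \<exists>y'. mode_solution N1 T a (\<mu> \<xi>) q (\<lambda>t. hat v (f t) \<xi>) (\<lambda>t. hat v (w t) \<xi>) y' \<and>
        hat v (w 0) \<xi> = hat v v0 \<xi> \<and> y' 0 = hat v v1 \<xi>"
    and z: "\<forall>\<xi>\<in>I. \<exists>y'. mode_solution N2 T a (\<mu> \<xi>) q (\<lambda>t. hat v (f t) \<xi>) (\<lambda>t. hat v (z t) \<xi>) y' \<and>
        hat v (z 0) \<xi> = hat v v0 \<xi> \<and> y' 0 = hat v v1 \<xi>"
    and L2: "w t \<in> L2" "z t \<in> L2" and t: "t \<in> {0..T}"
  shows "AE x in lebesgue. z t x = w t x"
proof -
  have v: "\<forall>\<xi>\<in>I. v \<xi> \<in> L2" using bi unfolding biorthogonal_def by blast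
  have eq: "hat v (z t) \<xi> = hat v (w t) \<xi>" if \<xi>: "\<xi> \<in> I" for \<xi>
  proof -
    obtain y' where y': "mode_solution N1 T a (\<mu> \<xi>) q (\<lambda>t. hat v (f t) \<xi>) (\<lambda>t. hat v (w t) \<xi>) y'"
      "hat v (w 0) \<xi> = hat v v0 \<xi>" "y' 0 = hat v v1 \<xi>" using w \<xi> by blast
    obtain z' where z': "mode_solution N2 T a (\<mu> \<xi>) q (\<lambda>t. hat v (f t) \<xi>) (\<lambda>t. hat v (z t) \<xi>) z'"
      "hat v (z 0) \<xi> = hat v v0 \<xi>" "z' 0 = hat v v1 \<xi>" using z \<xi> by blast
    have "(\<lambda>t. hat v (w t) \<xi>) t = (\<lambda>t. hat v (z t) \<xi>) t"
      by (rule mode_solution_unique[OF a[rule_format] a'c a0[rule_format] \<mu>[rule_format, OF \<xi>] N q[rule_format] y'(1) z'(1)]) (use y' z' t in auto)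
    then show ?thesis by simp
  qed
  have "AE x in lebesgue. z t x - w t x = 0"
  proof (rule hat_determines[OF rb bi])
    show "(\<lambda>x. z t x - w t x) \<in> L2" by (rule L2_diff[OF L2(2,1)])
    show "hat v (\<lambda>x. z t x - w t x) \<xi> = 0" if "\<xi> \<in> I" for \<xi>
      using hat_diff[where v = v and \<xi> = \<xi>, OF L2(2,1)] v eq that by simp
  qed
  then show ?thesis by simp
qed

lemma continuous_map_gevrey_L2:
  assumes "\<forall>\<xi>\<in>I. v \<xi> \<in> L2" "continuous_map (top_of_set {0..T::real}) (gevrey_topology I lam v s) w" "t \<in> {0..T}"
  shows "w t \<in> L2"
proof -
  have "limitin (gevrey_topology I lam v s) w (w t) (at t within {0..T})"
    using assms(2,3) unfolding continuous_map_gevrey_iff by blast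
  then have "w t \<in> gevrey I lam v s" unfolding limitin_def topspace_gevrey_topology[OF assms(1)] by blast
  then show ?thesis by (rule gevrey_L2)
qed

lemma hat_curve_derivative:
  assumes v: "\<forall>\<xi>\<in>I. v \<xi> \<in> L2" and L2: "\<And>r. r \<in> {0..T} \<Longrightarrow> w r \<in> L2" and t: "t \<in> {0..T}" and \<xi>: "\<xi> \<in> I"
    and der: "has_curve_derivative (gevrey_topology I lam v s) T w w' t"
  shows "((\<lambda>t. hat v (w t) \<xi>) has_vector_derivative hat v w' \<xi>) (at t within {0..T})"
  unfolding has_vector_derivative_quotient_iff
proof (rule Lim_transform_eventually)
  show "((\<lambda>r. hat v (diff_quotient w t r) \<xi>) \<longlongrightarrow> hat v w' \<xi>) (at t within {0..T})"
    using der unfolding has_curve_derivative_def by (rule tendsto_hat_if_limitin_gevrey[OF v _ \<xi>])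
  have "\<forall>\<^sub>F r in at t within {0..T}. r \<in> {0..T}" by (auto simp: eventually_at_filter)
  then show "\<forall>\<^sub>F r in at t within {0..T}. hat v (diff_quotient w t r) \<xi> = (hat v (w r) \<xi> - hat v (w t) \<xi>) / complex_of_real (r - t)"
  proof (rule eventually_mono)
    fix r assume "r \<in> {0..T}"
    then show "hat v (diff_quotient w t r) \<xi> = (hat v (w r) \<xi> - hat v (w t) \<xi>) / complex_of_real (r - t)"
      by (intro hat_diff_quotient L2) (use t v \<xi> in auto)
  qed
qed

text \<open>The equation off \<open>N\<close> does not give a Lipschitz bound for \<open>y'\<close>; it has to come from the regularity class
  of the curve, which enters through the premise \<open>lip\<close>.\<close>

lemma mode_solution_if_solves_off:
  assumes so: "solves_off N I v \<mu> T a q f v0 v1 w" and \<xi>: "\<xi> \<in> I"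
    and lip: "\<And>y' y''. (\<forall>t\<in>{0..T}. ((\<lambda>t. hat v (w t) \<xi>) has_vector_derivative y' t) (at t within {0..T})) \<Longrightarrow>
      (\<forall>t\<in>{0..T} - N. (y' has_vector_derivative y'' t) (at t within {0..T}) \<and>
        y'' t = hat v (f t) \<xi> - of_real (a t * \<mu> \<xi> + q t) * hat v (w t) \<xi>) \<Longrightarrow> \<exists>L. L-lipschitz_on {0..T} y'"
  shows "\<exists>y'. mode_solution N T a (\<mu> \<xi>) q (\<lambda>t. hat v (f t) \<xi>) (\<lambda>t. hat v (w t) \<xi>) y' \<and>
        hat v (w 0) \<xi> = hat v v0 \<xi> \<and> y' 0 = hat v v1 \<xi>"
proof -
  obtain y' y'' where y': "\<forall>t\<in>{0..T}. ((\<lambda>t. hat v (w t) \<xi>) has_vector_derivative y' t) (at t within {0..T})"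
    and y'': "\<forall>t\<in>{0..T} - N. (y' has_vector_derivative y'' t) (at t within {0..T}) \<and>
        y'' t + of_real (a t * \<mu> \<xi>) * hat v (w t) \<xi> + of_real (q t) * hat v (w t) \<xi> = hat v (f t) \<xi>"
    and init: "hat v (w 0) \<xi> = hat v v0 \<xi>" "y' 0 = hat v v1 \<xi>"
    using so \<xi> unfolding solves_off_def by blast
  have "x = c - of_real (\<alpha> + \<beta>) * h" if "x + of_real \<alpha> * h + of_real \<beta> * h = c" for x c h :: complex and \<alpha> \<beta> :: real
    using that by (auto simp: algebra_simps)
  then have y''2: "\<forall>t\<in>{0..T} - N. (y' has_vector_derivative y'' t) (at t within {0..T}) \<and>
        y'' t = hat v (f t) \<xi> - of_real (a t * \<mu> \<xi> + q t) * hat v (w t) \<xi>"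
    using y'' by blast
  have "mode_solution N T a (\<mu> \<xi>) q (\<lambda>t. hat v (f t) \<xi>) (\<lambda>t. hat v (w t) \<xi>) y'"
    unfolding mode_solution_def
  proof (intro conjI)
    show "\<exists>L. L-lipschitz_on {0..T} y'" by (rule lip[OF y' y''2])
    show "\<forall>t\<in>{0..T} - N. (y' has_vector_derivative hat v (f t) \<xi> - of_real (a t * \<mu> \<xi> + q t) * hat v (w t) \<xi>) (at t within {0..T})"
    proof
      fix t assume "t \<in> {0..T} - N"
      then have "(y' has_vector_derivative y'' t) (at t within {0..T})"
        and eq: "y'' t = hat v (f t) \<xi> - of_real (a t * \<mu> \<xi> + q t) * hat v (w t) \<xi>" using y''2 by blast+
      then show "(y' has_vector_derivative hat v (f t) \<xi> - of_real (a t * \<mu> \<xi> + q t) * hat v (w t) \<xi>) (at t within {0..T})"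
        by (simp only: eq)
    qed
  qed (rule y')
  then show ?thesis using init by blast
qed

lemma solves_off_if_mode_solution:
  assumes "\<And>\<xi>. \<xi> \<in> I \<Longrightarrow> \<exists>y'. mode_solution N T a (\<mu> \<xi>) q (\<lambda>t. hat v (f t) \<xi>) (\<lambda>t. hat v (w t) \<xi>) y' \<and>
        hat v (w 0) \<xi> = hat v v0 \<xi> \<and> y' 0 = hat v v1 \<xi>"
  shows "solves_off N I v \<mu> T a q f v0 v1 w"
  unfolding solves_off_def
proof
  fix \<xi> assume "\<xi> \<in> I"
  then obtain y' where y': "mode_solution N T a (\<mu> \<xi>) q (\<lambda>t. hat v (f t) \<xi>) (\<lambda>t. hat v (w t) \<xi>) y'"
    "hat v (w 0) \<xi> = hat v v0 \<xi>" "y' 0 = hat v v1 \<xi>" using assms by blast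
  have eq: "c - of_real (\<alpha> + \<beta>) * h + of_real \<alpha> * h + of_real \<beta> * h = c" for c h :: complex and \<alpha> \<beta> :: real
    by (simp add: algebra_simps)
  show "\<exists>y' y''. (\<forall>t\<in>{0..T}. ((\<lambda>t. hat v (w t) \<xi>) has_vector_derivative y' t) (at t within {0..T})) \<and>
     (\<forall>t\<in>{0..T} - N. (y' has_vector_derivative y'' t) (at t within {0..T}) \<and>
        y'' t + of_real (a t * \<mu> \<xi>) * hat v (w t) \<xi> + of_real (q t) * hat v (w t) \<xi> = hat v (f t) \<xi>) \<and>
     hat v (w 0) \<xi> = hat v v0 \<xi> \<and> y' 0 = hat v v1 \<xi>"
  proof (rule exI[of _ y'], rule exI[of _ "\<lambda>t. hat v (f t) \<xi> - of_real (a t * \<mu> \<xi> + q t) * hat v (w t) \<xi>"], intro conjI ballI eq y'(2,3))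
    fix t
    show "((\<lambda>t. hat v (w t) \<xi>) has_vector_derivative y' t) (at t within {0..T})" if "t \<in> {0..T}"
      using y'(1) that unfolding mode_solution_def by blast
    show "(y' has_vector_derivative hat v (f t) \<xi> - of_real (a t * \<mu> \<xi> + q t) * hat v (w t) \<xi>) (at t within {0..T})" if "t \<in> {0..T} - N"
      using y'(1) that unfolding mode_solution_def by blast
  qed
qed

text \<open>The difference quotients of the derivative form a bounded set, on which the \<open>\<xi>\<close>-th coefficient is bounded.\<close>

lemma W2inf_modes:
  assumes v: "\<forall>\<xi>\<in>I. v \<xi> \<in> L2" and T: "T > 0" and W: "W2inf_curve I lam v s T w"
    and so: "solves_off N I v \<mu> T a q f v0 v1 w" and \<xi>: "\<xi> \<in> I"
  shows "\<exists>y'. mode_solution N T a (\<mu> \<xi>) q (\<lambda>t. hat v (f t) \<xi>) (\<lambda>t. hat v (w t) \<xi>) y' \<and>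
        hat v (w 0) \<xi> = hat v v0 \<xi> \<and> y' 0 = hat v v1 \<xi>"
proof (rule mode_solution_if_solves_off[OF so \<xi>])
  fix y' y'' :: "real \<Rightarrow> complex"
  assume y': "\<forall>t\<in>{0..T}. ((\<lambda>t. hat v (w t) \<xi>) has_vector_derivative y' t) (at t within {0..T})"
  obtain w' where w: "continuous_map (top_of_set {0..T}) (gevrey_topology I lam v s) w"
    and w': "continuous_map (top_of_set {0..T}) (gevrey_topology I lam v s) w'"
    and ww': "\<forall>t\<in>{0..T}. has_curve_derivative (gevrey_topology I lam v s) T w (w' t) t"
    and bd: "gevrey_bounded I lam v s {diff_quotient w' t r | t r. t \<in> {0..T} \<and> r \<in> {0..T} \<and> r \<noteq> t}"
    using W unfolding W2inf_curve_def by blast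
  have y'w': "y' t = hat v (w' t) \<xi>" if t: "t \<in> {0..T}" for t
  proof (rule vector_derivative_unique_within)
    show "at t within {0..T} \<noteq> bot" using t T by (simp add: trivial_limit_within)
    show "((\<lambda>t. hat v (w t) \<xi>) has_vector_derivative y' t) (at t within {0..T})" using y' t by blast
    show "((\<lambda>t. hat v (w t) \<xi>) has_vector_derivative hat v (w' t) \<xi>) (at t within {0..T})"
      by (rule hat_curve_derivative[OF v _ t \<xi>]) (use continuous_map_gevrey_L2[OF v w] ww' t in auto)
  qed
  obtain K where K: "K > 0" "\<forall>h\<in>{diff_quotient w' t r | t r. t \<in> {0..T} \<and> r \<in> {0..T} \<and> r \<noteq> t}. cmod (hat v h \<xi>) \<le> K"
    using hat_bounded_if_gevrey_bounded[OF v bd \<xi>] by blast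
  have "K-lipschitz_on {0..T} y'"
  proof (rule lipschitz_onI)
    fix r t assume rt: "r \<in> {0..T}" "t \<in> {0..T}"
    show "dist (y' r) (y' t) \<le> K * dist r t"
    proof (cases "r = t")
      case False
      have "cmod (hat v (diff_quotient w' t r) \<xi>) \<le> K" using K(2) rt False by blast
      also have "hat v (diff_quotient w' t r) \<xi> = (y' r - y' t) / complex_of_real (r - t)"
        unfolding y'w'[OF rt(1)] y'w'[OF rt(2)]
        by (rule hat_diff_quotient) (use continuous_map_gevrey_L2[OF v w'] rt v \<xi> in auto)
      finally have "cmod (y' r - y' t) / \<bar>r - t\<bar> \<le> K" by (simp only: norm_divide norm_of_real)
      then show ?thesis using False by (simp add: dist_norm divide_le_eq)
    qed simp
  qed (use K in simp)
  then show "\<exists>L. L-lipschitz_on {0..T} y'" by blast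
qed

text \<open>Here the equation holds at all times and makes the second derivative continuous, hence bounded.\<close>

lemma continuous_coefficient_modes:
  assumes T: "T > 0" and a: "continuous_on {0..T} a" and q: "continuous_on {0..T} q"
    and f: "continuous_on {0..T} (\<lambda>t. hat v (f t) \<xi>)"
    and so: "solves_off {} I v \<mu> T a q f v0 v1 w" and \<xi>: "\<xi> \<in> I"
  shows "\<exists>y'. mode_solution {} T a (\<mu> \<xi>) q (\<lambda>t. hat v (f t) \<xi>) (\<lambda>t. hat v (w t) \<xi>) y' \<and>
        hat v (w 0) \<xi> = hat v v0 \<xi> \<and> y' 0 = hat v v1 \<xi>"
proof (rule mode_solution_if_solves_off[OF so \<xi>])
  fix y' y'' :: "real \<Rightarrow> complex"
  assume y': "\<forall>t\<in>{0..T}. ((\<lambda>t. hat v (w t) \<xi>) has_vector_derivative y' t) (at t within {0..T})"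
    and y'': "\<forall>t\<in>{0..T} - {}. (y' has_vector_derivative y'' t) (at t within {0..T}) \<and>
        y'' t = hat v (f t) \<xi> - of_real (a t * \<mu> \<xi> + q t) * hat v (w t) \<xi>"
  have w: "continuous_on {0..T} (\<lambda>t. hat v (w t) \<xi>)"
    by (rule continuous_on_vector_derivative) (use y' in blast)
  have "continuous_on {0..T} (\<lambda>t. hat v (f t) \<xi> - of_real (a t * \<mu> \<xi> + q t) * hat v (w t) \<xi>)"
    by (intro continuous_intros f a q w)
  from compact_imp_bounded[OF compact_continuous_image[OF this compact_Icc]]
  obtain K where K: "\<forall>t\<in>{0..T}. cmod (hat v (f t) \<xi> - of_real (a t * \<mu> \<xi> + q t) * hat v (w t) \<xi>) \<le> K"
    unfolding bounded_iff by auto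
  have "0 \<le> cmod (hat v (f 0) \<xi> - of_real (a 0 * \<mu> \<xi> + q 0) * hat v (w 0) \<xi>)" by simp
  also have "\<dots> \<le> K" using K T by simp
  finally have K0: "K \<ge> 0" .
  have "K-lipschitz_on {0..T} y'"
  proof (rule bounded_derivative_imp_lipschitz)
    show "(y' has_derivative (\<lambda>h. h *\<^sub>R y'' t)) (at t within {0..T})" if "t \<in> {0..T}" for t
      using y'' that unfolding has_vector_derivative_def by blast
    show "onorm (\<lambda>h::real. h *\<^sub>R y'' t) \<le> K" if t: "t \<in> {0..T}" for t
    proof (rule onorm_bound[OF K0])
      fix h :: real
      have "cmod (y'' t) \<le> K" using K y'' t by auto
      then have "\<bar>h\<bar> * cmod (y'' t) \<le> \<bar>h\<bar> * K" by (intro mult_left_mono) auto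
      then show "norm (h *\<^sub>R y'' t) \<le> K * norm h" by (simp add: mult.commute)
    qed
  qed (use K0 in auto)
  then show "\<exists>L. L-lipschitz_on {0..T} y'" by blast
qed

lemma mu_bounds:
  assumes "\<xi> \<in> I" "c > 0"
  shows "0 \<le> mu I lam c \<xi> \<and> mu I lam c \<xi> \<le> (1 + c) * (bracket lam \<xi>)\<^sup>2"
proof -
  have "(bracket lam \<xi>)\<^sup>2 = 1 + cmod (lam \<xi>)" unfolding bracket_def by simp
  moreover have "0 \<le> c * cmod (lam \<xi>)" using assms(2) by simp
  ultimately show ?thesis using assms(2) unfolding mu_def by (simp add: distrib_left distrib_right)
qed

theorem theorem2p3:
  fixes V :: "real ^ 'n \<Rightarrow> complex" and D :: "(real ^ 'n \<Rightarrow> complex) set"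
    and I :: "'i set" and lam :: "'i \<Rightarrow> complex" and u v :: "'i \<Rightarrow> real ^ 'n \<Rightarrow> complex"
    and c T s :: real and l :: nat and a q :: "real \<Rightarrow> real"
    and f :: "real \<Rightarrow> real ^ 'n \<Rightarrow> complex" and v0 v1 :: "real ^ 'n \<Rightarrow> complex"
  assumes "schroedinger_eigensystem V D I lam u v" and "c > 0"
    and "T > 0"
    and "l \<ge> 2" and "Cl_scalar l T a" and "\<forall>t\<in>{0..T}. a t \<ge> 0"
    and "Linf T q"
    and "1 \<le> s" and "s < 1 + real l / 2"
    and "C_curve 0 (gevrey_topology I lam v s) T f"
    and "v0 \<in> gevrey I lam v s" and "v1 \<in> gevrey I lam v s"
  shows "unique_curve T (\<lambda>w. W2inf_curve I lam v s T w \<and>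
           (\<exists>N. negligible N \<and> solves_off N I v (mu I lam c) T a q f v0 v1 w))
       \<and> (\<forall>r. continuous_on {0..T} r \<and> (AE t in lebesgue_on {0..T}. q t = r t) \<longrightarrow>
            unique_curve T (\<lambda>w. C_curve 2 (gevrey_topology I lam v s) T w \<and>
              solves_off {} I v (mu I lam c) T a r f v0 v1 w))"
proof -
  let ?X = "gevrey_topology I lam v s" and ?\<mu> = "mu I lam c"
  have rb: "riesz_basis I u" and bi: "biorthogonal I u v"
    using assms(1) unfolding schroedinger_eigensystem_def by blast+
  have T: "T > 0" and l: "l \<ge> 2" by fact+
  have v: "\<forall>\<xi>\<in>I. v \<xi> \<in> L2" using bi unfolding biorthogonal_def by blast
  obtain d :: "nat \<Rightarrow> real \<Rightarrow> real" where d: "d 0 = a" "\<forall>j\<le>l. continuous_on {0..T} (d j)"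
    "\<forall>j<l. \<forall>t\<in>{0..T}. (d j has_real_derivative d (Suc j) t) (at t within {0..T})"
    using assms(5) unfolding Cl_scalar_def by blast
  have nonneg: "\<forall>t\<in>{0..T}. d 0 t \<ge> 0" using assms(6) d(1) by blast
  have a': "\<forall>t\<in>{0..T}. (a has_real_derivative d 1 t) (at t within {0..T})"
    using d(3)[rule_format, of 0] l d(1) by simp
  have a'c: "continuous_on {0..T} (d 1)" using d(2)[rule_format, of 1] l by simp
  have ac: "continuous_on {0..T} a" using d(2)[rule_format, of 0] d(1) by simp
  have c0: "1 + c \<ge> 0" using assms(2) by simp
  have \<mu>: "\<forall>\<xi>\<in>I. 0 \<le> ?\<mu> \<xi> \<and> ?\<mu> \<xi> \<le> (1 + c) * (bracket lam \<xi>)\<^sup>2"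
    by (intro ballI mu_bounds assms(2))
  then have \<mu>0: "\<forall>\<xi>\<in>I. ?\<mu> \<xi> \<ge> 0" by blast
  have f: "continuous_map (top_of_set {0..T}) ?X f" using assms(10) unfolding C_curve_def by auto
  have fc: "continuous_on {0..T} (\<lambda>t. hat v (f t) \<xi>)" if "\<xi> \<in> I" for \<xi>
    by (rule continuous_on_hat_curve[OF v f that])
  note exists = gevrey_solution_exists[OF rb bi l T d(2,3) nonneg assms(8,9) c0 \<mu>]
  note unique = hat_modes_determine[OF rb bi a' a'c assms(6) \<mu>0]

  have part1: "unique_curve T (\<lambda>w. W2inf_curve I lam v s T w \<and>
           (\<exists>N. negligible N \<and> solves_off N I v ?\<mu> T a q f v0 v1 w))"
  proof -
    have qm: "q \<in> borel_measurable (lebesgue_on {0..T})" using assms(7) unfolding Linf_def by blast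
    obtain M0 where "AE t in lebesgue_on {0..T}. \<bar>q t\<bar> \<le> M0" using assms(7) unfolding Linf_def by blast
    from negligible_if_AE_lebesgue_on[OF this] obtain Nq where Nq: "negligible Nq" "\<forall>t\<in>{0..T} - Nq. \<bar>q t\<bar> \<le> M0"
      by auto
    define M where "M = \<bar>M0\<bar>"
    \<comment> \<open>truncation gives a potential that is bounded everywhere and equals \<open>q\<close> off the null set \<open>Nq\<close>\<close>
    define p where "p t = max (- M) (min M (q t))" for t
    have pm: "p \<in> borel_measurable (lebesgue_on {0..T})"
      unfolding p_def[abs_def] using qm by (intro borel_measurable_max borel_measurable_min) auto
    have pb: "\<bar>p t\<bar> \<le> M" for t unfolding p_def M_def by auto
    then have pb': "\<forall>t\<in>{0..T}. \<bar>p t\<bar> \<le> M" by blast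
    have pq: "p t = q t" if "t \<in> {0..T} - Nq" for t
      using Nq(2)[rule_format, OF that] unfolding p_def M_def by auto
    obtain Np where Np: "negligible Np" "\<forall>t\<in>{0..T} - Np. ((\<lambda>t. integral {0..t} p) has_real_derivative p t) (at t within {0..T})"
      using bounded_measurable_differentiation[OF pm pb] by blast
    from exists[OF pm pb' Np f assms(11,12)]
    obtain w w' w'' where w: "continuous_map (top_of_set {0..T}) ?X w" "continuous_map (top_of_set {0..T}) ?X w'"
      "\<forall>t\<in>{0..T}. has_curve_derivative ?X T w (w' t) t"
      "gevrey_bounded I lam v s {diff_quotient w' t r | t r. t \<in> {0..T} \<and> r \<in> {0..T} \<and> r \<noteq> t}"
      "\<forall>t\<in>{0..T} - Np. has_curve_derivative ?X T w' (w'' t) t"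
      "continuous_on {0..T} p \<longrightarrow> continuous_map (top_of_set {0..T}) ?X w''"
      "\<forall>\<xi>\<in>I. mode_solution Np T (d 0) (?\<mu> \<xi>) p (\<lambda>t. hat v (f t) \<xi>) (\<lambda>t. hat v (w t) \<xi>) (\<lambda>t. hat v (w' t) \<xi>) \<and>
        hat v (w 0) \<xi> = hat v v0 \<xi> \<and> hat v (w' 0) \<xi> = hat v v1 \<xi>"
      by (elim exE conjE)
    define N where "N = Np \<union> Nq"
    have N: "negligible N" unfolding N_def using Np(1) Nq(1) by simp
    have W: "W2inf_curve I lam v s T w"
      unfolding W2inf_curve_def
    proof (rule exI[of _ w'], rule exI[of _ w''], intro conjI w(1-4))
      show "AE t in lebesgue_on {0..T}. has_curve_derivative ?X T w' (w'' t) t"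
        by (rule AE_lebesgue_on_if_negligible[OF Np(1)]) (use w(5) in auto)
    qed
    have modes: "\<exists>y'. mode_solution N T a (?\<mu> \<xi>) q (\<lambda>t. hat v (f t) \<xi>) (\<lambda>t. hat v (w t) \<xi>) y' \<and>
        hat v (w 0) \<xi> = hat v v0 \<xi> \<and> y' 0 = hat v v1 \<xi>" if \<xi>: "\<xi> \<in> I" for \<xi>
    proof (rule exI[of _ "\<lambda>t. hat v (w' t) \<xi>"], intro conjI)
      have m: "mode_solution Np T a (?\<mu> \<xi>) p (\<lambda>t. hat v (f t) \<xi>) (\<lambda>t. hat v (w t) \<xi>) (\<lambda>t. hat v (w' t) \<xi>)"
        using w(7) \<xi> unfolding d(1) by blast
      show "mode_solution N T a (?\<mu> \<xi>) q (\<lambda>t. hat v (f t) \<xi>) (\<lambda>t. hat v (w t) \<xi>) (\<lambda>t. hat v (w' t) \<xi>)"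
        by (rule mode_solution_cong[OF m]) (use pq in \<open>auto simp: N_def\<close>)
    qed (use w(7) \<xi> in blast)+
    show ?thesis
      unfolding unique_curve_def
    proof (rule exI[of _ w], intro conjI allI impI ballI)
      show "W2inf_curve I lam v s T w" by (rule W)
      show "\<exists>N. negligible N \<and> solves_off N I v ?\<mu> T a q f v0 v1 w"
        using N solves_off_if_mode_solution[OF modes] by blast
    next
      fix z t assume "W2inf_curve I lam v s T z \<and> (\<exists>N. negligible N \<and> solves_off N I v ?\<mu> T a q f v0 v1 z)"
        and t: "t \<in> {0..T}"
      then obtain N' where z: "W2inf_curve I lam v s T z" "negligible N'" "solves_off N' I v ?\<mu> T a q f v0 v1 z" by blast
      have zc: "continuous_map (top_of_set {0..T}) ?X z" using z(1) unfolding W2inf_curve_def by blast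
      show "AE x in lebesgue. z t x = w t x"
        by (rule unique[OF N z(2) Nq(1) Nq(2) ballI[OF modes] ballI[OF W2inf_modes[OF v T z(1) z(3)]]
              continuous_map_gevrey_L2[OF v w(1) t] continuous_map_gevrey_L2[OF v zc t] t])
    qed
  qed

  have part2: "unique_curve T (\<lambda>w. C_curve 2 ?X T w \<and> solves_off {} I v ?\<mu> T a r f v0 v1 w)"
    if r: "continuous_on {0..T} r" for r
  proof -
    have rm: "r \<in> borel_measurable (lebesgue_on {0..T})"
      using r by (intro continuous_imp_measurable_on_sets_lebesgue) auto
    obtain M where M: "\<forall>t\<in>{0..T}. \<bar>r t\<bar> \<le> M"
      using compact_imp_bounded[OF compact_continuous_image[OF r compact_Icc]] unfolding bounded_iff by auto
    then have M': "\<forall>t\<in>{0..T} - {}. \<bar>r t\<bar> \<le> M" by simp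
    have rd: "\<forall>t\<in>{0..T} - {}. ((\<lambda>t. integral {0..t} r) has_real_derivative r t) (at t within {0..T})"
      using integral_has_real_derivative[OF r] by simp
    from exists[OF rm M negligible_empty rd f assms(11,12)]
    obtain w w' w'' where w: "continuous_map (top_of_set {0..T}) ?X w" "continuous_map (top_of_set {0..T}) ?X w'"
      "\<forall>t\<in>{0..T}. has_curve_derivative ?X T w (w' t) t"
      "gevrey_bounded I lam v s {diff_quotient w' t r | t r. t \<in> {0..T} \<and> r \<in> {0..T} \<and> r \<noteq> t}"
      "\<forall>t\<in>{0..T} - {}. has_curve_derivative ?X T w' (w'' t) t"
      "continuous_on {0..T} r \<longrightarrow> continuous_map (top_of_set {0..T}) ?X w''"
      "\<forall>\<xi>\<in>I. mode_solution {} T (d 0) (?\<mu> \<xi>) r (\<lambda>t. hat v (f t) \<xi>) (\<lambda>t. hat v (w t) \<xi>) (\<lambda>t. hat v (w' t) \<xi>) \<and>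
        hat v (w 0) \<xi> = hat v v0 \<xi> \<and> hat v (w' 0) \<xi> = hat v v1 \<xi>"
      by (elim exE conjE)
    have modes: "\<exists>y'. mode_solution {} T a (?\<mu> \<xi>) r (\<lambda>t. hat v (f t) \<xi>) (\<lambda>t. hat v (w t) \<xi>) y' \<and>
        hat v (w 0) \<xi> = hat v v0 \<xi> \<and> y' 0 = hat v v1 \<xi>" if "\<xi> \<in> I" for \<xi>
      using w(7) that unfolding d(1) by blast
    define D where "D j = (if j = 0 then w else if j = 1 then w' else w'')" for j :: nat
    have C2: "C_curve 2 ?X T w"
      unfolding C_curve_def
    proof (rule exI[of _ D], intro conjI allI impI ballI)
      show "D 0 = w" unfolding D_def by simp
      show "continuous_map (top_of_set {0..T}) ?X (D j)" if "j \<le> 2" for j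
        unfolding D_def using w(1,2,6) r by simp
      show "has_curve_derivative ?X T (D j) (D (Suc j) t) t" if "j < 2" "t \<in> {0..T}" for j t
      proof -
        have "j = 0 \<or> j = 1" using that(1) by auto
        then show ?thesis unfolding D_def using w(3,5) that(2) by auto
      qed
    qed
    show ?thesis
      unfolding unique_curve_def
    proof (rule exI[of _ w], intro conjI allI impI ballI)
      show "C_curve 2 ?X T w" by (rule C2)
      show "solves_off {} I v ?\<mu> T a r f v0 v1 w" by (rule solves_off_if_mode_solution[OF modes])
    next
      fix z t assume "C_curve 2 ?X T z \<and> solves_off {} I v ?\<mu> T a r f v0 v1 z" and t: "t \<in> {0..T}"
      then have z: "C_curve 2 ?X T z" "solves_off {} I v ?\<mu> T a r f v0 v1 z" by blast+
      have zc: "continuous_map (top_of_set {0..T}) ?X z" using z(1) unfolding C_curve_def by auto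
      show "AE x in lebesgue. z t x = w t x"
        by (rule unique[OF negligible_empty negligible_empty negligible_empty M' ballI[OF modes]
              ballI[OF continuous_coefficient_modes[OF T ac r fc z(2)]]
              continuous_map_gevrey_L2[OF v w(1) t] continuous_map_gevrey_L2[OF v zc t] t])
    qed
  qed
  show ?thesis using part1 part2 by blast
qed

end
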